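(* Let $f=\frac PQe^{S/T}$ with associated data as in the context. Fix a zero $c_j$ of $T$, of multiplicity $m_j$, and choose $r>0$ so small that $\overline{D(c_j,r)}\cap\Sigma=\{c_j\}$, $c_j$ is the unique nearest point of $\Sigma$ for every point of $\overline{D(c_j,r)}\setminus\{c_j\}$, and $P_\sharp$ has no zero on $\overline{D(c_j,r)}$. Then $\mu_{\mathrm{fix}}(\partial D(c_j,r))=0$ and $$\sum_{\substack{\zeta:\,B_n(\zeta)=0\\|\zeta-c_j|<r}}\operatorname{mult}_\zeta(B_n)=m_jn+o(n).$$ Equivalently, the same asymptotic count, with multiplicity, holds for the zeros of $f^{(n)}$ in $D(c_j,r)\setminus\{c_j\}$. Let $E(z)=S(z)/T(z)=\sum_{s=1}^{m_j}\lambda_{j,s}(z-c_j)^{-s}+E_j^{\mathrm{reg}}(z)$ with $\lambda_{j,m_j}\ne0$ and $E_j^{\mathrm{reg}}$ holomorphic near $c_j$. For every $\chi\in C_c(\mathbb C)$, $$\frac1{m_jn}\sum_{\substack{f^{(n)}(\zeta)=0\\0<|\zeta-c_j|<r}}\operatorname{mult}_\zeta(f^{(n)})\,\chi\bigl(n^{1/m_j}(\zeta-c_j)\bigr)\longrightarrow\int_{\mathbb C}\chi\,d\widehat\mu_{m_j,\lambda_{j,m_j}}.$$ If $r_n\downarrow0$ and $n^{1/m_j}r_n\to\infty$, then $$\nu_{j,n}:=\frac1{m_jn}\sum_{\substack{f^{(n)}(\zeta)=0\\0<|\zeta-c_j|<r_n}}\operatorname{mult}_\zeta(f^{(n)})\,\delta_{n^{1/m_j}(\zeta-c_j)}$$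 converges to $\widehat\mu_{m_j,\lambda_{j,m_j}}$ weakly on $\widehat{\mathbb C}$ as finite Borel measures. In particular $\nu_{j,n}(\widehat{\mathbb C})\to1$.
   Context: Hyperexponential setup. Let $P,Q,S,T\in\mathbb C[z]$ with $P,Q\ne0$, $\gcd(P,Q)=\gcd(S,T)=1$, $T$ nonconstant, and $f=\frac PQ\exp(S/T)$. Normalizations: $T$ is monic; $Q=1$ if $Q$ is constant and $Q$ is monic otherwise; either $P/Q\equiv1$ or $P/Q$ is nonconstant. $\mathcal Z(R)$ is the set of distinct finite zeros of a polynomial $R$. Write $E=S/T=H+M/T$ with $H,M$ polynomials and $\deg M<\deg T$; $h=\deg H$ if $H$ is nonconstant and $h=0$ otherwise. $T$ has distinct zeros $c_1,\dots,c_{\check t}$ with multiplicities $m_1,\dots,m_{\check t}$; $b_1,\dots,b_{\check q}$ are the distinct zeros of $Q$ that are not zeros of $T$. Put $P_T=\prod_j(z-c_j)^{\operatorname{ord}_{c_j}P}$, $P_\sharp=P/P_T$, $W=\prod_j(z-c_j)^{m_j+1}\prod_k(z-b_k)$, $d=\deg W$, $\kappa=d+h-1$, $\Sigma=\mathcal Z(T)\cup\mathcal Z(Q)=\{a_1,\dots,a_N\}$ (distinct points), $\Lambda=E'+P_T'/P_T-Q'/Q$, $U=W\Lambda$ (a polynomial). Define $B_0=P_\sharp$, $B_{n+1}=WB_n'+(U-nW')B_n$; these are nonzero polynomials and $f^{(n)}=\frac{P_TB_n}{QW^n}e^E$. With $\mathcal V_i=\{z:|z-a_i|\le|z-a_j|\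 \forall j\}$ and $E_{ij}=\mathcal V_i\cap\mathcal V_j$ if one-dimensional (empty otherwise), $\mu_{\mathrm{fix}}=\frac1\kappa\sum_jm_j\delta_{c_j}+\frac1{2\pi\kappa}\sum_{1\le i<j\le N}\frac{|a_i-a_j|}{|\cdot-a_i||\cdot-a_j|}d\ell|_{E_{ij}}$, $d\ell$ being arclength. Microscopic measure: for $m\ge1$ put $c^{\ast}_m=\left(\frac{m+1}m\right)^{m+1}$. $\mu_m$ is the probability measure on $[0,c^\ast_m]$ with Cauchy transform $\int\frac{d\mu_m(x)}{\zeta-x}=1-v(\zeta)^{-m}$, where $v$ is the branch, holomorphic on $\mathbb C\setminus[0,c^\ast_m]$, of $v^{m+1}=m\zeta(v-1)$ with $v(\zeta)=1+\frac1{m\zeta}+O(\zeta^{-2})$ as $\zeta\to\infty$; it has no atom at $0$. For $\lambda\in\mathbb C^\times$ choose $\eta$ with $\eta^m=-\lambda$ and define $\phi_\nu:[0,c^\ast_m]\to\widehat{\mathbb C}$, $0\le\nu\le m-1$, by $\phi_\nu(0)=\infty$, $\phi_\nu(x)=e^{2\pi i\nu/m}\eta x^{-1/m}$ for $x>0$ (positive real root). Set $\widehat\mu_{m,\lambda}=\frac1m\sum_{\nu=0}^{m-1}(\phi_\nu)_\#\mu_m$, a probability measure on the Riemann sphere $\widehat{\mathbb C}$ without atom at $\infty$, independent of $\eta$. Weak convergence on $\widehat{\mathbb C}$ means convergence against continuous functions on $\widehat{\mathbb C}$. *)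

theory Defs
  imports
    "HOL-Complex_Analysis.Complex_Analysis"
    "HOL-Probability.Probability"
    "HOL-Computational_Algebra.Computational_Algebra"
    "HOL-Library.Landau_Symbols"
begin

section \<open>Hyperexponential functions and their derivative polynomials\<close>

definition zeros :: "complex poly \<Rightarrow> complex set" where
  "zeros R = {z. poly R z = 0}"

definition hyperexp_data ::
  "complex poly \<Rightarrow> complex poly \<Rightarrow> complex poly \<Rightarrow> complex poly \<Rightarrow> bool" where
  "hyperexp_data P Q S T \<longleftrightarrow>
     P \<noteq> 0 \<and> Q \<noteq> 0 \<and> coprime P Q \<and> coprime S T \<and> degree T > 0 \<and>
     lead_coeff T = 1 \<and>
     (if degree Q = 0 then Q = 1 else lead_coeff Q = 1) \<and>
     (P = Q \<or> (\<nexists>k. P = smult k Q))"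

definition expo :: "complex poly \<Rightarrow> complex poly \<Rightarrow> complex \<Rightarrow> complex" where
  "expo S T z = poly S z / poly T z"

text \<open>Only the values off the zeros of \<open>T\<close> and \<open>Q\<close> are meaningful; elsewhere division by zero
  yields an arbitrary value.\<close>

definition hyperexp ::
  "complex poly \<Rightarrow> complex poly \<Rightarrow> complex poly \<Rightarrow> complex poly \<Rightarrow> complex \<Rightarrow> complex" where
  "hyperexp P Q S T z = poly P z / poly Q z * exp (expo S T z)"

definition sing_set :: "complex poly \<Rightarrow> complex poly \<Rightarrow> complex set" where
  "sing_set Q T = zeros T \<union> zeros Q"

definition PT :: "complex poly \<Rightarrow> complex poly \<Rightarrow> complex poly" where
  "PT P T = (\<Prod>c\<in>zeros T. [:- c, 1:] ^ order c P)"

definition Psharp :: "complex poly \<Rightarrow> complex poly \<Rightarrow> complex poly" where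
  "Psharp P T = P div PT P T"

definition Wpoly :: "complex poly \<Rightarrow> complex poly \<Rightarrow> complex poly" where
  "Wpoly Q T = (\<Prod>c\<in>zeros T. [:- c, 1:] ^ (order c T + 1)) * (\<Prod>b\<in>zeros Q - zeros T. [:- b, 1:])"

text \<open>\<open>S div T\<close> is the polynomial part of \<open>S / T\<close>; its \<open>degree\<close> is \<open>0\<close> when it is constant.\<close>

definition kappa :: "complex poly \<Rightarrow> complex poly \<Rightarrow> complex poly \<Rightarrow> nat" where
  "kappa Q S T = degree (Wpoly Q T) + degree (S div T) - 1"

definition Lam ::
  "complex poly \<Rightarrow> complex poly \<Rightarrow> complex poly \<Rightarrow> complex poly \<Rightarrow> complex \<Rightarrow> complex" where
  "Lam P Q S T z = deriv (expo S T) z + poly (pderiv (PT P T)) z / poly (PT P T) z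
                    - poly (pderiv Q) z / poly Q z"

text \<open>The polynomial that agrees with the rational function \<open>W \<Lambda>\<close> off the singular set;
  it exists by \<open>poly_Upoly\<close> below.\<close>

definition Upoly ::
  "complex poly \<Rightarrow> complex poly \<Rightarrow> complex poly \<Rightarrow> complex poly \<Rightarrow> complex poly" where
  "Upoly P Q S T = (THE U. \<forall>z. z \<notin> sing_set Q T \<longrightarrow> poly U z = poly (Wpoly Q T) z * Lam P Q S T z)"

primrec Bpoly ::
  "complex poly \<Rightarrow> complex poly \<Rightarrow> complex poly \<Rightarrow> complex poly \<Rightarrow> nat \<Rightarrow> complex poly" where
  "Bpoly P Q S T 0 = Psharp P T"
| "Bpoly P Q S T (Suc n) =
     Wpoly Q T * pderiv (Bpoly P Q S T n) +
     (Upoly P Q S T - of_nat n * pderiv (Wpoly Q T)) * Bpoly P Q S T n"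

definition deriv_zeros ::
  "complex poly \<Rightarrow> complex poly \<Rightarrow> complex poly \<Rightarrow> complex poly \<Rightarrow> nat \<Rightarrow> complex set" where
  "deriv_zeros P Q S T n = {\<zeta>. \<zeta> \<notin> sing_set Q T \<and> (deriv ^^ n) (hyperexp P Q S T) \<zeta> = 0}"

definition deriv_mult ::
  "complex poly \<Rightarrow> complex poly \<Rightarrow> complex poly \<Rightarrow> complex poly \<Rightarrow> nat \<Rightarrow> complex \<Rightarrow> nat" where
  "deriv_mult P Q S T n \<zeta> = nat (zorder ((deriv ^^ n) (hyperexp P Q S T)) \<zeta>)"


section \<open>The limit measure on the plane\<close>

definition vor_cell :: "complex set \<Rightarrow> complex \<Rightarrow> complex set" where
  "vor_cell A a = {z. \<forall>b\<in>A. cmod (z - a) \<le> cmod (z - b)}"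

definition vor_edge :: "complex set \<Rightarrow> complex \<Rightarrow> complex \<Rightarrow> complex set" where
  "vor_edge A a b =
     (let F = vor_cell A a \<inter> vor_cell A b in if aff_dim F = 1 then F else {})"

text \<open>Arclength on the perpendicular bisector of \<open>a \<noteq> b\<close>, as the image of Lebesgue measure
  under a unit speed parametrisation of that line, which contains \<open>vor_edge A a b\<close>.\<close>

definition bisector_length :: "complex \<Rightarrow> complex \<Rightarrow> complex measure" where
  "bisector_length a b =
     distr lborel borel (\<lambda>t. (a + b) / 2 + of_real t * (\<i> * (b - a) / of_real (cmod (b - a))))"

text \<open>The sum runs over ordered pairs of distinct points, so that every edge occurs
  twice; hence the factor \<open>1 / 2\<close> in front of it.\<close>

definition mu_fix :: "complex poly \<Rightarrow> complex poly \<Rightarrow> complex poly \<Rightarrow> complex measure" where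
  "mu_fix Q S T = measure_of UNIV (sets borel) (\<lambda>X.
     ennreal (1 / kappa Q S T) * (\<Sum>c\<in>zeros T. of_nat (order c T) * emeasure (return borel c) X) +
     ennreal (1 / (2 * pi * kappa Q S T)) * (ennreal (1 / 2) *
       (\<Sum>(a, b) \<in> {(a, b). a \<in> sing_set Q T \<and> b \<in> sing_set Q T \<and> a \<noteq> b}.
          \<integral>\<^sup>+ z. ennreal (cmod (a - b) / (cmod (z - a) * cmod (z - b)))
                * indicator (vor_edge (sing_set Q T) a b \<inter> X) z \<partial>bisector_length a b)))"


section \<open>The microscopic measure\<close>

definition cstar :: "nat \<Rightarrow> real" where
  "cstar m = ((real m + 1) / real m) ^ (m + 1)"

definition cut :: "nat \<Rightarrow> complex set" where
  "cut m = of_real ` {0..cstar m}"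

definition micro_branch :: "nat \<Rightarrow> (complex \<Rightarrow> complex) \<Rightarrow> bool" where
  "micro_branch m v \<longleftrightarrow>
     v holomorphic_on (- cut m) \<and>
     (\<forall>\<zeta>. \<zeta> \<notin> cut m \<longrightarrow> v \<zeta> ^ (m + 1) = of_nat m * \<zeta> * (v \<zeta> - 1)) \<and>
     (\<lambda>\<zeta>. v \<zeta> - (1 + 1 / (of_nat m * \<zeta>))) \<in> O[at_infinity](\<lambda>\<zeta>. 1 / \<zeta>\<^sup>2)"

text \<open>The branch is determined off the cut only, hence the existential quantifier.\<close>

definition mu_micro :: "nat \<Rightarrow> real measure" where
  "mu_micro m = (THE \<mu>. prob_space \<mu> \<and> sets \<mu> = sets borel \<and> (AE x in \<mu>. x \<in> {0..cstar m}) \<and>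
     (\<exists>v. micro_branch m v \<and>
        (\<forall>\<zeta>. \<zeta> \<notin> cut m \<longrightarrow>
           (LINT x|\<mu>. 1 / (\<zeta> - complex_of_real x)) = 1 - 1 / v \<zeta> ^ m)))"

text \<open>The Riemann sphere is the one-point compactification of the plane, with \<open>None\<close> as the point
  at infinity.\<close>

definition riemann_sphere :: "complex option topology" where
  "riemann_sphere = Alexandroff_compactification euclidean"

definition sphere_borel :: "complex option measure" where
  "sphere_borel = sigma UNIV {X. openin riemann_sphere X}"

text \<open>The value for \<open>x < 0\<close> is irrelevant, since \<open>mu_micro m\<close> lives on \<open>{0..cstar m}\<close>.\<close>

definition phi :: "nat \<Rightarrow> complex \<Rightarrow> nat \<Rightarrow> real \<Rightarrow> complex option" where
  "phi m \<eta> \<nu> x =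
     (if x = 0 then None
      else Some (exp (2 * pi * \<i> * of_nat \<nu> / of_nat m) * \<eta> * of_real (x powr (- 1 / real m))))"

definition mu_hat :: "nat \<Rightarrow> complex \<Rightarrow> complex option measure" where
  "mu_hat m lam = (let \<eta> = (SOME \<eta>. \<eta> ^ m = - lam) in
     measure_of UNIV (sets sphere_borel) (\<lambda>X.
       ennreal (1 / real m) * (\<Sum>\<nu><m. emeasure (distr (mu_micro m) sphere_borel (phi m \<eta> \<nu>)) X)))"

definition sphere_weak_conv ::
  "(nat \<Rightarrow> complex option measure) \<Rightarrow> complex option measure \<Rightarrow> bool" where
  "sphere_weak_conv \<nu> \<mu> \<longleftrightarrow>
     (\<forall>n. finite_measure (\<nu> n) \<and> sets (\<nu> n) = sets sphere_borel) \<and>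
     finite_measure \<mu> \<and> sets \<mu> = sets sphere_borel \<and>
     (\<forall>g :: complex option \<Rightarrow> complex. continuous_map riemann_sphere euclidean g \<longrightarrow>
        (\<lambda>n. LINT w|\<nu> n. g w) \<longlonglongrightarrow> (LINT w|\<mu>. g w))"

definition nu_local ::
  "complex poly \<Rightarrow> complex poly \<Rightarrow> complex poly \<Rightarrow> complex poly \<Rightarrow> complex \<Rightarrow> real \<Rightarrow> nat
     \<Rightarrow> complex option measure" where
  "nu_local P Q S T c \<rho> n =
     distr (point_measure {\<zeta> \<in> deriv_zeros P Q S T n. 0 < cmod (\<zeta> - c) \<and> cmod (\<zeta> - c) < \<rho>}
              (\<lambda>\<zeta>. ennreal (real (deriv_mult P Q S T n \<zeta>) / (real (order c T) * real n))))
       sphere_borel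
       (\<lambda>\<zeta>. Some (of_real (root (order c T) (real n)) * (\<zeta> - c)))"

section \<open>Well-definedness\<close>

lemma finite_zeros: "R \<noteq> 0 \<Longrightarrow> finite (zeros R)"
  unfolding zeros_def by (rule poly_roots_finite)

lemma dvd_mult_pderiv:
  assumes "p \<noteq> 0" "(\<Prod>c\<in>zeros p. [:- c, 1:]) dvd D"
  shows "p dvd D * pderiv p"
  using assms
proof (induction "degree p" arbitrary: p rule: less_induct)
  case less
  show ?case
  proof (cases "degree p = 0")
    case True
    then show ?thesis by (simp add: pderiv_eq_0_iff)
  next
    case False
    then obtain a where a: "poly p a = 0"
      using fundamental_theorem_of_algebra[of p] by (auto simp: constant_degree)
    then obtain q where q: "p = [:- a, 1:] * q"
      by (auto simp: poly_eq_0_iff_dvd)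
    have q0: "q \<noteq> 0" using q less.prems by auto
    have "degree p = degree [:- a, 1:] + degree q"
      unfolding q using q0 by (intro degree_mult_eq) auto
    then have deg: "degree q < degree p" by simp
    have sub: "zeros q \<subseteq> zeros p" unfolding zeros_def q by auto
    have fin: "finite (zeros p)" using less.prems(1) by (rule finite_zeros)
    have "(\<Prod>c\<in>zeros q. [:- c, 1:]) dvd D"
      using prod_dvd_prod_subset[OF fin sub, of "\<lambda>c. [:- c, 1:]"] less.prems(2) dvd_trans by blast
    from less.hyps[OF deg q0 this] have IH: "q dvd D * pderiv q" .
    have "[:- a, 1:] dvd (\<Prod>c\<in>zeros p. [:- c, 1:])"
      using fin a by (intro dvd_prodI) (auto simp: zeros_def)
    then have aD: "[:- a, 1:] dvd D" using less.prems(2) dvd_trans by blast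
    define A where "A = [:- a, 1:]"
    have qA: "p = A * q" using q by (simp only: A_def)
    have "pderiv A = 1" by (simp add: A_def pderiv_pCons)
    then have "pderiv p = q + A * pderiv q"
      unfolding qA pderiv_mult by (simp only: mult_1_right add.commute)
    then have "D * pderiv p = D * q + A * (D * pderiv q)"
      by (simp only: distrib_left mult.left_commute)
    moreover have "p dvd D * q"
      unfolding qA by (rule mult_dvd_mono) (use aD in \<open>simp_all only: A_def dvd_refl\<close>)
    moreover have "p dvd A * (D * pderiv q)"
      unfolding qA by (rule mult_dvd_mono[OF dvd_refl IH])
    ultimately show ?thesis by (simp only: dvd_add)
  qed
qed

lemma PT_nonzero: "T \<noteq> 0 \<Longrightarrow> PT P T \<noteq> 0"
  unfolding PT_def by (simp add: finite_zeros)

lemma zeros_PT: "T \<noteq> 0 \<Longrightarrow> zeros (PT P T) \<subseteq> zeros T"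
  by (auto simp: PT_def zeros_def poly_prod finite_zeros[unfolded zeros_def])

lemma poly_Upoly:
  assumes "T \<noteq> 0" "Q \<noteq> 0" "z \<notin> sing_set Q T"
  shows "poly (Upoly P Q S T) z = poly (Wpoly Q T) z * Lam P Q S T z"
proof -
  define D where "D = (\<Prod>c\<in>zeros T. [:- c, 1:])"
  define V where "V = (\<Prod>b\<in>zeros Q - zeros T. [:- b, 1:])"
  define l where "l = lead_coeff T"
  define G where "G = smult (1 / l) (D * V)"
  have l0: "l \<noteq> 0" using assms by (simp add: l_def)
  have T: "T = smult l (\<Prod>c\<in>zeros T. [:- c, 1:] ^ order c T)"
    unfolding l_def zeros_def by (rule complex_poly_decompose[symmetric])
  have "Wpoly Q T = (\<Prod>c\<in>zeros T. [:- c, 1:] ^ order c T) * (D * V)"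
    by (simp only: Wpoly_def D_def V_def power_add power_one_right prod.distrib mult.assoc)
  also have "\<dots> = smult l (\<Prod>c\<in>zeros T. [:- c, 1:] ^ order c T) * G"
    using l0 by (simp add: G_def)
  also have "\<dots> = T * G" by (simp only: T[symmetric])
  finally have WG: "Wpoly Q T = T * G" .
  have DG: "D dvd G" unfolding G_def by (simp add: dvd_smult)
  have DW: "D * V dvd Wpoly Q T" unfolding WG G_def by (simp add: dvd_smult)
  obtain K1 where K1: "G * pderiv T = T * K1"
    using dvd_mult_pderiv[OF assms(1) DG[unfolded D_def]] by (rule dvdE)
  have "(\<Prod>c\<in>zeros (PT P T). [:- c, 1:]) dvd D"
    unfolding D_def by (intro prod_dvd_prod_subset finite_zeros zeros_PT assms)
  then have "(\<Prod>c\<in>zeros (PT P T). [:- c, 1:]) dvd Wpoly Q T"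
    by (rule dvd_trans[OF _ dvd_trans[OF dvd_triv_left DW]])
  from dvd_mult_pderiv[OF PT_nonzero[OF assms(1)] this]
  obtain K2 where K2: "Wpoly Q T * pderiv (PT P T) = PT P T * K2" by (rule dvdE)
  have "D * V = (\<Prod>c\<in>zeros T \<union> (zeros Q - zeros T). [:- c, 1:])"
    unfolding D_def V_def using assms by (intro prod.union_disjoint[symmetric]) (auto simp: finite_zeros)
  moreover have "(\<Prod>c\<in>zeros Q. [:- c, 1:]) dvd (\<Prod>c\<in>zeros T \<union> (zeros Q - zeros T). [:- c, 1:])"
    using assms by (intro prod_dvd_prod_subset) (auto simp: finite_zeros)
  ultimately have "(\<Prod>c\<in>zeros Q. [:- c, 1:]) dvd Wpoly Q T"
    using DW by (simp only:) (rule dvd_trans)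
  from dvd_mult_pderiv[OF assms(2) this]
  obtain K3 where K3: "Wpoly Q T * pderiv Q = Q * K3" by (rule dvdE)
  define U where "U = G * pderiv S - S * K1 + K2 - K3"
  have U: "poly U w = poly (Wpoly Q T) w * Lam P Q S T w" if w: "w \<notin> sing_set Q T" for w
  proof -
    have nz: "poly T w \<noteq> 0" "poly Q w \<noteq> 0" "poly (PT P T) w \<noteq> 0"
      using w zeros_PT[OF assms(1), of P] by (auto simp: sing_set_def zeros_def)
    have "(expo S T has_field_derivative
            (poly (pderiv S) w * poly T w - poly S w * poly (pderiv T) w) / (poly T w * poly T w)) (at w)"
      unfolding expo_def[abs_def] using nz by (auto intro!: derivative_eq_intros poly_DERIV)
    then have d: "deriv (expo S T) w =
            (poly (pderiv S) w * poly T w - poly S w * poly (pderiv T) w) / (poly T w * poly T w)"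
      by (rule DERIV_imp_deriv)
    have k1: "poly G w * poly (pderiv T) w = poly T w * poly K1 w"
      using arg_cong[OF K1, of "\<lambda>p. poly p w"] by simp
    have k2: "poly (Wpoly Q T) w * poly (pderiv (PT P T)) w = poly (PT P T) w * poly K2 w"
      using arg_cong[OF K2, of "\<lambda>p. poly p w"] by simp
    have k3: "poly (Wpoly Q T) w * poly (pderiv Q) w = poly Q w * poly K3 w"
      using arg_cong[OF K3, of "\<lambda>p. poly p w"] by simp
    have 1: "poly (Wpoly Q T) w * deriv (expo S T) w
              = poly G w * poly (pderiv S) w - poly S w * (poly G w * poly (pderiv T) w) / poly T w"
      unfolding d WG using nz by (simp add: field_simps)
    have 2: "poly (Wpoly Q T) w * (poly (pderiv (PT P T)) w / poly (PT P T) w) = poly K2 w"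
      using nz k2 by (simp add: field_simps)
    have 3: "poly (Wpoly Q T) w * (poly (pderiv Q) w / poly Q w) = poly K3 w"
      using nz k3 by (simp add: field_simps)
    have "poly (Wpoly Q T) w * Lam P Q S T w
            = poly (Wpoly Q T) w * deriv (expo S T) w
              + poly (Wpoly Q T) w * (poly (pderiv (PT P T)) w / poly (PT P T) w)
              - poly (Wpoly Q T) w * (poly (pderiv Q) w / poly Q w)"
      unfolding Lam_def by (simp only: ring_distribs)
    also have "\<dots> = poly U w"
      unfolding 1 2 3 k1 U_def using nz by simp
    finally show ?thesis by simp
  qed
  have unique: "U1 = U" if "\<forall>z. z \<notin> sing_set Q T \<longrightarrow> poly U1 z = poly (Wpoly Q T) z * Lam P Q S T z" for U1
  proof (rule ccontr)
    assume "U1 \<noteq> U"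
    then have "finite {z. poly (U1 - U) z = 0}" by (intro poly_roots_finite) simp
    moreover have "- sing_set Q T \<subseteq> {z. poly (U1 - U) z = 0}" using that U by auto
    ultimately have "finite (- sing_set Q T)" using finite_subset by blast
    moreover have "finite (sing_set Q T)" using assms by (simp add: sing_set_def finite_zeros)
    ultimately have "finite (UNIV :: complex set)" by (metis Compl_partition finite_UnI)
    then show False by (simp add: infinite_UNIV_char_0)
  qed
  have "Upoly P Q S T = U"
    unfolding Upoly_def using U unique by (intro the_equality) auto
  then show ?thesis using U assms(3) by simp
qed

lemma closed_vor_cell: "closed (vor_cell A a)"
proof -
  have "vor_cell A a = (\<Inter>b\<in>A. {z. cmod (z - a) \<le> cmod (z - b)})"
    by (auto simp: vor_cell_def)
  moreover have "closed {z. cmod (z - a) \<le> cmod (z - b)}" for b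
    by (intro closed_Collect_le continuous_intros)
  ultimately show ?thesis by auto
qed

lemma vor_edge_borel [measurable]: "vor_edge A a b \<in> sets borel"
  unfolding vor_edge_def Let_def
  by (auto intro!: borel_closed closed_Int closed_vor_cell)

lemma vor_edge_subset_bisector: "b \<in> A \<Longrightarrow> a \<in> A \<Longrightarrow> vor_edge A a b \<subseteq> {z. cmod (z - a) = cmod (z - b)}"
  by (auto simp: vor_edge_def vor_cell_def Let_def split: if_splits intro: antisym)

lemma range_bisector:
  assumes "a \<noteq> b"
  shows "range (\<lambda>t. (a + b) / 2 + of_real t * (\<i> * (b - a) / of_real (cmod (b - a))))
           = {z. cmod (z - a) = cmod (z - b)}"
proof -
  define u where "u = (b - a) / of_real (cmod (b - a))"
  define l where "l = cmod (b - a) / 2"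
  have l: "l > 0" using assms by (simp add: l_def)
  have u: "cmod u = 1" using assms by (simp add: u_def norm_divide)
  have ab: "(a + b) / 2 - a = of_real l * u" "b - (a + b) / 2 = of_real l * u"
    using assms by (simp_all add: u_def l_def field_simps)
  have *: "cmod (z - a) = cmod (z - b) \<longleftrightarrow> (\<exists>t. z = (a + b) / 2 + of_real t * (\<i> * u))" for z
  proof -
    define y where "y = (z - (a + b) / 2) / u"
    have u0: "u \<noteq> 0" using u by auto
    have uy: "u * y = z - (a + b) / 2" using u0 by (simp add: y_def)
    have "z - a = u * y + ((a + b) / 2 - a)" "z - b = u * y - (b - (a + b) / 2)"
      unfolding uy by simp_all
    then have za: "z - a = u * (y + of_real l)" and zb: "z - b = u * (y - of_real l)"
      unfolding ab by (simp_all add: ring_distribs mult.commute)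
    have "cmod (z - a) = cmod (z - b) \<longleftrightarrow> cmod (y + of_real l) = cmod (y - of_real l)"
      unfolding za zb by (simp add: norm_mult u)
    also have "\<dots> \<longleftrightarrow> (Re y + l)\<^sup>2 = (Re y - l)\<^sup>2"
      by (simp add: cmod_def)
    also have "\<dots> \<longleftrightarrow> Re y = 0"
      using l by (auto simp: power2_eq_square algebra_simps)
    also have "\<dots> \<longleftrightarrow> (\<exists>t. y = of_real t * \<i>)"
    proof
      assume "Re y = 0"
      then have "y = of_real (Im y) * \<i>" by (simp add: complex_eq_iff)
      then show "\<exists>t. y = of_real t * \<i>" ..
    qed auto
    also have "\<dots> \<longleftrightarrow> (\<exists>t. z = (a + b) / 2 + of_real t * (\<i> * u))"
      using u0 by (auto simp: y_def field_simps)
    finally show ?thesis .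
  qed
  show ?thesis by (auto simp: * u_def)
qed

lemma sets_bisector_length [simp, measurable_cong]: "sets (bisector_length a b) = sets borel"
  by (simp add: bisector_length_def)

lemma sets_mu_fix [simp]: "sets (mu_fix Q S T) = sets borel"
  unfolding mu_fix_def by (subst sets_measure_of) (auto simp: sets.sigma_sets_eq[of borel, simplified])

lemma suminf_weighted_sums:
  fixes e :: "'a \<Rightarrow> nat \<Rightarrow> ennreal" and g :: "'b \<Rightarrow> nat \<Rightarrow> ennreal"
  assumes "\<And>c. (\<Sum>n. e c n) = e' c" "\<And>p. (\<Sum>n. g p n) = g' p"
  shows "(\<Sum>n. k * (\<Sum>c\<in>C. w c * e c n) + k' * (k'' * (\<Sum>p\<in>D. g p n)))
           = k * (\<Sum>c\<in>C. w c * e' c) + k' * (k'' * (\<Sum>p\<in>D. g' p))"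
  by (simp add: suminf_add[symmetric] suminf_sum assms)

lemma emeasure_mu_fix:
  assumes X: "X \<in> sets borel"
  shows "emeasure (mu_fix Q S T) X =
     ennreal (1 / kappa Q S T) * (\<Sum>c\<in>zeros T. of_nat (order c T) * emeasure (return borel c) X) +
     ennreal (1 / (2 * pi * kappa Q S T)) * (ennreal (1 / 2) *
       (\<Sum>(a, b) \<in> {(a, b). a \<in> sing_set Q T \<and> b \<in> sing_set Q T \<and> a \<noteq> b}.
          \<integral>\<^sup>+ z. ennreal (cmod (a - b) / (cmod (z - a) * cmod (z - b)))
                * indicator (vor_edge (sing_set Q T) a b \<inter> X) z \<partial>bisector_length a b))"
  (is "_ = ?f X")
proof -
  have ind: "(\<Sum>n. indicator (E \<inter> A n) z) = (indicator (E \<inter> (\<Union>n. A n)) z :: ennreal)"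
    if "disjoint_family A" for A :: "nat \<Rightarrow> complex set" and E z
  proof -
    have "disjoint_family (\<lambda>n. E \<inter> A n)" using that by (auto simp: disjoint_family_on_def)
    moreover have "(\<Union>n. E \<inter> A n) = E \<inter> (\<Union>n. A n)" by auto
    ultimately show ?thesis using suminf_indicator[of "\<lambda>n. E \<inter> A n" z] by metis
  qed
  have cs: "(\<Sum>n. ?f (A n)) = ?f (\<Union>n. A n)"
    if A: "range A \<subseteq> sets borel" "disjoint_family A" for A :: "nat \<Rightarrow> complex set"
  proof -
    have Am [measurable]: "A n \<in> sets borel" for n using A by auto
    have 1: "(\<Sum>n. emeasure (return borel c) (A n)) = emeasure (return borel c) (\<Union>n. A n)" for c
      using A by (intro suminf_emeasure) auto
    have 2: "(\<Sum>n. \<integral>\<^sup>+ z. ennreal (cmod (a - b) / (cmod (z - a) * cmod (z - b)))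
                * indicator (vor_edge (sing_set Q T) a b \<inter> A n) z \<partial>bisector_length a b)
           = (\<integral>\<^sup>+ z. ennreal (cmod (a - b) / (cmod (z - a) * cmod (z - b)))
                * indicator (vor_edge (sing_set Q T) a b \<inter> (\<Union>n. A n)) z \<partial>bisector_length a b)" for a b
      by (subst nn_integral_suminf[symmetric]) (auto simp: ind[OF A(2)])
    have 3: "(\<Sum>n. case p of (a, b) \<Rightarrow> \<integral>\<^sup>+ z. ennreal (cmod (a - b) / (cmod (z - a) * cmod (z - b)))
                * indicator (vor_edge (sing_set Q T) a b \<inter> A n) z \<partial>bisector_length a b)
           = (case p of (a, b) \<Rightarrow> (\<integral>\<^sup>+ z. ennreal (cmod (a - b) / (cmod (z - a) * cmod (z - b)))
                * indicator (vor_edge (sing_set Q T) a b \<inter> (\<Union>n. A n)) z \<partial>bisector_length a b))" for p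
      by (cases p) (simp add: 2)
    show ?thesis
      by (rule suminf_weighted_sums[OF 1 3])
  qed
  show ?thesis
  proof (rule emeasure_measure_of[OF mu_fix_def])
    show "countably_additive (sets (mu_fix Q S T)) ?f"
      unfolding countably_additive_def sets_mu_fix using cs by blast
  qed (auto simp: positive_def X)
qed

lemma space_sphere_borel [simp]: "space sphere_borel = UNIV"
  by (simp add: sphere_borel_def)

lemma topspace_riemann_sphere [simp]: "topspace riemann_sphere = UNIV"
  using notin_range_Some by (auto simp: riemann_sphere_def)

lemma measurable_Some_sphere [measurable]: "Some \<in> measurable borel sphere_borel"
  unfolding sphere_borel_def
proof (rule measurable_measure_of)
  fix Y assume "Y \<in> {X. openin riemann_sphere X}"
  then consider U where "open U" "Y = Some ` U"
    | C where "closed C" "Y = insert None (Some ` (- C))"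
    by (auto simp: riemann_sphere_def openin_Alexandroff_compactification
          Compl_eq_Diff_UNIV[symmetric])
  then have "open (Some -` Y)"
  proof cases
    case (2 C)
    have "Some -` Y = - C" using 2 by auto
    then show ?thesis using 2(1) by (simp add: open_Compl)
  qed (simp add: inj_vimage_image_eq)
  then show "Some -` Y \<inter> space borel \<in> sets borel" by simp
qed auto

lemma measurable_phi [measurable]: "phi m \<eta> \<nu> \<in> measurable borel sphere_borel"
proof -
  have "(\<lambda>x. exp (2 * pi * \<i> * of_nat \<nu> / of_nat m) * \<eta> * complex_of_real (x powr (- 1 / real m)))
          \<in> borel_measurable borel"
    by measurable
  from measurable_compose[OF this measurable_Some_sphere] show ?thesis
    unfolding phi_def[abs_def] by (intro measurable_If) auto
qed

lemma sets_mu_hat [simp]: "sets (mu_hat m lam) = sets sphere_borel"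
  using sets.sigma_sets_eq[of sphere_borel] sets.space_closed[of sphere_borel]
  by (simp add: mu_hat_def Let_def)

lemma emeasure_mu_hat:
  assumes "X \<in> sets sphere_borel"
  shows "emeasure (mu_hat m lam) X =
    ennreal (1 / real m) *
      (\<Sum>\<nu><m. emeasure (distr (mu_micro m) sphere_borel (phi m (SOME \<eta>. \<eta> ^ m = - lam) \<nu>)) X)"
  (is "_ = ?f X")
proof (rule emeasure_measure_of[OF mu_hat_def[unfolded Let_def]])
  show "countably_additive (sets (mu_hat m lam)) ?f"
    unfolding countably_additive_def sets_mu_hat
    by (simp add: suminf_sum suminf_emeasure)
qed (use assms in \<open>auto simp: positive_def\<close>)


end

theory Submission
  imports Defs "HOL-Library.Multiset"
begin

text \<open>
Near the pole $c_j$ of order $m$ write $z = c_j + x$, $x = n^{-1/m}\eta Y$ and $\kappa = Y^m$.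
Cauchy's inequality on $|\tau| = t$ for $A_n(x) = x^n f^{(n)}(c_j + x)/(n!\,f(c_j + x))$ compares
$|A_n|$ with $t^{-n}\exp(n \max \Re((1 - (1+\tau)^{-m})/\kappa))$, and the saddle
$1 + \tau = v$ is the branch defining $\mu_m$.  Multiplying by the $n$-th power of the inverse saddle value
gives functions $H_n$ with $|H_n| \le e^{o(n)}$ locally uniformly on $\{Y : Y^m \notin [1/c^*_m, \infty)\}$ and
$|H_n(0)| \ge 1/(en)$.  Jensen's inequality leaves only $o(n)$ zeros in compact subsets of that domain, and the
logarithmic derivative of $H_n$ near $0$ yields the limits of the power sums of $u = 1/Y$ over the zeros.
These are the moments of the $m$-th root of $\mu_m$ on the star $\{u : u^m \in [0, c^*_m]\}$, where
polynomials in $u$ are dense.  The total count $mn + o(n)$ is an argument principle on circles where a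
polynomial in $1/x$ coming from the residues of $f (z - c_j)^k$ is not too small.
\<close>

section \<open>Fuss--Catalan series and the microscopic measure\<close>

text \<open>Two facts on \<open>H\<close> are available: an upper bound off the slit and the value
  at 0. No asymptotic formula is proved, and no bound on the slit itself, where the zeros gather.
  Hence the detour through power sums of u = 1/Y, which are read off at Y = 0. They decide the limit
  because the star has no interior and does not separate the plane, so that conj u is itself a limit
  of polynomials in u. The logarithmic derivative does not see the power sum of exponent 0; this is
  what the separate count of all zeros in the disc supplies.

  The Cauchy estimate is needed only near the slit and for large Y; the maximum principle does the
  rest. Near the slit the circle through the saddle, |tau| = |v - 1|, is the right one, which is a
  fact of plane trigonometry on Re (1 + tau)^(-m). The slit starts at 1 / \<open>cstar m\<close>
  because \<open>cstar m\<close> is the zeta for which v^(m+1) = m zeta (v - 1) has a double root, v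
  = 1 + 1/m.

  As \<open>mu_micro\<close> is a definite description, existence and uniqueness of the measure come
  first: its moments are Raney numbers, and they are realised by a product of independent Beta
  variables.\<close>

lemma fls_residue_sum: "fls_residue (\<Sum>i\<in>A. f i) = (\<Sum>i\<in>A. fls_residue (f i))"
 by (induction A rule: infinite_finite_induct) auto

text \<open>Lagrange inversion in residue form. After cutting \<open>V\<close> beyond degree n, each
  term k V_k F' F^(k-1-n) with k < n is a derivative and has residue 0, and the tail gives a power
  series. Only k = n survives, where F'/F has residue 1 because \<open>F\<close> has a simple
  zero.\<close>

lemma fls_residue_deriv_div_power:
 fixes F V :: "complex fps"
 assumes F0: "fps_nth F 0 = 0" and F1: "fps_nth F 1 \<noteq> 0"
 shows "fls_residue (fps_to_fls (fps_deriv (V oo F)) / fps_to_fls F ^ n) = of_nat n * fps_nth V n"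
proof -
 define f where "f = fps_to_fls F"
 have f0: "f \<noteq> 0" using F1 by (auto simp: f_def)
 define G where "G = fps_shift (Suc n) V oo F"
 define P where "P = (\<Sum>k\<le>n. fps_const (fps_nth V k) * fps_X ^ k)"
 have V: "V = P + fps_X ^ Suc n * fps_shift (Suc n) V"
 proof (rule fps_ext)
  fix j
  have "fps_nth P j = (if j \<le> n then fps_nth V j else 0)"
   by (auto simp: P_def fps_sum_nth if_distrib[of "\<lambda>x. _ * x"] cong: if_cong)
  moreover have "fps_nth (fps_X ^ Suc n * fps_shift (Suc n) V) j = (if j \<le> n then 0 else fps_nth V j)"
   by (subst fps_X_power_mult_nth) auto
  ultimately show "fps_nth V j = fps_nth (P + fps_X ^ Suc n * fps_shift (Suc n) V) j"
   by simp
 qed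
 have XF: "(fps_X :: complex fps) ^ k oo F = F ^ k" for k
  by (subst fps_compose_power[symmetric]) (simp_all add: F0)
 have "V oo F = (P oo F) + F ^ Suc n * G"
  by (subst V) (simp only: fps_compose_add_distrib fps_compose_mult_distrib[OF F0] G_def XF)
 moreover have "P oo F = (\<Sum>k\<le>n. fps_const (fps_nth V k) * F ^ k)"
  unfolding P_def fps_compose_sum_distrib
  by (simp only: fps_compose_mult_distrib[OF F0] XF fps_const_compose)
 ultimately have VF: "V oo F = (\<Sum>k\<le>n. fps_const (fps_nth V k) * F ^ k) + F ^ Suc n * G" by simp
 have dp: "fps_deriv (F ^ k) = of_nat k * fps_deriv F * F ^ (k - 1)" for k
  by (simp add: fps_deriv_power fps_of_nat)
 have d: "fps_deriv (V oo F) = (\<Sum>k\<le>n. fps_const (fps_nth V k) * (of_nat k * fps_deriv F * F ^ (k - 1)))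
   + F ^ n * (of_nat (Suc n) * fps_deriv F * G + F * fps_deriv G)"
  unfolding VF by (simp only: fps_deriv_add fps_deriv_mult dp fps_deriv_sum fps_deriv_const diff_Suc_1)
   (simp add: algebra_simps del: of_nat_Suc)
 define df where "df = fps_to_fls (fps_deriv F)"
 have df: "fls_deriv f = df" by (simp add: f_def df_def fls_deriv_fps_to_fls)
 have s: "fps_to_fls (\<Sum>k\<in>A. g k) = (\<Sum>k\<in>A. fps_to_fls (g k))" for A :: "nat set" and g :: "nat \<Rightarrow> complex fps"
  by (induction A rule: infinite_finite_induct) (auto simp: fps_to_fls_plus)
 have "fps_to_fls (fps_deriv (V oo F)) / f ^ n =
   (\<Sum>k\<le>n. fls_const (fps_nth V k) * (of_nat k * df * f ^ (k - 1) / f ^ n))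
    + fps_to_fls (of_nat (Suc n) * fps_deriv F * G + F * fps_deriv G)"
  unfolding d using f0
  by (simp add: fps_to_fls_plus s fls_times_fps_to_fls add_divide_distrib sum_divide_distrib
    f_def df_def fps_to_fls_power del: of_nat_Suc)
 moreover have "fls_residue (of_nat k * df * f ^ (k - 1) / f ^ n) = (if k = n then of_nat n else 0)"
  if k: "k \<le> n" for k
 proof (cases "k = n")
  case True
  show ?thesis
  proof (cases "n = 0")
   case False
   then have "of_nat k * df * f ^ (k - 1) / f ^ n = of_nat n * (fls_deriv f * inverse f)"
    using f0 True by (cases n) (auto simp: df field_simps)
   moreover have "fls_subdegree f = 1"
    unfolding f_def fls_subdegree_fls_to_fps
    using F0 F1 by (auto intro!: subdegreeI simp: less_Suc_eq)
   ultimately show ?thesis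
    using True fls_residue_deriv_times_inverse_eq_subdegree(1)[of f]
    by (simp only: fls_of_nat fls_residue_fls_const_times) simp
  qed (use True in simp)
 next
  case False
  then have kn: "k < n" using k by simp
  define h where "h = inverse (f ^ (n - k))"
  obtain j where j: "n - k = Suc j" using kn by (metis Suc_diff_Suc)
  have "fls_deriv (inverse f ^ (n - k)) = of_nat (n - k) * inverse f ^ j * fls_deriv (inverse f)"
   unfolding j by (simp only: fls_deriv_power diff_Suc_1 mult_ac)
  also have "\<dots> = - (of_nat (n - k) * (inverse f ^ (n - k + 1)) * df)"
   unfolding j fls_inverse_deriv df by (simp add: power2_eq_square)
  finally have "fls_deriv (inverse f ^ (n - k)) = - (of_nat (n - k) * (inverse f ^ (n - k + 1)) * df)" .
  moreover have "of_nat k * df * f ^ (k - 1) / f ^ n = of_nat k * (inverse f ^ (n - k + 1)) * df"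
  proof (cases k)
   case (Suc j)
   then have "f ^ n = f ^ j * f ^ (n - k + 1)" proof -
    have "n = j + (n - k + 1)" using kn Suc by simp
    then show ?thesis by (metis power_add)
   qed
   then show ?thesis using f0 Suc by (simp add: field_simps)
  qed simp
  ultimately have "of_nat k * df * f ^ (k - 1) / f ^ n
    = fls_const (- (of_nat k / of_nat (n - k))) * fls_deriv (inverse f ^ (n - k))"
   using kn by (simp add: fls_of_nat fls_const_mult_const[symmetric] mult.assoc[symmetric] del: of_nat_diff)
  then show ?thesis using False by (simp only: fls_residue_fls_const_times fls_residue_deriv) simp
 qed
 ultimately have "fls_residue (fps_to_fls (fps_deriv (V oo F)) / f ^ n) =
   (\<Sum>k\<le>n. fps_nth V k * (if k = n then of_nat n else 0))"
  by (simp only: fls_residue_add fls_residue_sum fls_residue_fls_const_times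
    fls_residue_power_series fls_subdegree_fls_to_fps_gt0) simp
 then show ?thesis by (simp add: f_def if_distrib[of "\<lambda>x. _ * x"] cong: if_cong)
qed

text \<open>The expansion of v^(-m) in powers of x = 1/(m zeta). Since V - x is then v^(-(m+1)), the
  equation of the branch becomes (V - x)^m = V^(m+1), in which only V occurs.\<close>

definition fuss_fps :: "nat \<Rightarrow> complex fps" where
 "fuss_fps m = Abs_fps (\<lambda>n. if n = 0 then 1
   else - of_nat m / of_nat n * of_nat (((m + 1) * (n - 1)) choose (n - 1)))"

text \<open>Put x = t (1 + t)^(-(m+1)) and V = (1 + t)^(-m); then V - x = (1 + t)^(-(m+1)), and both
  sides are (1 + t)^(-m (m+1)). Here 1 + t is the branch v. Lagrange inversion computes the
  coefficients of V as a series in x and finds those of \<open>fuss_fps m\<close>.\<close>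

lemma fuss_fps_identity:
 assumes m: "m \<ge> 1"
 shows "(fuss_fps m - fps_X) ^ m = fuss_fps m ^ (m + 1)"
proof -
 define L :: "complex fps" where "L = 1 + fps_X"
 define F where "F = fps_X * inverse L ^ (m + 1)"
 define H where "H = inverse L ^ m"
 have L0: "fps_nth L 0 = 1" by (simp add: L_def)
 have LL: "inverse L * L = 1" using L0 by (intro inverse_mult_eq_1) auto
 have F0: "fps_nth F 0 = 0" and F1: "fps_nth F 1 \<noteq> 0"
  by (simp_all add: F_def L0 fps_power_zeroth)
 define V where "V = H oo fps_inv F"
 have "fps_inv F oo F = fps_X" by (rule fps_inv[OF F0 F1])
 have I0: "fps_nth (fps_inv F) 0 = 0" by (simp add: fps_inv_def)
 have VF: "V oo F = H" unfolding V_def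
  by (subst fps_compose_assoc[symmetric]) (use F0 I0 fps_inv[OF F0 F1] in auto)
 have F_inv: "F oo fps_inv F = fps_X" by (rule fps_inv_right[OF F0 F1])
 have "V - fps_X = (H - F) oo fps_inv F" unfolding V_def
  by (simp add: fps_compose_sub_distrib F_inv)
 also have "H - F = inverse L ^ (m + 1)"
 proof -
  have "H = inverse L ^ (m + 1) * L" using LL by (simp add: H_def mult.assoc)
  then show ?thesis by (simp add: F_def L_def algebra_simps)
 qed
 finally have VX: "V - fps_X = inverse L ^ (m + 1) oo fps_inv F" .
 have "(V - fps_X) ^ m = V ^ (m + 1)"
  unfolding VX unfolding V_def H_def
  by (simp add: fps_compose_power[OF I0] mult.commute flip: power_mult power_Suc)
 moreover have "V = fuss_fps m"
 proof (rule fps_ext)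
  fix n
  show "fps_nth V n = fps_nth (fuss_fps m) n"
  proof (cases n)
   case 0
   have "fps_nth V 0 = fps_nth (V oo F) 0" by (simp add: F0)
   then show ?thesis using 0 by (simp add: VF H_def fuss_fps_def L0 fps_power_zeroth)
  next
   case (Suc k)
   have dH: "fps_deriv H = - of_nat m * inverse L ^ (m + 1)"
   proof -
    obtain j where j: "m = Suc j" using m by (cases m) auto
    have "fps_deriv H = of_nat m * inverse L ^ j * fps_deriv (inverse L)"
     unfolding H_def j by (simp only: fps_deriv_power' diff_Suc_1 mult_ac)
    also have "fps_deriv (inverse L) = - (inverse L ^ 2)"
     using L0 by (simp add: fps_inverse_deriv L_def)
    finally show ?thesis by (simp add: j power2_eq_square mult_ac del: of_nat_Suc)
   qed
   define l where "l = fps_to_fls L"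
   have l0: "l \<noteq> 0" using L0 by (auto simp: l_def)
   have il: "fps_to_fls (inverse L) = inverse l" using L0
    by (simp add: l_def fls_inverse_fps_to_fls subdegree_eq_0_iff)
   have "(m + 1) * Suc k = (m + 1) + (m + 1) * k" by simp
   then have e: "l ^ ((m + 1) * Suc k) = l ^ (m + 1) * l ^ ((m + 1) * k)" by (simp only: power_add)
   have "fps_to_fls (fps_deriv H) / fps_to_fls F ^ n =
     - of_nat m * inverse l ^ (m + 1) / (fls_X * inverse l ^ (m + 1)) ^ n"
    unfolding dH F_def by (simp only: fls_times_fps_to_fls fps_to_fls_power il fps_to_fls_of_nat fps_to_fls_uminus fps_X_to_fls)
   also have "\<dots> = - of_nat m * l ^ ((m + 1) * k) / fls_X ^ n"
    using l0 e unfolding Suc power_mult_distrib power_mult[symmetric]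
    by (simp add: field_simps power_inverse)
   also have "\<dots> = fls_const (- of_nat m) * fls_shift n (fps_to_fls (L ^ ((m + 1) * k)))"
    by (simp only: fls_divide_X_power[symmetric] fps_to_fls_power l_def)
      (simp add: fls_of_nat fls_shifted_times_simps)
   finally have "fls_residue (fps_to_fls (fps_deriv H) / fps_to_fls F ^ n) =
     - of_nat m * fls_residue (fls_shift n (fps_to_fls (L ^ ((m + 1) * k))))"
    by (simp only: fls_residue_fls_const_times)
   also have "fls_residue (fls_shift n (fps_to_fls (L ^ ((m + 1) * k)))) = fps_nth (L ^ ((m + 1) * k)) k"
    using Suc by simp
   also have "\<dots> = of_nat (((m + 1) * k) choose k)"
    using fps_binomial_of_nat[of "(m + 1) * k", where 'a = complex]
    by (simp add: L_def fps_binomial_nth binomial_gbinomial flip: fps_binomial_of_nat)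
   finally have "of_nat n * fps_nth V n = - of_nat m * of_nat (((m + 1) * k) choose k)"
    using fls_residue_deriv_div_power[OF F0 F1, of V n] unfolding VF by simp
   then have "fps_nth V n = - of_nat m * of_nat (((m + 1) * k) choose k) / of_nat n"
    by (metis Suc nonzero_mult_div_cancel_left of_nat_neq_0)
   then show ?thesis by (simp add: Suc fuss_fps_def)
  qed
 qed
 ultimately show ?thesis by simp
qed

section \<open>The moments of the microscopic measure, and a measure that has them\<close>

lemma fact_mult_pochhammer:
 assumes "n \<ge> 1"
 shows "fact (n * k) = real n ^ (n * k) * (\<Prod>j=1..n. pochhammer (real j / real n) k)"
proof (induction k)
 case (Suc k)
 have "fact (n * Suc k) = fact (n * k) * (\<Prod>j=1..n. real (n * k + j))"
 proof -
  have "fact (a + i) = fact a * (\<Prod>j=1..i. real (a + j))" for a i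
   by (induction i) (auto simp: algebra_simps)
  from this[of "n * k" n] show ?thesis by (simp add: add.commute)
 qed
 also have "(\<Prod>j=1..n. real (n * k + j)) = (\<Prod>j=1..n. real n * (real j / real n + real k))"
  using assms by (intro prod.cong) (auto simp: field_simps)
 also have "\<dots> = real n ^ n * (\<Prod>j=1..n. real j / real n + real k)"
  by (simp add: prod.distrib)
 finally show ?case
  unfolding Suc.IH by (simp add: pochhammer_Suc prod.distrib power_add mult_ac)
qed auto

text \<open>The coefficient of zeta^(-k-1) in 1 - v^(-m), the prescribed Cauchy transform, as given
  by \<open>fuss_fps m\<close> at x = 1/(m zeta).\<close>

definition micro_moment :: "nat \<Rightarrow> nat \<Rightarrow> real" where
 "micro_moment m k = real (((m + 1) * k) choose k) / (real (k + 1) * real m ^ k)"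

text \<open>The multiplication formula splits the factorials of (m+1) k and m k into Pochhammer
  symbols. Each quotient with parameters a below and a + b is the k-th moment of a Beta law, and
  j/(m+1) < j/m makes every b positive: positivity of the moment sequence becomes visible.\<close>

lemma micro_moment_pochhammer:
 assumes "m \<ge> 1"
 shows "micro_moment m k = cstar m ^ k * (pochhammer 1 k / pochhammer 2 k) *
   (\<Prod>j=1..m. pochhammer (real j / real (m + 1)) k / pochhammer (real j / real m) k)"
proof -
 have p2: "pochhammer 2 k = (real k + 1) * fact k"
  by (induction k) (auto simp: pochhammer_Suc algebra_simps)
 have A: "fact ((m + 1) * k) = real (m + 1) ^ ((m + 1) * k) * (fact k * (\<Prod>j=1..m. pochhammer (real j / real (m + 1)) k))"
  using fact_mult_pochhammer[of "m + 1" k] by (simp add: pochhammer_fact prod.cl_ivl_Suc mult_ac)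
 have B: "fact (m * k) = real m ^ (m * k) * (\<Prod>j=1..m. pochhammer (real j / real m) k)"
  by (rule fact_mult_pochhammer[OF assms])
 have pm: "(\<Prod>j=1..m. pochhammer (real j / real m) k) > 0"
  using assms by (intro prod_pos) (auto intro!: pochhammer_pos)
 have c: "cstar m ^ k = real (m + 1) ^ ((m + 1) * k) / (real m ^ (m * k) * real m ^ k)"
  unfolding cstar_def power_mult[symmetric] power_add[symmetric]
  by (simp add: power_divide add.commute mult.commute)
 have "real (((m + 1) * k) choose k) = fact ((m + 1) * k) / (fact k * fact (m * k))"
  using binomial_fact[of k "(m + 1) * k", where 'a = real] by simp
 also have "\<dots> = real (m + 1) ^ ((m + 1) * k) / real m ^ (m * k)
   * ((\<Prod>j=1..m. pochhammer (real j / real (m + 1)) k) / (\<Prod>j=1..m. pochhammer (real j / real m) k))"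
  unfolding A B by simp
 finally have b: "real (((m + 1) * k) choose k) = real (m + 1) ^ ((m + 1) * k) / real m ^ (m * k)
   * ((\<Prod>j=1..m. pochhammer (real j / real (m + 1)) k) / (\<Prod>j=1..m. pochhammer (real j / real m) k))" .
 have "pochhammer 1 k / pochhammer 2 k = 1 / real (k + 1)"
  unfolding p2 by (simp add: pochhammer_fact[symmetric] add.commute)
 then show ?thesis
  unfolding micro_moment_def c b prod_dividef by (simp add: mult_ac)
qed

text \<open>The absolute value matters because \<open>ennreal\<close> sends negative numbers to 0:
  with it, powers stay multiplicative on the whole line. Excluding the endpoint 0 from the support
  is what later rules out an atom at 0.\<close>

lemma beta_law:
 fixes a b :: real
 assumes "a > 0" "b > 0"
 shows "\<exists>M :: real measure. prob_space M \<and> sets M = sets borel \<and> (AE t in M. t \<in> {0<..1}) \<and>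
   (\<forall>k. (\<integral>\<^sup>+t. ennreal (\<bar>t\<bar> ^ k) \<partial>M) = ennreal (pochhammer a k / pochhammer (a + b) k))"
proof -
 define w where "w t = indicator {0..1} t * (t powr (a - 1) * (1 - t) powr (b - 1)) / Beta a b" for t :: real
 have B: "Beta a b > 0" using assms by (simp add: Beta_def)
 have w0: "w t \<ge> 0" for t using B by (auto simp: w_def)
 have [measurable]: "w \<in> borel_measurable borel" unfolding w_def by measurable
 define M where "M = density lborel (\<lambda>t. ennreal (w t))"
 have mom: "(\<integral>\<^sup>+t. ennreal (\<bar>t\<bar> ^ k) \<partial>M) = ennreal (pochhammer a k / pochhammer (a + b) k)" for k
 proof -
  have "((\<lambda>t. t powr (a + real k - 1) * (1 - t) powr (b - 1)) has_integral Beta (a + real k) b) {0..1}"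
   using assms by (intro has_integral_Beta_real) auto
  then have "((\<lambda>t. t powr (a + real k - 1) * (1 - t) powr (b - 1) / Beta a b) has_integral
     (Beta (a + real k) b / Beta a b)) {0..1}" by (rule has_integral_divide)
  moreover have "t powr (a + real k - 1) * (1 - t) powr (b - 1) / Beta a b = \<bar>t\<bar> ^ k * w t" if "t \<in> {0..1} - {0}" for t
   using that by (simp add: w_def powr_realpow[symmetric] powr_add[symmetric] algebra_simps)
  ultimately have "((\<lambda>t. \<bar>t\<bar> ^ k * w t) has_integral (Beta (a + real k) b / Beta a b)) {0..1}"
   by (intro has_integral_spike[of "{0}" "{0..1}" "\<lambda>t. \<bar>t\<bar> ^ k * w t"]) auto
  then have "((\<lambda>t. \<bar>t\<bar> ^ k * w t) has_integral (Beta (a + real k) b / Beta a b)) UNIV"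
   by (rule has_integral_on_superset) (auto simp: w_def)
  then have "(\<integral>\<^sup>+t. ennreal (\<bar>t\<bar> ^ k * w t) \<partial>lborel) = ennreal (Beta (a + real k) b / Beta a b)"
   using w0 by (intro nn_integral_has_integral_lborel) auto
  moreover have "(\<integral>\<^sup>+t. ennreal (\<bar>t\<bar> ^ k) \<partial>M) = (\<integral>\<^sup>+t. ennreal (\<bar>t\<bar> ^ k * w t) \<partial>lborel)"
   unfolding M_def by (subst nn_integral_density) (auto simp: w0 ennreal_mult'[symmetric] mult.commute)
  moreover have "Beta (a + real k) b / Beta a b = pochhammer a k / pochhammer (a + b) k"
  proof -
   have na: "a \<notin> \<int>\<^sub>\<le>\<^sub>0" "a + b \<notin> \<int>\<^sub>\<le>\<^sub>0" using assms by (auto elim!: nonpos_Ints_cases)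
   have "Gamma a > 0" "Gamma b > 0" "Gamma (a + b) > 0" "Gamma (a + b + real k) > 0" using assms by auto
   then show ?thesis
    unfolding pochhammer_Gamma[OF na(1)] pochhammer_Gamma[OF na(2)]
    by (simp add: Beta_def field_simps)
  qed
  ultimately show ?thesis by simp
 qed
 have "prob_space M"
  using mom[of 0] by (intro prob_spaceI) (simp add: M_def)
 moreover have "AE t in M. t \<in> {0<..1}"
  unfolding M_def
  using AE_lborel_singleton[of 0]
  by (subst AE_density) (auto simp: w_def indicator_def elim!: eventually_mono split: if_splits)
 moreover have "sets M = sets borel" by (simp add: M_def)
 ultimately show ?thesis using mom by blast
qed

text \<open>Law of a product of independent variables. A second factor in (0, 1] preserves the
  interval (0, L].\<close>

lemma mult_convolution:
 fixes M N :: "real measure"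
 assumes "prob_space M" "sets M = sets borel" "AE x in M. x \<in> {0<..L}"
  and "\<And>k. (\<integral>\<^sup>+x. ennreal (\<bar>x\<bar> ^ k) \<partial>M) = ennreal (u k)"
  and "prob_space N" "sets N = sets borel" "AE x in N. x \<in> {0<..1}"
  and "\<And>k. (\<integral>\<^sup>+x. ennreal (\<bar>x\<bar> ^ k) \<partial>N) = ennreal (w k)" "\<And>k. u k \<ge> 0"
 shows "\<exists>K :: real measure. prob_space K \<and> sets K = sets borel \<and> (AE x in K. x \<in> {0<..L}) \<and>
   (\<forall>k. (\<integral>\<^sup>+x. ennreal (\<bar>x\<bar> ^ k) \<partial>K) = ennreal (u k * w k))"
proof -
 interpret M: prob_space M by fact
 interpret N: prob_space N by fact
 interpret pair_prob_space M N ..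
 note [measurable_cong] = assms(2,6)
 define K where "K = distr (M \<Otimes>\<^sub>M N) borel (\<lambda>(x, t). x * t)"
 have "prob_space K" unfolding K_def by (intro prob_space_distr) measurable
 moreover have "AE z in M \<Otimes>\<^sub>M N. fst z \<in> {0<..L} \<and> snd z \<in> {0<..1}"
 proof (rule AE_pair_measure)
  show "{z \<in> space (M \<Otimes>\<^sub>M N). fst z \<in> {0<..L} \<and> snd z \<in> {0<..1}} \<in> sets (M \<Otimes>\<^sub>M N)"
   by measurable
  show "AE x in M. AE y in N. fst (x, y) \<in> {0<..L} \<and> snd (x, y) \<in> {0<..1}"
   using assms(3) assms(7) by (auto elim!: eventually_mono)
 qed
 then have "AE x in K. x \<in> {0<..L}"
  unfolding K_def
 proof (subst AE_distr_iff)
  assume *: "AE z in M \<Otimes>\<^sub>M N. fst z \<in> {0<..L} \<and> snd z \<in> {0<..1}"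
  show "AE z in M \<Otimes>\<^sub>M N. (case z of (x, t) \<Rightarrow> x * t) \<in> {0<..L}"
   using *
  proof eventually_elim
   case (elim z)
   then have "fst z * snd z \<le> fst z * 1" by (intro mult_left_mono) auto
   moreover have "fst z \<le> L" using elim by simp
   ultimately have "fst z * snd z \<le> L" by linarith
   then show ?case using elim by (auto simp: case_prod_beta)
  qed
 qed auto
 moreover have "(\<integral>\<^sup>+x. ennreal (\<bar>x\<bar> ^ k) \<partial>K) = ennreal (u k * w k)" for k
 proof -
  have "(\<integral>\<^sup>+x. ennreal (\<bar>x\<bar> ^ k) \<partial>K) = (\<integral>\<^sup>+z. ennreal (\<bar>fst z\<bar> ^ k) * ennreal (\<bar>snd z\<bar> ^ k) \<partial>(M \<Otimes>\<^sub>M N))"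
   unfolding K_def by (subst nn_integral_distr) (auto intro!: nn_integral_cong simp: abs_mult power_mult_distrib ennreal_mult)
  also have "\<dots> = (\<integral>\<^sup>+x. \<integral>\<^sup>+t. ennreal (\<bar>x\<bar> ^ k) * ennreal (\<bar>t\<bar> ^ k) \<partial>N \<partial>M)"
   by (subst N.nn_integral_fst[symmetric]) auto
  also have "\<dots> = (\<integral>\<^sup>+x. ennreal (\<bar>x\<bar> ^ k) \<partial>M) * (\<integral>\<^sup>+t. ennreal (\<bar>t\<bar> ^ k) \<partial>N)"
   by (simp add: nn_integral_cmult nn_integral_multc)
  finally show ?thesis using assms by (simp add: ennreal_mult')
 qed
 moreover have "sets K = sets borel" by (simp add: K_def)
 ultimately show ?thesis by blast
qed

text \<open>Start from the point mass at \<open>cstar m\<close> and multiply in one Beta variable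
  for each factor of \<open>micro_moment_pochhammer\<close>: the uniform one for the quotient with 1
  and 2, then those with parameters j/(m+1) and j/m - j/(m+1) for j = 1, ..., m.\<close>

lemma micro_moment_measure_exists:
 assumes "m \<ge> 1"
 shows "\<exists>M :: real measure. prob_space M \<and> sets M = sets borel \<and> (AE x in M. x \<in> {0<..cstar m}) \<and>
   (\<forall>k. (\<integral>\<^sup>+x. ennreal (\<bar>x\<bar> ^ k) \<partial>M) = ennreal (micro_moment m k))"
proof -
 have cpos: "cstar m > 0" using assms by (simp add: cstar_def)
 define u where "u i k = cstar m ^ k * (pochhammer 1 k / pochhammer 2 k) *
   (\<Prod>j=1..i. pochhammer (real j / real (m + 1)) k / pochhammer (real j / real m) k)" for i k
 have pp: "pochhammer x k \<ge> 0" if "x > 0" for x :: real and k using that by (simp add: pochhammer_pos less_imp_le)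
 have u0: "u i k \<ge> 0" for i k
  unfolding u_def using cpos assms by (intro mult_nonneg_nonneg divide_nonneg_nonneg prod_nonneg pp) (auto intro!: divide_nonneg_nonneg pp)
 have "\<exists>M :: real measure. prob_space M \<and> sets M = sets borel \<and> (AE x in M. x \<in> {0<..cstar m}) \<and>
   (\<forall>k. (\<integral>\<^sup>+x. ennreal (\<bar>x\<bar> ^ k) \<partial>M) = ennreal (u i k))" if "i \<le> m" for i
  using that
 proof (induction i)
  case 0
  obtain N :: "real measure" where N: "prob_space N" "sets N = sets borel" "AE t in N. t \<in> {0<..1}"
   "\<And>k. (\<integral>\<^sup>+t. ennreal (\<bar>t\<bar> ^ k) \<partial>N) = ennreal (pochhammer 1 k / pochhammer 2 k)"
   using beta_law[of 1 1] by auto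
  have "\<exists>K :: real measure. prob_space K \<and> sets K = sets borel \<and> (AE x in K. x \<in> {0<..cstar m}) \<and>
   (\<forall>k. (\<integral>\<^sup>+x. ennreal (\<bar>x\<bar> ^ k) \<partial>K) = ennreal (cstar m ^ k * (pochhammer 1 k / pochhammer 2 k)))"
   using cpos
   by (intro mult_convolution[of "return borel (cstar m)", OF _ _ _ _ N])
     (auto simp: prob_space_return AE_return nn_integral_return)
  then show ?case by (simp add: u_def)
 next
  case (Suc i)
  then obtain M :: "real measure" where M: "prob_space M" "sets M = sets borel" "AE x in M. x \<in> {0<..cstar m}"
   "\<And>k. (\<integral>\<^sup>+x. ennreal (\<bar>x\<bar> ^ k) \<partial>M) = ennreal (u i k)" by auto
  define a where "a = real (Suc i) / real (m + 1)"
  define b where "b = real (Suc i) / real m - a"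
  have ab: "a > 0" "b > 0" "a + b = real (Suc i) / real m" using assms
   by (auto simp: a_def b_def intro!: divide_strict_left_mono)
  obtain N :: "real measure" where N: "prob_space N" "sets N = sets borel" "AE t in N. t \<in> {0<..1}"
   "\<And>k. (\<integral>\<^sup>+t. ennreal (\<bar>t\<bar> ^ k) \<partial>N) = ennreal (pochhammer a k / pochhammer (a + b) k)"
   using beta_law[OF ab(1,2)] by auto
  have "u (Suc i) k = u i k * (pochhammer a k / pochhammer (a + b) k)" for k
   unfolding u_def ab(3) unfolding a_def by simp
  then show ?case using mult_convolution[OF M N u0] by simp
 qed
 from this[of m] show ?thesis using micro_moment_pochhammer[OF assms] by (simp add: u_def)
qed

section \<open>Lower bounds for polynomials on grids and on circles\<close>

lemma fact_ge_power_div_3: "(real n / 3) ^ n \<le> fact n"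
proof -
 have "(real n) ^ n / fact n \<le> exp (real n)"
 proof -
  have "(\<Sum>i\<in>{n}. real n ^ i /\<^sub>R fact i) \<le> (\<Sum>i. real n ^ i /\<^sub>R fact i)"
   by (intro sum_le_suminf summable_exp_generic) auto
  then show ?thesis by (simp add: exp_def field_simps)
 qed
 also have "exp (real n) \<le> 3 ^ n"
  using exp_le by (simp add: exp_of_nat_mult[of n "1::real", simplified] power_mono)
 finally show ?thesis by (simp add: field_simps)
qed

lemma coeff_shift_diff:
 fixes p :: "real poly"
 assumes "degree p \<le> Suc q"
 shows "degree (pcompose p [:h, 1:] - p) \<le> q \<and>
     coeff (pcompose p [:h, 1:] - p) q = real (Suc q) * h * coeff p (Suc q)"
 using assms
proof (induction q arbitrary: p)
 case 0
 then obtain a r where p': "p = pCons a r" "degree r \<le> 0" by (cases p) (auto split: if_splits)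
 then obtain b where p: "p = [:a, b:]" by (auto elim: degree_eq_zeroE)
 show ?case by (simp add: p pcompose_pCons)
next
 case (Suc q)
 obtain a r where p: "p = pCons a r" by (cases p)
 have r: "degree r \<le> Suc q" using Suc.prems by (auto simp: p split: if_splits)
 define d where "d = pcompose r [:h, 1:] - r"
 have d: "degree d \<le> q" "coeff d q = real (Suc q) * h * coeff r (Suc q)"
  using Suc.IH[OF r] by (auto simp: d_def)
 have "pcompose p [:h, 1:] - p = pCons 0 d + smult h (d + r)"
  by (simp add: p pcompose_pCons d_def algebra_simps)
 moreover have "degree (pCons 0 d) \<le> Suc q" using d(1) by (simp add: degree_pCons_le le_trans[OF degree_pCons_le])
 moreover have "degree (smult h (d + r)) \<le> Suc q"
  using d(1) r by (intro degree_smult_le[THEN le_trans] degree_add_le) auto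
 moreover have "coeff d (Suc q) = 0" using d(1) by (simp add: coeff_eq_0)
 ultimately show ?case using d(2) by (auto simp: p degree_add_le algebra_simps)
qed

text \<open>The q-th difference with step h equals q! h^q times the coefficient of degree q, and it
  is a signed sum of grid values of total weight 2^q. The induction takes one difference at a time:
  one of two neighbouring values is at least half of it.\<close>

lemma poly_grid_lower_bound:
 fixes p :: "real poly"
 assumes "degree p \<le> q" "h > 0"
 shows "\<exists>j\<le>q. \<bar>coeff p q\<bar> * fact q * h ^ q / 2 ^ q \<le> \<bar>poly p (x + real j * h)\<bar>"
 using assms(1)
proof (induction q arbitrary: p)
 case 0
 then obtain a where "p = [:a:]" by (metis degree_eq_zeroE le_0_eq)
 then show ?case by simp
next
 case (Suc q)
 define d where "d = pcompose p [:h, 1:] - p"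
 have d: "degree d \<le> q" "coeff d q = real (Suc q) * h * coeff p (Suc q)"
  using coeff_shift_diff[OF Suc.prems] by (auto simp: d_def)
 obtain j where j: "j \<le> q" "\<bar>coeff d q\<bar> * fact q * h ^ q / 2 ^ q \<le> \<bar>poly d (x + real j * h)\<bar>"
  using Suc.IH[OF d(1)] by auto
 define B where "B = \<bar>coeff p (Suc q)\<bar> * fact (Suc q) * h ^ Suc q / 2 ^ Suc q"
 have "\<bar>coeff d q\<bar> * fact q * h ^ q / 2 ^ q = 2 * B"
  using assms(2) unfolding d(2) B_def abs_mult by (simp add: field_simps del: of_nat_Suc)
 moreover have "poly d (x + real j * h) = poly p (x + real (Suc j) * h) - poly p (x + real j * h)"
  by (simp add: d_def poly_pcompose algebra_simps)
 ultimately have "B \<le> \<bar>poly p (x + real (Suc j) * h)\<bar> \<or> B \<le> \<bar>poly p (x + real j * h)\<bar>"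
  using j(2) by linarith
 then show ?case using j(1) unfolding B_def by (metis Suc_le_mono le_SucI)
qed

text \<open>A Cartan type estimate. On a grid of q equal steps across the interval, q! >= (q/3)^q
  cancels the q in the step width; the 6 is this 3 times the 2 lost in each difference.\<close>

lemma prod_dist_lower_bound:
 fixes e :: "'a \<Rightarrow> nat" and s :: "'a \<Rightarrow> real"
 assumes "finite A" "t1 < t2"
 shows "\<exists>t\<in>{t1..t2}. ((t2 - t1) / 6) ^ (\<Sum>a\<in>A. e a) \<le> (\<Prod>a\<in>A. \<bar>t - s a\<bar> ^ e a)"
proof -
 define q where "q = (\<Sum>a\<in>A. e a)"
 define p where "p = (\<Prod>a\<in>A. [:- s a, 1:] ^ e a)"
 have deg: "degree p = q"
  unfolding p_def q_def by (subst degree_prod_eq_sum_degree) (auto simp: degree_power_eq)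
 have "lead_coeff p = 1" unfolding p_def by (simp add: lead_coeff_prod lead_coeff_power)
 then have c: "coeff p q = 1" by (simp add: deg)
 have pv: "\<bar>poly p t\<bar> = (\<Prod>a\<in>A. \<bar>t - s a\<bar> ^ e a)" for t
  by (simp add: p_def poly_prod abs_prod power_abs)
 show ?thesis
 proof (cases "q = 0")
  case True
  then show ?thesis using assms by (intro bexI[of _ t1]) (auto simp: q_def)
 next
  case False
  define h where "h = (t2 - t1) / real q"
  have h: "h > 0" using False assms by (simp add: h_def)
  obtain j where j: "j \<le> q" "1 * fact q * h ^ q / 2 ^ q \<le> \<bar>poly p (t1 + real j * h)\<bar>"
   using poly_grid_lower_bound[of p q h t1] deg h c by auto
  have "real j * h \<le> real q * h" using j h by (intro mult_right_mono) auto
  also have "real q * h = t2 - t1" using False by (simp add: h_def)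
  finally have t: "t1 + real j * h \<in> {t1..t2}" using h by auto
  have "((t2 - t1) / 6) ^ q = (real q / 3) ^ q * (h / 2) ^ q"
   using False by (simp add: h_def flip: power_mult_distrib)
  also have "\<dots> \<le> fact q * (h / 2) ^ q" using h by (intro mult_right_mono fact_ge_power_div_3) auto
  also have "\<dots> \<le> \<bar>poly p (t1 + real j * h)\<bar>" using j(2) by (simp add: power_divide)
  finally show ?thesis using t pv q_def by auto
 qed
qed

text \<open>Compare |s - a| with |s0 - a| zero by zero. Zeros with |a| < 2 t2 satisfy |s0 - a| <= 3
  t2 and are handled together by \<open>prod_dist_lower_bound\<close>, through |s - a| >= |t - |a||.
  For the others a factor 1/3 suffices, whatever t is. The loss per zero is (t2 - t1)/6 divided by 3
  t2, whence the 18.\<close>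

lemma poly_min_modulus:
 fixes p :: "complex poly"
 assumes t: "0 < t1" "t1 < t2" and s0: "cmod s0 = t1" and p0: "poly p s0 \<noteq> 0"
 shows "\<exists>t\<in>{t1..t2}. \<forall>s. cmod s = t \<longrightarrow>
  cmod (poly p s0) * ((t2 - t1) / (18 * t2)) ^ degree p \<le> cmod (poly p s)"
proof -
 have pn: "p \<noteq> 0" using p0 by auto
 define Z where "Z = zeros p"
 have fZ: "finite Z" using pn by (simp add: Z_def finite_zeros)
 define e where "e a = order a p" for a
 have dec: "smult (lead_coeff p) (\<Prod>a\<in>Z. [:- a, 1:] ^ e a) = p"
  unfolding Z_def zeros_def e_def by (rule complex_poly_decompose)
 have pv: "cmod (poly p s) = cmod (lead_coeff p) * (\<Prod>a\<in>Z. cmod (s - a) ^ e a)" for s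
  by (subst dec[symmetric]) (simp add: poly_prod norm_mult norm_power flip: prod_norm)
 have deg: "(\<Sum>a\<in>Z. e a) = degree p"
 proof -
  have "degree p = degree (\<Prod>a\<in>Z. [:- a, 1:] ^ e a)"
   using pn by (subst dec[symmetric]) (simp del: )
  also have "\<dots> = (\<Sum>a\<in>Z. e a)"
   by (subst degree_prod_eq_sum_degree) (auto simp: degree_power_eq)
  finally show ?thesis by simp
 qed
 define N where "N = {a\<in>Z. cmod a < 2 * t2}"
 define k where "k = (t2 - t1) / (18 * t2)"
 have k: "0 < k" "k \<le> 1/3" using t by (auto simp: k_def field_simps)
 obtain t where t': "t \<in> {t1..t2}"
  and tN: "((t2 - t1) / 6) ^ (\<Sum>a\<in>N. e a) \<le> (\<Prod>a\<in>N. \<bar>t - cmod a\<bar> ^ e a)"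
  using prod_dist_lower_bound[of N t1 t2 e cmod] fZ t by (auto simp: N_def)
 show ?thesis
 proof (intro bexI[OF _ t'] allI impI)
  fix s :: complex assume s: "cmod s = t"
  have a0: "s0 \<noteq> a" if "a \<in> Z" for a using that p0 by (auto simp: Z_def zeros_def)
  have 1: "(\<Prod>a\<in>N. (cmod (s0 - a) * k) ^ e a) \<le> (\<Prod>a\<in>N. cmod (s - a) ^ e a)"
  proof -
   have "(\<Prod>a\<in>N. (cmod (s0 - a) * k) ^ e a) \<le> (\<Prod>a\<in>N. ((3 * t2) * k) ^ e a)"
   proof (intro prod_mono conjI power_mono mult_right_mono zero_le_power mult_nonneg_nonneg)
    fix a assume a: "a \<in> N"
    have "cmod (s0 - a) \<le> t1 + cmod a" using norm_triangle_ineq4[of s0 a] s0 by simp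
    then show "cmod (s0 - a) \<le> 3 * t2" using a t by (auto simp: N_def)
   qed (use k in auto)
   also have "\<dots> = ((t2 - t1) / 6) ^ (\<Sum>a\<in>N. e a)"
    proof -
    have "(3 * t2) * k = (t2 - t1) / 6" using t by (simp add: k_def field_simps)
    then show ?thesis by (simp only: power_sum)
   qed
   also note tN
   also have "(\<Prod>a\<in>N. \<bar>t - cmod a\<bar> ^ e a) \<le> (\<Prod>a\<in>N. cmod (s - a) ^ e a)"
    by (intro prod_mono conjI power_mono) (auto simp: s[symmetric] norm_triangle_ineq3)
   finally show ?thesis .
  qed
  have 2: "(\<Prod>a\<in>Z-N. (cmod (s0 - a) * k) ^ e a) \<le> (\<Prod>a\<in>Z-N. cmod (s - a) ^ e a)"
  proof (intro prod_mono conjI power_mono zero_le_power mult_nonneg_nonneg)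
   fix a assume a: "a \<in> Z - N"
   have "cmod (s0 - a) * k \<le> (t1 + cmod a) * (1/3)"
    using k norm_triangle_ineq4[of s0 a] s0 by (intro mult_mono) auto
   also have "\<dots> \<le> cmod a - t" using a t t' by (auto simp: N_def)
   also have "\<dots> \<le> cmod (s - a)" using s norm_triangle_ineq2[of a s] by (simp add: norm_minus_commute)
   finally show "cmod (s0 - a) * k \<le> cmod (s - a)" .
  qed (use k in auto)
  have split: "(\<Prod>a\<in>Z. f a) = (\<Prod>a\<in>N. f a) * (\<Prod>a\<in>Z-N. f a)" for f :: "complex \<Rightarrow> real"
   using fZ by (subst mult.commute, intro prod.subset_diff) (auto simp: N_def)
  have "(\<Prod>a\<in>Z. (cmod (s0 - a) * k) ^ e a) \<le> (\<Prod>a\<in>Z. cmod (s - a) ^ e a)"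
   unfolding split using k by (intro mult_mono 1 2 prod_nonneg) auto
  moreover have "(\<Prod>a\<in>Z. (cmod (s0 - a) * k) ^ e a) = (\<Prod>a\<in>Z. cmod (s0 - a) ^ e a) * k ^ degree p"
   by (simp add: power_mult_distrib prod.distrib deg flip: power_sum)
  ultimately show "cmod (poly p s0) * ((t2 - t1) / (18 * t2)) ^ degree p \<le> cmod (poly p s)"
   unfolding pv k_def[symmetric] by (simp add: mult.assoc mult_left_mono)
 qed
qed

section \<open>Measures on an interval and their Cauchy transform in the variable 1/zeta\<close>

definition slit :: "real \<Rightarrow> complex set" where
 "slit L = {k. Im k \<noteq> 0 \<or> Re k < 1 / L}"

lemma open_slit: "open (slit L)"
proof -
 have "slit L = {k. Im k \<noteq> 0} \<union> {k. Re k < 1 / L}" by (auto simp: slit_def)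
 moreover have "open {k. Im k \<noteq> 0}"
  by (intro open_Collect_neq continuous_intros)
 moreover have "open {k. Re k < 1 / L}" by (intro open_Collect_less continuous_intros)
 ultimately show ?thesis by auto
qed

lemma scale_slit:
 assumes "k \<in> slit L" "L > 0" "0 \<le> t" "t \<le> 1"
 shows "of_real t * k \<in> slit L"
proof (cases "Im k = 0 \<or> t = 0")
 case True
 have "t * Re k < 1 / L" if "Im k = 0"
 proof (cases "Re k \<le> 0")
  case True
  then have "t * Re k \<le> 0" using assms by (simp add: mult_le_0_iff)
  then show ?thesis using assms(2) by (smt (verit) divide_pos_pos)
 next
  case False
  then have "t * Re k \<le> 1 * Re k" using assms by (intro mult_right_mono) auto
  then show ?thesis using assms that by (auto simp: slit_def)
 qed
 then show ?thesis using True assms(2) by (auto simp: slit_def)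
qed (use assms in \<open>auto simp: slit_def\<close>)

lemma connected_slit:
 assumes "L > 0"
 shows "connected (slit L)"
proof -
 have "starlike (slit L)"
  unfolding starlike_def
 proof (intro bexI[of _ 0] ballI subsetI)
  fix k z assume "k \<in> slit L" "z \<in> closed_segment 0 k"
  then show "z \<in> slit L" using scale_slit[of k L] assms by (auto simp: in_segment scaleR_conv_of_real)
 qed (use assms in \<open>auto simp: slit_def\<close>)
 then show ?thesis by (rule starlike_imp_connected)
qed

lemma slit_bound_away:
 assumes "k \<in> slit L" "L > 0"
 shows "\<exists>d>0. \<forall>x\<in>{0..L}. d \<le> cmod (1 - k * of_real x)"
proof -
 have nz: "1 - k * of_real x \<noteq> 0" if "x \<in> {0..L}" for x
 proof
  assume "1 - k * of_real x = 0"
  then have e: "k * of_real x = 1" by simp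
  then have "Re k * x = 1" "Im k * x = 0" by (auto simp: complex_eq_iff)
  moreover from this have x: "x > 0" using that by (cases "x = 0") auto
  ultimately have "Im k = 0" "Re k = 1 / x" by (auto simp: field_simps)
  moreover have "1 / x \<ge> 1 / L" using x that by (intro divide_left_mono) auto
  ultimately show False using assms by (auto simp: slit_def)
 qed
 have "continuous_on {0..L} (\<lambda>x. cmod (1 - k * of_real x))" by (intro continuous_intros)
 then obtain x0 where x0: "x0 \<in> {0..L}" "\<And>x. x \<in> {0..L} \<Longrightarrow> cmod (1 - k * of_real x0) \<le> cmod (1 - k * of_real x)"
  using continuous_attains_inf[of "{0..L}" "\<lambda>x. cmod (1 - k * of_real x)"] assms(2) by auto
 then show ?thesis using nz by (intro exI[of _ "cmod (1 - k * of_real x0)"]) auto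
qed

locale interval_measure = prob_space M for M :: "real measure" +
 fixes L :: real
 assumes sets_M [measurable_cong]: "sets M = sets borel" and L_pos: "L > 0"
  and AE_L: "AE x in M. x \<in> {0..L}"
begin

text \<open>This is zeta times the Cauchy transform at zeta = 1/k. In the variable k the point at
  infinity becomes 0, where the expansion in moments converges, and the cut [0, L] becomes the ray
  removed from \<open>slit L\<close>.\<close>

definition J :: "complex \<Rightarrow> complex" where
 "J k = (LINT x|M. 1 / (1 - k * of_real x))"

definition mom :: "nat \<Rightarrow> real" where
 "mom n = (LINT x|M. x ^ n)"

lemma space_M [simp]: "space M = UNIV"
 using sets_eq_imp_space_eq[OF sets_M] by simp

lemma integrable_mom: "integrable M (\<lambda>x. x ^ n)"
proof (rule integrable_const_bound[of _ "L ^ n"])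
 show "AE x in M. norm (x ^ n) \<le> L ^ n"
  using AE_L by eventually_elim (auto simp: power_mono)
qed measurable

lemma mom_le: "mom n \<le> L ^ n"
proof -
 have "mom n \<le> (LINT x|M. L ^ n)"
  unfolding mom_def
 proof (rule integral_mono_AE[OF integrable_mom])
  show "AE x in M. x ^ n \<le> L ^ n" using AE_L by eventually_elim (auto simp: power_mono)
 qed auto
 then show ?thesis by (simp add: prob_space[simplified])
qed

lemma mom_0: "mom 0 = 1"
 by (simp add: mom_def prob_space[simplified])

lemma norm_integral_bound:
 fixes f :: "real \<Rightarrow> complex"
 assumes [measurable]: "f \<in> borel_measurable borel" and "\<And>x. x \<in> {0..L} \<Longrightarrow> cmod (f x) \<le> B"
 shows "integrable M f" "cmod (LINT x|M. f x) \<le> B"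
proof -
 have b: "AE x in M. cmod (f x) \<le> B" using AE_L by eventually_elim (use assms in auto)
 show i: "integrable M f"
  by (rule integrable_const_bound[OF b]) measurable
 have "cmod (LINT x|M. f x) \<le> (LINT x|M. cmod (f x))" by (rule integral_norm_bound)
 also have "\<dots> \<le> (LINT x|M. B)"
  by (rule integral_mono_AE) (use b i in auto)
 finally show "cmod (LINT x|M. f x) \<le> B" by (simp add: prob_space[simplified])
qed

lemma integrable_J:
 assumes "k \<in> slit L"
 shows "integrable M (\<lambda>x. 1 / (1 - k * of_real x))"
proof -
 obtain d where d: "d > 0" "\<And>x. x \<in> {0..L} \<Longrightarrow> d \<le> cmod (1 - k * of_real x)"
  using slit_bound_away[OF assms L_pos] by auto
 show ?thesis
 proof (rule norm_integral_bound)
  fix x assume "x \<in> {0..L}"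
  then have "d \<le> cmod (1 - k * of_real x)" by (rule d(2))
  then show "cmod (1 / (1 - k * of_real x)) \<le> 1 / d" using d(1) by (auto simp: norm_divide intro!: frac_le)
 qed measurable
qed

lemma J_holomorphic: "J holomorphic_on slit L"
proof -
 have "\<exists>D. (J has_field_derivative D) (at k)" if k: "k \<in> slit L" for k
 proof -
  obtain d where d: "d > 0" "\<And>x. x \<in> {0..L} \<Longrightarrow> d \<le> cmod (1 - k * of_real x)"
   using slit_bound_away[OF k L_pos] by auto
  define g where "g x = of_real x / (1 - k * of_real x) ^ 2" for x :: real
  have [measurable]: "g \<in> borel_measurable borel" unfolding g_def by measurable
  have gi: "integrable M g"
  proof (rule norm_integral_bound)
   fix x assume x: "x \<in> {0..L}"
   have "cmod (g x) = x / cmod (1 - k * of_real x) ^ 2" using x by (simp add: g_def norm_divide norm_power)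
   also have "\<dots> \<le> L / d ^ 2" using x d by (intro frac_le power_mono) auto
   finally show "cmod (g x) \<le> L / d ^ 2" .
  qed measurable
  \<comment> \<open>The remainder of first order is h x^2 / (a^2 b) with the two denominators a and
    b below, and |a| >= d, |b| >= d/2, x <= L.\<close>
  define B where "B = 2 * L ^ 2 / d ^ 3"
  have est: "cmod ((J (k + h) - J k) / h - (LINT x|M. g x)) \<le> B * cmod h"
   if h: "h \<noteq> 0" "cmod h < d / (2 * L)" "k + h \<in> slit L" for h
  proof -
   have "(J (k + h) - J k) / h - (LINT x|M. g x) =
     (LINT x|M. (1 / (1 - (k + h) * of_real x) - 1 / (1 - k * of_real x)) / h - g x)"
    unfolding J_def using integrable_J[OF k] integrable_J[OF h(3)] gi by simp
   also have "cmod \<dots> \<le> B * cmod h"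
   proof (rule norm_integral_bound)
    fix x assume x: "x \<in> {0..L}"
    define a where "a = 1 - k * of_real x"
    define b where "b = 1 - (k + h) * of_real x"
    have a: "cmod a \<ge> d" using d x by (auto simp: a_def)
    have "cmod (h * of_real x) \<le> cmod h * L" using x by (auto simp: norm_mult intro: mult_left_mono)
    also have "\<dots> \<le> d / 2" using h(2) L_pos by (simp add: field_simps)
    finally have hx: "cmod (h * of_real x) \<le> d / 2" .
    have b: "cmod b \<ge> d / 2"
    proof -
     have "a = b + h * of_real x" by (simp add: a_def b_def algebra_simps)
     then have "cmod a \<le> cmod b + cmod (h * of_real x)" using norm_triangle_ineq by metis
     then show ?thesis using a hx by simp
    qed
    have nz: "a \<noteq> 0" "b \<noteq> 0" using a b d by auto
    have ba: "b = a - h * of_real x" by (simp add: a_def b_def algebra_simps)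
    have "(1 / b - 1 / a) / h - of_real x / a ^ 2 = h * of_real x ^ 2 / (a ^ 2 * b)"
    proof -
     have "1 / b - 1 / a = (a - b) / (a * b)" using nz by (simp add: diff_divide_eq_iff divide_diff_eq_iff)
     then have "(1 / b - 1 / a) / h - of_real x / a ^ 2 = of_real x / (a * b) - of_real x / (a * a)"
      using h(1) by (simp add: ba power2_eq_square)
     also have "\<dots> = of_real x * (a - b) / (a * a * b)"
      using nz by (simp add: field_simps)
     finally show ?thesis by (simp add: ba power2_eq_square mult_ac)
    qed
    then have "cmod ((1 / b - 1 / a) / h - g x) = cmod h * x ^ 2 / (cmod a ^ 2 * cmod b)"
     by (simp add: g_def a_def norm_mult norm_divide norm_power)
    also have "\<dots> \<le> cmod h * L ^ 2 / (d ^ 2 * (d / 2))"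
     using x a b d by (intro frac_le mult_mono power_mono mult_nonneg_nonneg) auto
    also have "\<dots> = B * cmod h" by (simp add: B_def power2_eq_square power3_eq_cube)
    finally show "cmod ((1 / (1 - (k + h) * of_real x) - 1 / (1 - k * of_real x)) / h - g x) \<le> B * cmod h"
     by (simp add: a_def b_def)
   qed measurable
   finally show ?thesis .
  qed
  obtain e where e: "e > 0" "ball k e \<subseteq> slit L" using open_slit k open_contains_ball by blast
  have "((\<lambda>h. (J (k + h) - J k) / h - (LINT x|M. g x)) \<longlongrightarrow> 0) (at 0)"
  proof (rule Lim_null_comparison)
   show "((\<lambda>h. B * cmod h) \<longlongrightarrow> 0) (at 0)" by (auto intro!: tendsto_eq_intros)
   show "\<forall>\<^sub>F h in at 0. cmod ((J (k + h) - J k) / h - (LINT x|M. g x)) \<le> B * cmod h"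
    unfolding eventually_at
   proof (intro exI[of _ "min e (d / (2 * L))"] conjI ballI impI)
    show "min e (d / (2 * L)) > 0" using e d L_pos by simp
    fix h :: complex assume "h \<noteq> 0 \<and> dist h 0 < min e (d / (2 * L))"
    moreover from this have "k + h \<in> ball k e" by (simp add: dist_norm)
    ultimately show "cmod ((J (k + h) - J k) / h - (LINT x|M. g x)) \<le> B * cmod h"
     using e by (intro est) auto
   qed
  qed
  then have "(\<lambda>h. (J (k + h) - J k) / h) \<midarrow>0\<rightarrow> (LINT x|M. g x)" by (rule LIM_zero_cancel)
  then show ?thesis unfolding DERIV_def by blast
 qed
 then show ?thesis using open_slit by (subst holomorphic_on_open) auto
qed

lemma ball_subset_slit: "ball 0 (1 / L) \<subseteq> slit L"
proof
 fix k :: complex assume "k \<in> ball 0 (1 / L)"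
 then have "Re k < 1 / L" using complex_Re_le_cmod[of k] by (simp add: dist_norm)
 then show "k \<in> slit L" by (simp add: slit_def)
qed

lemma J_sums:
 assumes k: "cmod k < 1 / L"
 shows "(\<lambda>n. of_real (mom n) * k ^ n) sums J k"
proof -
 define q where "q = cmod k * L"
 have q: "0 \<le> q" "q < 1" using k L_pos by (auto simp: q_def field_simps)
 have ks: "k \<in> slit L" using k ball_subset_slit by (auto simp: dist_norm)
 have kx: "cmod (k * of_real x) \<le> q" if "x \<in> {0..L}" for x
  using that by (auto simp: norm_mult q_def intro: mult_left_mono)
 have "cmod ((\<Sum>i<n. of_real (mom i) * k ^ i) - J k) \<le> q ^ n / (1 - q)" for n
 proof -
  have pw: "(k * of_real x) ^ i = k ^ i * complex_of_real (x ^ i)" for i x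
   by (simp add: power_mult_distrib)
  have ii: "integrable M (\<lambda>x. (k * complex_of_real x) ^ i)" for i
   unfolding pw by (intro integrable_mult_right integrable_of_real integrable_mom)
  have "(LINT x|M. (k * complex_of_real x) ^ i) = of_real (mom i) * k ^ i" for i
   unfolding pw mom_def by (simp only: integral_mult_right_zero integral_complex_of_real mult.commute)
  then have "(\<Sum>i<n. of_real (mom i) * k ^ i) = (LINT x|M. (\<Sum>i<n. (k * of_real x) ^ i))"
   using ii by (subst Bochner_Integration.integral_sum) auto
  moreover have "integrable M (\<lambda>x. (\<Sum>i<n. (k * of_real x) ^ i))"
   using ii by (intro Bochner_Integration.integrable_sum) auto
  ultimately have "(\<Sum>i<n. of_real (mom i) * k ^ i) - J k = (LINT x|M. (\<Sum>i<n. (k * of_real x) ^ i) - 1 / (1 - k * of_real x))"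
   unfolding J_def using integrable_J[OF ks] by simp
  also have "cmod \<dots> \<le> q ^ n / (1 - q)"
  proof (rule norm_integral_bound)
   fix x assume x: "x \<in> {0..L}"
   define a where "a = k * of_real x"
   have a: "cmod a \<le> q" using kx[OF x] by (simp add: a_def)
   then have a1: "a \<noteq> 1" using q by auto
   have "(\<Sum>i<n. a ^ i) - 1 / (1 - a) = - (a ^ n / (1 - a))"
    using a1 by (simp add: sum_gp_strict divide_simps)
   moreover have "cmod (1 - a) \<ge> 1 - q" using norm_triangle_ineq2[of 1 a] a by simp
   ultimately have "cmod ((\<Sum>i<n. a ^ i) - 1 / (1 - a)) \<le> q ^ n / (1 - q)"
    using a q by (auto simp: norm_divide norm_power intro!: frac_le power_mono)
   then show "cmod ((\<Sum>i<n. (k * of_real x) ^ i) - 1 / (1 - k * of_real x)) \<le> q ^ n / (1 - q)"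
    by (simp add: a_def)
  qed measurable
  finally show ?thesis .
 qed
 moreover have "(\<lambda>n. q ^ n / (1 - q)) \<longlonglongrightarrow> 0"
  using q by (auto intro!: tendsto_eq_intros LIMSEQ_power_zero)
 ultimately have "(\<lambda>n. (\<Sum>i<n. of_real (mom i) * k ^ i) - J k) \<longlonglongrightarrow> 0"
  by (rule Lim_null_comparison[OF always_eventually, OF allI])
 then show ?thesis unfolding sums_def by (rule LIM_zero_cancel)
qed

lemma J_0: "J 0 = 1"
 by (simp add: J_def prob_space[simplified])

text \<open>Bounded support makes the Taylor remainder of the characteristic function at most 2 (|t|
  L)^n / n!, so the moments determine it, and with it the measure by Levy's theorem.\<close>

lemma char_sums: "(\<lambda>n. \<Sum>k\<le>n. ((\<i> * t) ^ k / fact k) * mom k) \<longlonglongrightarrow> char M t"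
proof -
 interpret real_distribution M by unfold_locales (auto simp: sets_M)
 have "cmod (char M t - (\<Sum>k\<le>n. ((\<i> * t) ^ k / fact k) * mom k)) \<le> 2 * ((\<bar>t\<bar> * L) ^ n / fact n)" for n
 proof -
  have "cmod (char M t - (\<Sum>k\<le>n. ((\<i> * t) ^ k / fact k) * expectation (\<lambda>x. x ^ k))) \<le>
   (2 * \<bar>t\<bar> ^ n / fact n) * expectation (\<lambda>x. \<bar>x\<bar> ^ n)"
   by (rule char_approx1) (rule integrable_mom)
  also have "expectation (\<lambda>x. \<bar>x\<bar> ^ n) = mom n"
   unfolding mom_def
  proof (rule integral_cong_AE)
   show "AE x in M. \<bar>x\<bar> ^ n = x ^ n" using AE_L by eventually_elim auto
  qed auto
  also have "(2 * \<bar>t\<bar> ^ n / fact n) * mom n \<le> (2 * \<bar>t\<bar> ^ n / fact n) * L ^ n"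
   by (intro mult_left_mono mom_le) auto
  finally show ?thesis by (simp add: mom_def power_mult_distrib)
 qed
 moreover have "(\<lambda>n. 2 * ((\<bar>t\<bar> * L) ^ n / fact n)) \<longlonglongrightarrow> 0"
  using tendsto_mult_left[OF summable_LIMSEQ_zero[OF summable_exp_generic[of "\<bar>t\<bar> * L"]], of 2]
  by (simp add: divide_inverse mult.commute)
 ultimately have "(\<lambda>n. char M t - (\<Sum>k\<le>n. ((\<i> * t) ^ k / fact k) * mom k)) \<longlonglongrightarrow> 0"
  by (rule Lim_null_comparison[OF always_eventually, OF allI])
 from tendsto_minus[OF this]
 have "(\<lambda>n. (\<Sum>k\<le>n. ((\<i> * t) ^ k / fact k) * mom k) - char M t) \<longlonglongrightarrow> 0"
  by simp
 then show ?thesis by (rule LIM_zero_cancel)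
qed

end

lemma interval_measure_eqI:
 assumes "interval_measure M L" "interval_measure N L"
  and "\<And>n. interval_measure.mom M n = interval_measure.mom N n"
 shows "M = N"
proof -
 interpret M: interval_measure M L by fact
 interpret N: interval_measure N L by fact
 have "char M t = char N t" for t
  using M.char_sums[of t] N.char_sums[of t] by (intro LIMSEQ_unique) (auto simp: assms(3))
 moreover have "real_distribution M" "real_distribution N"
  by (unfold_locales, auto simp: M.sets_M) (unfold_locales, auto simp: N.sets_M)
 ultimately show ?thesis by (intro Levy_uniqueness) auto
qed

section \<open>Identification of \<open>mu_micro\<close>\<close>

lemma cstar_pos: "m \<ge> 1 \<Longrightarrow> cstar m > 0"
 by (simp add: cstar_def)

lemma differentiable_zero_bound:
 fixes f :: "complex \<Rightarrow> complex"
 assumes "(f has_field_derivative D) (at 0)" "f 0 = 0"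
 shows "\<exists>d>0. \<forall>k. cmod k < d \<longrightarrow> cmod (f k) \<le> (cmod D + 1) * cmod k"
proof -
 have "(\<lambda>h. f h / h) \<midarrow>0\<rightarrow> D" using assms by (simp add: DERIV_def)
 then have "\<forall>\<^sub>F h in at 0. dist (f h / h) D < 1" by (rule tendstoD) simp
 then obtain d where d: "d > 0" "\<And>h. h \<noteq> 0 \<Longrightarrow> dist h 0 < d \<Longrightarrow> dist (f h / h) D < 1"
  by (auto simp: eventually_at)
 show ?thesis
 proof (intro exI[of _ d] conjI allI impI)
  fix k :: complex assume k: "cmod k < d"
  show "cmod (f k) \<le> (cmod D + 1) * cmod k"
  proof (cases "k = 0")
   case False
   then have "dist (f k / k) D < 1" using d(2)[of k] k by simp
   then have "cmod (f k / k) \<le> cmod D + 1"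
    using norm_triangle_ineq2[of "f k / k" D] by (simp add: dist_norm)
   then show ?thesis using False by (simp add: norm_divide field_simps)
  qed (use assms in simp)
 qed (use d in auto)
qed

locale fuss_measure = interval_measure M "cstar m" for M m +
 assumes m_ge: "m \<ge> 1" and mom_micro: "\<And>n. mom n = micro_moment m n"
begin

abbreviation "SL \<equiv> slit (cstar m)"

text \<open>This is v^(-m) at zeta = 1/k, because the Cauchy transform at that point is k
  J(k).\<close>

definition V :: "complex \<Rightarrow> complex" where "V k = 1 - k * J k"

lemma V_holomorphic: "V holomorphic_on SL"
 unfolding V_def by (intro holomorphic_intros J_holomorphic)

lemma V_sums:
 assumes k: "cmod k < 1 / cstar m"
 shows "(\<lambda>n. fps_nth (fuss_fps m) n * (k / of_nat m) ^ n) sums V k"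
proof -
 have m0: "(of_nat m :: complex) \<noteq> 0" using m_ge by simp
 have "(\<lambda>n. - (k * (of_real (mom n) * k ^ n))) sums - (k * J k)"
  by (intro sums_minus sums_mult J_sums k)
 moreover have "- (k * (of_real (mom n) * k ^ n)) = fps_nth (fuss_fps m) (Suc n) * (k / of_nat m) ^ Suc n" for n
  using m0 by (simp add: mom_micro micro_moment_def fuss_fps_def power_divide)
 ultimately have "(\<lambda>n. fps_nth (fuss_fps m) (Suc n) * (k / of_nat m) ^ Suc n) sums (V k - 1)"
  by (simp add: V_def)
 then show ?thesis by (subst (asm) sums_Suc_iff) (simp add: fuss_fps_def)
qed

lemma V_identity_near_0:
 assumes k: "cmod k < 1 / cstar m"
 shows "(V k - k / of_nat m) ^ m = V k ^ (m + 1)"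
proof -
 define F where "F = fuss_fps m"
 have m0: "real m > 0" using m_ge by simp
 define R where "R = 1 / (real m * cstar m)"
 have R: "R > 0" using m0 L_pos by (simp add: R_def)
 have kR: "cmod z < R \<Longrightarrow> cmod (of_nat m * z) < 1 / cstar m" for z
  using m0 L_pos by (simp add: R_def norm_mult field_simps)
 have rad: "fps_conv_radius F \<ge> ereal R"
  unfolding fps_conv_radius_def
 proof (rule conv_radius_geI_ex')
  fix r assume "0 < r" "ereal r < ereal R"
  then have "summable (\<lambda>n. fps_nth F n * (of_nat m * of_real r / of_nat m) ^ n)"
   unfolding F_def by (intro sums_summable[OF V_sums] kR) auto
  then show "summable (\<lambda>n. fps_nth F n * of_real r ^ n)" using m0 by simp
 qed
 define z where "z = k / of_nat m"
 have z: "cmod z < R" using k m0 L_pos by (simp add: z_def R_def norm_divide field_simps)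
 then have zr: "ereal (cmod z) < fps_conv_radius F"
  using rad by (metis less_ereal.simps(1) order_less_le_trans)
 have e: "eval_fps F z = V k" unfolding eval_fps_def F_def z_def
  using V_sums[OF k] by (simp add: sums_iff)
 have zr': "ereal (cmod z) < fps_conv_radius (F - fps_X)"
  using fps_conv_radius_diff[of F fps_X] zr by (simp add: order_less_le_trans)
 have "(eval_fps F z - z) ^ m = eval_fps ((F - fps_X) ^ m) z"
  using zr zr' by (subst eval_fps_power) (auto simp: eval_fps_diff)
 also have "\<dots> = eval_fps (F ^ (m + 1)) z"
  using fuss_fps_identity[OF m_ge] by (simp add: F_def)
 also have "\<dots> = eval_fps F z ^ (m + 1)" by (rule eval_fps_power[OF zr])
 finally show ?thesis unfolding e unfolding z_def .
qed

lemma zero_in_slit: "0 \<in> SL"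
 using L_pos by (simp add: slit_def)

text \<open>The power series identity holds near 0 and spreads by analytic continuation, as the slit
  plane is connected.\<close>

lemma V_identity:
 assumes k: "k \<in> SL"
 shows "(V k - k / of_nat m) ^ m = V k ^ (m + 1)"
proof (rule analytic_continuation_open[of "ball 0 (1 / cstar m)" SL "\<lambda>k. (V k - k / of_nat m) ^ m" "\<lambda>k. V k ^ (m + 1)"])
 show "(\<lambda>k. (V k - k / of_nat m) ^ m) holomorphic_on SL" "(\<lambda>k. V k ^ (m + 1)) holomorphic_on SL"
  using m_ge by (auto intro!: holomorphic_intros V_holomorphic)
 show "connected SL" by (rule connected_slit[OF L_pos])
 show "(V z - z / of_nat m) ^ m = V z ^ (m + 1)" if "z \<in> ball 0 (1 / cstar m)" for z
  using V_identity_near_0[of z] that by (simp add: dist_norm)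
qed (use k L_pos ball_subset_slit open_slit in auto)

lemma V_0: "V 0 = 1" by (simp add: V_def)

lemma V_nonzero:
 assumes k: "k \<in> SL" shows "V k \<noteq> 0" "V k - k / of_nat m \<noteq> 0"
proof -
 show "V k \<noteq> 0"
 proof
  assume v: "V k = 0"
  have "(V k - k / of_nat m) ^ m = V k ^ (m + 1)" by (rule V_identity[OF k])
  also have "\<dots> = 0" using v by simp
  finally have "k = 0" using m_ge v by simp
  then show False using v V_0 by simp
 qed
 then have "V k ^ (m + 1) \<noteq> 0" by (rule power_not_zero)
 then have "(V k - k / of_nat m) ^ m \<noteq> 0" unfolding V_identity[OF k] .
 then show "V k - k / of_nat m \<noteq> 0" using m_ge by (metis not_one_le_zero power_eq_0_iff gr0I)
qed

text \<open>Recovers v from V = v^(-m): since V - k/m is v^(-(m+1)), the quotient is v. Being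
  rational in V and k, it needs no choice of an m-th root.\<close>

definition vb :: "complex \<Rightarrow> complex" where "vb k = V k / (V k - k / of_nat m)"

lemma vb_holomorphic: "vb holomorphic_on SL"
 unfolding vb_def using V_nonzero by (intro holomorphic_intros V_holomorphic) (use m_ge in auto)

lemma vb_nonzero: "k \<in> SL \<Longrightarrow> vb k \<noteq> 0"
 using V_nonzero by (simp add: vb_def)

lemma vb_0: "vb 0 = 1" by (simp add: vb_def V_0)

lemma vb_minus_1: "k \<in> SL \<Longrightarrow> vb k - 1 = (k / of_nat m) / (V k - k / of_nat m)"
proof -
 assume k: "k \<in> SL"
 have "(v - w) / w = v / w - 1" if "w \<noteq> 0" for v w :: complex using that by (simp add: diff_divide_distrib)
 from this[OF V_nonzero(2)[OF k], of "V k"] show ?thesis by (simp add: vb_def)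
qed

lemma vb_power_m: "k \<in> SL \<Longrightarrow> vb k ^ m * V k = 1"
 using V_nonzero[of k] V_identity[of k] by (simp add: vb_def power_divide)

lemma vb_inverse_power: "k \<in> SL \<Longrightarrow> 1 / vb k ^ m = V k"
 using vb_power_m[of k] vb_nonzero[of k] by (simp add: divide_eq_eq mult.commute)

lemma vb_equation:
 assumes k: "k \<in> SL" shows "k / of_nat m * vb k ^ (m + 1) = vb k - 1"
proof -
 have "vb k ^ (m + 1) * V k = vb k" using vb_power_m[OF k] by simp
 then have "vb k ^ (m + 1) = vb k / V k" using V_nonzero(1)[OF k] by (simp add: nonzero_eq_divide_eq)
 also have "\<dots> = 1 / (V k - k / of_nat m)" using V_nonzero(1)[OF k] by (simp add: vb_def)
 finally have "vb k ^ (m + 1) = 1 / (V k - k / of_nat m)" .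
 then show ?thesis by (simp add: vb_minus_1[OF k])
qed

lemma inverse_in_slit: "zeta \<notin> cut m \<Longrightarrow> zeta \<noteq> 0 \<and> 1 / zeta \<in> SL"
proof -
 assume z: "zeta \<notin> cut m"
 have 0: "zeta \<noteq> 0" using z L_pos by (auto simp: cut_def)
 moreover have "1 / zeta \<in> SL"
 proof (rule ccontr)
  assume "1 / zeta \<notin> SL"
  then have i: "Im (1 / zeta) = 0" and r: "Re (1 / zeta) \<ge> 1 / cstar m" by (auto simp: slit_def)
  define t where "t = Re (1 / zeta)"
  have e: "1 / zeta = of_real t" using i by (simp add: complex_eq_iff t_def)
  have t: "t \<ge> 1 / cstar m" using r by (simp add: t_def)
  then have tp: "t > 0" using L_pos by (smt (verit) divide_pos_pos)
  have "zeta = of_real (1 / t)" using e 0 tp by (simp add: field_simps)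
  moreover have "1 / t \<in> {0..cstar m}" using t tp L_pos by (simp add: field_simps)
  ultimately show False using z unfolding cut_def by blast
 qed
 ultimately show ?thesis by simp
qed

lemma cauchy_transform:
 assumes "zeta \<noteq> 0"
 shows "(LINT x|M. 1 / (zeta - complex_of_real x)) = 1 - V (1 / zeta)"
proof -
 have "1 - V (1 / zeta) = (1 / zeta) * J (1 / zeta)" by (simp add: V_def)
 also have "\<dots> = (LINT x|M. (1 / zeta) * (1 / (1 - (1 / zeta) * of_real x)))"
  unfolding J_def by (rule integral_mult_right_zero[symmetric])
 also have "\<dots> = (LINT x|M. 1 / (zeta - complex_of_real x))"
  using assms by (intro Bochner_Integration.integral_cong refl) (simp add: divide_simps)
 finally show ?thesis by simp
qed

lemma micro_branch_vb: "micro_branch m (\<lambda>zeta. vb (1 / zeta))"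
 unfolding micro_branch_def
proof (intro conjI allI impI)
 have m0: "of_nat m \<noteq> (0 :: complex)" using m_ge by simp
 show "(\<lambda>zeta. vb (1 / zeta)) holomorphic_on - cut m"
 proof (rule holomorphic_on_compose_gen[of "\<lambda>zeta. 1 / zeta" _ vb SL, unfolded o_def])
  show "(\<lambda>zeta. 1 / zeta) holomorphic_on - cut m"
   using inverse_in_slit by (intro holomorphic_intros) auto
 qed (use vb_holomorphic inverse_in_slit in auto)
 show "vb (1 / zeta) ^ (m + 1) = of_nat m * zeta * (vb (1 / zeta) - 1)" if "zeta \<notin> cut m" for zeta
  using vb_equation[of "1 / zeta"] inverse_in_slit[OF that] m0 by (simp add: field_simps)
 \<comment> \<open>By the saddle equation v - 1 - k/m equals (k/m) (v^(m+1) - 1), and v^(m+1) - 1 is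
   O(k) since v(0) = 1. This gives order two in k = 1/zeta.\<close>
 have "((\<lambda>k. vb k ^ (m + 1) - 1) has_field_derivative deriv (\<lambda>k. vb k ^ (m + 1) - 1) 0) (at 0)"
  using zero_in_slit open_slit
  by (intro holomorphic_derivI[of _ SL] holomorphic_intros vb_holomorphic) auto
 from differentiable_zero_bound[OF this] obtain d C where
  d: "d > 0" "\<And>k. cmod k < d \<Longrightarrow> cmod (vb k ^ (m + 1) - 1) \<le> C * cmod k" by (auto simp: vb_0)
 define R where "R = max (1 / d) (cstar m) + 1"
 show "(\<lambda>zeta. vb (1 / zeta) - (1 + 1 / (of_nat m * zeta))) \<in> O[at_infinity](\<lambda>zeta. 1 / zeta\<^sup>2)"
 proof (rule bigoI[of _ "C / real m"])
  show "\<forall>\<^sub>F zeta in at_infinity. norm (vb (1 / zeta) - (1 + 1 / (of_nat m * zeta))) \<le> C / real m * norm (1 / zeta\<^sup>2)"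
   unfolding eventually_at_infinity
  proof (intro exI[of _ R] allI impI)
   fix zeta :: complex assume z: "R \<le> cmod zeta"
   have zz: "cmod zeta > 1 / d" "cmod zeta > cstar m" using z by (auto simp: R_def)
   then have z0: "zeta \<noteq> 0" using L_pos by auto
   have k: "cmod (1 / zeta) < d" using zz(1) d(1) z0 by (simp add: norm_divide field_simps)
   have ks: "1 / zeta \<in> SL" using zz(2) z0 L_pos
    by (intro subsetD[OF ball_subset_slit]) (simp add: dist_norm norm_divide field_simps)
   have "vb (1 / zeta) - (1 + 1 / (of_nat m * zeta)) = (1 / zeta) / of_nat m * (vb (1 / zeta) ^ (m + 1) - 1)"
    using vb_equation[OF ks] by (simp add: algebra_simps)
   also have "cmod \<dots> \<le> (1 / cmod zeta) / real m * (C * cmod (1 / zeta))"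
    unfolding norm_mult using d(2)[OF k] by (intro mult_mono) (auto simp: norm_divide norm_mult)
   finally show "norm (vb (1 / zeta) - (1 + 1 / (of_nat m * zeta))) \<le> C / real m * norm (1 / zeta\<^sup>2)"
    by (simp add: norm_divide norm_mult norm_power power2_eq_square mult_ac)
  qed
 qed
qed

end

lemma fuss_measure_exists:
 assumes "m \<ge> 1"
 shows "\<exists>M. fuss_measure M m \<and> (AE x in M. x > 0)"
proof -
 obtain M :: "real measure" where M: "prob_space M" "sets M = sets borel" "AE x in M. x \<in> {0<..cstar m}"
   "\<And>k. (\<integral>\<^sup>+x. ennreal (\<bar>x\<bar> ^ k) \<partial>M) = ennreal (micro_moment m k)"
  using micro_moment_measure_exists[OF assms] by blast
 have a: "AE x in M. x \<in> {0..cstar m}" "AE x in M. x > 0" using M(3) by (eventually_elim, simp)+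
 interpret interval_measure M "cstar m"
  using M(1,2) a(1) cstar_pos[OF assms] by (simp add: interval_measure_def interval_measure_axioms_def)
 have "mom n = micro_moment m n" for n
 proof -
  have "mom n = (LINT x|M. \<bar>x\<bar> ^ n)"
   unfolding mom_def
  proof (rule integral_cong_AE)
   show "AE x in M. x ^ n = \<bar>x\<bar> ^ n" using a(1) by eventually_elim auto
  qed auto
  also have "\<dots> = enn2real (\<integral>\<^sup>+x. ennreal (\<bar>x\<bar> ^ n) \<partial>M)"
   by (rule integral_eq_nn_integral) auto
  finally show ?thesis by (simp add: M(4) micro_moment_def)
 qed
 then show ?thesis using a(2) assms
  by (intro exI[of _ M]) (auto simp: fuss_measure_def fuss_measure_axioms_def interval_measure_axioms)
qed

text \<open>For small k the map v -> 1 + (k/m) v^(m+1) is a contraction on the disc of radius 2: its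
  difference quotient has m + 1 terms of size at most 2^m, and (m+1)/m <= 2.\<close>

lemma fuss_root_unique:
 fixes v w k :: complex
 assumes "m \<ge> 1" "k / of_nat m * v ^ (m + 1) = v - 1" "k / of_nat m * w ^ (m + 1) = w - 1"
  and "cmod v \<le> 2" "cmod w \<le> 2" "cmod k * (2 * 2 ^ m) < 1"
 shows "v = w"
proof (rule ccontr)
 assume ne: "v \<noteq> w"
 have "v - w = k / of_nat m * (v ^ (m + 1) - w ^ (m + 1))"
  unfolding right_diff_distrib assms(2,3) by simp
 also have "v ^ (m + 1) - w ^ (m + 1) = (v - w) * (\<Sum>i\<le>m. v ^ i * w ^ (m - i))"
  using diff_power_eq_sum[of v m w] by (simp add: lessThan_Suc_atMost mult.commute)
 finally have "(v - w) * 1 = (v - w) * (k / of_nat m * (\<Sum>i\<le>m. v ^ i * w ^ (m - i)))"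
  by (simp only: mult_ac mult_1)
 then have "1 = k / of_nat m * (\<Sum>i\<le>m. v ^ i * w ^ (m - i))" using ne by (simp only: mult_cancel_left) simp
 then have "1 = cmod k / real m * cmod (\<Sum>i\<le>m. v ^ i * w ^ (m - i))"
  by (metis norm_divide norm_mult norm_of_nat norm_one)
 also have "cmod (\<Sum>i\<le>m. v ^ i * w ^ (m - i)) \<le> (\<Sum>i\<le>m. 2 ^ m)"
 proof (rule sum_norm_le)
  fix i assume "i \<in> {..m}"
  then have "(2::real) ^ m = 2 ^ i * 2 ^ (m - i)" by (simp flip: power_add)
  then show "cmod (v ^ i * w ^ (m - i)) \<le> 2 ^ m"
   using assms(4,5) by (auto simp: norm_mult norm_power intro!: mult_mono power_mono)
 qed
 finally have "1 \<le> cmod k / real m * (\<Sum>i\<le>m. 2 ^ m)"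
  by this (intro mult_left_mono, auto)
 also have "\<dots> = cmod k * (((real m + 1) / real m) * 2 ^ m)" by simp
 also have "\<dots> \<le> cmod k * (2 * 2 ^ m)"
  using assms(1) by (intro mult_left_mono mult_right_mono) (auto simp: field_simps)
 finally show False using assms(6) by simp
qed

text \<open>The decay condition in \<open>micro_branch\<close> forces v to tend to 1 at infinity, so
  by \<open>fuss_root_unique\<close> it agrees with \<open>vb\<close> near k = 0. There the Cauchy
  transforms agree, hence the moments, hence the measures.\<close>

lemma mu_micro_spec_unique:
 assumes "fuss_measure M m"
  and N: "prob_space N" "sets N = sets borel" "AE x in N. x \<in> {0..cstar m}"
  and v: "micro_branch m v"
   "\<forall>zeta. zeta \<notin> cut m \<longrightarrow> (LINT x|N. 1 / (zeta - complex_of_real x)) = 1 - 1 / v zeta ^ m"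
 shows "N = M"
proof -
 interpret M: fuss_measure M m by fact
 interpret N: interval_measure N "cstar m"
  using N M.L_pos by (auto simp: interval_measure_def interval_measure_axioms_def)
 have m0: "of_nat m \<noteq> (0 :: complex)" using M.m_ge by simp
 have vlim: "(v \<longlongrightarrow> 1) at_infinity"
 proof -
  have "(\<lambda>zeta. v zeta - (1 + 1 / (of_nat m * zeta))) \<in> O[at_infinity](\<lambda>zeta. 1 / zeta\<^sup>2)"
   using v(1) by (simp add: micro_branch_def)
  then obtain C where C: "\<forall>\<^sub>F zeta in at_infinity. norm (v zeta - (1 + 1 / (of_nat m * zeta))) \<le> C * norm (1 / zeta\<^sup>2)"
   by (elim landau_o.bigE)
  have i: "((\<lambda>zeta::complex. 1 / zeta) \<longlongrightarrow> 0) at_infinity"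
   by (intro tendsto_divide_0[OF tendsto_const] filterlim_ident)
  have "((\<lambda>zeta::complex. C * norm ((1 / zeta)\<^sup>2)) \<longlongrightarrow> C * norm ((0::complex)\<^sup>2)) at_infinity"
   by (intro tendsto_intros i)
  then have "((\<lambda>zeta::complex. C * norm (1 / zeta\<^sup>2)) \<longlongrightarrow> 0) at_infinity"
   by (simp add: power_divide)
  then have "((\<lambda>zeta. v zeta - (1 + 1 / (of_nat m * zeta))) \<longlongrightarrow> 0) at_infinity"
   by (rule Lim_null_comparison[OF C])
  moreover have "((\<lambda>zeta::complex. 1 + 1 / (of_nat m * zeta)) \<longlongrightarrow> 1 + 0) at_infinity"
  proof (rule tendsto_add[OF tendsto_const])
   have "((\<lambda>zeta::complex. (1 / of_nat m) * (1 / zeta)) \<longlongrightarrow> (1 / of_nat m) * 0) at_infinity"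
    by (intro tendsto_mult_left tendsto_divide_0[OF tendsto_const] filterlim_ident)
   then show "((\<lambda>zeta::complex. 1 / (of_nat m * zeta)) \<longlongrightarrow> 0) at_infinity" by simp
  qed
  ultimately have "((\<lambda>zeta. (v zeta - (1 + 1 / (of_nat m * zeta))) + (1 + 1 / (of_nat m * zeta))) \<longlongrightarrow> 0 + (1 + 0)) at_infinity"
   by (rule tendsto_add)
  then show ?thesis by simp
 qed
 have "\<forall>\<^sub>F k in at 0. v (1 / k) = M.vb k"
 proof -
  have "filterlim (\<lambda>k::complex. 1 / k) at_infinity (at 0)"
   using filterlim_inverse_at_infinity by (simp add: divide_inverse)
  from filterlim_compose[OF vlim this] have "((\<lambda>k. v (1 / k)) \<longlongrightarrow> 1) (at 0)" .
  then have 1: "\<forall>\<^sub>F k in at 0. dist (v (1 / k)) 1 < 1" by (rule tendstoD) simp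
  have "isCont M.vb 0"
   using holomorphic_on_imp_continuous_on[OF M.vb_holomorphic] M.zero_in_slit
   by (simp add: continuous_on_eq_continuous_at open_slit)
  then have "(M.vb \<longlongrightarrow> 1) (at 0)" by (simp add: isCont_def M.vb_0)
  then have 2: "\<forall>\<^sub>F k in at 0. dist (M.vb k) 1 < 1" by (rule tendstoD) simp
  have "((\<lambda>k. cmod k * (2 * 2 ^ m)) \<longlongrightarrow> 0) (at 0)" by (auto intro!: tendsto_eq_intros)
  then have 3: "\<forall>\<^sub>F k in at 0. cmod k * (2 * 2 ^ m) < 1" by (rule order_tendstoD) simp
  have "((\<lambda>k::complex. cmod k) \<longlongrightarrow> 0) (at 0)" by (auto intro!: tendsto_eq_intros)
  then have 4: "\<forall>\<^sub>F k::complex in at 0. cmod k < 1 / cstar m" by (rule order_tendstoD) (use M.L_pos in simp)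
  have 5: "\<forall>\<^sub>F k::complex in at 0. k \<noteq> 0" by (simp add: eventually_at_filter)
  show ?thesis using 1 2 3 4 5
  proof eventually_elim
   case (elim k)
   have ks: "k \<in> slit (cstar m)" using elim M.ball_subset_slit by (auto simp: dist_norm)
   have zc: "1 / k \<notin> cut m"
   proof
    assume "1 / k \<in> cut m"
    then obtain x where x: "x \<in> {0..cstar m}" "1 / k = of_real x" by (auto simp: cut_def)
    then have "cmod (1 / k) \<le> cstar m" by simp
    then show False using elim M.L_pos by (simp add: norm_divide field_simps)
   qed
   have "v (1 / k) ^ (m + 1) = of_nat m * (1 / k) * (v (1 / k) - 1)"
    using v(1) zc by (simp add: micro_branch_def)
   then have e: "k / of_nat m * v (1 / k) ^ (m + 1) = v (1 / k) - 1" using elim m0 by (simp add: field_simps)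
   have "cmod (v (1 / k)) \<le> 2" "cmod (M.vb k) \<le> 2"
    using elim norm_triangle_ineq2[of "v (1 / k)" 1] norm_triangle_ineq2[of "M.vb k" 1] by (auto simp: dist_norm)
   then show ?case by (intro fuss_root_unique[OF M.m_ge e M.vb_equation[OF ks]]) (use elim in auto)
  qed
 qed
 moreover have "\<forall>\<^sub>F k::complex in at 0. k \<noteq> 0" by (simp add: eventually_at_filter)
 moreover have "\<forall>\<^sub>F k::complex in at 0. cmod k < 1 / cstar m"
  using M.L_pos by (intro order_tendstoD(2)[of _ 0]) (auto intro!: tendsto_eq_intros)
 ultimately have "\<forall>\<^sub>F k in at 0. N.J k = M.J k"
 proof eventually_elim
  case (elim k)
  have ks: "k \<in> slit (cstar m)" using elim M.ball_subset_slit by (auto simp: dist_norm)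
  have zc: "1 / k \<notin> cut m"
  proof
   assume "1 / k \<in> cut m"
   then obtain x where x: "x \<in> {0..cstar m}" "1 / k = of_real x" by (auto simp: cut_def)
   then have "cmod (1 / k) \<le> cstar m" by simp
   then show False using elim M.L_pos by (simp add: norm_divide field_simps)
  qed
  have "k * N.J k = (LINT x|N. 1 / (1 / k - complex_of_real x))"
   unfolding N.J_def integral_mult_right_zero[symmetric]
   using elim by (intro Bochner_Integration.integral_cong refl) (simp add: field_simps)
  also have "\<dots> = 1 - 1 / M.vb k ^ m" using v(2) zc elim by auto
  also have "1 / M.vb k ^ m = M.V k" by (rule M.vb_inverse_power[OF ks])
  also have "1 - M.V k = k * M.J k" by (simp add: M.V_def)
  finally show ?case using elim by simp
 qed
 then have evn: "\<forall>\<^sub>F k in nhds 0. N.J k = M.J k"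
  using M.J_0 N.J_0 by (simp add: eventually_nhds_conv_at)
 define FM where "FM = Abs_fps (\<lambda>n. complex_of_real (M.mom n))"
 define FN where "FN = Abs_fps (\<lambda>n. complex_of_real (N.mom n))"
 have rad: "fps_conv_radius (Abs_fps (\<lambda>n. complex_of_real (interval_measure.mom K n))) \<ge> ereal (1 / cstar m)"
  if "interval_measure K (cstar m)" for K
  unfolding fps_conv_radius_def
  using interval_measure.J_sums[OF that] by (intro conv_radius_geI_ex') (auto simp: sums_iff)
 have rM: "fps_conv_radius FM > 0" "fps_conv_radius FN > 0"
  using rad[OF M.interval_measure_axioms] rad[OF N.interval_measure_axioms] M.L_pos
  unfolding FM_def FN_def by (metis divide_pos_pos ereal_less(2) order.strict_trans2 zero_less_one)+
 have "\<forall>\<^sub>F k in nhds 0. cmod k < 1 / cstar m"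
  using eventually_nhds_in_open[of "ball 0 (1 / cstar m)" "0::complex"] M.L_pos by (simp add: dist_norm)
 with evn have ev: "\<forall>\<^sub>F k in nhds 0. eval_fps FM k = eval_fps FN k"
 proof eventually_elim
  case (elim k)
  then show ?case using M.J_sums[of k] N.J_sums[of k] by (simp add: eval_fps_def FM_def FN_def sums_iff)
 qed
 have FMN: "FM = FN" by (rule eval_fps_eqD[OF rM ev])
 then have "M.mom n = N.mom n" for n
  
  using arg_cong[OF FMN, of "\<lambda>F. fps_nth F n"] unfolding FM_def FN_def fps_nth_Abs_fps by simp
 then show ?thesis
  using interval_measure_eqI[OF N.interval_measure_axioms M.interval_measure_axioms] by simp
qed

text \<open>From here on \<open>mu_micro\<close> is used only through its moments and its
  positivity. The latter is the absence of an atom at 0 and will mean that \<open>mu_hat\<close>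
  puts no mass at infinity.\<close>

theorem mu_micro_fuss:
 assumes "m \<ge> 1"
 shows "fuss_measure (mu_micro m) m" "AE x in mu_micro m. x > 0"
proof -
 obtain M where M: "fuss_measure M m" "AE x in M. x > 0" using fuss_measure_exists[OF assms] by blast
 interpret M: fuss_measure M m by fact
 have "mu_micro m = M"
  unfolding mu_micro_def
 proof (rule the_equality)
  have "(LINT x|M. 1 / (zeta - complex_of_real x)) = 1 - 1 / M.vb (1 / zeta) ^ m" if "zeta \<notin> cut m" for zeta
  proof -
   have "1 / M.vb (1 / zeta) ^ m = M.V (1 / zeta)" using M.vb_inverse_power[of "1 / zeta"] M.inverse_in_slit[OF that] by blast
   then show ?thesis using M.cauchy_transform M.inverse_in_slit[OF that] by simp
  qed
  then show "prob_space M \<and> sets M = sets borel \<and> (AE x in M. x \<in> {0..cstar m}) \<and>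
   (\<exists>v. micro_branch m v \<and> (\<forall>zeta. zeta \<notin> cut m \<longrightarrow>
      (LINT x|M. 1 / (zeta - complex_of_real x)) = 1 - 1 / v zeta ^ m))"
   using M.prob_space_axioms M.sets_M M.AE_L M.micro_branch_vb by blast
 qed (use mu_micro_spec_unique[OF M(1)] in blast)
 then show "fuss_measure (mu_micro m) m" "AE x in mu_micro m. x > 0" using M by metis+
qed

section \<open>The circle |tau| = |v - 1| through the saddle, and Re (1 + tau)^(-m) on it\<close>

lemma sin_mult_ratio_decreasing:
 assumes m: "m \<ge> 1" and xy: "0 < x" "x \<le> y" "real m * y \<le> pi"
 shows "sin (real m * y) * sin x \<le> sin (real m * x) * sin y"
proof -
 have pim: "pi / real m \<le> pi" using m by (simp add: divide_le_eq)
 have yp: "y \<le> pi / real m" using m xy by (simp add: field_simps)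
 \<comment> \<open>Numerator of the derivative of sin (m u) / sin u. Its own derivative is -(m^2 -
   1) sin (m u) sin u <= 0, and it vanishes at 0.\<close>
 define g where "g u = real m * cos (real m * u) * sin u - sin (real m * u) * cos u" for u
 have g: "g u \<le> 0" if u: "0 \<le> u" "u \<le> y" for u
 proof -
  have "g u \<le> g 0"
  proof (rule DERIV_nonpos_imp_nonincreasing[OF u(1)])
   fix s assume s: "0 \<le> s" "s \<le> u"
   have "(g has_real_derivative - ((real m)\<^sup>2 - 1) * (sin (real m * s) * sin s)) (at s)"
    unfolding g_def by (auto intro!: derivative_eq_intros simp: algebra_simps power2_eq_square)
   moreover have "sin (real m * s) \<ge> 0" "sin s \<ge> 0"
   proof -
    have "real m * s \<le> real m * y" using s u by (intro mult_left_mono) auto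
    then show "sin (real m * s) \<ge> 0" using xy s by (intro sin_ge_zero) auto
    show "sin s \<ge> 0" using s u yp pim by (intro sin_ge_zero) auto
   qed
   moreover have "(real m)\<^sup>2 \<ge> 1" using m by simp
   ultimately show "\<exists>D. (g has_real_derivative D) (at s) \<and> D \<le> 0"
    by (intro exI conjI) (auto intro!: mult_nonpos_nonneg)
  qed
  then show ?thesis by (simp add: g_def)
 qed
 show ?thesis
 \<comment> \<open>At y = pi the quotient is undefined; but then m = 1 and both sides
   coincide.\<close>
 proof (cases "y = pi")
  case True
  then have "real m * pi \<le> 1 * pi" using xy by simp
  then have "m = 1" using m unfolding mult_le_cancel_right by auto
  then show ?thesis by simp
 next
  case False
  then have ypi: "y < pi" using yp pim by simp
  have "sin (real m * y) / sin y \<le> sin (real m * x) / sin x"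
  proof (rule DERIV_nonpos_imp_nonincreasing[OF xy(2)])
   fix s assume s: "x \<le> s" "s \<le> y"
   have sp: "sin s > 0" using s xy ypi by (intro sin_gt_zero) auto
   have "((\<lambda>u. sin (real m * u) / sin u) has_real_derivative g s / (sin s * sin s)) (at s)"
    using sp by (auto intro!: derivative_eq_intros simp: g_def)
   moreover have "g s / (sin s * sin s) \<le> 0" using g[of s] s xy sp by (simp add: divide_nonpos_pos)
   ultimately show "\<exists>D. ((\<lambda>u. sin (real m * u) / sin u) has_real_derivative D) (at s) \<and> D \<le> 0" by blast
  qed
  moreover have "sin x > 0" "sin y > 0" using xy ypi by (auto intro!: sin_gt_zero)
  ultimately show ?thesis by (simp add: field_simps)
 qed
qed

text \<open>Consider the triangle with vertices 0, 1 and 1 + tau, where |tau| = t: \<open>b\<close>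
  stands for its angle at 1 + tau, that is arg tau - arg (1 + tau), \<open>ph b\<close> for the
  angle at 0, and \<open>rh b\<close> for |1 + tau|. The law of sines reads sin (ph b) = t sin b, so
  b parametrises the upper half of the circle. The value \<open>bs\<close> belongs to the saddle,
  where b = m ph b; the last two assumptions fix the sign of b - m ph b on either side of
  it.\<close>

locale critical_circle =
 fixes m :: nat and t bs :: real
 assumes m: "m \<ge> 2" and t: "0 < t" "t < 1"
  and bs: "0 \<le> bs" "bs < pi"
  and q_after: "\<And>b. bs \<le> b \<Longrightarrow> b \<le> pi \<Longrightarrow> t * sin b \<le> sin (b / real m)"
  and q_before: "\<And>b. 0 \<le> b \<Longrightarrow> b \<le> bs \<Longrightarrow> sin (b / real m) \<le> t * sin b"
begin

definition ph :: "real \<Rightarrow> real" where "ph b = arcsin (t * sin b)"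
definition rh :: "real \<Rightarrow> real" where "rh b = cos (ph b) + t * cos b"
text \<open>Minus the real part of (1 + tau)^(-m), as 1 + tau = rh b e^(i ph b). The goal is that it
  is largest at \<open>bs\<close>.\<close>

definition KK :: "real \<Rightarrow> real" where "KK b = - (cos (real m * ph b) / rh b ^ m)"

lemma ts:
 assumes "b \<in> {0..pi}"
 shows "0 \<le> t * sin b" "t * sin b \<le> t" "t * sin b < 1" "t * sin b \<le> 1" "-1 < t * sin b" "-1 \<le> t * sin b"
proof -
 have "0 \<le> sin b" using assms by (simp add: sin_ge_zero)
 then show *: "0 \<le> t * sin b" using t by simp
 have "t * sin b \<le> t * 1" using t by (intro mult_left_mono) auto
 then show **: "t * sin b \<le> t" by simp
 show "t * sin b < 1" "t * sin b \<le> 1" "-1 < t * sin b" "-1 \<le> t * sin b" using * ** t by linarith+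
qed

lemma ph_range: assumes "b \<in> {0..pi}" shows "0 \<le> ph b" "ph b < pi / 2"
proof -
 show "0 \<le> ph b" unfolding ph_def using ts(1,4)[OF assms] by (intro arcsin_nonneg) auto
 show "ph b < pi / 2" unfolding ph_def using arcsin_lt_bounded[OF ts(5,3)[OF assms]] by simp
qed

lemma sin_ph: "b \<in> {0..pi} \<Longrightarrow> sin (ph b) = t * sin b"
 using ts[of b] by (simp add: ph_def)

lemma cos_ph_pos: "b \<in> {0..pi} \<Longrightarrow> cos (ph b) > 0"
 using ph_range by (intro cos_gt_zero_pi) force+

lemma cos_ph_gt: assumes "b \<in> {0..pi}" shows "t * \<bar>cos b\<bar> < cos (ph b)"
proof -
 have "(t * \<bar>cos b\<bar>)\<^sup>2 = t\<^sup>2 - (t * sin b)\<^sup>2"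
  by (simp add: power_mult_distrib cos_squared_eq right_diff_distrib)
 also have "\<dots> < 1 - (t * sin b)\<^sup>2" using t by (simp add: power_less_one_iff)
 also have "\<dots> = (cos (ph b))\<^sup>2" using sin_ph[OF assms] by (simp add: cos_squared_eq)
 finally show ?thesis using cos_ph_pos[OF assms] by (intro power2_less_imp_less[of _ "cos (ph b)"]) auto
qed

lemma rh_pos: "b \<in> {0..pi} \<Longrightarrow> rh b > 0"
 using cos_ph_gt[of b] t abs_le_D2[of "t * cos b" "t * \<bar>cos b\<bar>"] unfolding rh_def by (simp add: abs_mult)

lemma ph_deriv: assumes "b \<in> {0..pi}"
 shows "(ph has_real_derivative t * cos b / cos (ph b)) (at b)"
proof -
 note b = ts(5,3)[OF assms]
 have "(ph has_real_derivative (inverse (sqrt (1 - (t * sin b)\<^sup>2)) * (t * cos b))) (at b)"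
  unfolding ph_def
  by (rule DERIV_chain'[where f = "\<lambda>b. t * sin b" and g = arcsin, OF _ DERIV_arcsin[OF b]])
    (auto intro!: derivative_eq_intros)
 moreover have "sqrt (1 - (t * sin b)\<^sup>2) = cos (ph b)"
  unfolding sin_ph[OF assms, symmetric] using cos_ph_pos[OF assms] by (simp add: cos_squared_eq[symmetric])
 ultimately show ?thesis by (simp add: field_simps)
qed

lemma rh_eq: "b \<in> {0..pi} \<Longrightarrow> rh b = (1 + t * cos b / cos (ph b)) * cos (ph b)"
 using cos_ph_pos[of b] by (simp add: rh_def field_simps)

lemma rh_deriv: assumes "b \<in> {0..pi}"
 shows "(rh has_real_derivative - (sin (ph b) * (1 + t * cos b / cos (ph b)))) (at b)"
 unfolding rh_def using ph_deriv[OF assms] sin_ph[OF assms]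
 by (auto intro!: derivative_eq_intros simp: algebra_simps)

lemma one_plus_pos: "b \<in> {0..pi} \<Longrightarrow> 1 + t * cos b / cos (ph b) > 0"
 using rh_pos[of b] rh_eq[of b] cos_ph_pos[of b] by (simp add: zero_less_mult_iff)

text \<open>Every factor except the sine is positive, so KK increases exactly where sin (m ph b - b)
  is positive: the saddle b = m ph b is a critical point.\<close>

lemma KK_deriv: assumes b: "b \<in> {0..pi}"
 shows "(KK has_real_derivative - (real m * t * (1 + t * cos b / cos (ph b)) / rh b ^ (m + 1) * sin (b - real m * ph b))) (at b)"
proof -
 define p' where "p' = t * cos b / cos (ph b)"
 define r where "r = rh b"
 define p where "p = ph b"
 have r: "r > 0" using rh_pos[OF b] by (simp add: r_def)
 have cp: "cos p * p' = t * cos b" using cos_ph_pos[OF b] by (simp add: p'_def p_def)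
 have sp: "sin p = t * sin b" using sin_ph[OF b] by (simp add: p_def)
 have re: "r = (1 + p') * cos p" using rh_eq[OF b] by (simp add: r_def p'_def p_def)
 have m1: "r ^ m = r * r ^ (m - 1)" using m by (cases m) auto
 have "(KK has_real_derivative - ((- (sin (real m * p) * (real m * p')) * r ^ m
   - cos (real m * p) * (real m * (r ^ (m - 1) * - (sin p * (1 + p'))))) / (r ^ m * r ^ m))) (at b)"
  unfolding KK_def using ph_deriv[OF b] rh_deriv[OF b] r
  by (auto intro!: derivative_eq_intros simp: p'_def r_def p_def)
 also have "- ((- (sin (real m * p) * (real m * p')) * r ^ m
   - cos (real m * p) * (real m * (r ^ (m - 1) * - (sin p * (1 + p'))))) / (r ^ m * r ^ m))
   = real m * (r * p' * sin (real m * p) - sin p * (1 + p') * cos (real m * p)) * r ^ (m - 1) / (r ^ m * r ^ m)"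
  unfolding m1 minus_divide_left by (simp add: algebra_simps)
 also have "r * p' * sin (real m * p) - sin p * (1 + p') * cos (real m * p)
   = (1 + p') * ((cos p * p') * sin (real m * p) - sin p * cos (real m * p))"
  by (subst re) (simp add: algebra_simps)
 also have "\<dots> = (1 + p') * - (t * sin (b - real m * p))"
  unfolding cp sp by (simp add: sin_diff algebra_simps)
 also have "real m * ((1 + p') * - (t * sin (b - real m * p))) * r ^ (m - 1) / (r ^ m * r ^ m)
   = - (real m * t * (1 + p') / r ^ (m + 1) * sin (b - real m * p))"
 proof -
  have "real m * ((1 + p') * - (t * sin (b - real m * p))) * r ^ (m - 1) / (r ^ m * r ^ m)
   = - (real m * t * (1 + p') * sin (b - real m * p)) * (r ^ (m - 1) / (r ^ m * r ^ m))" by simp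
  also have "r ^ (m - 1) / (r ^ m * r ^ m) = 1 / r ^ (m + 1)"
   using r by (simp add: m1)
  finally show ?thesis by simp
 qed
 finally show ?thesis by (simp add: p'_def r_def p_def)
qed

lemma KK_mono:
 assumes "a \<le> b" "0 \<le> a" "b \<le> pi"
  and "\<And>x. a \<le> x \<Longrightarrow> x \<le> b \<Longrightarrow> sin (x - real m * ph x) \<le> 0"
 shows "KK a \<le> KK b"
proof (rule DERIV_nonneg_imp_nondecreasing[OF assms(1)])
 fix x assume x: "a \<le> x" "x \<le> b"
 then have xx: "x \<in> {0..pi}" using assms by auto
 have "real m * t * (1 + t * cos x / cos (ph x)) / rh x ^ (m + 1) \<ge> 0"
  using rh_pos[OF xx] one_plus_pos[OF xx] t by (intro divide_nonneg_nonneg mult_nonneg_nonneg) auto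
 then have "- (real m * t * (1 + t * cos x / cos (ph x)) / rh x ^ (m + 1) * sin (x - real m * ph x)) \<ge> 0"
  using assms(4)[OF x] by (simp only: neg_0_le_iff_le mult_nonneg_nonpos)
 then show "\<exists>y. (KK has_real_derivative y) (at x) \<and> 0 \<le> y" using KK_deriv[OF xx] by blast
qed

lemma KK_antimono:
 assumes "a \<le> b" "0 \<le> a" "b \<le> pi"
  and "\<And>x. a \<le> x \<Longrightarrow> x \<le> b \<Longrightarrow> sin (x - real m * ph x) \<ge> 0"
 shows "KK b \<le> KK a"
proof (rule DERIV_nonpos_imp_nonincreasing[OF assms(1)])
 fix x assume x: "a \<le> x" "x \<le> b"
 then have xx: "x \<in> {0..pi}" using assms by auto
 have "real m * t * (1 + t * cos x / cos (ph x)) / rh x ^ (m + 1) \<ge> 0"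
  using rh_pos[OF xx] one_plus_pos[OF xx] t by (intro divide_nonneg_nonneg mult_nonneg_nonneg) auto
 then have "- (real m * t * (1 + t * cos x / cos (ph x)) / rh x ^ (m + 1) * sin (x - real m * ph x)) \<le> 0"
  using assms(4)[OF x] by (simp only: neg_le_0_iff_le mult_nonneg_nonneg)
 then show "\<exists>y. (KK has_real_derivative y) (at x) \<and> y \<le> 0" using KK_deriv[OF xx] by blast
qed

lemma bm: "b \<in> {0..pi} \<Longrightarrow> b / real m \<le> pi / 2"
proof -
 assume "b \<in> {0..pi}"
 then have "b / real m \<le> pi / 2" using m by (intro frac_le) auto
 then show ?thesis .
qed

lemma bm': "b \<in> {0..pi} \<Longrightarrow> - (pi / 2) \<le> b / real m"
proof -
 assume "b \<in> {0..pi}"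
 then have "0 \<le> b / real m" by simp
 then show ?thesis using pi_ge_zero by linarith
qed

lemma ph_le: assumes "bs \<le> b" "b \<le> pi" shows "real m * ph b \<le> b"
proof -
 have b: "b \<in> {0..pi}" using assms bs by auto
 have "ph b \<le> arcsin (sin (b / real m))"
  unfolding ph_def using q_after[OF assms] ts[OF b] by (intro arcsin_le_arcsin) auto
 also have "\<dots> = b / real m" using bm[OF b] bm'[OF b] by (intro arcsin_sin) auto
 finally show ?thesis using m by (simp add: field_simps)
qed

lemma ph_ge: assumes "0 \<le> b" "b \<le> bs" shows "b \<le> real m * ph b"
proof -
 have b: "b \<in> {0..pi}" using assms bs by auto
 have "b / real m = arcsin (sin (b / real m))"
  using bm[OF b] bm'[OF b] by (intro arcsin_sin[symmetric]) auto
 also have "\<dots> \<le> ph b"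
  unfolding ph_def using q_before[OF assms] ts(4)[OF b] by (intro arcsin_le_arcsin) auto
 finally show ?thesis using m by (simp add: field_simps)
qed

lemma ph_bs: "real m * ph bs = bs"
 using ph_ge[of bs] ph_le[of bs] bs by auto

lemma ph_mono: assumes "0 \<le> a" "a \<le> b" "b \<le> pi / 2" shows "ph a \<le> ph b"
 unfolding ph_def
proof (rule arcsin_le_arcsin)
 have "sin a \<le> sin b" using assms by (intro sin_monotone_2pi_le) auto
 then show "t * sin a \<le> t * sin b" using t by simp
qed (use ts(6)[of a] ts(4)[of b] assms in auto)

lemma ph_reflect: "ph (pi - b) = ph b"
 by (simp add: ph_def)

lemma rh_antimono: assumes "0 \<le> a" "a \<le> b" "b \<le> pi" shows "rh b \<le> rh a"
proof (rule DERIV_nonpos_imp_nonincreasing[OF assms(2)])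
 fix x assume "a \<le> x" "x \<le> b"
 then have xx: "x \<in> {0..pi}" using assms by auto
 have "sin (ph x) \<ge> 0" using sin_ph[OF xx] ts[OF xx] by simp
 then have "- (sin (ph x) * (1 + t * cos x / cos (ph x))) \<le> 0"
  using one_plus_pos[OF xx] by (simp only: neg_le_0_iff_le) (intro mult_nonneg_nonneg, auto)
 then show "\<exists>y. (rh has_real_derivative y) (at x) \<and> y \<le> 0" using rh_deriv[OF xx] by blast
qed

text \<open>Beyond \<open>bs\<close> one has 0 <= b - m ph b <= pi, and KK decreases. Before
  \<open>bs\<close>, KK increases as long as ph x <= ph bs, for then 0 <= m ph x - x <= bs - x <=
  pi. If bs <= pi/2 this covers everything, since ph increases on [0, pi/2]. If bs > pi/2 it only
  reaches pi - bs, as ph is symmetric about pi/2; on [pi - bs, bs] the maximum is sought at end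
  points and critical points.\<close>

lemma KK_le: assumes b: "b \<in> {0..pi}" shows "KK b \<le> KK bs"
proof (cases "bs \<le> b")
 case True
 show ?thesis
 proof (rule KK_antimono[OF True])
  fix x assume x: "bs \<le> x" "x \<le> b"
  then have "x - real m * ph x \<ge> 0" "x - real m * ph x \<le> pi" using ph_le[of x] b ph_range(1)[of x] bs
    mult_nonneg_nonneg[of "real m" "ph x"] unfolding atLeastAtMost_iff by linarith+
  then show "sin (x - real m * ph x) \<ge> 0" by (rule sin_ge_zero)
 qed (use b bs in auto)
next
 case False
 have neg: "sin (x - real m * ph x) \<le> 0" if "0 \<le> x" "x \<le> bs" "ph x \<le> ph bs" for x
 proof -
  have "real m * ph x \<le> real m * ph bs" using that by (intro mult_left_mono) auto
  then have "real m * ph x - x \<le> pi" "0 \<le> real m * ph x - x" using ph_bs bs that ph_ge[of x] by auto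
  then have "sin (real m * ph x - x) \<ge> 0" by (intro sin_ge_zero) auto
  then show ?thesis by (metis minus_diff_eq sin_minus neg_le_0_iff_le)
 qed
 show ?thesis
 proof (cases "bs \<le> pi / 2")
  case True
  show ?thesis
   by (rule KK_mono) (use False b True bs in \<open>auto intro!: neg ph_mono\<close>)
 next
  case big: False
  \<comment> \<open>Dominates KK at critical points, where sin (x - m ph x) = 0 forces |cos (m ph
    x)| = |cos x|. On [pi - bs, bs] it is largest at \<open>bs\<close>, because |cos| is and
    \<open>rh\<close> is smallest there; at \<open>bs\<close> it equals KK.\<close>
  define W where "W x = \<bar>cos x\<bar> / rh x ^ m" for x
  have Wmono: "W x \<le> W bs" if x: "pi - bs \<le> x" "x \<le> bs" for x
  proof -
   define y where "y = max x (pi - x)"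
   have y: "pi / 2 \<le> y" "y \<le> bs" using x by (auto simp: y_def max_def)
   have cy: "\<bar>cos y\<bar> = \<bar>cos x\<bar>" by (auto simp: y_def max_def)
   have "\<bar>cos y\<bar> \<le> \<bar>cos bs\<bar>"
    using cos_monotone_0_pi_le[of y bs] cos_monotone_0_pi_le[of "pi / 2" y] y bs by auto
   moreover have "rh bs \<le> rh x"
    using x bs by (intro rh_antimono) auto
   moreover have "rh bs > 0" using rh_pos[of bs] bs by auto
   ultimately show ?thesis unfolding W_def cy[symmetric]
    by (intro frac_le power_mono) auto
  qed
  have KW: "KK bs = W bs"
   using big bs cos_monotone_0_pi_le[of "pi / 2" bs] by (simp add: KK_def W_def ph_bs)
  have refl: "KK (pi - bs) \<le> KK bs"
  proof -
   have "KK (pi - bs) = W (pi - bs)"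
    using big bs cos_monotone_0_pi_le[of "pi / 2" bs] by (simp add: KK_def W_def ph_bs ph_reflect)
   then show ?thesis using Wmono[of "pi - bs"] KW big by simp
  qed
  show ?thesis
  proof (cases "b \<le> pi - bs")
   case True
   have "KK b \<le> KK (pi - bs)"
   proof (rule KK_mono[OF True])
    fix x assume x: "b \<le> x" "x \<le> pi - bs"
    have "ph x \<le> ph (pi - bs)" using x b big by (intro ph_mono) auto
    then show "sin (x - real m * ph x) \<le> 0" using x b big by (intro neg) (auto simp: ph_reflect)
   qed (use b bs in auto)
   then show ?thesis using refl by simp
  next
   case False': False
   have "continuous_on {pi - bs..bs} KK"
   proof (intro continuous_at_imp_continuous_on ballI)
    fix x assume "x \<in> {pi - bs..bs}"
    then have "x \<in> {0..pi}" using bs by auto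
    then show "isCont KK x" using KK_deriv DERIV_isCont by blast
   qed
   then obtain x where x: "x \<in> {pi - bs..bs}" "\<And>y. y \<in> {pi - bs..bs} \<Longrightarrow> KK y \<le> KK x"
    using continuous_attains_sup[of "{pi - bs..bs}" KK] big by auto
   have "KK x \<le> KK bs"
   proof (cases "x = bs \<or> x = pi - bs")
    case True
    then show ?thesis using refl by auto
   next
    case False
    then have xi: "pi - bs < x" "x < bs" using x by auto
    have xx: "x \<in> {0..pi}" using xi bs by auto
    define C where "C = real m * t * (1 + t * cos x / cos (ph x)) / rh x ^ (m + 1)"
    have C: "C > 0"
     using rh_pos[OF xx] one_plus_pos[OF xx] t m by (auto simp: C_def intro!: divide_pos_pos mult_pos_pos)
    have "- (C * sin (x - real m * ph x)) = 0"
    proof (rule DERIV_local_max[OF KK_deriv[OF xx, folded C_def], of "min (x - (pi - bs)) (bs - x)"])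
     show "0 < min (x - (pi - bs)) (bs - x)" using xi by simp
     show "\<forall>y. \<bar>x - y\<bar> < min (x - (pi - bs)) (bs - x) \<longrightarrow> KK y \<le> KK x"
     proof (intro allI impI x(2))
      fix y assume "\<bar>x - y\<bar> < min (x - (pi - bs)) (bs - x)"
      then show "y \<in> {pi - bs..bs}" unfolding atLeastAtMost_iff by linarith
     qed
    qed
    then have s: "sin (x - real m * ph x) = 0" using C by simp
    define q where "q = x - real m * ph x"
    have "\<bar>cos q\<bar> = 1" using s sin_zero_abs_cos_one by (simp add: q_def)
    moreover have "cos (real m * ph x) = cos x * cos q"
     using s cos_diff[of x q] by (simp add: q_def)
    ultimately have "\<bar>cos (real m * ph x)\<bar> = \<bar>cos x\<bar>" by (simp add: abs_mult)
    then have "KK x \<le> W x"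
     using rh_pos[OF xx] unfolding KK_def W_def minus_divide_left by (intro divide_right_mono) auto
    then show ?thesis using Wmono[of x] KW xi by simp
   qed
   then show ?thesis using x(2)[of b] False False' by auto
  qed
 qed
qed

lemma circle_point:
 assumes b: "b \<in> {0..pi}"
 shows "1 + of_real t * cis (b + ph b) = of_real (rh b) * cis (ph b)"
proof -
 have "of_real (rh b) * cis (ph b) - of_real t * cis (b + ph b)
   = cis (ph b) * (of_real (rh b) - of_real t * cis b)"
  by (simp add: cis_mult[symmetric] algebra_simps)
 also have "of_real (rh b) - of_real t * cis b = cis (- ph b)"
  using sin_ph[OF b] by (simp add: complex_eq_iff rh_def)
 finally show ?thesis by (simp add: cis_mult algebra_simps)
qed

lemma Re_inverse_power:
 assumes b: "b \<in> {0..pi}"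
 shows "Re (1 / (1 + of_real t * cis (b + ph b)) ^ m) = - KK b"
proof -
 have "1 / (1 + of_real t * cis (b + ph b)) ^ m = of_real (1 / rh b ^ m) * cis (- (real m * ph b))"
  unfolding circle_point[OF b] power_mult_distrib Complex.DeMoivre
  by (simp add: divide_inverse)
 then show ?thesis by (simp add: KK_def)
qed

lemma angle_surj:
 assumes "0 \<le> a" "a \<le> pi"
 shows "\<exists>b\<in>{0..pi}. b + ph b = a"
proof -
 have "\<exists>b. 0 \<le> b \<and> b \<le> pi \<and> b + ph b = a"
 proof (rule IVT)
  show "\<forall>x. 0 \<le> x \<and> x \<le> pi \<longrightarrow> isCont (\<lambda>b. b + ph b) x"
   using DERIV_isCont[OF ph_deriv] by (auto intro!: continuous_intros)
 qed (use assms in \<open>auto simp: ph_def\<close>)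
 then show ?thesis by auto
qed

lemma Re_inverse_power_circle:
 assumes "cmod tau = t"
 shows "Re (1 / (1 + tau) ^ m) \<ge> - KK bs"
proof -
 define u where "u = (if Im tau \<ge> 0 then tau else cnj tau)"
 have "cnj (1 / (1 + tau) ^ m) = 1 / (1 + cnj tau) ^ m" by simp
 then have "Re (1 / (1 + tau) ^ m) = Re (1 / (1 + cnj tau) ^ m)" by (metis cnj.simps(1))
 then have eq: "Re (1 / (1 + tau) ^ m) = Re (1 / (1 + u) ^ m)" by (simp add: u_def)
 have u: "cmod u = t" "Im u \<ge> 0" using assms by (auto simp: u_def)
 have "0 \<le> Arg u" "Arg u \<le> pi" using u Arg_less_0[of u] Arg_le_pi[of u] by auto
 then obtain b where b: "b \<in> {0..pi}" "b + ph b = Arg u" using angle_surj by blast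
 have "u = of_real t * cis (b + ph b)" using u(1) b(2) by (metis rcis_cmod_Arg rcis_def)
 then show ?thesis using Re_inverse_power[OF b(1)] KK_le[OF b(1)] by (simp add: eq)
qed

text \<open>Maximum principle for the real part of -(1 + z)^(-m); t < 1 keeps the pole z = -1
  outside.\<close>

lemma Re_inverse_power_disc:
 assumes "cmod tau < t"
 shows "Re (1 / (1 + tau) ^ m) \<ge> - KK bs"
proof -
 have nz: "1 + z \<noteq> 0" if "cmod z \<le> t" for z
  using that t by (metis add_eq_0_iff norm_minus_cancel norm_one not_le)
 have "Re (- (1 / (1 + tau) ^ m)) \<le> KK bs"
 proof (rule maximum_real_frontier[of "\<lambda>z. - (1 / (1 + z) ^ m)" "ball 0 t"])
  show "(\<lambda>z. - (1 / (1 + z) ^ m)) holomorphic_on interior (ball 0 t)"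
   using nz by (auto intro!: holomorphic_intros)
  show "continuous_on (closure (ball 0 t)) (\<lambda>z::complex. - (1 / (1 + z) ^ m))"
  proof -
   have "continuous_on (cball 0 t) (\<lambda>z::complex. - (1 / (1 + z) ^ m))"
    by (intro continuous_intros) (use nz in \<open>auto simp: dist_norm\<close>)
   then show ?thesis using t by simp
  qed
  show "Re (- (1 / (1 + z) ^ m)) \<le> KK bs" if "z \<in> frontier (ball 0 t)" for z
   using Re_inverse_power_circle[of z] that t by (simp add: dist_norm)
 qed (use assms in \<open>auto simp: dist_norm\<close>)
 then show ?thesis by simp
qed

end

lemma abs_sin_mult_le: "\<bar>sin (real n * x)\<bar> \<le> real n * \<bar>sin x\<bar>"
proof (induction n)
 case (Suc n)
 have "sin (real (Suc n) * x) = sin (real n * x) * cos x + cos (real n * x) * sin x"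
  by (simp add: algebra_simps sin_add)
 also have "\<bar>\<dots>\<bar> \<le> \<bar>sin (real n * x)\<bar> * 1 + 1 * \<bar>sin x\<bar>"
  by (intro order_trans[OF abs_triangle_ineq] add_mono) (auto simp: abs_mult mult_left_le mult_left_le_one_le)
 finally show ?case using Suc by (simp add: algebra_simps)
qed simp

text \<open>For m = 1 the saddle circle is the unit circle and passes through the pole. There z ->
  1/(1 + z) maps the unit disc to the half plane Re > 1/2, and points with |v - 1| = 1 to its
  boundary.\<close>

lemma Re_inverse_ge_half:
 assumes "cmod tau < 1" shows "Re (1 / (1 + tau)) \<ge> 1 / 2"
proof -
 define a where "a = Re tau"
 define b where "b = Im tau"
 have ab: "a ^ 2 + b ^ 2 < 1" using assms by (simp add: a_def b_def cmod_def)
 have "\<bar>a\<bar> < 1" using assms abs_Re_le_cmod[of tau] by (simp add: a_def)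
 then have p: "(1 + a) ^ 2 + b ^ 2 > 0" by (intro add_pos_nonneg) auto
 have "Re (1 / (1 + tau)) = (1 + a) / ((1 + a) ^ 2 + b ^ 2)"
  by (simp add: Re_divide a_def b_def)
 moreover have "(1 + a) ^ 2 + b ^ 2 \<le> 2 * (1 + a)" using ab by (simp add: power2_eq_square algebra_simps)
 then have "1 / 2 \<le> (1 + a) / ((1 + a) ^ 2 + b ^ 2)" using p by (simp add: pos_le_divide_eq)
 ultimately show ?thesis by simp
qed

lemma Re_inverse_eq_half:
 assumes "cmod (v - 1) = 1" "v \<noteq> 0" shows "Re (1 / v) = 1 / 2"
proof -
 define a where "a = Re v"
 define b where "b = Im v"
 have "(a - 1) ^ 2 + b ^ 2 = 1" using assms by (simp add: a_def b_def cmod_def)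
 then have ab: "a ^ 2 + b ^ 2 = 2 * a" by (simp add: power2_eq_square algebra_simps)
 have "a ^ 2 + b ^ 2 \<noteq> 0" using assms by (simp add: a_def b_def complex_eq_iff sum_power2_eq_zero_iff)
 then have "a \<noteq> 0" "a / (a ^ 2 + b ^ 2) = 1 / 2" unfolding ab by auto
 then show ?thesis by (simp add: Re_divide a_def b_def)
qed

text \<open>With p = Arg v, the condition on arguments gives sin p = t sin (m p), so the circle is a
  \<open>critical_circle\<close> with bs = m p, and the sign assumptions follow from the
  monotonicity of sin (m x) / sin x. The real point 1 + 1/m is the limiting case p = 0. For m = 1
  the radius is 1, and half planes replace trigonometry.\<close>

lemma saddle_circle_bound_upper:
 fixes v :: complex
 assumes m: "m \<ge> 1"
  and v: "v = of_real (1 + 1 / real m) \<or> (Im v > 0 \<and> (real m + 1) * Arg v = Arg (v - 1))"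
 shows "cmod (v - 1) \<le> 1 \<and> (\<forall>tau. cmod tau < cmod (v - 1) \<longrightarrow> Re (1 / v ^ m) \<le> Re (1 / (1 + tau) ^ m))"
proof -
 define t where "t = cmod (v - 1)"
 define p where "p = (if Im v > 0 then Arg v else 0)"
 have v0: "v \<noteq> 0" using v by (auto simp: complex_eq_iff) (smt (verit) divide_nonneg_nonneg of_nat_0_le_iff)
 \<comment> \<open>The relation t sin (m p) = sin p is the imaginary part of e^(-i p) v = |v|, where
   v = 1 + t e^(i (m+1) p).\<close>
 have A: "t > 0 \<and> 1 + of_real t * cis ((real m + 1) * p) = v \<and> (p > 0 \<longrightarrow> sin p > 0 \<and> (real m + 1) * p < pi \<and> t * sin (real m * p) = sin p)
   \<and> (p = 0 \<longrightarrow> t = 1 / real m) \<and> p \<ge> 0"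
 proof (cases "Im v > 0")
  case True
  have vu: "(real m + 1) * Arg v = Arg (v - 1)"
   using v True by auto
  have p: "p = Arg v" using True by (simp add: p_def)
  have pp: "0 < p" "p < pi" using True Arg_lt_pi[of v] by (auto simp: p)
  have th: "Arg (v - 1) < pi" using True Arg_lt_pi[of "v - 1"] by auto
  have t0: "t > 0" using True by (auto simp: t_def)
  have v1: "v - 1 = of_real t * cis ((real m + 1) * p)"
   unfolding p vu t_def by (metis rcis_cmod_Arg rcis_def)
  have vr: "v = of_real (cmod v) * cis p" unfolding p by (metis rcis_cmod_Arg rcis_def)
  have "of_real (cmod v) * cis p = 1 + of_real t * cis ((real m + 1) * p)" using v1 vr by (simp add: algebra_simps)
  then have "of_real (cmod v) * (cis p * cis (- p)) = cis (- p) + of_real t * (cis ((real m + 1) * p) * cis (- p))"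
   by (simp only: mult.assoc[symmetric]) (simp only: ring_distribs mult_1_left)
  then have "of_real (cmod v) = cis (- p) + of_real t * cis (real m * p)"
   by (simp add: cis_mult algebra_simps)
  then have "0 = - sin p + t * sin (real m * p)" by (auto simp: complex_eq_iff)
  then show ?thesis using t0 v1 pp th sin_gt_zero[of p] vu by (auto simp: algebra_simps p)
 next
  case False
  then have "v = of_real (1 + 1 / real m)" using v by auto
  then show ?thesis using False m by (auto simp: t_def p_def norm_divide)
 qed
 show ?thesis
 proof (cases "m = 1")
  case True
  have t1: "t = 1" using A True by (cases "p = 0") auto
  then have "Re (1 / v) = 1 / 2" using Re_inverse_eq_half[of v] v0 by (simp add: t_def)
  moreover have "Re (1 / (1 + tau)) \<ge> 1 / 2" if "cmod tau < t" for tau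
   using that t1 by (intro Re_inverse_ge_half) simp
  ultimately have "Re (1 / v) \<le> Re (1 / (1 + tau))" if "cmod tau < t" for tau
   using that by (metis (full_types))
  then have "\<forall>tau. cmod tau < t \<longrightarrow> Re (1 / v) \<le> Re (1 / (1 + tau))" by blast
  then show ?thesis using t1 unfolding t_def[symmetric] True power_one_right by simp
 next
  case False
  then have m2: "m \<ge> 2" using m by simp
  \<comment> \<open>For p > 0, t = sin p / sin (m p) and p < m p < pi - p; for p = 0, t =
    1/m.\<close>
  have t1: "t < 1"
  proof (cases "p = 0")
   case True
   then have "t = 1 / real m" using A by blast
   moreover have "1 / real m \<le> 1 / 2" using m2 by (intro divide_left_mono) auto
   ultimately show ?thesis by simp
  next
   case False
   then have pp: "p > 0" "(real m + 1) * p < pi" "sin p > 0" "t * sin (real m * p) = sin p" using A by auto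
   have mp: "real m * p > 1 * p" using m2 pp(1) by (intro mult_strict_right_mono) auto
   have "sin p < sin (real m * p)"
   proof (cases "real m * p \<le> pi / 2")
    case True
    then show ?thesis using mp pp pi_ge_zero by (intro sin_monotone_2pi) linarith+
   next
    case False
    have "sin p < sin (pi - real m * p)"
    proof (rule sin_monotone_2pi)
     show "- (pi / 2) \<le> p" using pp(1) pi_ge_zero by linarith
     show "p < pi - real m * p" using pp(2) by (simp add: algebra_simps)
     show "pi - real m * p \<le> pi / 2" using False by simp
    qed
    then show ?thesis by simp
   qed
   then have "t * sin (real m * p) < 1 * sin (real m * p)" using pp by simp
   moreover have "sin (real m * p) > 0" using \<open>sin p < _\<close> pp(3) by linarith
   ultimately show ?thesis by (simp only: mult_less_cancel_right_pos)
  qed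
  have t0: "t > 0" using A by blast
  have bs: "0 \<le> real m * p" "real m * p < pi"
  proof -
   show "0 \<le> real m * p" using A by simp
   have "p > 0 \<Longrightarrow> real m * p < pi" using A by (simp add: algebra_simps)
   then show "real m * p < pi" using A pi_gt_zero by (cases "p = 0") auto
  qed
  interpret critical_circle m t "real m * p"
  proof
   show "t * sin b \<le> sin (b / real m)" if b: "real m * p \<le> b" "b \<le> pi" for b
   proof (cases "p = 0")
    case True
    then have tm: "t = 1 / real m" using A by blast
    have "t * sin b \<le> 1 / real m * \<bar>sin (real m * (b / real m))\<bar>"
     unfolding tm using m by (intro mult_left_mono) auto
    also have "\<dots> \<le> 1 / real m * (real m * \<bar>sin (b / real m)\<bar>)"
     by (intro mult_left_mono abs_sin_mult_le) auto
    also have "\<dots> = \<bar>sin (b / real m)\<bar>" using m by simp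
    also have "\<dots> = sin (b / real m)"
    proof -
     have "b / real m \<le> pi / 1" using b True m by (intro frac_le) auto
     then have "sin (b / real m) \<ge> 0" using b True by (intro sin_ge_zero) auto
     then show ?thesis by simp
    qed
    finally show ?thesis .
   next
    case False
    then have pp: "p > 0" "sin p > 0" "t * sin (real m * p) = sin p" using A by auto
    have "t * sin (real m * p) > 0" using pp by simp
    then have s: "sin (real m * p) > 0" using A by (simp add: zero_less_mult_iff)
    have "sin (real m * (b / real m)) * sin p \<le> sin (real m * p) * sin (b / real m)"
     using b pp m by (intro sin_mult_ratio_decreasing) (auto simp: field_simps)
    then have "sin (real m * p) * (t * sin b) \<le> sin (real m * p) * sin (b / real m)"
     using m by (simp add: pp(3)[symmetric] mult_ac)
    then show ?thesis using s by (simp add: mult_le_cancel_left)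
   qed
   show "sin (b / real m) \<le> t * sin b" if b: "0 \<le> b" "b \<le> real m * p" for b
   proof (cases "b = 0")
    case False
    then have "b > 0" using b by simp
    moreover have "p \<noteq> 0" using \<open>b > 0\<close> b by auto
    ultimately have bp: "b > 0" "p > 0" using A by auto
    then have pp: "p > 0" "sin p > 0" "t * sin (real m * p) = sin p" using A by auto
    have "t * sin (real m * p) > 0" using pp by simp
    then have s: "sin (real m * p) > 0" using A by (simp add: zero_less_mult_iff)
    have "sin (real m * p) * sin (b / real m) \<le> sin (real m * (b / real m)) * sin p"
     using b bp m bs by (intro sin_mult_ratio_decreasing) (auto simp: field_simps)
    then have "sin (real m * p) * sin (b / real m) \<le> sin (real m * p) * (t * sin b)"
     using m by (simp add: pp(3)[symmetric] mult_ac)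
    then show ?thesis using s by (simp add: mult_le_cancel_left)
   qed auto
  qed (use t0 t1 m2 bs in simp_all)
  have "ph (real m * p) = p" using ph_bs m by simp
  then have e: "1 + of_real t * cis (real m * p + ph (real m * p)) = v" using A by (simp add: algebra_simps)
  have "Re (1 / v ^ m) = - KK (real m * p)"
   using Re_inverse_power[of "real m * p"] bs unfolding e by simp
  then show ?thesis using t1 Re_inverse_power_disc unfolding t_def[symmetric] by simp
 qed
qed

text \<open>What the Cauchy estimate needs from a boundary value v of \<open>vb\<close>. On the slit
  k is real and positive, so the inequality says that Re ((1 - (1 + tau)^(-m)) / k) does not exceed
  its saddle value on any circle of radius below |v - 1|.\<close>

definition saddle_good :: "nat \<Rightarrow> complex \<Rightarrow> bool" where
 "saddle_good m v \<longleftrightarrow> v \<noteq> 0 \<and> v \<noteq> 1 \<and> cmod (v - 1) \<le> 1 \<and>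
   (\<forall>tau. cmod tau < cmod (v - 1) \<longrightarrow> Re (1 / v ^ m) \<le> Re (1 / (1 + tau) ^ m))"

lemma saddle_good_cnj_imp:
 assumes "saddle_good m (cnj v)" shows "saddle_good m v"
proof -
 have e: "Re (1 / (cnj z) ^ m) = Re (1 / z ^ m)" for z
 proof -
  have "1 / (cnj z) ^ m = cnj (1 / z ^ m)" by simp
  then show ?thesis by (metis cnj.simps(1))
 qed
 have n: "cmod (cnj v - 1) = cmod (v - 1)" by (metis complex_cnj_diff complex_cnj_one complex_mod_cnj)
 have "Re (1 / v ^ m) \<le> Re (1 / (1 + tau) ^ m)" if "cmod tau < cmod (v - 1)" for tau
  using assms that e[of v] e[of "1 + tau"] unfolding saddle_good_def n
  by (metis complex_cnj_add complex_cnj_one complex_mod_cnj)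
 then show ?thesis using assms unfolding saddle_good_def n by auto
qed

lemma saddle_goodI:
 assumes m: "m \<ge> 1"
  and v: "v = of_real (1 + 1 / real m) \<or> (Im v < 0 \<and> (real m + 1) * Arg v = Arg (v - 1))"
 shows "saddle_good m v"
proof -
 define w where "w = cnj v"
 have Ac: "Arg (cnj z) = - Arg z" if "Im z < 0" for z
  using that Arg_cnj[of z] by (auto simp: complex_is_Real_iff)
 have "w = of_real (1 + 1 / real m) \<or> (Im w > 0 \<and> (real m + 1) * Arg w = Arg (w - 1))"
  using v
 proof
  assume *: "Im v < 0 \<and> (real m + 1) * Arg v = Arg (v - 1)"
  have "w - 1 = cnj (v - 1)" by (simp add: w_def)
  then have "Arg (w - 1) = - Arg (v - 1)" using Ac[of "v - 1"] * by simp
  then show ?thesis using * Ac[of v] by (simp add: w_def)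
 qed (simp add: w_def)
 moreover from this have "w \<noteq> 0" "w \<noteq> 1"
  using m by (auto simp: complex_eq_iff) (smt (verit) divide_nonneg_nonneg of_nat_0_le_iff)
 ultimately have "saddle_good m w"
  using saddle_circle_bound_upper[OF m, of w] by (simp add: saddle_good_def)
 then show ?thesis unfolding w_def by (rule saddle_good_cnj_imp)
qed

section \<open>Boundary values of \<open>vb\<close> on the slit\<close>

lemma strict_bernoulli:
 fixes w :: real
 assumes "w > 0" "m \<ge> 1" "w ^ (m + 1) \<le> 1 + real (m + 1) * (w - 1)"
 shows "w = 1"
proof (rule ccontr)
 assume ne: "w \<noteq> 1"
 have pos: "(w - 1) * (w ^ i - 1) \<ge> 0" for i
  using assms(1) by (cases "w \<ge> 1") (auto intro!: mult_nonneg_nonneg mult_nonpos_nonpos simp: power_le_one)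
 have "w ^ (m + 1) - 1 = (w - 1) * (\<Sum>i\<le>m. w ^ i)"
  using power_diff_1_eq[of w "m + 1"] by (simp add: lessThan_Suc_atMost)
 then have "w ^ (m + 1) - 1 - real (m + 1) * (w - 1) = (w - 1) * (\<Sum>i\<le>m. w ^ i - 1)"
  by (simp add: sum_subtractf algebra_simps)
 also have "\<dots> = (\<Sum>i\<le>m. (w - 1) * (w ^ i - 1))" by (simp add: sum_distrib_left)
 also have "\<dots> \<ge> (w - 1) * (w ^ 1 - 1)"
  using assms(2) by (intro member_le_sum[of 1 "{..m}" "\<lambda>i. (w - 1) * (w ^ i - 1)"] pos) auto
 finally have "(w - 1) * (w ^ 1 - 1) \<le> w ^ (m + 1) - 1 - real (m + 1) * (w - 1)" .
 moreover have "(w - 1) * (w ^ 1 - 1) > 0" using ne by (simp add: zero_less_mult_iff) linarith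
 ultimately show False using assms(3) by linarith
qed

context fuss_measure
begin

lemma m0: "of_nat m \<noteq> (0 :: complex)" using m_ge by simp

lemma lower_half_in_slit: "Im k < 0 \<Longrightarrow> k \<in> SL" by (simp add: slit_def)

lemma vb_tendsto_1: "(vb \<longlongrightarrow> 1) (at 0)"
proof -
 have "isCont vb 0"
  using holomorphic_on_imp_continuous_on[OF vb_holomorphic] zero_in_slit
  by (simp add: continuous_on_eq_continuous_at open_slit)
 then show ?thesis by (simp add: isCont_def vb_0)
qed

lemma cnj_J: "J (cnj k) = cnj (J k)"
proof -
 have "cnj (J k) = (LINT x|M. cnj (1 / (1 - k * of_real x)))"
  unfolding J_def by (rule Bochner_Integration.integral_cnj[symmetric])
 then show ?thesis unfolding J_def by simp
qed

lemma cnj_vb: "vb (cnj k) = cnj (vb k)"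
 by (simp add: vb_def V_def cnj_J)

text \<open>Base point for \<open>half_plane\<close>. Near k = 0 the value v is close to 1, with
  small argument, and k = -i e moves v - 1, which is about k/m, downwards.\<close>

lemma imaginary_witness: "\<exists>e>0. Im (vb (- \<i> * of_real e)) < 0 \<and> \<bar>(real m + 1) * Arg (vb (- \<i> * of_real e))\<bar> < pi / 2"
proof -
 have "((\<lambda>e. - \<i> * complex_of_real e) \<longlongrightarrow> - \<i> * complex_of_real 0) (at_right 0)" by (intro tendsto_intros)
 then have f: "filterlim (\<lambda>e. - \<i> * complex_of_real e) (at 0) (at_right 0)"
  by (auto simp: filterlim_at eventually_at_filter)
 have l: "((\<lambda>e. vb (- \<i> * complex_of_real e)) \<longlongrightarrow> 1) (at_right 0)"
  by (rule filterlim_compose[OF vb_tendsto_1 f])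
 have "((\<lambda>e. Re (vb (- \<i> * complex_of_real e) ^ (m + 1))) \<longlongrightarrow> Re (1 ^ (m + 1))) (at_right 0)"
  by (intro tendsto_intros l)
 then have 1: "\<forall>\<^sub>F e in at_right 0. Re (vb (- \<i> * complex_of_real e) ^ (m + 1)) > 0"
  by (rule order_tendstoD) simp
 have "((\<lambda>e. Arg (vb (- \<i> * complex_of_real e))) \<longlongrightarrow> Arg 1) (at_right 0)"
  by (rule isCont_tendsto_compose[OF continuous_at_Arg l]) (simp add: complex_nonpos_Reals_iff)
 then have "((\<lambda>e. \<bar>(real m + 1) * Arg (vb (- \<i> * complex_of_real e))\<bar>) \<longlongrightarrow> \<bar>(real m + 1) * Arg 1\<bar>) (at_right 0)"
  by (intro tendsto_rabs tendsto_mult_left)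
 then have 2: "\<forall>\<^sub>F e in at_right 0. \<bar>(real m + 1) * Arg (vb (- \<i> * complex_of_real e))\<bar> < pi / 2"
  by (rule order_tendstoD) simp
 have 3: "\<forall>\<^sub>F e::real in at_right 0. e > 0" by (simp add: eventually_at_filter)
 from 1 2 3 have "\<forall>\<^sub>F e in at_right 0. e > 0 \<and> Im (vb (- \<i> * of_real e)) < 0 \<and> \<bar>(real m + 1) * Arg (vb (- \<i> * of_real e))\<bar> < pi / 2"
 proof eventually_elim
  case (elim e)
  define k where "k = - \<i> * complex_of_real e"
  have ks: "k \<in> SL" using elim by (intro lower_half_in_slit) (simp add: k_def)
  have "vb k - 1 = k / of_nat m * vb k ^ (m + 1)" using vb_equation[OF ks] by simp
  also have "\<dots> = of_real (e / real m) * (- \<i> * vb k ^ (m + 1))" by (simp add: k_def)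
  finally have "Im (vb k - 1) = Im (of_real (e / real m) * (- \<i> * vb k ^ (m + 1)))" by simp
  also have "\<dots> = (e / real m) * - Re (vb k ^ (m + 1))"
   unfolding times_complex.sel(2) by simp
  finally have "Im (vb k - 1) = (e / real m) * - Re (vb k ^ (m + 1))" .
  moreover have "(e / real m) * Re (vb k ^ (m + 1)) > 0"
   using elim m_ge unfolding k_def by (intro mult_pos_pos) auto
  ultimately have "Im (vb k - 1) < 0" by linarith
  then have "Im (vb k) < 0" by simp
  then show ?case using elim by (simp add: k_def)
 qed
 then show ?thesis using eventually_happens'[of "at_right (0::real)"] by fastforce
qed

text \<open>A real v would make k real by the saddle equation, so Im v keeps one sign on the half
  plane. Thus all three arguments are continuous there, and the equation yields the relation modulo
  2 pi; connectedness makes the multiple constant and the base point makes it 0. The choice of the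
  branch has become a relation between arguments, which survives passage to the boundary.\<close>

lemma half_plane:
 assumes k: "Im k < 0"
 shows "Im (vb k) < 0" "(real m + 1) * Arg (vb k) = Arg (vb k - 1) - Arg k"
proof -
 define S where "S = {k. Im k < 0}"
 have S: "connected S" "S \<subseteq> SL"
  using convex_halfspace_Im_lt[of 0] by (auto simp: S_def convex_connected slit_def)
 obtain e where e: "e > 0" "Im (vb (- \<i> * of_real e)) < 0" "\<bar>(real m + 1) * Arg (vb (- \<i> * of_real e))\<bar> < pi / 2"
  using imaginary_witness by auto
 define k0 where "k0 = - \<i> * complex_of_real e"
 have k0: "k0 \<in> S" using e by (simp add: k0_def S_def)
 have cont: "continuous_on S vb"
  using holomorphic_on_imp_continuous_on[OF vb_holomorphic] S(2) continuous_on_subset by blast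
 have nz: "Im (vb z) \<noteq> 0" if z: "z \<in> S" for z
 proof
  assume i: "Im (vb z) = 0"
  define r where "r = Re (vb z)"
  have r: "vb z = of_real r" using i by (simp add: complex_eq_iff r_def)
  have zs: "z \<in> SL" using z S by auto
  have "r \<noteq> 0" using vb_nonzero[OF zs] r by auto
  then have "z = of_nat m * (of_real r - 1) / of_real r ^ (m + 1)"
   using vb_equation[OF zs] m0 unfolding r by (simp add: field_simps)
  also have "\<dots> = of_real (real m * (r - 1) / r ^ (m + 1))" by simp
  finally have "Im z = 0" by (metis Im_complex_of_real)
  then show False using z by (simp add: S_def)
 qed
 have neg: "Im (vb z) < 0" if z: "z \<in> S" for z
 proof (rule ccontr)
  assume "\<not> Im (vb z) < 0"
  then have vz: "Im (vb z) > 0" using nz[OF z] by simp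
  have "connected ((\<lambda>z. Im (vb z)) ` S)"
   by (intro connected_continuous_image S continuous_intros cont)
  then have "0 \<in> (\<lambda>z. Im (vb z)) ` S"
   by (rule connectedD_interval[of _ "Im (vb k0)" "Im (vb z)"])
     (use k0 z e(2) vz in \<open>auto simp: k0_def\<close>)
  then show False using nz by auto
 qed
 show "Im (vb k) < 0" using neg k by (simp add: S_def)
 define a where "a z = (real m + 1) * Arg (vb z) - Arg (vb z - 1) + Arg z" for z
 have ca: "continuous_on S a"
 proof -
  have "isCont Arg w" if "Im w < 0" for w using that by (intro continuous_at_Arg) (auto simp: complex_nonpos_Reals_iff)
  then have *: "continuous_on {w. Im w < 0} Arg" by (intro continuous_at_imp_continuous_on) auto
  have "continuous_on S (\<lambda>z. Arg (vb z))" "continuous_on S (\<lambda>z. Arg (vb z - 1))" "continuous_on S Arg"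
   by (rule continuous_on_compose2[OF * cont], use neg in force)
     (rule continuous_on_compose2[OF * continuous_on_diff[OF cont continuous_on_const]], use neg in force,
     rule continuous_on_subset[OF *], simp add: S_def)
  then show ?thesis unfolding a_def
   by (intro continuous_on_add continuous_on_diff continuous_on_mult continuous_on_const)
 qed
 have cis_a: "cis (a z) = 1" if z: "z \<in> S" for z
 proof -
  have zs: "z \<in> SL" using z S by auto
  define v where "v = vb z"
  have z0: "z \<noteq> 0" using z by (auto simp: S_def)
  have v0: "v \<noteq> 0" "v - 1 \<noteq> 0" using vb_nonzero[OF zs] neg[OF z] by (auto simp: v_def)
  have p: "w = of_real (cmod w) * cis (Arg w)" for w by (metis rcis_cmod_Arg rcis_def)
  have "z * v ^ (m + 1) = of_nat m * (v - 1)" using vb_equation[OF zs] m0 by (simp add: v_def field_simps)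
  have "of_real (cmod z * cmod v ^ (m + 1)) * (cis (Arg z) * cis ((real m + 1) * Arg v))
    = (of_real (cmod z) * cis (Arg z)) * (of_real (cmod v) * cis (Arg v)) ^ (m + 1)"
   unfolding power_mult_distrib Complex.DeMoivre by (simp add: mult_ac add.commute)
  also have "\<dots> = of_nat m * (v - 1)"
   unfolding p[of z, symmetric] p[of v, symmetric] by fact
  also have "\<dots> = of_real (real m * cmod (v - 1)) * cis (Arg (v - 1))"
   by (subst p[of "v - 1"]) simp
  finally have "of_real (cmod z * cmod v ^ (m + 1)) * (cis (Arg z) * cis ((real m + 1) * Arg v))
    = of_real (real m * cmod (v - 1)) * cis (Arg (v - 1))" .
  moreover have "cmod z * cmod v ^ (m + 1) = real m * cmod (v - 1)"
   using \<open>z * v ^ (m + 1) = of_nat m * (v - 1)\<close> by (metis norm_mult norm_of_nat norm_power)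
  moreover have "complex_of_real (real m * cmod (v - 1)) \<noteq> 0" using v0 m_ge by simp
  ultimately have "cis (Arg z) * cis ((real m + 1) * Arg v) = cis (Arg (v - 1))"
   by (metis mult_left_cancel)
  then have "cis (Arg z) * cis ((real m + 1) * Arg v) * cis (- Arg (v - 1)) = 1"
   by (simp add: cis_mult)
  then show ?thesis by (simp add: cis_mult a_def v_def algebra_simps)
 qed
 have "a constant_on S"
 proof (rule continuous_discrete_range_constant[OF S(1) ca])
  fix x assume x: "x \<in> S"
  show "\<exists>d>0. \<forall>y. y \<in> S \<and> a y \<noteq> a x \<longrightarrow> d \<le> norm (a y - a x)"
  proof (intro exI[of _ 1] conjI allI impI)
   fix y assume y: "y \<in> S \<and> a y \<noteq> a x"
   then have "cis (a y - a x) = 1" using cis_a[of y] cis_a[OF x] by (simp add: cis_divide[symmetric])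
   then have "cos (a y - a x) = 1" by (auto simp: complex_eq_iff)
   then obtain n :: int where n: "a y - a x = of_int n * 2 * pi" by (auto simp: cos_one_2pi_int)
   then have "n \<noteq> 0" using y by auto
   then have "\<bar>of_int n\<bar> \<ge> (1::real)" by linarith
   then have "1 * 1 \<le> \<bar>of_int n\<bar> * (2 * pi)" using pi_gt3 by (intro mult_mono) auto
   then show "1 \<le> norm (a y - a x)" by (simp add: n abs_mult)
  qed simp
 qed
 \<comment> \<open>Here Arg k0 = -pi/2, Arg (v - 1) lies in (-pi, 0) and |(m+1) Arg v| < pi/2, so |a
   k0| < pi and the multiple of 2 pi is 0.\<close>
 moreover have "a k0 = 0"
 proof -
  have "- (pi / 2) \<le> pi" using pi_ge_zero by linarith
  then have "Arg k0 = - (pi / 2)" using e(1)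
   by (intro Arg_unique[of e]) (simp_all add: k0_def exp_minus cis_conv_exp[symmetric] complex_eq_iff Re_exp Im_exp)
  moreover have "Arg (vb k0 - 1) < 0" "- pi < Arg (vb k0 - 1)"
   using e(2) Arg_less_0[of "vb k0 - 1"] mpi_less_Arg[of "vb k0 - 1"] by (auto simp: k0_def)
  ultimately have ab: "\<bar>a k0\<bar> < pi" using e(3) unfolding a_def k0_def by linarith
  have "cos (a k0) = 1" using cis_a[OF k0] by (auto simp: complex_eq_iff)
  then obtain n :: int where n: "a k0 = of_int n * 2 * pi" by (auto simp: cos_one_2pi_int)
  have "n = 0"
  proof (rule ccontr)
   assume "n \<noteq> 0"
   then have "\<bar>of_int n\<bar> \<ge> (1::real)" by linarith
   then have "1 * (2 * pi) \<le> \<bar>of_int n\<bar> * (2 * pi)" by (intro mult_right_mono) auto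
   then show False using ab by (simp add: n abs_mult)
  qed
  then show ?thesis using n by simp
 qed
 ultimately have "a k = 0" using k0 k unfolding constant_on_def S_def by auto
 then show "(real m + 1) * Arg (vb k) = Arg (vb k - 1) - Arg k" by (simp add: a_def)
qed

text \<open>In the limit Arg k is 0. For real v, values below 1 contradict the relation of
  \<open>half_plane\<close>; a value r > 1 satisfies k0 r^(m+1) = m (r - 1), and k0 >= 1 /
  \<open>cstar m\<close> leaves only the double root 1 + 1/m, by the equality case of Bernoulli's
  inequality.\<close>

lemma boundary_limit_lower:
 assumes k: "\<And>n. Im (k n) < 0" "k \<longlonglongrightarrow> of_real k0" "k0 \<ge> 1 / cstar m"
  and v: "(\<lambda>n. vb (k n)) \<longlonglongrightarrow> v"
 shows "v = of_real (1 + 1 / real m) \<or> (Im v < 0 \<and> (real m + 1) * Arg v = Arg (v - 1))"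
proof -
 have k0: "k0 > 0" using k(3) L_pos by (smt (verit) divide_pos_pos)
 have eq: "of_real k0 / of_nat m * v ^ (m + 1) = v - 1"
 proof (rule LIMSEQ_unique)
  show "(\<lambda>n. k n / of_nat m * vb (k n) ^ (m + 1)) \<longlonglongrightarrow> of_real k0 / of_nat m * v ^ (m + 1)"
   using m0 by (intro tendsto_intros k v)
  have "(\<lambda>n. vb (k n) - 1) \<longlonglongrightarrow> v - 1" by (intro tendsto_intros v)
  then show "(\<lambda>n. k n / of_nat m * vb (k n) ^ (m + 1)) \<longlonglongrightarrow> v - 1"
   using vb_equation[OF lower_half_in_slit[OF k(1)]] by simp
 qed
 have v0: "v \<noteq> 0" using eq by auto
 have v1: "v \<noteq> 1" using eq k0 m_ge by auto
 have rel: "(real m + 1) * Arg (vb (k n)) = Arg (vb (k n) - 1) - Arg (k n)" and neg: "Im (vb (k n)) < 0" for n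
  using half_plane[OF k(1)] by auto
 have "(\<lambda>n. Im (vb (k n))) \<longlonglongrightarrow> Im v" by (intro tendsto_intros v)
 then have "Im v \<le> 0" by (rule LIMSEQ_le_const2) (use neg in \<open>auto intro: less_imp_le\<close>)
 have Arg_c: "(\<lambda>n. Arg (w n)) \<longlonglongrightarrow> Arg z" if "w \<longlonglongrightarrow> z" "z \<notin> \<real>\<^sub>\<le>\<^sub>0" for w z
  by (rule isCont_tendsto_compose[OF continuous_at_Arg[OF that(2)] that(1)])
 \<comment> \<open>\<open>Arg\<close> takes values in (-pi, pi] and jumps across the negative axis:
   approached from below its limit is -pi and not \<open>Arg z\<close>.\<close>
 have Arg_n: "(\<lambda>n. Arg (w n)) \<longlonglongrightarrow> - pi" if "w \<longlonglongrightarrow> z" "z \<in> \<real>\<^sub>\<le>\<^sub>0" "z \<noteq> 0" "\<And>n. Im (w n) < 0" for w z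
 proof -
  have "- z \<notin> \<real>\<^sub>\<le>\<^sub>0" using that by (auto simp: complex_nonpos_Reals_iff complex_eq_iff)
  then have "(\<lambda>n. Arg (- w n)) \<longlonglongrightarrow> Arg (- z)" by (intro Arg_c tendsto_intros that)
  moreover have "Arg (- z) = 0" using that by (auto simp: complex_nonpos_Reals_iff Arg_eq_0 complex_is_Real_iff)
  moreover have am: "Arg (w n) = Arg (- w n) - pi" for n
  proof -
   have a: "Arg (w n) < 0" "- pi < Arg (w n)" using that(4)[of n] Arg_less_0[of "w n"] mpi_less_Arg[of "w n"] by linarith+
   have "w n = of_real (cmod (w n)) * cis (Arg (w n))" by (metis rcis_cmod_Arg rcis_def)
   moreover have "cis (Arg (w n) + pi) = - cis (Arg (w n))" by (simp add: complex_eq_iff)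
   ultimately have "of_real (cmod (w n)) * exp (\<i> * of_real (Arg (w n) + pi)) = - w n"
    by (metis cis_conv_exp mult_minus_right)
   then have "Arg (- w n) = Arg (w n) + pi"
    by (rule Arg_unique) (use a that(4)[of n] in auto)
   then show ?thesis by simp
  qed
  ultimately have "(\<lambda>n. Arg (- w n) - pi) \<longlonglongrightarrow> 0 - pi" by (intro tendsto_intros) simp
  then show ?thesis using am by simp
 qed
 have Ak: "(\<lambda>n. Arg (k n)) \<longlonglongrightarrow> 0"
  using Arg_c[OF k(2)] k0 by (simp add: complex_nonpos_Reals_iff)
 have lv1: "(\<lambda>n. vb (k n) - 1) \<longlonglongrightarrow> v - 1" by (intro tendsto_intros v)
 have L: "(real m + 1) * x = y" if "(\<lambda>n. Arg (vb (k n))) \<longlonglongrightarrow> x" "(\<lambda>n. Arg (vb (k n) - 1)) \<longlonglongrightarrow> y" for x y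
 proof (rule LIMSEQ_unique)
  show "(\<lambda>n. (real m + 1) * Arg (vb (k n))) \<longlonglongrightarrow> (real m + 1) * x" by (intro tendsto_intros that)
  have "(\<lambda>n. Arg (vb (k n) - 1) - Arg (k n)) \<longlonglongrightarrow> y - 0" by (intro tendsto_intros that Ak)
  then show "(\<lambda>n. (real m + 1) * Arg (vb (k n))) \<longlonglongrightarrow> y" using rel by simp
 qed
 show ?thesis
 proof (cases "Im v < 0")
  case True
  have "(real m + 1) * Arg v = Arg (v - 1)"
   by (rule L) (use True v lv1 in \<open>auto intro!: Arg_c simp: complex_nonpos_Reals_iff\<close>)
  then show ?thesis using True by simp
 next
  case False
  then have iv: "Im v = 0" using \<open>Im v \<le> 0\<close> by simp
  define r where "r = Re v"
  have r: "v = of_real r" using iv by (simp add: r_def complex_eq_iff)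
  have r0: "r \<noteq> 0" "r \<noteq> 1" using v0 v1 r by auto
  have "r > 1"
  proof (rule ccontr)
   assume "\<not> r > 1"
   then have r1: "r < 1" using r0 by simp
   have A1: "(\<lambda>n. Arg (vb (k n) - 1)) \<longlonglongrightarrow> - pi"
    by (rule Arg_n[OF lv1]) (use r1 neg in \<open>auto simp: r complex_nonpos_Reals_iff\<close>)
   show False
   proof (cases "r < 0")
    case True
    have "(\<lambda>n. Arg (vb (k n))) \<longlonglongrightarrow> - pi"
     by (rule Arg_n[OF v]) (use True neg in \<open>auto simp: r complex_nonpos_Reals_iff\<close>)
    from L[OF this A1] have "real m * pi = 0" by (simp add: algebra_simps)
    then show False using m_ge by simp
   next
    case False
    have "(\<lambda>n. Arg (vb (k n))) \<longlonglongrightarrow> Arg v"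
     by (rule Arg_c[OF v]) (use False r0 in \<open>auto simp: r complex_nonpos_Reals_iff\<close>)
    moreover have "Arg v = 0" using False r0 by (simp add: r)
    ultimately show False using L[OF _ A1, of 0] by simp
   qed
  qed
  \<comment> \<open>Scaled so that the double root becomes 1: then w^(m+1) = r^(m+1) /
    \<open>cstar m\<close> and m (r - 1) = 1 + (m+1) (w - 1).\<close>
  define w where "w = r * real m / (real m + 1)"
  have mr: "real m > 0" using m_ge by simp
  have rw: "r = ((real m + 1) / real m) * w" using mr by (simp add: w_def)
  have "complex_of_real (k0 / real m * r ^ (m + 1)) = complex_of_real (r - 1)"
   using eq unfolding r by simp
  then have "k0 / real m * r ^ (m + 1) = r - 1" by (simp only: of_real_eq_iff)
  then have e: "k0 * r ^ (m + 1) = real m * (r - 1)" using mr by (simp add: field_simps)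
  have w0: "w > 0" using \<open>r > 1\<close> mr by (simp add: w_def)
  have "w ^ (m + 1) = 1 / cstar m * r ^ (m + 1)"
   unfolding rw power_mult_distrib cstar_def[symmetric] using L_pos by simp
  also have "\<dots> \<le> k0 * r ^ (m + 1)" using k(3) \<open>r > 1\<close> by (intro mult_right_mono) auto
  also have "\<dots> = 1 + real (m + 1) * (w - 1)" unfolding e using mr by (simp add: rw field_simps)
  finally have "w = 1" by (rule strict_bernoulli[OF w0 m_ge])
  then show ?thesis using mr r rw by (simp add: field_simps)
 qed
qed

lemma boundary_limit:
 assumes k: "\<And>n. Im (k n) \<noteq> 0" "k \<longlonglongrightarrow> of_real k0" "k0 \<ge> 1 / cstar m"
  and v: "(\<lambda>n. vb (k n)) \<longlonglongrightarrow> v"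
 shows "saddle_good m v"
proof (cases "infinite {n. Im (k n) < 0}")
 case True
 then obtain r :: "nat \<Rightarrow> nat" where r: "strict_mono r" "\<And>n. r n \<in> {n. Im (k n) < 0}"
  using infinite_enumerate by blast
 show ?thesis
  by (intro saddle_goodI[OF m_ge] boundary_limit_lower[of "k \<circ> r" k0])
    (use r(2) k(3) LIMSEQ_subseq_LIMSEQ[OF k(2) r(1)] LIMSEQ_subseq_LIMSEQ[OF v r(1)] in \<open>auto simp: o_def\<close>)
next
 case False
 then have "infinite {n. Im (k n) > 0}"
 proof -
  have "UNIV = {n. Im (k n) < 0} \<union> {n. Im (k n) > 0}" using k(1) by (auto simp: less_le not_less)
  then show ?thesis using False by (metis finite_Un infinite_UNIV_nat)
 qed
 then obtain r :: "nat \<Rightarrow> nat" where r: "strict_mono r" "\<And>n. r n \<in> {n. Im (k n) > 0}"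
  using infinite_enumerate by blast
 have l: "(\<lambda>n. cnj (k (r n))) \<longlonglongrightarrow> cnj (of_real k0)" "(\<lambda>n. cnj (vb (k (r n)))) \<longlonglongrightarrow> cnj v"
  by (intro tendsto_cnj LIMSEQ_subseq_LIMSEQ[OF k(2) r(1), unfolded o_def]
    LIMSEQ_subseq_LIMSEQ[OF v r(1), unfolded o_def])+
 have "saddle_good m (cnj v)"
  by (intro saddle_goodI[OF m_ge] boundary_limit_lower[of "\<lambda>n. cnj (k (r n))" k0])
    (use r(2) k(3) l in \<open>auto simp: cnj_vb\<close>)
 then show ?thesis by (rule saddle_good_cnj_imp)
qed

end

section \<open>Counting zeros in the disc\<close>

lemma compact_norm_bound:
 fixes g :: "complex \<Rightarrow> complex"
 assumes "compact K" "continuous_on K g"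
 shows "\<exists>M\<ge>0. \<forall>x\<in>K. cmod (g x) \<le> M"
proof -
 have "bounded (g ` K)" using compact_continuous_image[OF assms(2,1)] by (rule compact_imp_bounded)
 then obtain M where M: "\<forall>y\<in>g ` K. cmod y \<le> M" unfolding bounded_iff by blast
 show ?thesis by (intro exI[of _ "max M 0"]) (use M in force)
qed

lemma choose_le_power2: "real ((n + k) choose k) \<le> 2 ^ (n + k)"
proof -
 have "(n + k) choose k \<le> 2 ^ (n + k)" by (rule binomial_le_pow2)
 then have "real ((n + k) choose k) \<le> real (2 ^ (n + k))" by (simp only: of_nat_le_iff)
 then show ?thesis by simp
qed

lemma negative_binomial_sums:
 fixes u :: complex
 assumes "cmod u < 1"
 shows "(\<lambda>k. of_nat ((n + k) choose k) * u ^ k) sums (1 / (1 - u) ^ (n + 1))"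
proof -
 have nz: "1 - u \<noteq> 0" using assms by auto
 have perm: "(e * a) * (e * b) = (e * e) * (a * b)" for e a b :: complex by (simp add: ac_simps)
 have "(\<lambda>k. ((- of_nat (n + 1)) gchoose k) * (- u) ^ k) sums (1 + - u) powr (- of_nat (n + 1))"
  using assms by (intro gen_binomial_complex) simp
 moreover have "((- of_nat (n + 1)) gchoose k) * (- u) ^ k = of_nat ((n + k) choose k) * u ^ k" for k
 proof -
  have "((- of_nat (n + 1) :: complex) gchoose k) = (-1) ^ k * (of_nat (n + k) gchoose k)"
   by (subst gbinomial_minus) (simp add: add.commute)
  moreover have "(- u) ^ k = (-1) ^ k * u ^ k" by (simp add: power_minus[of u])
  moreover have "(-1) ^ k * (-1) ^ k = (1::complex)" by (simp flip: power_mult_distrib)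
  ultimately show ?thesis by (metis perm binomial_gbinomial mult_1)
 qed
 moreover have "(1 + - u) powr (- of_nat (n + 1)) = 1 / (1 - u) ^ (n + 1)"
  using nz unfolding powr_minus by (subst powr_nat') (auto simp: divide_inverse)
 ultimately show ?thesis by simp
qed

text \<open>Binomial coefficients are at most 2^(n+k), so the tail is geometric with ratio 2 |u| <=
  1/2.\<close>

lemma negative_binomial_remainder:
 fixes u :: complex
 assumes u: "cmod u \<le> 1 / 4"
 shows "cmod (1 / (1 - u) ^ (n + 1) - (\<Sum>k<q. of_nat ((n + k) choose k) * u ^ k)) \<le> 2 ^ (n + 1) * (2 * cmod u) ^ q"
proof -
 define a where "a k = of_nat ((n + k) choose k) * u ^ k" for k
 have s: "a sums (1 / (1 - u) ^ (n + 1))" unfolding a_def using u by (intro negative_binomial_sums) auto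
 have "(\<lambda>k. a (k + q)) sums (1 / (1 - u) ^ (n + 1) - (\<Sum>k<q. a k))"
  by (rule sums_split_initial_segment[OF s])
 then have e: "1 / (1 - u) ^ (n + 1) - (\<Sum>k<q. a k) = (\<Sum>k. a (k + q))" by (simp add: sums_iff)
 have b: "cmod (a (k + q)) \<le> 2 ^ n * (2 * cmod u) ^ q * (1 / 2) ^ k" for k
 proof -
  have "cmod (a (k + q)) = real ((n + (k + q)) choose (k + q)) * cmod u ^ (k + q)"
   by (simp add: a_def norm_mult norm_power)
  also have "\<dots> \<le> 2 ^ (n + (k + q)) * cmod u ^ (k + q)"
   by (intro mult_right_mono choose_le_power2) auto
  also have "\<dots> = 2 ^ n * (2 * cmod u) ^ q * (2 * cmod u) ^ k" by (simp add: power_add power_mult_distrib mult_ac)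
  also have "\<dots> \<le> 2 ^ n * (2 * cmod u) ^ q * (1 / 2) ^ k"
   using u by (intro mult_left_mono power_mono) auto
  finally show ?thesis .
 qed
 have "cmod (\<Sum>k. a (k + q)) \<le> (\<Sum>k. 2 ^ n * (2 * cmod u) ^ q * (1 / 2) ^ k)"
  by (rule norm_suminf_le[OF b]) (auto intro!: summable_mult summable_geometric)
 also have "\<dots> = 2 ^ n * (2 * cmod u) ^ q * 2" by (subst suminf_mult) (auto simp: suminf_geometric)
 finally have "cmod (1 / (1 - u) ^ (n + 1) - (\<Sum>k<q. a k)) \<le> 2 ^ n * (2 * cmod u) ^ q * 2" unfolding e .
 then show ?thesis unfolding a_def by (simp add: mult_ac)
qed

text \<open>On the small circle |w - c| = s expand (w - z)^(-(n+1)) in powers of (w - c)/(z - c).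
  The residue becomes a polynomial in 1/(z - c), whose coefficients are residues of f(w) (w - c)^k,
  up to a tail that is exponentially small in q.\<close>

lemma residue_approx:
 fixes f :: "complex \<Rightarrow> complex"
 assumes f: "f holomorphic_on ball c R - {c}" and s: "0 < s" "s < R" "4 * s \<le> cmod (z - c)"
  and M: "\<And>w. cmod (w - c) = s \<Longrightarrow> cmod (f w) \<le> M"
 shows "cmod ((z - c) ^ (n + 1) * residue (\<lambda>w. f w / (w - z) ^ (n + 1)) c
      - (-1) ^ (n + 1) * (\<Sum>k<q. of_nat ((n + k) choose k) * residue (\<lambda>w. f w * (w - c) ^ k) c * (1 / (z - c)) ^ k))
     \<le> s * M * (2 ^ (n + 1) * (2 * s / cmod (z - c)) ^ q)"
proof -
 define x where "x = z - c"
 have x0: "x \<noteq> 0" "cmod x \<ge> 4 * s" using s by (auto simp: x_def)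
 define R' where "R' = min R (cmod x)"
 have R': "s < R'" using s x0 by (auto simp: R'_def x_def)
 have sub: "ball c R' \<subseteq> ball c R" by (auto simp: R'_def)
 have zn: "w \<noteq> z" if "w \<in> ball c R'" for w using that by (auto simp: R'_def dist_norm x_def norm_minus_commute)
 have f': "f holomorphic_on ball c R' - {c}" by (rule holomorphic_on_subset[OF f]) (use sub in auto)
 have cb: "cball c s \<subseteq> ball c R'" using R' by auto
 have A: "((\<lambda>w. f w / (w - z) ^ (n + 1)) has_contour_integral 2 * pi * \<i> * residue (\<lambda>w. f w / (w - z) ^ (n + 1)) c) (circlepath c s)"
  by (rule base_residue[OF open_ball _ s(1) _ cb]) (use zn R' s in \<open>auto intro!: holomorphic_intros f'\<close>)
 have Bk: "((\<lambda>w. f w * (w - c) ^ k) has_contour_integral 2 * pi * \<i> * residue (\<lambda>w. f w * (w - c) ^ k) c) (circlepath c s)" for k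
  by (rule base_residue[OF open_ball _ s(1) _ cb]) (use R' s in \<open>auto intro!: holomorphic_intros f'\<close>)
 define g where "g w = x ^ (n + 1) * (f w / (w - z) ^ (n + 1))
   - (\<Sum>k<q. (-1) ^ (n + 1) * of_nat ((n + k) choose k) * (1 / x) ^ k * (f w * (w - c) ^ k))" for w
 define I where "I = x ^ (n + 1) * (2 * pi * \<i> * residue (\<lambda>w. f w / (w - z) ^ (n + 1)) c)
   - (\<Sum>k<q. (-1) ^ (n + 1) * of_nat ((n + k) choose k) * (1 / x) ^ k * (2 * pi * \<i> * residue (\<lambda>w. f w * (w - c) ^ k) c))"
 have gI: "(g has_contour_integral I) (circlepath c s)"
  unfolding g_def I_def
  by (intro has_contour_integral_diff has_contour_integral_lmul A has_contour_integral_sum Bk) auto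
 have bound: "cmod (g w) \<le> M * (2 ^ (n + 1) * (2 * s / cmod x) ^ q)" if w: "cmod (w - c) = s" for w
 proof -
  define u where "u = (w - c) / x"
  have cu: "cmod u = s / cmod x" using w by (simp add: u_def norm_divide)
  have u4: "cmod u \<le> 1 / 4" using x0 s by (simp add: cu field_simps)
  have u1: "1 - u \<noteq> 0" using u4 by auto
  have "w - z = - x * (1 - u)" using x0 by (simp add: u_def x_def field_simps)
  then have "x ^ (n + 1) / (w - z) ^ (n + 1) = (x / (- x * (1 - u))) ^ (n + 1)" by (simp only: power_divide)
  also have "x / (- x * (1 - u)) = (-1) * (1 / (1 - u))" using x0 u1 by (simp add: field_simps)
  also have "((-1) * (1 / (1 - u))) ^ (n + 1) = (-1) ^ (n + 1) * (1 / (1 - u) ^ (n + 1))"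
   by (simp only: power_mult_distrib power_one_over)
  finally have e1: "x ^ (n + 1) / (w - z) ^ (n + 1) = (-1) ^ (n + 1) * (1 / (1 - u) ^ (n + 1))" .
  have "(1 / x) ^ k * (w - c) ^ k = u ^ k" for k by (simp add: u_def power_divide)
  then have pk: "(1 / x) ^ k * (f w * (w - c) ^ k) = f w * u ^ k" for k by (metis mult.left_commute)
  have "(\<Sum>k<q. (-1) ^ (n + 1) * of_nat ((n + k) choose k) * (1 / x) ^ k * (f w * (w - c) ^ k))
   = (\<Sum>k<q. (f w * (-1) ^ (n + 1)) * (of_nat ((n + k) choose k) * u ^ k))"
   by (intro sum.cong refl) (simp only: mult.assoc pk, simp only: mult_ac)
  also have "\<dots> = (f w * (-1) ^ (n + 1)) * (\<Sum>k<q. of_nat ((n + k) choose k) * u ^ k)"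
   by (rule sum_distrib_left[symmetric])
  finally have s1: "(\<Sum>k<q. (-1) ^ (n + 1) * of_nat ((n + k) choose k) * (1 / x) ^ k * (f w * (w - c) ^ k))
   = (f w * (-1) ^ (n + 1)) * (\<Sum>k<q. of_nat ((n + k) choose k) * u ^ k)" .
  have "x ^ (n + 1) * (f w / (w - z) ^ (n + 1)) = f w * (x ^ (n + 1) / (w - z) ^ (n + 1))" by simp
  then have s2: "x ^ (n + 1) * (f w / (w - z) ^ (n + 1)) = (f w * (-1) ^ (n + 1)) * (1 / (1 - u) ^ (n + 1))"
   unfolding e1 by (simp only: mult.assoc)
  have "g w = f w * ((-1) ^ (n + 1) * (1 / (1 - u) ^ (n + 1) - (\<Sum>k<q. of_nat ((n + k) choose k) * u ^ k)))"
   unfolding g_def s1 s2 by (simp only: right_diff_distrib mult.assoc)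
  then have "cmod (g w) = cmod (f w) * cmod (1 / (1 - u) ^ (n + 1) - (\<Sum>k<q. of_nat ((n + k) choose k) * u ^ k))"
   by (simp only: norm_mult norm_power norm_minus_cancel norm_one power_one mult_1)
  also have "\<dots> \<le> M * (2 ^ (n + 1) * (2 * cmod u) ^ q)"
   using M[OF w] negative_binomial_remainder[OF u4] order_trans[OF norm_ge_zero M[OF w]]
   by (intro mult_mono) auto
  finally show ?thesis by (simp add: cu)
 qed
 have "cmod (f (c + of_real s)) \<le> M" by (rule M) (use s in simp)
 then have M0: "0 \<le> M" using norm_ge_zero order_trans by blast
 define X where "X = x ^ (n + 1) * residue (\<lambda>w. f w / (w - z) ^ (n + 1)) c
      - (-1) ^ (n + 1) * (\<Sum>k<q. of_nat ((n + k) choose k) * residue (\<lambda>w. f w * (w - c) ^ k) c * (1 / x) ^ k)"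
 have "cmod I \<le> (M * (2 ^ (n + 1) * (2 * s / cmod x) ^ q)) * (2 * pi * s)"
  using M0 s by (intro has_contour_integral_bound_circlepath[OF gI] bound) auto
 moreover have "I = (2 * pi * \<i>) * X"
 proof -
  have "(\<Sum>k<q. (-1) ^ (n + 1) * of_nat ((n + k) choose k) * (1 / x) ^ k * (2 * pi * \<i> * residue (\<lambda>w. f w * (w - c) ^ k) c))
   = (\<Sum>k<q. (2 * pi * \<i> * (-1) ^ (n + 1)) * (of_nat ((n + k) choose k) * residue (\<lambda>w. f w * (w - c) ^ k) c * (1 / x) ^ k))"
   by (intro sum.cong refl) (simp only: mult_ac)
  also have "\<dots> = (2 * pi * \<i> * (-1) ^ (n + 1)) * (\<Sum>k<q. of_nat ((n + k) choose k) * residue (\<lambda>w. f w * (w - c) ^ k) c * (1 / x) ^ k)"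
   by (rule sum_distrib_left[symmetric])
  finally show ?thesis unfolding I_def X_def by (simp only: right_diff_distrib mult_ac)
 qed
 then have "cmod I = 2 * pi * cmod X" by (simp add: norm_mult)
 ultimately have "(2 * pi) * cmod X \<le> (2 * pi) * (s * M * (2 ^ (n + 1) * (2 * s / cmod x) ^ q))"
  by (simp only: mult_ac)
 then have "cmod X \<le> s * M * (2 ^ (n + 1) * (2 * s / cmod x) ^ q)"
  by (rule mult_left_le_imp_le) simp
 then show ?thesis unfolding X_def x_def .
qed

text \<open>All these residues vanish exactly when there is no principal part. In the residue
  theorem for f(u)/(u - w) on a circle about c and w, the residue at c is the limit of the
  truncations in \<open>residue_approx\<close> with n = 0, which are all 0. What remains is Cauchy's
  formula, and its right-hand side is holomorphic at c.\<close>

lemma removable_if_residues_vanish: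
 fixes f :: "complex \<Rightarrow> complex"
 assumes f: "f holomorphic_on ball c R - {c}" and R: "R > 0"
  and res: "\<And>k. residue (\<lambda>w. f w * (w - c) ^ k) c = 0"
 shows "\<exists>g. g holomorphic_on ball c (R / 2) \<and> (\<forall>w\<in>ball c (R / 2) - {c}. f w = g w)"
proof -
 define C where "C = circlepath c (R / 2)"
 have pi_C: "path_image C = sphere c (R / 2)" using R by (simp add: C_def)
 have fc: "continuous_on (path_image C) f"
  using holomorphic_on_imp_continuous_on[OF f] by (rule continuous_on_subset) (use R pi_C in auto)
 define G where "G w = contour_integral C (\<lambda>u. f u / (u - w) ^ 1)" for w
 have int: "((\<lambda>u. f u / (u - w) ^ 1) has_contour_integral G w) C" if w: "w \<in> ball c (R / 2)" for w
 proof -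
  have "continuous_on (path_image C) (\<lambda>u. f u / (u - w) ^ 1)"
   by (intro continuous_intros fc) (use w pi_C in auto)
  then show ?thesis unfolding G_def C_def
   by (intro has_contour_integral_integral contour_integrable_continuous_circlepath)
     (use R in \<open>auto simp: C_def\<close>)
 qed
 have "G holomorphic_on ball c (R / 2)"
 proof -
  have "\<exists>D. (G has_field_derivative D) (at w)" if w: "w \<in> ball c (R / 2)" for w
   using Cauchy_next_derivative_circlepath(2)[of c "R / 2" f 1 G w] fc int w by (auto simp: C_def)
  then show ?thesis by (subst holomorphic_on_open) auto
 qed
 then have "(\<lambda>w. G w / (2 * pi * \<i>)) holomorphic_on ball c (R / 2)" by (intro holomorphic_intros) auto
 moreover have "f w = G w / (2 * pi * \<i>)" if w: "w \<in> ball c (R / 2) - {c}" for w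
 proof -
  define x where "x = cmod (w - c)"
  have x: "x > 0" "x < R / 2" using w by (auto simp: x_def dist_norm norm_minus_commute)
  define s where "s = x / 4"
  have s: "0 < s" "s < R" "4 * s \<le> x" using x R by (auto simp: s_def)
  have "compact (f ` sphere c s)"
   by (intro compact_continuous_image continuous_on_subset[OF holomorphic_on_imp_continuous_on[OF f]])
     (use s in auto)
  then obtain M where M: "\<And>v. v \<in> sphere c s \<Longrightarrow> cmod (f v) \<le> M"
   using compact_imp_bounded bounded_iff by (metis image_eqI)
  define I where "I = residue (\<lambda>v. f v / (v - w) ^ (0 + 1)) c"
  have le: "cmod ((w - c) * I) \<le> s * M * (2 * (2 * s / x) ^ q)" for q
   using residue_approx[OF f s(1,2), of w M 0 q] s(3) M res
   by (auto simp: x_def I_def dist_norm norm_minus_commute)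
  have "(\<lambda>q. s * M * (2 * (2 * s / x) ^ q)) \<longlonglongrightarrow> s * M * (2 * 0)"
   using x by (intro tendsto_intros LIMSEQ_power_zero) (auto simp: s_def)
  then have "cmod ((w - c) * I) \<le> 0"
   by (intro LIMSEQ_le_const[of _ _ "cmod ((w - c) * I)"]) (use le in auto)
  then have I0: "I = 0" using x by (auto simp: x_def)
  have "contour_integral C (\<lambda>u. f u / (u - w) ^ 1) = 2 * pi * \<i> *
    (\<Sum>p\<in>{c, w}. winding_number C p * residue (\<lambda>u. f u / (u - w) ^ 1) p)"
   unfolding C_def
  proof (rule Residue_theorem[of "ball c R"])
   show "(\<lambda>u. f u / (u - w) ^ 1) holomorphic_on ball c R - {c, w}"
    by (intro holomorphic_intros holomorphic_on_subset[OF f]) auto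
   show "\<forall>z. z \<notin> ball c R \<longrightarrow> winding_number (circlepath c (R / 2)) z = 0"
    using R by (auto intro!: winding_number_zero_outside[of _ "cball c (R / 2)"])
   show "path_image (circlepath c (R / 2)) \<subseteq> ball c R - {c, w}"
    using R w by (auto simp: dist_norm norm_minus_commute)
  qed (use R w x in \<open>auto simp: x_def dist_norm norm_minus_commute\<close>)
  moreover have "winding_number C p = 1" if "p \<in> {c, w}" for p
   unfolding C_def using that x R by (intro winding_number_circlepath) (auto simp: x_def)
  moreover have "residue (\<lambda>u. f u / (u - w) ^ Suc 0) w = f w"
  proof -
   have "residue (\<lambda>u. f u / (u - w) ^ Suc 0) w = (deriv ^^ 0) f w / fact 0"
    by (rule residue_holomorphic_over_power[of "ball c R - {c}"]) (use f w x R in \<open>auto simp: x_def dist_norm norm_minus_commute\<close>)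
   then show ?thesis by simp
  qed
  moreover have "c \<noteq> w" using w by auto
  ultimately have "G w = 2 * pi * \<i> * f w" using I0 by (simp add: G_def I_def)
  then show ?thesis by simp
 qed
 ultimately show ?thesis by blast
qed

section \<open>Counting zeros in a disc by contour integrals\<close>

lemma poly_holomorphic: "poly p holomorphic_on (A :: complex set)"
proof -
 have "(\<lambda>z. poly p z) holomorphic_on A" by (intro holomorphic_intros)
 then show ?thesis by simp
qed

definition disc_count :: "complex \<Rightarrow> real \<Rightarrow> complex poly \<Rightarrow> nat" where
 "disc_count c rho p = (\<Sum>zeta | poly p zeta = 0 \<and> cmod (zeta - c) < rho. order zeta p)"

lemma disc_count_mult:
 assumes "p \<noteq> 0" "q \<noteq> 0"
 shows "disc_count c rho (p * q) = disc_count c rho p + disc_count c rho q"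
proof -
 define A where "A = {zeta. poly (p * q) zeta = 0 \<and> cmod (zeta - c) < rho}"
 have pq: "p * q \<noteq> 0" using assms by simp
 have fin: "finite A" unfolding A_def using poly_roots_finite[OF pq] by (rule rev_finite_subset) auto
 have e: "disc_count c rho u = (\<Sum>zeta\<in>A. order zeta u)" if "u dvd p * q" "u \<noteq> 0" for u
  unfolding disc_count_def
 proof (rule sum.mono_neutral_left[OF fin])
  obtain k where k: "p * q = u * k" using \<open>u dvd p * q\<close> by (elim dvdE)
  have "poly (p * q) zeta = 0" if "poly u zeta = 0" for zeta unfolding k using that by simp
  then show "{zeta. poly u zeta = 0 \<and> cmod (zeta - c) < rho} \<subseteq> A" by (auto simp: A_def simp del: poly_mult)
  show "\<forall>i\<in>A - {zeta. poly u zeta = 0 \<and> cmod (zeta - c) < rho}. order i u = 0"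
  proof
   fix i assume "i \<in> A - {zeta. poly u zeta = 0 \<and> cmod (zeta - c) < rho}"
   then have "poly u i \<noteq> 0" by (auto simp: A_def)
   then show "order i u = 0" by (rule order_0I)
  qed
 qed
 show ?thesis
  using e[of "p * q"] e[of p] e[of q] assms pq by (simp add: order_mult[OF pq] sum.distrib)
qed

lemma disc_count_power: "p \<noteq> 0 \<Longrightarrow> disc_count c rho (p ^ n) = n * disc_count c rho p"
 by (induction n) (auto simp: disc_count_mult disc_count_def[of c rho 1])

lemma disc_count_le_degree:
 assumes "p \<noteq> 0" shows "disc_count c rho p \<le> degree p"
proof -
 have "disc_count c rho p \<le> (\<Sum>zeta | poly p zeta = 0. order zeta p)"
  unfolding disc_count_def by (intro sum_mono2 poly_roots_finite assms) auto
 also have "\<dots> = degree p"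
 proof -
  have "degree p = degree (\<Prod>a | poly p a = 0. [:- a, 1:] ^ order a p)"
   using assms by (subst complex_poly_decompose[of p, symmetric]) (simp del: )
  also have "\<dots> = (\<Sum>zeta | poly p zeta = 0. order zeta p)"
   by (subst degree_prod_eq_sum_degree) (auto simp: degree_power_eq)
  finally show ?thesis by simp
 qed
 finally show ?thesis .
qed

lemma disc_count_mono: "p \<noteq> 0 \<Longrightarrow> rho \<le> rho' \<Longrightarrow> disc_count c rho p \<le> disc_count c rho' p"
 unfolding disc_count_def by (intro sum_mono2 finite_subset[OF _ poly_roots_finite[of p]]) auto

lemma disc_count_linear: "rho > 0 \<Longrightarrow> disc_count c rho [:- c, 1:] = 1"
proof -
 assume r: "rho > 0"
 have "{zeta. poly [:- c, 1:] zeta = 0 \<and> cmod (zeta - c) < rho} = {c}" using r by auto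
 then show ?thesis using order_power_n_n[of c 1] by (simp add: disc_count_def)
qed

lemma log_deriv_integral_poly:
 assumes p: "p \<noteq> 0" and r: "rho > 0" and nz: "\<And>z. cmod (z - c) = rho \<Longrightarrow> poly p z \<noteq> 0"
 shows "contour_integral (circlepath c rho) (\<lambda>z. poly (pderiv p) z / poly p z) = 2 * pi * \<i> * of_nat (disc_count c rho p)"
proof -
 define A where "A = {z. poly p z = 0}"
 have fin: "finite A" using p by (simp add: A_def poly_roots_finite)
 have holo_poly: "poly p holomorphic_on UNIV" by (rule poly_holomorphic)
 have dp: "deriv (poly p) = poly (pderiv p)" by (rule ext) (rule DERIV_imp_deriv[OF poly_DERIV])
 have "contour_integral (circlepath c rho) (\<lambda>z. deriv (poly p) z * 1 / poly p z) =
  2 * pi * \<i> * (\<Sum>w\<in>{w \<in> UNIV. poly p w = 0 \<or> w \<in> {}}. winding_number (circlepath c rho) w * 1 * of_int (zorder (poly p) w))"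
  by (rule argument_principle[where S = UNIV and poles = "{}" and h = "\<lambda>_. 1"])
    (use fin nz r in \<open>auto simp: A_def dist_norm norm_minus_commute holo_poly\<close>)
 also have "(\<Sum>w\<in>{w \<in> UNIV. poly p w = 0 \<or> w \<in> {}}. winding_number (circlepath c rho) w * 1 * of_int (zorder (poly p) w))
   = (\<Sum>w\<in>A. if cmod (w - c) < rho then of_nat (order w p) else (0::complex))"
 proof (intro sum.cong)
  fix w assume w: "w \<in> A"
  have z: "zorder (poly p) w = int (order w p)"
  proof -
   obtain q where q: "p = [:- w, 1:] ^ order w p * q" "\<not> [:- w, 1:] dvd q" using order_decomp[OF p, of w] by blast
   show ?thesis
   proof (rule zorder_eqI[OF open_UNIV UNIV_I, of "poly q"])
    show "poly q w \<noteq> 0" using q(2) by (simp add: poly_eq_0_iff_dvd)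
    show "poly p z = poly q z * (z - w) powi int (order w p)" for z
     by (subst q(1)) (simp add: power_int_def mult.commute)
    show "poly q holomorphic_on UNIV" by (rule poly_holomorphic)
   qed
  qed
  show "winding_number (circlepath c rho) w * 1 * of_int (zorder (poly p) w) = (if cmod (w - c) < rho then of_nat (order w p) else 0)"
  proof (cases "cmod (w - c) < rho")
   case False
   then have "cmod (w - c) > rho" using nz[of w] w by (auto simp: A_def less_le)
   then have "winding_number (circlepath c rho) w = 0"
    using r by (intro winding_number_zero_outside[of _ "cball c rho"]) (auto simp: dist_norm norm_minus_commute)
   then show ?thesis using False by simp
  qed (simp add: winding_number_circlepath z)
 qed (auto simp: A_def)
 also have "\<dots> = of_nat (disc_count c rho p)"
  unfolding disc_count_def of_nat_sum
  by (subst sum.inter_filter[symmetric, OF fin]) (auto simp: A_def intro!: sum.cong)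
 finally show ?thesis by (simp add: dp)
qed

text \<open>The values stay in the disc of radius 1 about 1, where \<open>Ln\<close> is holomorphic;
  so \<open>Ln (h z)\<close> is a primitive along the circle.\<close>

lemma log_deriv_integral_near_1:
 assumes S: "open S" "sphere c rho \<subseteq> S" and h: "h holomorphic_on S" and r: "rho > 0"
  and n: "\<And>z. z \<in> sphere c rho \<Longrightarrow> cmod (h z - 1) < 1"
 shows "((\<lambda>z. deriv h z / h z) has_contour_integral 0) (circlepath c rho)"
proof -
 define S' where "S' = S \<inter> h -` ball 1 1"
 have oS': "open S'" unfolding S'_def
  using continuous_open_preimage[OF holomorphic_on_imp_continuous_on[OF h] S(1) open_ball] .
 have sub: "sphere c rho \<subseteq> S'" using S n by (auto simp: S'_def dist_norm norm_minus_commute)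
 have "((\<lambda>z. deriv h z / h z) has_contour_integral (Ln (h (pathfinish (circlepath c rho))) - Ln (h (pathstart (circlepath c rho))))) (circlepath c rho)"
 proof (rule contour_integral_primitive[of S' "\<lambda>z. Ln (h z)" "\<lambda>z. deriv h z / h z"])
  fix z assume z: "z \<in> S'"
  have "Re (h z) > 0"
  proof -
   have "cmod (h z - 1) < 1" using z by (auto simp: S'_def dist_norm norm_minus_commute)
   then have "\<bar>Re (h z - 1)\<bar> < 1" using abs_Re_le_cmod[of "h z - 1"] by linarith
   then show ?thesis by simp
  qed
  then have "h z \<notin> \<real>\<^sub>\<le>\<^sub>0" by (auto simp: complex_nonpos_Reals_iff)
  moreover have "(h has_field_derivative deriv h z) (at z)"
   using z by (intro holomorphic_derivI[OF h S(1)]) (auto simp: S'_def)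
  ultimately have "((\<lambda>z. Ln (h z)) has_field_derivative deriv h z / h z) (at z)"
   by (auto intro!: derivative_eq_intros simp: divide_inverse mult.commute)
  then show "((\<lambda>z. Ln (h z)) has_field_derivative deriv h z / h z) (at z within S')"
   by (rule has_field_derivative_at_within)
 qed (use sub r in auto)
 then show ?thesis by simp
qed

lemma order_factor:
 fixes p :: "complex poly"
 assumes "p \<noteq> 0"
 obtains q where "p = [:- a, 1:] ^ order a p * q" "poly q a \<noteq> 0"
 using order_decomp[OF assms, of a] by (auto simp: poly_eq_0_iff_dvd)

text \<open>p'/p has at most a simple pole. Used for the logarithmic derivatives of
  \<open>PT P T\<close> and \<open>Q\<close> in \<open>Lam\<close>.\<close>

lemma log_deriv_mult_square_tendsto_0:
 fixes p :: "complex poly"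
 assumes "p \<noteq> 0"
 shows "((\<lambda>z. (z - a) ^ 2 * (poly (pderiv p) z / poly p z)) \<longlongrightarrow> 0) (at a)"
proof -
 obtain q where q: "p = [:- a, 1:] ^ order a p * q" "poly q a \<noteq> 0" using order_factor[OF assms] .
 define k where "k = order a p"
 have ev: "\<forall>\<^sub>F z in at a. (z - a) * (of_nat k + (z - a) * (poly (pderiv q) z / poly q z)) = (z - a) ^ 2 * (poly (pderiv p) z / poly p z)"
 proof -
  have "isCont (poly q) a" by simp
  then have "\<forall>\<^sub>F z in at a. poly q z \<noteq> 0"
   using q(2) by (metis isCont_def tendsto_imp_eventually_ne)
  moreover have "\<forall>\<^sub>F z in at a. z \<noteq> a" by (simp add: eventually_at_filter)
  ultimately show ?thesis
  proof eventually_elim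
   case (elim z)
   define x where "x = z - a"
   have x: "x \<noteq> 0" using elim by (simp add: x_def)
   have pz: "poly p z = x ^ k * poly q z" by (subst q(1)) (simp add: k_def x_def)
   have "pderiv p = [:- a, 1:] ^ k * pderiv q + pderiv ([:- a, 1:] ^ k) * q"
    by (subst q(1)) (simp add: pderiv_mult k_def)
   moreover have "poly (pderiv ([:- a, 1:] ^ k)) z = of_nat k * x ^ (k - 1)"
    by (simp add: pderiv_power pderiv_pCons x_def)
   ultimately have dz: "poly (pderiv p) z = x ^ k * poly (pderiv q) z + of_nat k * x ^ (k - 1) * poly q z"
    by (simp add: x_def)
   have "x * (of_nat k + x * (poly (pderiv q) z / poly q z)) * poly p z = x ^ 2 * poly (pderiv p) z"
   proof (cases k)
    case 0
    then show ?thesis using elim unfolding pz dz by (simp add: power2_eq_square)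
   next
    case (Suc j)
    then show ?thesis using elim unfolding pz dz by (simp add: power2_eq_square field_simps)
   qed
   moreover have "poly p z \<noteq> 0" using pz x elim by simp
   ultimately show ?case by (simp add: x_def field_simps)
  qed
 qed
 have "((\<lambda>z. (z - a) * (of_nat k + (z - a) * (poly (pderiv q) z / poly q z))) \<longlongrightarrow>
   (a - a) * (of_nat k + (a - a) * (poly (pderiv q) a / poly q a))) (at a)"
  using q(2) by (intro tendsto_intros) auto
 then show ?thesis using Lim_transform_eventually[OF _ ev] by simp
qed

lemma zorder_poly_times:
 fixes p :: "complex poly"
 assumes p: "p \<noteq> 0" and S: "open S" "z \<in> S" and g: "g holomorphic_on S" "g z \<noteq> 0"
  and f: "\<And>w. w \<in> S \<Longrightarrow> f w = g w * poly p w"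
 shows "zorder f z = int (order z p)"
proof -
 obtain q where q: "p = [:- z, 1:] ^ order z p * q" "poly q z \<noteq> 0" using order_factor[OF p] .
 show ?thesis
 proof (rule zorder_eqI[OF S])
  show "(\<lambda>w. g w * poly q w) holomorphic_on S" by (intro holomorphic_intros g)
  show "g z * poly q z \<noteq> 0" using g q by simp
  show "f w = g w * poly q w * (w - z) powi int (order z p)" if "w \<in> S" "w \<noteq> z" for w
   using f[OF that(1)] by (subst (asm) q(1)) (simp add: power_int_def mult_ac)
 qed
qed

section \<open>The polynomials B_n at the pole c of the exponent\<close>

locale hyper_pole =
 fixes P Q S T :: "complex poly" and c :: complex and m :: nat
 assumes data: "hyperexp_data P Q S T" and c: "poly T c = 0" and m: "m = order c T"
begin

abbreviation "Sg \<equiv> sing_set Q T"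
abbreviation "W \<equiv> Wpoly Q T"
abbreviation "U \<equiv> Upoly P Q S T"
abbreviation "B \<equiv> Bpoly P Q S T"
abbreviation "f \<equiv> hyperexp P Q S T"
abbreviation "E \<equiv> expo S T"

lemma nz: "P \<noteq> 0" "Q \<noteq> 0" "T \<noteq> 0" using data by (auto simp: hyperexp_data_def)

lemma m_pos: "m \<ge> 1" using c nz m by (simp add: order_root Suc_le_eq)

lemma finite_Sg: "finite Sg" using nz by (simp add: sing_set_def finite_zeros)

lemma open_compl: "open (- Sg)" using finite_Sg by (simp add: finite_imp_closed open_Compl)

lemma c_in: "c \<in> Sg" using c by (simp add: sing_set_def zeros_def)

lemma T_nz: "z \<notin> Sg \<Longrightarrow> poly T z \<noteq> 0" and Q_nz: "z \<notin> Sg \<Longrightarrow> poly Q z \<noteq> 0"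
 by (auto simp: sing_set_def zeros_def)

lemma PT_nz: "z \<notin> Sg \<Longrightarrow> poly (PT P T) z \<noteq> 0"
 using zeros_PT[OF nz(3), of P] by (auto simp: sing_set_def zeros_def)

lemma W_zero_iff: "poly W z = 0 \<longleftrightarrow> z \<in> Sg"
 using nz by (auto simp: Wpoly_def poly_prod sing_set_def zeros_def finite_zeros[unfolded zeros_def] poly_roots_finite)

lemma W_nonzero: "W \<noteq> 0"
proof
 assume "W = 0"
 then have "Sg = UNIV" using W_zero_iff by auto
 then show False using finite_Sg by (simp add: infinite_UNIV_char_0)
qed

lemma P_factor: "PT P T * Psharp P T = P"
proof -
 have "PT P T dvd (\<Prod>a\<in>zeros T \<union> zeros P. [:- a, 1:] ^ order a P)"
  unfolding PT_def using nz finite_zeros by (intro prod_dvd_prod_subset) blast+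
 also have "(\<Prod>a\<in>zeros T \<union> zeros P. [:- a, 1:] ^ order a P) = (\<Prod>a\<in>zeros P. [:- a, 1:] ^ order a P)"
  using nz finite_zeros by (intro prod.mono_neutral_right) (blast, blast, auto simp: zeros_def order_0I)
 also have "\<dots> dvd smult (lead_coeff P) (\<Prod>a\<in>zeros P. [:- a, 1:] ^ order a P)"
  by (rule dvd_smult) simp
 also have "smult (lead_coeff P) (\<Prod>a\<in>zeros P. [:- a, 1:] ^ order a P) = P"
  unfolding zeros_def by (rule complex_poly_decompose)
 finally show ?thesis by (simp add: Psharp_def)
qed

lemma E_deriv:
 assumes "z \<notin> Sg" shows "(E has_field_derivative deriv E z) (at z)"
proof -
 have "E holomorphic_on - Sg"
  unfolding expo_def[abs_def] using T_nz by (intro holomorphic_intros) auto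
 then show ?thesis using assms open_compl by (intro holomorphic_derivI) auto
qed

lemma E_holomorphic: "E holomorphic_on - Sg"
 unfolding expo_def[abs_def] using T_nz by (intro holomorphic_intros) auto

lemma f_holomorphic: "f holomorphic_on - Sg"
 unfolding hyperexp_def[abs_def] using Q_nz by (intro holomorphic_intros E_holomorphic) auto

text \<open>The factor in f^(n) = R_n B_n, without zeros off the singular set; zeros and
  multiplicities of f^(n) there are those of B_n.\<close>

definition R :: "nat \<Rightarrow> complex \<Rightarrow> complex" where
 "R n z = poly (PT P T) z / (poly Q z * poly W z ^ n) * exp (E z)"

lemma R_holomorphic: "R n holomorphic_on - Sg"
 unfolding R_def using Q_nz W_zero_iff by (intro holomorphic_intros E_holomorphic) auto

lemma R_nz: "z \<notin> Sg \<Longrightarrow> R n z \<noteq> 0"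
 using Q_nz W_zero_iff PT_nz by (simp add: R_def)

lemma higher_deriv_f: "z \<notin> Sg \<Longrightarrow> (deriv ^^ n) f z = R n z * poly (B n) z"
proof (induction n arbitrary: z)
 case 0
 have "poly P z = poly (PT P T) z * poly (Psharp P T) z" by (subst P_factor[symmetric]) simp
 then show ?case by (simp add: R_def hyperexp_def)
next
 case (Suc n)
 note z = Suc.prems
 have nzs: "poly Q z \<noteq> 0" "poly (PT P T) z \<noteq> 0" "poly W z \<noteq> 0" using z Q_nz PT_nz W_zero_iff by auto
 have "((\<lambda>z. R n z * poly (B n) z) has_field_derivative R (Suc n) z * poly (B (Suc n)) z) (at z)"
 proof -
  define pt pt' q q' w w' b b' e' where defs: "pt = poly (PT P T) z" "pt' = poly (pderiv (PT P T)) z" "q = poly Q z"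
   "q' = poly (pderiv Q) z" "w = poly W z" "w' = poly (pderiv W) z" "b = poly (B n) z" "b' = poly (pderiv (B n)) z" "e' = deriv E z"
  have wn: "((\<lambda>z. poly W z ^ n) has_field_derivative of_nat n * w' * w ^ n / w) (at z)"
  proof (cases n)
   case (Suc k)
   have "((\<lambda>z. poly W z ^ n) has_field_derivative of_nat n * (w' * w ^ (n - 1))) (at z)"
    unfolding defs by (rule DERIV_power[THEN DERIV_cong]) (auto intro!: poly_DERIV)
   then show ?thesis using nzs Suc by (simp add: defs)
  qed auto
  have "((\<lambda>z. R n z * poly (B n) z) has_field_derivative
    (((pt' * (q * w ^ n) - pt * (q' * w ^ n + of_nat n * w' * w ^ n / w * q)) / ((q * w ^ n) * (q * w ^ n)) * exp (E z)
     + exp (E z) * e' * (pt / (q * w ^ n))) * b + b' * (pt / (q * w ^ n) * exp (E z)))) (at z)"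
   unfolding R_def defs using nzs
   by (intro DERIV_mult DERIV_divide poly_DERIV wn[unfolded defs] DERIV_fun_exp E_deriv z) auto
  also have "((pt' * (q * w ^ n) - pt * (q' * w ^ n + of_nat n * w' * w ^ n / w * q)) / ((q * w ^ n) * (q * w ^ n)) * exp (E z)
     + exp (E z) * e' * (pt / (q * w ^ n))) * b + b' * (pt / (q * w ^ n) * exp (E z))
    = pt / (q * (w * w ^ n)) * exp (E z) * (w * b' + (w * (e' + pt' / pt - q' / q) - of_nat n * w') * b)"
  proof -
   define wn where "wn = w ^ n"
   have "q \<noteq> 0" "pt \<noteq> 0" "w \<noteq> 0" "wn \<noteq> 0" using nzs by (auto simp: defs wn_def)
   note nzz = this
   define A where "A = pt / (q * wn)"
   define X where "X = exp (E z)"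
   have h1: "(pt' * (q * wn) - pt * (q' * wn + of_nat n * w' * wn / w * q)) / ((q * wn) * (q * wn))
     = A * (pt' / pt - q' / q - of_nat n * w' / w)"
    unfolding A_def using nzz by (simp add: field_simps)
   have h2: "pt / (q * (w * wn)) = A / w" unfolding A_def by simp
   have h3: "w * (e' + pt' / pt - q' / q) - of_nat n * w' = w * (e' + (pt' / pt - q' / q - of_nat n * w' / w))"
    using nzz by (simp add: algebra_simps)
   show ?thesis
    unfolding wn_def[symmetric] X_def[symmetric] h1 h2 h3 A_def[symmetric]
    using nzz(3) by (simp add: algebra_simps)
  qed
  also have "w * (e' + pt' / pt - q' / q) = poly U z"
   using poly_Upoly[OF nz(3,2) z] by (simp add: Lam_def defs)
  finally show ?thesis by (simp add: R_def defs)
 qed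
 moreover have "deriv ((deriv ^^ n) f) z = deriv (\<lambda>z. R n z * poly (B n) z) z"
 proof (rule deriv_cong_ev)
  have "\<forall>\<^sub>F x in nhds z. x \<in> - Sg" using open_compl z by (intro eventually_nhds_in_open) auto
  then show "\<forall>\<^sub>F x in nhds z. (deriv ^^ n) f x = R n x * poly (B n) x"
   by eventually_elim (rule Suc.IH, simp)
 qed simp
 ultimately show ?case by (simp add: DERIV_imp_deriv)
qed

definition Wt :: "complex poly" where "Wt = (\<Prod>a\<in>zeros T - {c}. [:- a, 1:] ^ (order a T + 1)) * (\<Prod>b\<in>zeros Q - zeros T. [:- b, 1:])"

lemma W_factor: "W = [:- c, 1:] ^ (m + 1) * Wt"
proof -
 have "(\<Prod>a\<in>zeros T. [:- a, 1:] ^ (order a T + 1)) = [:- c, 1:] ^ (m + 1) * (\<Prod>a\<in>zeros T - {c}. [:- a, 1:] ^ (order a T + 1))"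
  using c nz by (subst prod.remove[of _ c]) (auto simp: finite_zeros m zeros_def poly_roots_finite)
 then show ?thesis by (simp only: Wpoly_def Wt_def mult.assoc)
qed

lemma poly_W: "poly W z = (z - c) ^ (m + 1) * poly Wt z"
 unfolding W_factor poly_mult poly_power by simp

lemma Wt_nz: "z \<notin> Sg - {c} \<Longrightarrow> poly Wt z \<noteq> 0"
 using nz c by (auto simp: Wt_def poly_prod sing_set_def zeros_def finite_zeros[unfolded zeros_def] poly_roots_finite)

definition T1 :: "complex poly" where "T1 = (SOME q. T = [:- c, 1:] ^ m * q \<and> poly q c \<noteq> 0)"

lemma T1: "T = [:- c, 1:] ^ m * T1" "poly T1 c \<noteq> 0"
proof -
 have "\<exists>q. T = [:- c, 1:] ^ m * q \<and> poly q c \<noteq> 0" using order_factor[OF nz(3), of c] m by metis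
 from someI_ex[OF this] show "T = [:- c, 1:] ^ m * T1" "poly T1 c \<noteq> 0" by (auto simp: T1_def)
qed

lemma poly_T: "poly T z = (z - c) ^ m * poly T1 z"
 by (subst T1(1)) (simp only: poly_mult poly_power, simp)

definition s :: "complex \<Rightarrow> complex" where "s z = poly S z / poly T1 z"

text \<open>The top coefficient of the principal part of the exponent, because E = s / (z - c)^m
  with \<open>s\<close> holomorphic at c.\<close>

definition lamc :: complex where "lamc = s c"

lemma E_eq: "E z = s z / (z - c) ^ m"
 by (simp add: expo_def s_def poly_T mult.commute)

lemma lamc_nz: "lamc \<noteq> 0"
proof -
 have "coprime S T" using data by (simp add: hyperexp_data_def)
 then have "\<not> (poly S c = 0 \<and> poly T c = 0)" using coprime_poly_0[of S T c] by auto
 then show ?thesis using c T1 by (simp add: lamc_def s_def)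
qed

lemma T1_nz: "z \<notin> zeros T - {c} \<Longrightarrow> poly T1 z \<noteq> 0"
 using poly_T[of z] T1(2) by (cases "z = c") (auto simp: zeros_def)

lemma s_holomorphic: "s holomorphic_on - (Sg - {c})"
 unfolding s_def using T1_nz by (intro holomorphic_intros) (auto simp: sing_set_def)

lemma open_compl': "open (- (Sg - {c}))"
 by (intro open_Compl finite_imp_closed finite_Diff finite_Sg)

text \<open>W E' tends to -m lamc Wt(c), while W P_T'/P_T and W Q'/Q tend to 0, a zero of order m +
  1 >= 2 against at most a simple pole.\<close>

lemma U_c: "poly U c = - of_nat m * lamc * poly Wt c"
proof (rule tendsto_unique)
 show "(poly U \<longlongrightarrow> poly U c) (at c)" by (intro tendsto_intros)
 define G where "G z = poly Wt z * (- of_nat m * s z + (z - c) * deriv s z)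
   + (z - c) ^ (m - 1) * poly Wt z * ((z - c) ^ 2 * (poly (pderiv (PT P T)) z / poly (PT P T) z))
   - (z - c) ^ (m - 1) * poly Wt z * ((z - c) ^ 2 * (poly (pderiv Q) z / poly Q z))" for z
 have ds: "deriv s holomorphic_on - (Sg - {c})" using s_holomorphic open_compl' by (intro holomorphic_deriv)
 have cont: "isCont s c" "isCont (deriv s) c"
  using holomorphic_on_imp_continuous_on[OF ds] holomorphic_on_imp_continuous_on[OF s_holomorphic] open_compl'
  by (auto simp: continuous_on_eq_continuous_at)
 have "(G \<longlongrightarrow> poly Wt c * (- of_nat m * s c + (c - c) * deriv s c)
   + (c - c) ^ (m - 1) * poly Wt c * 0 - (c - c) ^ (m - 1) * poly Wt c * 0) (at c)"
  unfolding G_def using cont PT_nonzero[OF nz(3)] nz(2)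
  by (intro tendsto_intros log_deriv_mult_square_tendsto_0) (auto simp: isCont_def)
 then have "(G \<longlongrightarrow> - of_nat m * lamc * poly Wt c) (at c)" by (simp add: lamc_def mult_ac)
 moreover have "\<forall>\<^sub>F z in at c. G z = poly U z"
 proof -
  have "\<forall>\<^sub>F z in at c. z \<in> - (Sg - {c}) - {c}"
   using open_compl' by (intro eventually_at_in_open) auto
  then show ?thesis
  proof eventually_elim
   case (elim z)
   then have z: "z \<notin> Sg" "z \<noteq> c" by auto
   define x where "x = z - c"
   have x: "x \<noteq> 0" using z by (simp add: x_def)
   have "(s has_field_derivative deriv s z) (at z)"
    using elim s_holomorphic open_compl' by (intro holomorphic_derivI) auto
   then have "((\<lambda>z. s z / (z - c) ^ m) has_field_derivative
     (deriv s z * x ^ m - s z * (of_nat m * x ^ (m - 1))) / (x ^ m * x ^ m)) (at z)"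
    unfolding x_def using z by (auto intro!: derivative_eq_intros)
   then have dE: "deriv E z = (deriv s z * x ^ m - s z * (of_nat m * x ^ (m - 1))) / (x ^ m * x ^ m)"
    unfolding E_eq[abs_def] by (rule DERIV_imp_deriv)
   obtain k where k: "m = Suc k" using m_pos by (cases m) auto
   have num: "deriv s z * x ^ m - s z * (of_nat m * x ^ (m - 1)) = x ^ k * (- of_nat m * s z + x * deriv s z)"
    unfolding k by (simp add: algebra_simps)
   have den: "x ^ m * x ^ m = x ^ k * x ^ (m + 1)" unfolding k by simp
   have "x ^ k \<noteq> 0" using x by simp
   then have dE': "deriv E z = (- of_nat m * s z + x * deriv s z) / x ^ (m + 1)"
    unfolding dE num den by (rule nonzero_mult_divide_mult_cancel_left)
   have "poly W z * deriv E z = poly Wt z * (- of_nat m * s z + x * deriv s z)"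
    unfolding dE' poly_W x_def[symmetric] using x by simp
   moreover have "poly W z * y = x ^ (m - 1) * poly Wt z * (x ^ 2 * y)" for y
    unfolding poly_W x_def[symmetric] by (simp add: k power2_eq_square)
   ultimately show ?case
    unfolding poly_Upoly[OF nz(3,2) z(1)] Lam_def G_def x_def[symmetric]
    by (simp only: ring_distribs)
  qed
 qed
 ultimately show "(poly U \<longlongrightarrow> - of_nat m * lamc * poly Wt c) (at c)" by (rule Lim_transform_eventually)
qed simp

text \<open>Both W and W' vanish at c, as m + 1 >= 2, so at c the recursion is multiplication by
  U(c). This later gives B_n(c) /= 0, so that disc and punctured disc contain the same zeros, and
  the exact value of \<open>H n 0\<close>.\<close>

lemma B_c: "poly (B n) c = poly U c ^ n * poly (Psharp P T) c"
proof (induction n)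
 case (Suc n)
 have "poly W c = 0" using m_pos by (simp add: poly_W)
 moreover have "poly (pderiv W) c = 0"
 proof -
  have "pderiv W = [:- c, 1:] ^ (m + 1) * pderiv Wt + pderiv ([:- c, 1:] ^ (m + 1)) * Wt"
   unfolding W_factor by (simp only: pderiv_mult mult.commute add.commute)
  moreover have "poly (pderiv ([:- c, 1:] ^ (m + 1))) c = 0" using m_pos
   by (simp only: pderiv_power poly_mult poly_smult poly_power) (simp add: pderiv_pCons)
  ultimately show ?thesis by simp
 qed
 ultimately show ?case using Suc by simp
qed simp

lemma degree_B: "degree (B n) \<le> (degree W + degree U) * n + degree (Psharp P T)"
proof (induction n)
 case (Suc n)
 have a: "degree (W * pderiv (B n)) \<le> degree W + degree (B n)"
  by (rule order_trans[OF degree_mult_le]) (simp add: degree_pderiv)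
 have "degree (U - of_nat n * pderiv W) \<le> degree U + degree W"
 proof (rule degree_diff_le)
  have "degree (of_nat n * pderiv W) \<le> degree (of_nat n :: complex poly) + degree (pderiv W)"
   by (rule degree_mult_le)
  then show "degree (of_nat n * pderiv W) \<le> degree U + degree W" by (simp add: degree_pderiv)
 qed simp
 then have b: "degree ((U - of_nat n * pderiv W) * B n) \<le> degree U + degree W + degree (B n)"
  by (intro order_trans[OF degree_mult_le]) simp
 have "degree (B (Suc n)) \<le> degree W + degree U + degree (B n)"
  unfolding Bpoly.simps by (rule degree_add_le) (use a b in auto)
 then show ?case using Suc by simp
qed simp

lemma deriv_zeros_eq: "deriv_zeros P Q S T n = {z. z \<notin> Sg \<and> poly (B n) z = 0}"
 using higher_deriv_f R_nz by (auto simp: deriv_zeros_def)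

lemma deriv_mult_eq:
 assumes "z \<notin> Sg" "B n \<noteq> 0"
 shows "deriv_mult P Q S T n z = order z (B n)"
 unfolding deriv_mult_def
 by (subst zorder_poly_times[OF assms(2) open_compl, of z "R n"])
   (use assms R_holomorphic R_nz higher_deriv_f in auto)

text \<open>Multiply by (z - c)^m and let z tend to c. The coefficients quantified in the theorem
  thus reduce to the single number \<open>lamc\<close>.\<close>

lemma lam_top:
 assumes "Ereg analytic_on {c}" "\<forall>\<^sub>F z in at c. E z = (\<Sum>k = 1..m. lam k / (z - c) ^ k) + Ereg z"
 shows "lam m = lamc"
proof (rule tendsto_unique)
 have sc: "isCont s c"
  using holomorphic_on_imp_continuous_on[OF s_holomorphic] open_compl' by (auto simp: continuous_on_eq_continuous_at)
 show "(s \<longlongrightarrow> lamc) (at c)" using sc by (simp add: isCont_def lamc_def)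
 have Ec: "isCont Ereg c" using assms(1) by (rule analytic_at_imp_isCont)
 have "((\<lambda>z. (\<Sum>k = 1..m. lam k * (z - c) ^ (m - k)) + (z - c) ^ m * Ereg z) \<longlongrightarrow>
   (\<Sum>k = 1..m. lam k * (c - c) ^ (m - k)) + (c - c) ^ m * Ereg c) (at c)"
  using Ec by (intro tendsto_intros) (auto simp: isCont_def)
 moreover have "(\<Sum>k = 1..m. lam k * (c - c) ^ (m - k)) = (\<Sum>k = 1..m. if k = m then lam m else 0)"
  by (intro sum.cong) auto
 ultimately have "((\<lambda>z. (\<Sum>k = 1..m. lam k * (z - c) ^ (m - k)) + (z - c) ^ m * Ereg z) \<longlongrightarrow> lam m) (at c)"
  using m_pos by (simp add: power_0_left)
 moreover have "\<forall>\<^sub>F z in at c. (\<Sum>k = 1..m. lam k * (z - c) ^ (m - k)) + (z - c) ^ m * Ereg z = s z"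
 proof -
  have "\<forall>\<^sub>F z in at c. z \<noteq> c" by (simp add: eventually_at_filter)
  with assms(2) show ?thesis
  proof eventually_elim
   case (elim z)
   have x: "z - c \<noteq> 0" using elim by simp
   have "s z = (z - c) ^ m * E z" using x by (simp add: E_eq)
   also have "\<dots> = (\<Sum>k = 1..m. (z - c) ^ m * (lam k / (z - c) ^ k)) + (z - c) ^ m * Ereg z"
    unfolding elim(1) by (simp add: distrib_left sum_distrib_left)
   also have "(\<Sum>k = 1..m. (z - c) ^ m * (lam k / (z - c) ^ k)) = (\<Sum>k = 1..m. lam k * (z - c) ^ (m - k))"
    using x by (intro sum.cong) (auto simp: power_diff)
   finally show ?case by simp
  qed
 qed
 ultimately show "(s \<longlongrightarrow> lam m) (at c)" by (rule Lim_transform_eventually)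
qed simp

end

locale hyper_disc = hyper_pole +
 fixes r :: real
 assumes r_pos: "r > 0"
  and r_sing: "cball c r \<inter> sing_set Q T = {c}"
  and r_nearest: "\<forall>z \<in> cball c r - {c}. \<forall>a \<in> sing_set Q T - {c}. cmod (z - c) < cmod (z - a)"
  and r_Psharp: "\<forall>z \<in> cball c r. poly (Psharp P T) z \<noteq> 0"
begin

lemma B_c_nz: "poly (B n) c \<noteq> 0"
proof -
 have "poly Wt c \<noteq> 0" by (rule Wt_nz) simp
 then have "poly U c \<noteq> 0" using m_pos lamc_nz by (simp add: U_c)
 then show ?thesis using r_Psharp r_pos by (simp add: B_c)
qed

lemma B_nz: "B n \<noteq> 0" using B_c_nz[of n] by auto

lemma zeros_in_disc:
 assumes "rho \<le> r"
 shows "{zeta \<in> deriv_zeros P Q S T n. 0 < cmod (zeta - c) \<and> cmod (zeta - c) < rho} = {zeta. poly (B n) zeta = 0 \<and> cmod (zeta - c) < rho}"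
  (is "?L = ?R")
proof (intro equalityI subsetI)
 fix z assume z: "z \<in> ?R"
 then have zc: "z \<noteq> c" using B_c_nz by auto
 have "z \<in> cball c r" using z assms by (simp add: dist_norm norm_minus_commute)
 then have "z \<notin> Sg" using r_sing zc by blast
 then show "z \<in> ?L" using z zc by (simp add: deriv_zeros_eq)
next
 fix z assume "z \<in> ?L"
 then show "z \<in> ?R" unfolding deriv_zeros_eq by blast
qed

text \<open>Test the nearest-point hypothesis at the point of |z - c| = r in the direction of a: its
  distances are r from c and |a - c| - r from a. The room of 2 r will allow circles about points of
  the disc that enclose c and no other singular point.\<close>

lemma sing_dist: assumes a: "a \<in> Sg" "a \<noteq> c" shows "cmod (a - c) > 2 * r"
proof -
 define d where "d = cmod (a - c)"
 have "a \<notin> cball c r" using r_sing a by blast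
 then have d: "d > r" by (simp add: d_def dist_norm norm_minus_commute)
 define z where "z = c + of_real (r / d) * (a - c)"
 have zc: "cmod (z - c) = r" using d r_pos a by (simp add: z_def d_def norm_mult norm_divide)
 have "z - a = of_real (r / d - 1) * (a - c)" by (simp add: z_def algebra_simps)
 then have "cmod (z - a) = cmod (complex_of_real (r / d - 1)) * d" by (simp only: norm_mult d_def)
 then have "cmod (z - a) = \<bar>r / d - 1\<bar> * d" by (simp only: norm_of_real)
 also have "\<bar>r / d - 1\<bar> = 1 - r / d" using d r_pos by simp
 also have "(1 - r / d) * d = d - r" using d r_pos by (simp add: left_diff_distrib)
 finally have za: "cmod (z - a) = d - r" .
 have "z \<in> cball c r - {c}" using zc r_pos by (auto simp: dist_norm norm_minus_commute)
 then have "cmod (z - c) < cmod (z - a)" using r_nearest a by blast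
 then show ?thesis using zc za by (simp add: d_def)
qed

text \<open>No zero of T lies on the circle, so there is no atom; and a point of a Voronoi edge has
  two nearest points in the singular set, which the hypothesis on nearest points forbids.\<close>

lemma mu_fix_frontier: "emeasure (mu_fix Q S T) (frontier (ball c r)) = 0"
proof -
 have fr: "frontier (ball c r) = sphere c r" using r_pos by simp
 have b: "frontier (ball c r) \<in> sets borel" by simp
 have 1: "emeasure (return borel a) (sphere c r) = 0" if "a \<in> zeros T" for a
 proof -
  have "a \<in> Sg" using that by (simp add: sing_set_def)
  then have "a = c \<or> a \<notin> cball c r" using r_sing by blast
  then have "a \<notin> sphere c r" using r_pos by auto
  then show ?thesis by simp
 qed
 have 2: "vor_edge Sg a b \<inter> sphere c r = {}" if ab: "a \<in> Sg" "b \<in> Sg" "a \<noteq> b" for a b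
 proof -
  have "False" if z: "z \<in> vor_cell Sg a" "z \<in> vor_cell Sg b" "z \<in> sphere c r" for z
  proof -
   have zz: "z \<in> cball c r - {c}" using z r_pos by auto
   have "cmod (z - a) \<le> cmod (z - c)" "cmod (z - b) \<le> cmod (z - c)"
    using z c_in by (auto simp: vor_cell_def)
   then have "a = c" "b = c" using r_nearest zz ab by (metis DiffI not_le singletonD)+
   then show False using ab by simp
  qed
  then have "vor_cell Sg a \<inter> vor_cell Sg b \<inter> sphere c r = {}" by blast
  then show ?thesis unfolding vor_edge_def Let_def by simp
 qed
 have "(\<Sum>(a, b) \<in> {(a, b). a \<in> Sg \<and> b \<in> Sg \<and> a \<noteq> b}.
     \<integral>\<^sup>+ z. ennreal (cmod (a - b) / (cmod (z - a) * cmod (z - b)))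
        * indicator (vor_edge Sg a b \<inter> sphere c r) z \<partial>bisector_length a b) = 0"
  using 2 by (intro sum.neutral) auto
 moreover have "(\<Sum>a\<in>zeros T. of_nat (order a T) * emeasure (return borel a) (sphere c r)) = 0"
  using 1 by (intro sum.neutral) auto
 ultimately show ?thesis unfolding emeasure_mu_fix[OF b] unfolding fr by simp
qed

end

section \<open>The total number of zeros in D(c, r)\<close>

context hyper_disc
begin

text \<open>If f extended holomorphically, f'/f would have at most a simple pole, and B_1 = W
  P_sharp f'/f would vanish at c because W has a zero of order at least 2. But B_1(c) is not 0.
  Hence the polynomials in 1/(z - c) from \<open>residue_approx\<close> do not all vanish.\<close>

lemma f_nonremovable: "\<exists>k. residue (\<lambda>w. f w * (w - c) ^ k) c \<noteq> 0"
proof (rule ccontr)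
 assume "\<not> ?thesis"
 then have res: "residue (\<lambda>w. f w * (w - c) ^ k) c = 0" for k by blast
 have sub: "ball c (2 * r) - {c} \<subseteq> - Sg"
 proof
  fix z assume z: "z \<in> ball c (2 * r) - {c}"
  then have "cmod (z - c) < 2 * r" by (simp add: dist_norm norm_minus_commute)
  then show "z \<in> - Sg" using sing_dist[of z] z by force
 qed
 have "f holomorphic_on ball c (2 * r) - {c}" by (rule holomorphic_on_subset[OF f_holomorphic sub])
 from removable_if_residues_vanish[OF this _ res] r_pos obtain g where
  g: "g holomorphic_on ball c r" "\<And>w. w \<in> ball c r - {c} \<Longrightarrow> f w = g w" by auto
 have sub': "w \<notin> Sg" if "w \<in> ball c r - {c}" for w using sub that r_pos by (auto simp: subset_iff)
 have Ps: "poly (Psharp P T) w \<noteq> 0" if "w \<in> ball c r" for w using r_Psharp that by auto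
 have gnz: "g w \<noteq> 0" if w: "w \<in> ball c r - {c}" for w
  using g(2)[OF w] higher_deriv_f[OF sub'[OF w], of 0] R_nz[OF sub'[OF w], of 0] Ps[of w] w by auto
 have "c + of_real (r / 2) \<in> ball c r - {c}" using r_pos by (auto simp: dist_norm)
 then have ex: "\<exists>w\<in>ball c r. g w \<noteq> 0" using gnz by blast
 define k where "k = nat (zorder g c)"
 define h where "h = zor_poly g c"
 have zz: "c \<in> ball c r" using r_pos by simp
 from zorder_exist_zero[OF g(1) open_ball connected_ball zz ex]
 obtain rho where rho: "rho > 0" "cball c rho \<subseteq> ball c r" "h holomorphic_on cball c rho"
  "\<And>w. w \<in> cball c rho \<Longrightarrow> g w = h w * (w - c) ^ k \<and> h w \<noteq> 0"
  unfolding k_def h_def by blast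
 have hb: "h holomorphic_on ball c rho" by (rule holomorphic_on_subset[OF rho(3)]) auto
 \<comment> \<open>This is W P_sharp (f'/f) h for f = h (w - c)^k, written without the pole, so that
   its limit 0 is visible; it will equal B_1 h.\<close>
 define D where "D w = (w - c) ^ m * poly Wt w * poly (Psharp P T) w * (of_nat k * h w + (w - c) * deriv h w)" for w
 have "continuous_on (ball c rho) h" "continuous_on (ball c rho) (deriv h)"
  using hb by (auto intro!: holomorphic_on_imp_continuous_on holomorphic_deriv)
 then have cont: "isCont h c" "isCont (deriv h) c"
  using rho(1) by (auto simp: continuous_on_eq_continuous_at)
 have "(D \<longlongrightarrow> (c - c) ^ m * poly Wt c * poly (Psharp P T) c * (of_nat k * h c + (c - c) * deriv h c)) (at c)"
  unfolding D_def using cont by (intro tendsto_intros) (auto simp: isCont_def)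
 then have "(D \<longlongrightarrow> 0) (at c)" using m_pos by (simp add: power_0_left)
 moreover have "\<forall>\<^sub>F w in at c. D w = poly (B 1) w * h w"
 proof -
  have "\<forall>\<^sub>F w in at c. w \<in> ball c rho - {c}" using rho(1) by (intro eventually_at_in_open) auto
  then show ?thesis
  proof eventually_elim
   case (elim w)
   define x where "x = w - c"
   have x: "x \<noteq> 0" using elim by (simp add: x_def)
   have "w \<in> cball c rho" using elim by auto
   then have wr: "w \<in> ball c r - {c}" using elim rho(2) by blast
   note ws = sub'[OF wr]
   have gw: "g w = h w * x ^ k" using rho(4)[of w] elim by (simp add: x_def)
   have dh: "(h has_field_derivative deriv h w) (at w)" using elim hb by (intro holomorphic_derivI) auto
   have "((\<lambda>w. h w * (w - c) ^ k) has_field_derivative (deriv h w * x ^ k + h w * (of_nat k * x ^ (k - 1)))) (at w)"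
    unfolding x_def by (rule derivative_eq_intros dh refl | simp)+
   moreover have "\<forall>\<^sub>F v in nhds w. h v * (v - c) ^ k = f v"
   proof -
    have "\<forall>\<^sub>F v in nhds w. v \<in> ball c rho - {c}" using elim by (intro eventually_nhds_in_open) auto
    then show ?thesis
    proof eventually_elim
     case (elim v)
     then have v: "v \<in> cball c rho" by auto
     then have "v \<in> ball c r - {c}" using rho(2) elim by blast
     then show ?case using rho(4)[OF v] g(2) by simp
    qed
   qed
   ultimately have df: "deriv f w = deriv h w * x ^ k + h w * (of_nat k * x ^ (k - 1))"
   proof -
    assume d: "((\<lambda>w. h w * (w - c) ^ k) has_field_derivative deriv h w * x ^ k + h w * (of_nat k * x ^ (k - 1))) (at w)"
     and e: "\<forall>\<^sub>F v in nhds w. h v * (v - c) ^ k = f v"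
    have "deriv f w = deriv (\<lambda>w. h w * (w - c) ^ k) w"
     using e by (intro deriv_cong_ev) (auto elim: eventually_mono)
    then show ?thesis using DERIV_imp_deriv[OF d] by simp
   qed
   have kx: "of_nat k * x ^ (k - 1) * x = of_nat k * x ^ k" by (cases k) auto
   have R1: "R 0 w = R 1 w * poly W w" using W_zero_iff[of w] ws by (simp add: R_def)
   have fw: "f w = R 0 w * poly (Psharp P T) w" using higher_deriv_f[OF ws, of 0] by simp
   have "deriv f w = R 1 w * poly (B 1) w" using higher_deriv_f[OF ws, of 1] by simp
   then have "R 1 w * (poly W w * poly (Psharp P T) w * deriv f w) = R 1 w * (poly (B 1) w * f w)"
    using fw R1 by (simp only: mult_ac)
   then have "poly W w * poly (Psharp P T) w * deriv f w = poly (B 1) w * f w"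
    by (rule mult_left_cancel[OF R_nz[OF ws, of 1], THEN iffD1])
   then have e1: "poly W w * poly (Psharp P T) w * deriv f w = poly (B 1) w * (h w * x ^ k)"
    unfolding g(2)[OF wr] gw .
   have "h w * (of_nat k * x ^ (k - 1)) * x = h w * (of_nat k * x ^ k)"
    using kx by (simp only: mult.assoc)
   then have hx: "deriv f w * x = x ^ k * (of_nat k * h w + x * deriv h w)"
    unfolding df by (simp add: distrib_right distrib_left mult_ac)
   have "x ^ k * D w = x ^ m * poly Wt w * poly (Psharp P T) w * (x ^ k * (of_nat k * h w + x * deriv h w))"
    unfolding D_def x_def[symmetric] by (simp only: mult_ac)
   also have "\<dots> = poly W w * poly (Psharp P T) w * deriv f w"
    unfolding hx[symmetric] poly_W x_def[symmetric] by (simp add: mult_ac)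
   also have "\<dots> = x ^ k * (poly (B 1) w * h w)" unfolding e1 by (simp only: mult_ac)
   finally have "x ^ k * D w = x ^ k * (poly (B 1) w * h w)" .
   then show ?case using x by simp
  qed
 qed
 ultimately have "((\<lambda>w. poly (B 1) w * h w) \<longlongrightarrow> 0) (at c)" by (rule Lim_transform_eventually)
 moreover have "((\<lambda>w. poly (B 1) w * h w) \<longlongrightarrow> poly (B 1) c * h c) (at c)"
  using cont by (intro tendsto_intros) (auto simp: isCont_def)
 ultimately have "poly (B 1) c * h c = 0" by (intro tendsto_unique) auto
 then show False using B_c_nz[of 1] rho(1,4) by auto
qed

text \<open>The quotient h stays within 1 of 1 on the circle, so its logarithmic derivative
  integrates to 0. Up to a constant h is e^E times a quotient of polynomials, and E' integrates to 0
  as E is single-valued. Comparing numerator and denominator, the numbers of zeros satisfy (n + 1 +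
  k0 + d) + #P_T + #B_n = #Q + n (m + 1) + #rp, and #P_T, #Q, #rp are at most the degrees.\<close>

lemma count_from_approx:
 fixes p :: "complex poly"
 assumes rho: "rho > 0" "\<And>a. a \<in> Sg - {c} \<Longrightarrow> rho < cmod (a - c)"
  and p: "\<And>z. cmod (z - c) = rho \<Longrightarrow> poly p (1 / (z - c)) \<noteq> 0"
  and near: "\<And>z. cmod (z - c) = rho \<Longrightarrow>
    cmod ((z - c) ^ (n + 1) * (deriv ^^ n) f z / fact n / ((-1) ^ n * (1 / (z - c)) ^ k0 * poly p (1 / (z - c))) - 1) < 1"
 shows "\<bar>real (disc_count c rho (B n)) - real m * real n\<bar> \<le> real (degree p + degree Q + 1 + k0 + degree (PT P T))"
proof -
 define d where "d = degree p"
 \<comment> \<open>x^d p(1/x) as a polynomial in z, where x = z - c.\<close>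
 define rp where "rp = pcompose (reflect_poly p) [:- c, 1:]"
 have p0: "p \<noteq> 0" using p[of "c + of_real rho"] rho(1) by auto
 have rpz: "poly rp z = (z - c) ^ d * poly p (1 / (z - c))" if "z \<noteq> c" for z
  using that by (simp add: rp_def poly_pcompose poly_reflect_poly_nz d_def inverse_eq_divide)
 have nSg: "z \<notin> Sg" if "cmod (z - c) = rho" for z using rho that by force
 define L where "L = [:- c, 1:] ^ (n + 1 + k0 + d) * (PT P T * B n)"
 define Rr where "Rr = Q * (W ^ n * rp)"
 define K where "K = (-1) ^ n / (fact n :: complex)"
 define h where "h z = K * (poly L z * exp (E z) / poly Rr z)" for z
 define S where "S = - Sg \<inter> - {z. poly rp z = 0}"
 have rp0: "rp \<noteq> 0"
 proof
  assume "rp = 0"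
  then show False using rpz[of "c + of_real rho"] p[of "c + of_real rho"] rho(1) by auto
 qed
 have oS: "open S"
  unfolding S_def using poly_roots_finite[OF rp0] open_compl by (intro open_Int) (auto simp: finite_imp_closed open_Compl)
 have Rr_nz: "poly Rr z \<noteq> 0" if "z \<in> S" for z using that Q_nz W_zero_iff by (auto simp: Rr_def S_def)
 have sS: "z \<in> S" if "cmod (z - c) = rho" for z
  using nSg[OF that] p[OF that] rpz[of z] that rho(1) by (auto simp: S_def)
 have hh: "h z = (z - c) ^ (n + 1) * (deriv ^^ n) f z / fact n / ((-1) ^ n * (1 / (z - c)) ^ k0 * poly p (1 / (z - c)))"
  if z: "cmod (z - c) = rho" for z
 proof -
  define x where "x = z - c"
  have x: "x \<noteq> 0" using z rho(1) by (auto simp: x_def)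
  have nz1: "poly Q z \<noteq> 0" "poly W z \<noteq> 0" using nSg[OF z] Q_nz W_zero_iff by auto
  have pz: "poly p (1 / x) \<noteq> 0" using p[OF z] by (simp add: x_def)
  have sg: "(-1) ^ n * (-1) ^ n = (1::complex)" by (simp flip: power_mult_distrib)
  have "x \<noteq> 0 \<Longrightarrow> z \<noteq> c" by (auto simp: x_def)
  then have rx: "poly rp z = x ^ d * poly p (1 / x)" using rpz x by (simp add: x_def)
  have "(x ^ (n + 1) * (R n z * poly (B n) z) / fact n) / ((-1) ^ n * (1 / x) ^ k0 * poly p (1 / x))
   = x ^ (n + 1) * x ^ k0 * (R n z * poly (B n) z) * (-1) ^ n / (fact n * poly p (1 / x))"
   using x pz sg by (simp add: field_simps power_one_over)
  also have "\<dots> = h z"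
   unfolding h_def K_def L_def Rr_def R_def poly_mult poly_power rx
   using x nz1 pz by (simp add: power_add x_def[symmetric] field_simps)
  finally show ?thesis unfolding higher_deriv_f[OF nSg[OF z]] by (simp add: x_def)
 qed
 have hS: "h holomorphic_on S"
  unfolding h_def using Rr_nz by (intro holomorphic_intros holomorphic_on_subset[OF E_holomorphic]) (auto simp: S_def)
 have hnear: "cmod (h z - 1) < 1" if "z \<in> sphere c rho" for z
  using near[of z] hh[of z] that by (simp add: dist_norm norm_minus_commute)
 have h_nz: "h z \<noteq> 0" if "cmod (z - c) = rho" for z using hnear[of z] that by (auto simp: dist_norm norm_minus_commute)
 have L_nz: "poly L z \<noteq> 0" if "cmod (z - c) = rho" for z using h_nz[OF that] by (auto simp: h_def)
 have Bn: "B n \<noteq> 0" by (rule B_nz)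
 have PT0: "PT P T \<noteq> 0" using nz by (intro PT_nonzero)
 have lin0: "[:- c, 1:] ^ k \<noteq> 0" for k by (rule power_not_zero) simp
 have L0: "L \<noteq> 0" unfolding L_def by (intro no_zero_divisors lin0 PT0 Bn)
 have Rr0: "Rr \<noteq> 0" using nz W_nonzero rp0 by (simp add: Rr_def)
 have i0: "((\<lambda>z. deriv h z / h z) has_contour_integral 0) (circlepath c rho)"
  by (rule log_deriv_integral_near_1[OF oS _ hS rho(1) hnear]) (use sS in \<open>auto simp: dist_norm norm_minus_commute\<close>)
 have ld: "deriv h z / h z = (poly (pderiv L) z / poly L z + deriv E z) - poly (pderiv Rr) z / poly Rr z"
  if z: "cmod (z - c) = rho" for z
 proof -
  have zS: "z \<notin> Sg" by (rule nSg[OF z])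
  have K0: "K \<noteq> 0" by (simp add: K_def)
  note nzz = L_nz[OF z] Rr_nz[OF sS[OF z]]
  have "(h has_field_derivative K * (((poly (pderiv L) z * exp (E z) + exp (E z) * deriv E z * poly L z) * poly Rr z
    - poly L z * exp (E z) * poly (pderiv Rr) z) / (poly Rr z * poly Rr z))) (at z)"
   unfolding h_def using nzz
   by (intro DERIV_cmult DERIV_divide DERIV_mult poly_DERIV DERIV_fun_exp E_deriv zS) auto
  then have "deriv h z = K * (((poly (pderiv L) z * exp (E z) + exp (E z) * deriv E z * poly L z) * poly Rr z
    - poly L z * exp (E z) * poly (pderiv Rr) z) / (poly Rr z * poly Rr z))" by (rule DERIV_imp_deriv)
  then show ?thesis unfolding h_def using nzz K0 by (simp add: field_simps)
 qed
 have cont_int: "(\<lambda>z. poly (pderiv q) z / poly q z) contour_integrable_on circlepath c rho"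
  if "\<And>z. cmod (z - c) = rho \<Longrightarrow> poly q z \<noteq> 0" for q
  using that rho(1) by (intro contour_integrable_continuous_circlepath continuous_intros) (auto simp: dist_norm norm_minus_commute)
 have iE: "(deriv E has_contour_integral 0) (circlepath c rho)"
 proof -
  have "(deriv E has_contour_integral (E (pathfinish (circlepath c rho)) - E (pathstart (circlepath c rho)))) (circlepath c rho)"
   by (rule contour_integral_primitive[of "- Sg"])
     (use nSg rho(1) in \<open>auto intro: has_field_derivative_at_within E_deriv simp: dist_norm norm_minus_commute\<close>)
  then show ?thesis by simp
 qed
 have iL: "((\<lambda>z. poly (pderiv L) z / poly L z) has_contour_integral 2 * pi * \<i> * of_nat (disc_count c rho L)) (circlepath c rho)"
 proof -
  have "contour_integral (circlepath c rho) (\<lambda>z. poly (pderiv L) z / poly L z) = 2 * pi * \<i> * of_nat (disc_count c rho L)"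
   by (rule log_deriv_integral_poly[OF L0 rho(1)]) (rule L_nz)
  then show ?thesis using has_contour_integral_integral[OF cont_int[OF L_nz]] by (simp only:)
 qed
 have Rnz: "\<And>z. cmod (z - c) = rho \<Longrightarrow> poly Rr z \<noteq> 0" using Rr_nz sS by blast
 have iR: "((\<lambda>z. poly (pderiv Rr) z / poly Rr z) has_contour_integral 2 * pi * \<i> * of_nat (disc_count c rho Rr)) (circlepath c rho)"
 proof -
  have "contour_integral (circlepath c rho) (\<lambda>z. poly (pderiv Rr) z / poly Rr z) = 2 * pi * \<i> * of_nat (disc_count c rho Rr)"
   by (rule log_deriv_integral_poly[OF Rr0 rho(1)]) (rule Rnz)
  then show ?thesis using has_contour_integral_integral[OF cont_int[OF Rnz]] by (simp only:)
 qed
 have "((\<lambda>z. deriv h z / h z) has_contour_integral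
   (2 * pi * \<i> * of_nat (disc_count c rho L) + 0 - 2 * pi * \<i> * of_nat (disc_count c rho Rr))) (circlepath c rho)"
  by (rule has_contour_integral_eq[OF has_contour_integral_diff[OF has_contour_integral_add[OF iL iE] iR]])
    (use ld rho(1) in \<open>auto simp: dist_norm norm_minus_commute\<close>)
 then have "2 * pi * \<i> * of_nat (disc_count c rho L) + 0 - 2 * pi * \<i> * of_nat (disc_count c rho Rr) = 0"
  using i0 by (rule has_contour_integral_unique)
 then have "complex_of_nat (disc_count c rho L) = of_nat (disc_count c rho Rr)" by simp
 then have LR: "disc_count c rho L = disc_count c rho Rr" by (simp only: of_nat_eq_iff)
 have dW: "disc_count c rho W = m + 1"
 proof -
  have "Wt \<noteq> 0" using W_factor W_nonzero by auto
  moreover have "{zeta. poly Wt zeta = 0 \<and> cmod (zeta - c) < rho} = {}" using Wt_nz rho(2) by force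
  then have "disc_count c rho Wt = 0" unfolding disc_count_def by (simp only: sum.empty)
  ultimately show ?thesis
   unfolding W_factor by (subst disc_count_mult[OF lin0]) (simp_all add: disc_count_power disc_count_linear[OF rho(1)] del: power_Suc)
 qed
 have dL: "disc_count c rho L = (n + 1 + k0 + d) + (disc_count c rho (PT P T) + disc_count c rho (B n))"
 proof -
  have "disc_count c rho ([:- c, 1:] ^ (n + 1 + k0 + d)) = n + 1 + k0 + d"
   by (subst disc_count_power) (simp_all add: disc_count_linear[OF rho(1)])
  then show ?thesis
   unfolding L_def by (simp only: disc_count_mult[OF lin0 no_zero_divisors[OF PT0 Bn]] disc_count_mult[OF PT0 Bn])
 qed
 have dR: "disc_count c rho Rr = disc_count c rho Q + (n * (m + 1) + disc_count c rho rp)"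
  unfolding Rr_def using nz W_nonzero rp0 by (simp add: disc_count_mult disc_count_power dW)
 have "disc_count c rho rp \<le> d"
 proof -
  have "disc_count c rho rp \<le> degree rp" by (rule disc_count_le_degree[OF rp0])
  also have "degree rp = degree (reflect_poly p)" by (simp add: rp_def degree_pcompose)
  also have "\<dots> \<le> d" by (simp add: d_def degree_reflect_poly_le)
  finally show ?thesis .
 qed
 moreover have "disc_count c rho Q \<le> degree Q" "disc_count c rho (PT P T) \<le> degree (PT P T)"
  using nz PT0 by (auto intro: disc_count_le_degree)
 moreover have "real (n + 1 + k0 + d) + (real (disc_count c rho (PT P T)) + real (disc_count c rho (B n)))
   = real (disc_count c rho Q) + (real n * (real m + 1) + real (disc_count c rho rp))"
  using arg_cong[OF LR[unfolded dL dR], of real] by (simp add: algebra_simps)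
 ultimately show ?thesis unfolding d_def[symmetric] by (simp add: algebra_simps abs_le_iff)
qed

end

context hyper_disc
begin

lemma poly_max_circle:
 fixes p :: "complex poly"
 assumes "t > 0"
 shows "\<exists>s. cmod s = t \<and> cmod (poly p 0) \<le> cmod (poly p s)"
proof -
 have ne: "sphere (0::complex) t \<noteq> {}" using assms by simp
 have co: "continuous_on (sphere 0 t) (\<lambda>s. cmod (poly p s))" by (intro continuous_intros)
 obtain s where s: "s \<in> sphere 0 t" "\<And>w. w \<in> sphere 0 t \<Longrightarrow> cmod (poly p w) \<le> cmod (poly p s)"
  using continuous_attains_sup[OF compact_sphere ne co] by blast
 have "cmod (poly p 0) \<le> cmod (poly p s)"
 proof (rule maximum_modulus_frontier[where f = "poly p" and S = "ball 0 t"])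
  show "poly p holomorphic_on interior (ball 0 t)" by (rule poly_holomorphic)
  show "continuous_on (closure (ball 0 t)) (poly p)"
   by (rule holomorphic_on_imp_continuous_on[OF poly_holomorphic])
  show "cmod (poly p z) \<le> cmod (poly p s)" if "z \<in> frontier (ball 0 t)" for z
   using that assms by (intro s(2)) auto
 qed (use assms in auto)
 then show ?thesis using s(1) by (intro exI[of _ s]) auto
qed

text \<open>By the residue theorem on |w - z| = R0, f^(n)(z)/n! is a contour integral minus the
  residue at c. After multiplication by x^(n+1) the integral is O(theta^(2n)), and the residue is a
  polynomial in 1/x of degree about e n up to another O(theta^(2n)). By
  \<open>poly_min_modulus\<close> that polynomial is at least of order theta^n on some circle, so it
  dominates there. The price is a radius that depends on n and an error e n from the degree.\<close>

lemma count_on_interval: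
 assumes dl: "\<delta> > 0" "\<And>a. a \<in> Sg - {c} \<Longrightarrow> cmod (a - c) > 2 * r + 4 * \<delta>"
  and ab: "0 < a" "a < b" "b \<le> r + \<delta>"
 shows "\<exists>C. \<forall>e>0. \<forall>\<^sub>F n in sequentially. \<exists>rho\<in>{a..b}.
   \<bar>real (disc_count c rho (B n)) - real m * real n\<bar> \<le> e * real n + C"
proof -
 define A where "A k = residue (\<lambda>w. f w * (w - c) ^ k) c" for k
 define k0 where "k0 = (LEAST k. A k \<noteq> 0)"
 have "\<exists>k. A k \<noteq> 0" using f_nonremovable by (simp add: A_def)
 then have k0: "A k0 \<noteq> 0" unfolding k0_def by (rule LeastI_ex)
 have k0': "A k = 0" if "k < k0" for k using that not_less_Least[of k "\<lambda>k. A k \<noteq> 0"] by (auto simp: k0_def)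
 \<comment> \<open>Larger than |z - c| <= r + delta, so the circle about z encloses c; yet its
   points satisfy |w - c| <= 2 r + 3 delta and stay short of the other singular points.\<close>
 define R0 where "R0 = r + 2 * \<delta>"
 have R0: "b < R0" "R0 > 0" using ab dl(1) r_pos by (auto simp: R0_def)
 \<comment> \<open>theta^2 bounds b/R0, the decay of the contour integral; being at least 1/2, it
   also bounds the truncation error (1/4)^n by theta^(2n).\<close>
 define \<theta> where "\<theta> = max (sqrt (b / R0)) (1 / 2)"
 have th: "1 / 2 \<le> \<theta>" "\<theta> < 1" "b / R0 \<le> \<theta> ^ 2"
 proof -
  have br: "0 \<le> b / R0" "b / R0 < 1" using R0 ab by auto
  then have s: "sqrt (b / R0) < 1" by simp
  show "1 / 2 \<le> \<theta>" by (simp add: \<theta>_def)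
  show "\<theta> < 1" using s by (simp add: \<theta>_def)
  have "sqrt (b / R0) ^ 2 \<le> \<theta> ^ 2" using br by (intro power_mono) (auto simp: \<theta>_def)
  then show "b / R0 \<le> \<theta> ^ 2" using br by simp
 qed
 define t1 where "t1 = 1 / b"
 define t2 where "t2 = 1 / a"
 have t: "0 < t1" "t1 < t2" using ab by (auto simp: t1_def t2_def field_simps)
 define \<kappa> where "\<kappa> = (t2 - t1) / (18 * t2)"
 have kp: "0 < \<kappa>" "\<kappa> < 1" using t by (auto simp: \<kappa>_def field_simps)
 have punct: "w \<notin> Sg" if "0 < cmod (w - c)" "cmod (w - c) \<le> 2 * r + 4 * \<delta>" for w
  using dl(2)[of w] that by auto
 define K0 where "K0 = {w. \<delta> \<le> cmod (w - c) \<and> cmod (w - c) \<le> 2 * r + 3 * \<delta>}"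
 have "compact K0"
 proof -
  have "K0 = cball c (2 * r + 3 * \<delta>) - ball c \<delta>" by (auto simp: K0_def dist_norm norm_minus_commute)
  then show ?thesis by (simp add: compact_diff)
 qed
 moreover have "continuous_on K0 f"
 proof (rule holomorphic_on_imp_continuous_on[OF holomorphic_on_subset[OF f_holomorphic]])
  show "K0 \<subseteq> - Sg"
  proof
   fix w assume "w \<in> K0"
   then have "0 < cmod (w - c)" "cmod (w - c) \<le> 2 * r + 4 * \<delta>" using dl(1) by (auto simp: K0_def)
   then show "w \<in> - Sg" using punct by blast
  qed
 qed
 ultimately obtain Mf where Mf0: "Mf \<ge> 0" and Mf: "\<And>w. w \<in> K0 \<Longrightarrow> cmod (f w) \<le> Mf"
  using compact_norm_bound[of K0 f] by blast
 have ball_hol: "f holomorphic_on ball c (2 * r + 4 * \<delta>) - {c}"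
  by (rule holomorphic_on_subset[OF f_holomorphic]) (use punct in \<open>auto simp: dist_norm norm_minus_commute\<close>)
 define CQ where "CQ = real (degree Q + 1 + k0 + degree (PT P T)) + 1"
 show ?thesis
 proof (intro exI[of _ CQ] allI impI)
  fix e :: real assume e: "e > 0"
  \<comment> \<open>Caps the degree so that the loss kappa^(e' n) in \<open>poly_min_modulus\<close>
    is not worse than theta^n.\<close>
  define e' where "e' = min e (ln \<theta> / ln \<kappa>)"
  have lnk: "ln \<kappa> < 0" "ln \<theta> < 0" using kp th by auto
  have e': "e' > 0" "e' \<le> e" using e lnk by (auto simp: e'_def divide_neg_neg)
  have kth: "\<theta> \<le> \<kappa> powr e'"
  proof -
   have "e' \<le> ln \<theta> / ln \<kappa>" by (simp add: e'_def)
   then have "ln \<theta> \<le> e' * ln \<kappa>" using lnk by (simp add: le_divide_eq)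
   then have "exp (ln \<theta>) \<le> exp (e' * ln \<kappa>)" by simp
   then show ?thesis using th kp by (simp add: powr_def)
  qed
  \<comment> \<open>Makes y^(e' n) <= 8^(-n), which absorbs the factor 2^(n+1) of
    \<open>residue_approx\<close>. The radius sigma = a y / 2 gives 2 sigma / rho <= y.\<close>
  define y where "y = min (1 / 2) (exp (- ln 8 / e'))"
  have y: "0 < y" "y \<le> 1 / 2" "y powr e' \<le> 1 / 8"
  proof -
   show "0 < y" "y \<le> 1 / 2" by (auto simp: y_def)
   have "y powr e' \<le> exp (- ln 8 / e') powr e'" using e' \<open>0 < y\<close> by (intro powr_mono2) (auto simp: y_def)
   also have "\<dots> = exp (- ln 8)" using e' by (simp add: powr_def)
   also have "\<dots> = 1 / 8" by (simp add: exp_minus inverse_eq_divide)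
   finally show "y powr e' \<le> 1 / 8" .
  qed
  define \<sigma> where "\<sigma> = a * y / 2"
  have sg: "0 < \<sigma>" "4 * \<sigma> \<le> a" using ab y by (auto simp: \<sigma>_def)
  have sgR: "\<sigma> < 2 * r + 4 * \<delta>" using sg ab dl(1) r_pos by auto
  have "continuous_on (sphere c \<sigma>) f"
   by (intro holomorphic_on_imp_continuous_on[OF holomorphic_on_subset[OF ball_hol]])
     (use sg sgR in auto)
  from compact_norm_bound[OF compact_sphere this] obtain Ms where
   Ms0: "Ms \<ge> 0" and Ms': "\<forall>w\<in>sphere c \<sigma>. cmod (f w) \<le> Ms" by blast
  have Ms: "cmod (f w) \<le> Ms" if "cmod (w - c) = \<sigma>" for w
   using Ms' that by (simp add: dist_norm norm_minus_commute)
  define c1 where "c1 = (1 / b) ^ k0 * (cmod (A k0) * \<kappa>)"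
  have c1: "c1 > 0" using ab k0 kp by (auto simp: c1_def)
  define C2 where "C2 = b * Mf + 2 * \<sigma> * Ms"
  have C2: "C2 \<ge> 0" using ab Mf0 Ms0 sg by (auto simp: C2_def)
  have "(\<lambda>n. C2 * \<theta> ^ n) \<longlonglongrightarrow> C2 * 0" using th by (intro tendsto_intros LIMSEQ_power_zero) auto
  then have ev: "\<forall>\<^sub>F n in sequentially. C2 * \<theta> ^ n < c1" using c1 by (intro order_tendstoD(2)[where y = 0]) auto
  show "\<forall>\<^sub>F n in sequentially. \<exists>rho\<in>{a..b}. \<bar>real (disc_count c rho (B n)) - real m * real n\<bar> \<le> e * real n + CQ"
   using ev
  proof eventually_elim
   case (elim n)
   define d where "d = nat \<lceil>e' * real n\<rceil>"
   have d: "e' * real n \<le> real d" "real d \<le> e' * real n + 1"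
   proof -
    have "0 \<le> e' * real n" using e' by simp
    then show "e' * real n \<le> real d" "real d \<le> e' * real n + 1" unfolding d_def by linarith+
   qed
   \<comment> \<open>The truncated sum of \<open>residue_approx\<close> without its factor (1/x)^k0.
     As \<open>k0\<close> is the first index with nonzero residue, |p(0)| is bounded below
     independently of n.\<close>
   define p where "p = (\<Sum>j\<le>d. monom (of_nat ((n + (k0 + j)) choose (k0 + j)) * A (k0 + j)) j)"
   have degp: "degree p \<le> d"
    unfolding p_def by (intro degree_sum_le) (auto intro: order_trans[OF degree_monom_le])
   have pz: "poly p s = (\<Sum>j\<le>d. of_nat ((n + (k0 + j)) choose (k0 + j)) * A (k0 + j) * s ^ j)" for s
    by (simp add: p_def poly_sum poly_monom)
   have psum: "(\<Sum>k<k0 + Suc d. of_nat ((n + k) choose k) * A k * s ^ k) = s ^ k0 * poly p s" for s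
   proof -
    have "(\<Sum>k<k0 + Suc d. of_nat ((n + k) choose k) * A k * s ^ k) = (\<Sum>k\<in>{k0..<k0 + Suc d}. of_nat ((n + k) choose k) * A k * s ^ k)"
     by (rule sum.mono_neutral_right) (auto simp: k0')
    also have "\<dots> = (\<Sum>j<Suc d. of_nat ((n + (j + k0)) choose (j + k0)) * A (j + k0) * s ^ (j + k0))"
     using sum.shift_bounds_nat_ivl[of "\<lambda>k. of_nat ((n + k) choose k) * A k * s ^ k" 0 k0 "Suc d"]
     by (simp add: atLeast0LessThan add.commute)
    also have "\<dots> = s ^ k0 * poly p s"
     unfolding pz sum_distrib_left lessThan_Suc_atMost
     by (intro sum.cong refl) (simp add: power_add mult_ac add.commute[of _ k0])
    finally show ?thesis .
   qed
   have p0: "cmod (A k0) \<le> cmod (poly p 0)"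
   proof -
    have "poly p 0 = of_nat ((n + k0) choose k0) * A k0"
     unfolding pz by (simp add: power_0_left if_distrib[of "\<lambda>x. _ * x"] cong: if_cong)
    moreover have "(n + k0) choose k0 \<ge> 1" by (simp add: Suc_le_eq)
    then have "real ((n + k0) choose k0) \<ge> 1" by linarith
    ultimately show ?thesis using mult_right_mono[of 1 "real ((n + k0) choose k0)" "cmod (A k0)"] by (simp add: norm_mult)
   qed
   obtain s0 where s0: "cmod s0 = t1" "cmod (poly p 0) \<le> cmod (poly p s0)" using poly_max_circle[OF t(1)] by blast
   have ps0: "poly p s0 \<noteq> 0" using s0(2) p0 k0 by auto
   obtain tt where tt: "tt \<in> {t1..t2}" "\<And>s. cmod s = tt \<Longrightarrow> cmod (poly p s0) * \<kappa> ^ degree p \<le> cmod (poly p s)"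
    using poly_min_modulus[OF t s0(1) ps0] unfolding \<kappa>_def by blast
   define rho where "rho = 1 / tt"
   have ttp: "tt > 0" using tt(1) t by auto
   have "a * tt \<le> 1" "1 \<le> b * tt" using tt(1) ab by (auto simp: t1_def t2_def field_simps)
   then have rho: "rho \<in> {a..b}" using ttp by (auto simp: rho_def pos_le_divide_eq pos_divide_le_eq)
   have rp: "rho > 0" using rho ab by auto
   have rp': "rho < cmod (x - c)" if "x \<in> Sg - {c}" for x using dl(2)[OF that] rho ab dl(1) r_pos by auto
   have klow: "cmod (A k0) * \<kappa> * \<theta> ^ n \<le> cmod (poly p s)" if s: "cmod s = tt" for s
   proof -
    have "\<kappa> * \<theta> ^ n \<le> \<kappa> * (\<kappa> powr e') ^ n" using kth kp th by (intro mult_left_mono power_mono) auto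
    also have "\<dots> = \<kappa> powr (e' * real n + 1)" using kp by (simp add: powr_add powr_powr[symmetric] powr_realpow[symmetric] mult.commute)
    also have "\<dots> \<le> \<kappa> powr (real (degree p))" using kp d degp by (intro powr_mono') auto
    also have "\<dots> = \<kappa> ^ degree p" using kp by (simp add: powr_realpow)
    finally have "cmod (A k0) * (\<kappa> * \<theta> ^ n) \<le> cmod (poly p s0) * \<kappa> ^ degree p"
     using p0 s0(2) kp th by (intro mult_mono) auto
    then show ?thesis using tt(2)[OF s] by simp
   qed
   have near: "poly p (1 / (z - c)) \<noteq> 0 \<and>
     cmod ((z - c) ^ (n + 1) * (deriv ^^ n) f z / fact n / ((-1) ^ n * (1 / (z - c)) ^ k0 * poly p (1 / (z - c))) - 1) < 1"
    if z: "cmod (z - c) = rho" for z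
   proof -
    define x where "x = z - c"
    have x: "cmod x = rho" "x \<noteq> 0" using z rp by (auto simp: x_def)
    define pv where "pv = (1 / x) ^ k0 * poly p (1 / x)"
    have s: "cmod (1 / x) = tt" using x t tt by (simp add: norm_divide rho_def)
    have pvl: "c1 * \<theta> ^ n \<le> cmod pv"
    proof -
     have "(1 / b) ^ k0 * (cmod (A k0) * \<kappa> * \<theta> ^ n) \<le> cmod (1 / x) ^ k0 * cmod (poly p (1 / x))"
      using klow[OF s] tt(1) ttp ab kp th unfolding s
      by (intro mult_mono power_mono) (auto simp: t1_def)
     then show ?thesis by (simp add: c1_def pv_def norm_mult norm_power mult_ac)
    qed
    have thn: "\<theta> ^ n > 0" using th by simp
    then have pv0: "cmod pv > 0" using pvl c1 by (smt (verit) mult_pos_pos)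
    define rz where "rz = residue (\<lambda>w. f w / (w - z) ^ (n + 1)) c"
    have e2: "cmod (x ^ (n + 1) * rz - (-1) ^ (n + 1) * pv) \<le> 2 * \<sigma> * Ms * \<theta> ^ (2 * n)"
    proof -
     have "cmod (x ^ (n + 1) * rz - (-1) ^ (n + 1) * pv) \<le> \<sigma> * Ms * (2 ^ (n + 1) * (2 * \<sigma> / rho) ^ (k0 + Suc d))"
      using residue_approx[OF ball_hol sg(1) sgR, of z Ms n "k0 + Suc d"] sg rho Ms
      unfolding A_def[symmetric] psum z x_def[symmetric] pv_def rz_def x(1) by auto
     also have "\<dots> \<le> \<sigma> * Ms * (2 * \<theta> ^ (2 * n))"
     proof (intro mult_left_mono)
      have "2 * \<sigma> / rho \<le> y" using rho ab y by (simp add: \<sigma>_def field_simps mult_left_mono)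
      then have "(2 * \<sigma> / rho) ^ (k0 + Suc d) \<le> y ^ (k0 + Suc d)" using sg rp by (intro power_mono) auto
      also have "\<dots> \<le> y ^ d" using y by (intro power_decreasing) auto
      also have "\<dots> = y powr real d" using y by (simp add: powr_realpow)
      also have "\<dots> \<le> y powr (e' * real n)" using y d by (intro powr_mono') auto
      also have "\<dots> = (y powr e') ^ n" using y by (simp add: powr_powr[symmetric] powr_realpow)
      also have "\<dots> \<le> (1 / 8) ^ n" using y by (intro power_mono) auto
      finally have "2 ^ (n + 1) * (2 * \<sigma> / rho) ^ (k0 + Suc d) \<le> 2 ^ (n + 1) * (1 / 8) ^ n" by (intro mult_left_mono) auto
      also have "\<dots> = 2 * (1 / 4) ^ n" by (simp add: power_mult_distrib[symmetric])
      also have "\<dots> \<le> 2 * \<theta> ^ (2 * n)"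
      proof -
       have "(1 / 2) ^ 2 \<le> \<theta> ^ 2" using th by (intro power_mono) auto
       then show ?thesis unfolding power_mult by (intro mult_left_mono power_mono) (auto simp: power2_eq_square)
      qed
      finally show "2 ^ (n + 1) * (2 * \<sigma> / rho) ^ (k0 + Suc d) \<le> 2 * \<theta> ^ (2 * n)" .
     qed (use sg Ms0 in auto)
     finally show ?thesis by simp
    qed
    define I where "I = contour_integral (circlepath z R0) (\<lambda>w. f w / (w - z) ^ (n + 1))"
    have wK: "w \<in> K0" if "cmod (w - z) = R0" for w
    proof -
     have wc: "w - c = (w - z) + x" by (simp add: x_def)
     have "cmod (w - c) \<le> R0 + rho" "R0 - rho \<le> cmod (w - c)"
      unfolding wc using norm_triangle_ineq[of "w - z" x] norm_diff_ineq[of "w - z" x] that x(1) by linarith+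
     then show ?thesis using rho ab by (auto simp: K0_def R0_def)
    qed
    have zb: "z \<noteq> c" using x by (auto simp: x_def)
    have bz: "w \<notin> Sg" if "w \<in> ball z (r + 3 * \<delta>) - {z, c}" for w
    proof (rule punct)
     have wc: "w - c = (w - z) + x" by (simp add: x_def)
     have "cmod (w - c) \<le> cmod (w - z) + rho" unfolding wc using norm_triangle_ineq[of "w - z" x] x(1) by linarith
     then show "cmod (w - c) \<le> 2 * r + 4 * \<delta>" using that rho ab by (auto simp: dist_norm norm_minus_commute)
    qed (use that in auto)
    have zS: "z \<notin> Sg" using punct[of z] z rp rho ab dl(1) r_pos by auto
    have cont: "continuous_on (sphere z R0) (\<lambda>w. f w / (w - z) ^ (n + 1))"
    proof -
     have "sphere z R0 \<subseteq> - Sg"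
     proof
      fix w assume "w \<in> sphere z R0"
      then have "w \<in> K0" by (intro wK) (auto simp: dist_norm norm_minus_commute)
      then have "0 < cmod (w - c)" "cmod (w - c) \<le> 2 * r + 4 * \<delta>" using dl(1) by (auto simp: K0_def)
      then show "w \<in> - Sg" using punct by blast
     qed
     then show ?thesis
      using R0 by (intro continuous_intros holomorphic_on_imp_continuous_on[OF holomorphic_on_subset[OF f_holomorphic]]) auto
    qed
    have "((\<lambda>w. f w / (w - z) ^ (n + 1)) has_contour_integral I) (circlepath z R0)"
     unfolding I_def using cont R0 by (intro has_contour_integral_integral contour_integrable_continuous_circlepath) auto
    then have Ib: "cmod I \<le> (Mf / R0 ^ (n + 1)) * (2 * pi * R0)"
    proof (rule has_contour_integral_bound_circlepath)
     fix w assume "cmod (w - z) = R0"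
     then show "cmod (f w / (w - z) ^ (n + 1)) \<le> Mf / R0 ^ (n + 1)"
      using Mf[OF wK] R0 by (simp add: norm_divide norm_mult norm_power divide_right_mono)
    qed (use Mf0 R0 in auto)
    have Ires: "I = 2 * pi * \<i> * ((deriv ^^ n) f z / fact n + rz)"
    proof -
     have "I = complex_of_real (2 * pi) * \<i> * (\<Sum>q\<in>{z, c}. winding_number (circlepath z R0) q * residue (\<lambda>w. f w / (w - z) ^ (n + 1)) q)"
      unfolding I_def
     proof (rule Residue_theorem[of "ball z (r + 3 * \<delta>)"])
      show "(\<lambda>w. f w / (w - z) ^ (n + 1)) holomorphic_on ball z (r + 3 * \<delta>) - {z, c}"
       by (intro holomorphic_intros holomorphic_on_subset[OF f_holomorphic]) (use bz in auto)
      show "path_image (circlepath z R0) \<subseteq> ball z (r + 3 * \<delta>) - {z, c}"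
       using R0 dl(1) wK[of c] by (auto simp: R0_def K0_def dist_norm norm_minus_commute)
      show "\<forall>w. w \<notin> ball z (r + 3 * \<delta>) \<longrightarrow> winding_number (circlepath z R0) w = 0"
       using R0 dl(1) by (auto intro!: winding_number_zero_outside[of _ "cball z R0"] simp: R0_def)
     qed auto
     moreover have "winding_number (circlepath z R0) z = 1" "winding_number (circlepath z R0) c = 1"
      using R0 z rho by (auto intro!: winding_number_circlepath simp: norm_minus_commute)
     moreover have "residue (\<lambda>w. f w / (w - z) ^ (n + 1)) z = (deriv ^^ n) f z / fact n"
      using residue_holomorphic_over_power[OF open_compl _ f_holomorphic, of z n] zS by simp
     ultimately show ?thesis using zb by (simp add: rz_def)
    qed
    define Fn where "Fn = x ^ (n + 1) * (deriv ^^ n) f z / fact n"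
    have "Fn - (-1) ^ n * pv = x ^ (n + 1) * (I / (2 * pi * \<i>)) - (x ^ (n + 1) * rz - (-1) ^ (n + 1) * pv)"
    proof -
     have "I / (2 * pi * \<i>) = (deriv ^^ n) f z / fact n + rz" unfolding Ires by simp
     then show ?thesis unfolding Fn_def by (simp only:) (simp add: algebra_simps)
    qed
    also have "cmod \<dots> \<le> cmod (x ^ (n + 1) * (I / (2 * pi * \<i>))) + cmod (x ^ (n + 1) * rz - (-1) ^ (n + 1) * pv)"
     by (rule norm_triangle_ineq4)
    also have "cmod (x ^ (n + 1) * (I / (2 * pi * \<i>))) \<le> b * Mf * \<theta> ^ (2 * n)"
    proof -
     have "cmod (x ^ (n + 1) * (I / (2 * pi * \<i>))) = rho ^ (n + 1) * (cmod I / (2 * pi))"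
      using x by (simp add: norm_mult norm_divide norm_power)
     also have "\<dots> \<le> rho ^ (n + 1) * ((Mf / R0 ^ (n + 1)) * (2 * pi * R0) / (2 * pi))"
      using Ib rp by (intro mult_left_mono divide_right_mono) auto
     also have "\<dots> = rho * Mf * (rho / R0) ^ n" using R0 by (simp add: power_divide)
     also have "\<dots> \<le> b * Mf * (\<theta> ^ 2) ^ n"
     proof (intro mult_mono power_mono)
      have "rho / R0 \<le> b / R0" using rho R0 by (intro divide_right_mono) auto
      then show "rho / R0 \<le> \<theta> ^ 2" using th(3) by linarith
     qed (use rho rp ab R0 Mf0 in auto)
     finally show ?thesis by (simp add: power_mult)
    qed
    also note e2
    finally have "cmod (Fn - (-1) ^ n * pv) \<le> C2 * \<theta> ^ (2 * n)" by (simp add: C2_def algebra_simps)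
    also have "\<dots> = (C2 * \<theta> ^ n) * \<theta> ^ n" by (simp add: mult_2 power_add)
    also have "\<dots> < c1 * \<theta> ^ n" using elim thn by (intro mult_strict_right_mono) auto
    also note pvl
    finally have lt: "cmod (Fn - (-1) ^ n * pv) < cmod pv" .
    have "Fn / ((-1) ^ n * pv) - 1 = (Fn - (-1) ^ n * pv) / ((-1) ^ n * pv)" using pv0 by (simp add: diff_divide_distrib)
    then have "cmod (Fn / ((-1) ^ n * pv) - 1) = cmod (Fn - (-1) ^ n * pv) / cmod pv" by (simp add: norm_divide norm_mult norm_power)
    also have "\<dots> < 1" using lt pv0 by simp
    finally have "cmod (Fn / ((-1) ^ n * pv) - 1) < 1" .
    moreover have "poly p (1 / x) \<noteq> 0" using pv0 by (auto simp: pv_def)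
    ultimately show ?thesis unfolding Fn_def pv_def x_def[symmetric] by (simp add: mult.assoc)
   qed
   have "\<bar>real (disc_count c rho (B n)) - real m * real n\<bar> \<le> real (degree p + degree Q + 1 + k0 + degree (PT P T))"
    by (rule count_from_approx[OF rp rp']) (use near in auto)
   also have "\<dots> \<le> real d + real (degree Q + 1 + k0 + degree (PT P T))" using degp by simp
   also have "\<dots> \<le> e * real n + CQ"
    using d(2) mult_right_mono[OF e'(2), of "real n"] unfolding CQ_def by simp
   finally show "\<exists>rho\<in>{a..b}. \<bar>real (disc_count c rho (B n)) - real m * real n\<bar> \<le> e * real n + CQ"
    using rho by blast
  qed
 qed
qed

text \<open>The count is monotone in the radius, so radii depending on n are good enough: one in
  [r - delta, r] and one in [r, r + delta].\<close>

theorem count_disc: "(\<lambda>n. (real (disc_count c r (B n)) - real m * real n) / real n) \<longlonglongrightarrow> 0"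
proof -
 obtain \<delta> where dl: "\<delta> > 0" "\<delta> < r" "\<And>a. a \<in> Sg - {c} \<Longrightarrow> cmod (a - c) > 2 * r + 4 * \<delta>"
 proof -
  \<comment> \<open>The entry 6 r covers the case without further singular points and keeps delta
    below r.\<close>
  define D where "D = insert (6 * r) ((\<lambda>a. cmod (a - c)) ` (Sg - {c}))"
  have fD: "finite D" "D \<noteq> {}" using finite_Sg by (auto simp: D_def)
  have "Min D > 2 * r" using fD r_pos sing_dist by (auto simp: D_def)
  moreover have "cmod (a - c) \<ge> Min D" if "a \<in> Sg - {c}" for a using fD that by (intro Min_le) (auto simp: D_def)
  moreover have "Min D \<le> 6 * r" using fD by (intro Min_le) (auto simp: D_def)
  ultimately have MD: "2 * r < Min D" "Min D \<le> 6 * r" "\<And>a. a \<in> Sg - {c} \<Longrightarrow> Min D \<le> cmod (a - c)"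
   by blast+
  define \<delta> where "\<delta> = (Min D - 2 * r) / 8"
  have D8: "Min D = 2 * r + 8 * \<delta>" unfolding \<delta>_def by (simp add: field_simps)
  show ?thesis
  proof (rule that)
   show d0: "\<delta> > 0" using MD(1) by (simp add: \<delta>_def)
   show "\<delta> < r" using MD(2) D8 r_pos by linarith
   show "cmod (w - c) > 2 * r + 4 * \<delta>" if "w \<in> Sg - {c}" for w
    using MD(3)[OF that] d0 unfolding D8 by linarith
  qed
 qed
 obtain C1 where C1: "\<And>e. e > 0 \<Longrightarrow> \<forall>\<^sub>F n in sequentially. \<exists>rho\<in>{r - \<delta>..r}. \<bar>real (disc_count c rho (B n)) - real m * real n\<bar> \<le> e * real n + C1"
  using count_on_interval[OF dl(1,3), of "r - \<delta>" r] dl by auto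
 obtain C2 where C2: "\<And>e. e > 0 \<Longrightarrow> \<forall>\<^sub>F n in sequentially. \<exists>rho\<in>{r..r + \<delta>}. \<bar>real (disc_count c rho (B n)) - real m * real n\<bar> \<le> e * real n + C2"
  using count_on_interval[OF dl(1,3), of r "r + \<delta>"] dl r_pos by auto
 show ?thesis
 proof (rule tendstoI)
  fix e :: real assume e: "e > 0"
  define C where "C = max C1 C2"
  have "(\<lambda>n. C / real n) \<longlonglongrightarrow> 0" by (intro tendsto_divide_0[OF tendsto_const] filterlim_real_sequentially filterlim_at_top_imp_at_infinity)
  then have "\<forall>\<^sub>F n in sequentially. C / real n < e / 2" using e by (intro order_tendstoD(2)[where y = 0]) auto
  note cn = this
  have e2: "e / 2 > 0" using e by simp
  show "\<forall>\<^sub>F n in sequentially. dist ((real (disc_count c r (B n)) - real m * real n) / real n) 0 < e"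
   using cn eventually_gt_at_top[of "0::nat"] C1[OF e2] C2[OF e2]
  proof eventually_elim
   case (elim n)
   have n: "real n > 0" using elim by simp
   obtain r1 where r1: "r1 \<in> {r - \<delta>..r}" "\<bar>real (disc_count c r1 (B n)) - real m * real n\<bar> \<le> e / 2 * real n + C1" using elim e by auto
   obtain r2 where r2: "r2 \<in> {r..r + \<delta>}" "\<bar>real (disc_count c r2 (B n)) - real m * real n\<bar> \<le> e / 2 * real n + C2" using elim e by auto
   have "disc_count c r1 (B n) \<le> disc_count c r (B n)" "disc_count c r (B n) \<le> disc_count c r2 (B n)"
    using r1 r2 B_nz by (auto intro: disc_count_mono)
   then have "real (disc_count c r1 (B n)) \<le> real (disc_count c r (B n))" "real (disc_count c r (B n)) \<le> real (disc_count c r2 (B n))"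
    by auto
   then have "\<bar>real (disc_count c r (B n)) - real m * real n\<bar> \<le> e / 2 * real n + C"
    using r1(2) r2(2) unfolding C_def by linarith
   also have "\<dots> < e * real n" using elim n by (simp add: field_simps)
   finally show ?case using n by (simp add: dist_norm field_simps)
  qed
 qed
qed

end

section \<open>Tools from complex analysis\<close>

text \<open>The set where |h| > b is open and contained in the compact F, so its boundary lies
  inside D and carries |h| <= b. The maximum principle on that set shows it to be empty.\<close>

lemma maximum_modulus_relative_compact:
 assumes D: "open D" "h holomorphic_on D" and F: "compact F" "F \<subseteq> D"
  and out: "\<And>z. z \<in> D - F \<Longrightarrow> cmod (h z) \<le> b" and z: "z \<in> D"
 shows "cmod (h z) \<le> b"
proof (rule ccontr)
 assume zb: "\<not> cmod (h z) \<le> b"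
 define Z where "Z = {w \<in> D. cmod (h w) > b}"
 have cont: "continuous_on D h" by (rule holomorphic_on_imp_continuous_on[OF D(2)])
 have ZF: "Z \<subseteq> F" using out by (force simp: Z_def)
 have "open (D \<inter> (\<lambda>w. cmod (h w)) -` {b<..})"
  by (rule continuous_open_preimage[OF _ D(1)]) (intro continuous_intros cont, simp)
 moreover have "D \<inter> (\<lambda>w. cmod (h w)) -` {b<..} = Z" by (auto simp: Z_def)
 ultimately have oZ: "open Z" by simp
 have cl: "closure Z \<subseteq> F" using ZF compact_imp_closed[OF F(1)] by (rule closure_minimal)
 have "cmod (h z) \<le> b"
 proof (rule maximum_modulus_frontier[of h Z])
  show "h holomorphic_on interior Z"
   by (rule holomorphic_on_subset[OF D(2)]) (use cl F(2) interior_subset[of Z] closure_subset[of Z] in blast)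
  show "continuous_on (closure Z) h" by (rule continuous_on_subset[OF cont]) (use cl F(2) in blast)
  show "bounded Z" by (rule bounded_subset[OF compact_imp_bounded[OF F(1)] ZF])
  show "z \<in> Z" using z zb by (simp add: Z_def)
  show "cmod (h w) \<le> b" if "w \<in> frontier Z" for w
  proof -
   have "w \<in> closure Z - Z" using that oZ by (simp add: frontier_def interior_open)
   then show ?thesis using cl F(2) by (auto simp: Z_def)
  qed
 qed
 with zb show False by simp
qed

text \<open>Dividing by a Blaschke factor does not enlarge the bound b. The factor has modulus 1
  only on the unit circle, which is out of reach; on |z| = t the error is a factor 1 + (1 - t^2)/(t
  - t0), and t tends to 1.\<close>

lemma blaschke_quotient_bound:
 fixes k :: "complex \<Rightarrow> complex"
 assumes k: "k holomorphic_on ball 0 1" and a: "cmod a < 1"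
  and b: "\<And>w. cmod w < 1 \<Longrightarrow> cmod (k w * (w - a)) \<le> b * cmod (1 - cnj a * w)"
  and w: "cmod w < 1"
 shows "cmod (k w) \<le> b"
proof -
 define t0 where "t0 = max (cmod w) (cmod a)"
 have t0: "t0 < 1" "cmod w \<le> t0" "cmod a \<le> t0" "0 \<le> t0" using a w by (auto simp: t0_def le_max_iff_disj)
 have b0: "b \<ge> 0"
 proof -
  have "0 \<le> cmod (k 0 * (0 - a))" by simp
  also have "\<dots> \<le> b * cmod (1 - cnj a * 0)" by (rule b) simp
  finally show ?thesis by simp
 qed
 have est: "cmod (k w) \<le> b * (1 + (1 - t ^ 2) / (t - t0))" if t: "t0 < t" "t < 1" for t
 proof (rule maximum_modulus_frontier[of k "ball 0 t"])
  show "k holomorphic_on interior (ball 0 t)" by (rule holomorphic_on_subset[OF k]) (use t in auto)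
  have "closure (ball (0::complex) t) \<subseteq> ball 0 1" using t t0 by (simp add: subset_eq)
  then show "continuous_on (closure (ball 0 t)) k"
   by (rule continuous_on_subset[OF holomorphic_on_imp_continuous_on[OF k]])
  show "w \<in> ball 0 t" using t t0 by auto
  show "cmod (k z) \<le> b * (1 + (1 - t ^ 2) / (t - t0))" if "z \<in> frontier (ball 0 t)" for z
  proof -
   have z: "cmod z = t" using that t t0 by (simp add: frontier_ball)
   have za: "cmod (z - a) \<ge> t - t0" using norm_triangle_ineq2[of z a] z t0 by linarith
   then have za0: "cmod (z - a) > 0" using t by linarith
   \<comment> \<open>On |z| = t one has 1 - conj(a) z = (1 - t^2) + z conj(z - a), where the last
     term is at most |z - a|.\<close>
   have zz: "z * cnj z = of_real (t ^ 2)" using complex_norm_square[of z] z by simp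
   have "1 - cnj a * z = of_real (1 - t ^ 2) + z * cnj (z - a)"
    using zz by (simp add: algebra_simps)
   then have "cmod (1 - cnj a * z) \<le> cmod (of_real (1 - t ^ 2)) + cmod (z * cnj (z - a))"
    by (metis norm_triangle_ineq)
   also have "cmod (of_real (1 - t ^ 2)) = 1 - t ^ 2"
    unfolding norm_of_real using t t0 by (simp add: power_le_one)
   also have "cmod (z * cnj (z - a)) \<le> cmod (z - a)"
    unfolding norm_mult complex_mod_cnj z using t t0 by (intro mult_left_le_one_le) auto
   finally have 1: "cmod (1 - cnj a * z) \<le> (1 - t ^ 2) + cmod (z - a)" by simp
   have "(1 - t ^ 2) \<le> (1 - t ^ 2) / (t - t0) * cmod (z - a)"
   proof -
    have "(1 - t ^ 2) = (1 - t ^ 2) / (t - t0) * (t - t0)" using t by simp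
    also have "\<dots> \<le> (1 - t ^ 2) / (t - t0) * cmod (z - a)"
     using za t t0 by (intro mult_left_mono divide_nonneg_nonneg) (auto simp: power_le_one)
    finally show ?thesis .
   qed
   with 1 have "cmod (1 - cnj a * z) \<le> (1 + (1 - t ^ 2) / (t - t0)) * cmod (z - a)"
    unfolding distrib_right by linarith
   then have "b * cmod (1 - cnj a * z) \<le> b * ((1 + (1 - t ^ 2) / (t - t0)) * cmod (z - a))"
    using b0 by (rule mult_left_mono)
   moreover have "cmod (k z) * cmod (z - a) \<le> b * cmod (1 - cnj a * z)"
    using b[of z] z t by (simp add: norm_mult)
   ultimately have "cmod (k z) * cmod (z - a) \<le> (b * (1 + (1 - t ^ 2) / (t - t0))) * cmod (z - a)"
    by (simp add: mult.assoc)
   then show ?thesis using za0 by (rule mult_right_le_imp_le)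
  qed
 qed simp
 have "((\<lambda>t. b * (1 + (1 - t ^ 2) / (t - t0))) \<longlongrightarrow> b * (1 + (1 - 1 ^ 2) / (1 - t0))) (at_left 1)"
  using t0 by (intro tendsto_intros) auto
 then have "((\<lambda>t. b * (1 + (1 - t ^ 2) / (t - t0))) \<longlongrightarrow> b) (at_left 1)" by simp
 moreover have "\<forall>\<^sub>F t in at_left 1. cmod (k w) \<le> b * (1 + (1 - t ^ 2) / (t - t0))"
  unfolding eventually_at_left[OF t0(1)] using t0 est by (intro exI[of _ t0]) auto
 ultimately show ?thesis by (rule tendsto_lowerbound) simp
qed

text \<open>Jensen's inequality in Blaschke form: each zero in the multiset improves the bound at w0
  by its pseudo-hyperbolic distance from w0, at most q. The factors are psi w - psi a because psi
  will be a Riemann map; the difference quotient \<open>d\<close> converts them to w - a.\<close>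

lemma jensen_disc:
 fixes \<psi> h :: "complex \<Rightarrow> complex"
 assumes psi: "\<psi> holomorphic_on ball 0 1" and w0: "cmod w0 < 1" and q: "0 \<le> q"
  and A: "\<And>a. a \<in># Z \<Longrightarrow> cmod a < 1 \<and> cmod (w0 - a) \<le> q * cmod (1 - cnj a * w0)"
  and h: "h holomorphic_on ball 0 1"
  and b: "\<And>w. cmod w < 1 \<Longrightarrow> cmod ((\<Prod>a\<in>#Z. \<psi> w - \<psi> a) * h w) \<le> b"
 shows "cmod ((\<Prod>a\<in>#Z. \<psi> w0 - \<psi> a) * h w0) \<le> b * q ^ size Z"
 using A h b
proof (induction Z arbitrary: h)
 case empty
 then show ?case using w0 by simp
next
 case (add a Z)
 have a: "cmod a < 1" "cmod (w0 - a) \<le> q * cmod (1 - cnj a * w0)" using add.prems(1)[of a] by auto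
 have nz: "1 - cnj a * w \<noteq> 0" if "cmod w < 1" for w
 proof
  assume "1 - cnj a * w = 0"
  then have "cnj a * w = 1" by simp
  then have "cmod a * cmod w = 1" by (metis complex_mod_cnj norm_mult norm_one)
  moreover have "cmod a * cmod w \<le> cmod a * 1" using that by (intro mult_left_mono) auto
  ultimately show False using a(1) by linarith
 qed
 define d where "d w = (if w = a then deriv \<psi> a else (\<psi> w - \<psi> a) / (w - a))" for w
 have dh: "d holomorphic_on ball 0 1" unfolding d_def by (rule pole_lemma_open[OF psi open_ball])
 have dm: "d w * (w - a) = \<psi> w - \<psi> a" for w by (simp add: d_def)
 define h' where "h' w = d w * (1 - cnj a * w) * h w" for w
 have h': "h' holomorphic_on ball 0 1" unfolding h'_def by (intro holomorphic_intros dh add.prems)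
 define k where "k w = (\<Prod>x\<in>#Z. \<psi> w - \<psi> x) * h' w" for w
 have kh: "k holomorphic_on ball 0 1"
 proof -
  have "(\<lambda>w. \<Prod>x\<in>#Z. \<psi> w - \<psi> x) holomorphic_on ball 0 1"
   by (induction Z) (auto intro!: holomorphic_intros psi)
  then show ?thesis unfolding k_def by (intro holomorphic_intros h')
 qed
 have kg: "k w * (w - a) = (\<Prod>x\<in>#add_mset a Z. \<psi> w - \<psi> x) * h w * (1 - cnj a * w)" for w
  using dm[of w] by (simp add: k_def h'_def mult_ac)
 have kb: "cmod (k w) \<le> b" if w: "cmod w < 1" for w
 proof (rule blaschke_quotient_bound[OF kh a(1) _ w])
  fix w :: complex assume "cmod w < 1"
  then have "cmod ((\<Prod>x\<in>#add_mset a Z. \<psi> w - \<psi> x) * h w) \<le> b" by (rule add.prems(3))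
  then show "cmod (k w * (w - a)) \<le> b * cmod (1 - cnj a * w)"
   unfolding kg norm_mult[of _ "1 - cnj a * w"] by (rule mult_right_mono) simp
 qed
 have IH: "cmod (k w0) \<le> b * q ^ size Z"
  unfolding k_def by (rule add.IH) (use add.prems(1) h' kb k_def in auto)
 have n0: "cmod (1 - cnj a * w0) > 0" using nz[OF w0] by simp
 have "cmod ((\<Prod>x\<in>#add_mset a Z. \<psi> w0 - \<psi> x) * h w0) * cmod (1 - cnj a * w0) = cmod (k w0) * cmod (w0 - a)"
  unfolding norm_mult[symmetric] kg ..
 also have "\<dots> \<le> (b * q ^ size Z) * (q * cmod (1 - cnj a * w0))"
  by (rule mult_mono) (use IH a order_trans[OF norm_ge_zero IH] in auto)
 also have "\<dots> = (b * q ^ size (add_mset a Z)) * cmod (1 - cnj a * w0)" by simp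
 finally show ?case using n0 by (rule mult_right_le_imp_le)
qed

text \<open>\<open>jensen_disc\<close> carried over by the Riemann map, with q at least every
  pseudo-hyperbolic distance between the images of z0 and of points of K. It depends on G, z0 and K
  only, hence serves all n at once.\<close>

lemma zero_count_compact:
 fixes G K :: "complex set"
 assumes G: "open G" "simply_connected G" "G \<noteq> UNIV" "z0 \<in> G" and K: "compact K" "K \<subseteq> G"
 obtains q where "0 < q" "q < 1"
  "\<And>Z h b. \<lbrakk>set_mset Z \<subseteq> K; h holomorphic_on G; \<And>z. z \<in> G \<Longrightarrow> cmod ((\<Prod>y\<in>#Z. z - y) * h z) \<le> b\<rbrakk>
    \<Longrightarrow> cmod ((\<Prod>y\<in>#Z. z0 - y) * h z0) \<le> b * q ^ size Z"
proof -
 obtain \<phi> \<psi> where phi: "\<phi> holomorphic_on G" and psi: "\<psi> holomorphic_on ball 0 1"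
  and pg: "\<And>z. z \<in> G \<Longrightarrow> \<phi> z \<in> ball 0 1 \<and> \<psi> (\<phi> z) = z"
  and gp: "\<And>w. w \<in> ball 0 1 \<Longrightarrow> \<psi> w \<in> G \<and> \<phi> (\<psi> w) = w"
 proof -
  have "\<exists>f g. f holomorphic_on G \<and> g holomorphic_on ball 0 1 \<and> (\<forall>z\<in>G. f z \<in> ball 0 1 \<and> g (f z) = z) \<and>
    (\<forall>z\<in>ball 0 1. g z \<in> G \<and> f (g z) = z)"
   using Riemann_mapping_theorem[of G] G by blast
  then show ?thesis using that by blast
 qed
 define w0 where "w0 = \<phi> z0"
 have w0: "cmod w0 < 1" "\<psi> w0 = z0" using pg[OF G(4)] by (auto simp: w0_def)
 define t where "t y = cmod ((w0 - \<phi> y) / (1 - cnj (\<phi> y) * w0))" for y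
 have nz: "1 - cnj a * w0 \<noteq> 0" if "cmod a < 1" for a
 proof
  assume "1 - cnj a * w0 = 0"
  then have "cnj a * w0 = 1" by simp
  then have "cmod a * cmod w0 = 1" by (metis complex_mod_cnj norm_mult norm_one)
  moreover have "cmod a * cmod w0 \<le> cmod a * 1" using w0 by (intro mult_left_mono) auto
  ultimately show False using that by linarith
 qed
 have t1: "t y < 1" if y: "y \<in> G" for y
 proof -
  define a where "a = \<phi> y"
  have a: "cmod a < 1" using pg[OF y] by (simp add: a_def)
  have "cmod (1 - cnj a * w0) ^ 2 - cmod (w0 - a) ^ 2 = (1 - cmod a ^ 2) * (1 - cmod w0 ^ 2)"
   unfolding cmod_power2 by (simp add: power2_eq_square algebra_simps)
  moreover have "(1 - cmod a ^ 2) * (1 - cmod w0 ^ 2) > 0"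
   using a w0 by (intro mult_pos_pos) (auto simp: power_less_one_iff abs_square_less_1)
  ultimately have "cmod (w0 - a) ^ 2 < cmod (1 - cnj a * w0) ^ 2" by linarith
  then have "cmod (w0 - a) < cmod (1 - cnj a * w0)" by (rule power_less_imp_less_base) simp
  then show ?thesis using nz[OF a] by (simp add: t_def norm_divide a_def)
 qed
 have ct: "continuous_on K t"
  unfolding t_def
  using nz pg K(2) by (intro continuous_intros continuous_on_subset[OF holomorphic_on_imp_continuous_on[OF phi]]) auto
 obtain q where q: "0 < q" "q < 1" "\<And>y. y \<in> K \<Longrightarrow> t y \<le> q"
 proof (cases "K = {}")
  case True
  then show ?thesis using that[of "1 / 2"] by simp
 next
  case False
  obtain y where y: "y \<in> K" "\<And>x. x \<in> K \<Longrightarrow> t x \<le> t y"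
   using continuous_attains_sup[OF K(1) False ct] by auto
  show ?thesis
  proof (rule that[of "max (t y) (1 / 2)"])
   show "max (t y) (1 / 2) < 1" using t1[of y] y(1) K(2) by auto
  qed (use y in \<open>auto simp: le_max_iff_disj\<close>)
 qed
 show ?thesis
 proof (rule that[OF q(1,2)])
  fix Z h and b :: real
  assume Z: "set_mset Z \<subseteq> K" and h: "h holomorphic_on G"
   and b: "\<And>z. z \<in> G \<Longrightarrow> cmod ((\<Prod>y\<in>#Z. z - y) * h z) \<le> b"
  have ZG: "\<psi> (\<phi> y) = y" "cmod (\<phi> y) < 1" if "y \<in># Z" for y using that Z K(2) pg[of y] by auto
  have pr: "(\<Prod>a\<in>#image_mset \<phi> Z. \<psi> w - \<psi> a) = (\<Prod>y\<in>#Z. \<psi> w - y)" for w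
   using ZG(1) by (simp add: image_mset.compositionality comp_def cong: image_mset_cong)
  have "cmod ((\<Prod>a\<in>#image_mset \<phi> Z. \<psi> w0 - \<psi> a) * (h \<circ> \<psi>) w0) \<le> b * q ^ size (image_mset \<phi> Z)"
  proof (rule jensen_disc[OF psi w0(1)])
   show "cmod a < 1 \<and> cmod (w0 - a) \<le> q * cmod (1 - cnj a * w0)" if aZ: "a \<in># image_mset \<phi> Z" for a
   proof -
    obtain y where y: "y \<in># Z" "a = \<phi> y" using aZ unfolding in_image_mset by blast
    have "t y \<le> q" using q(3) y(1) Z by auto
    then have "cmod (w0 - a) / cmod (1 - cnj a * w0) \<le> q" by (simp add: t_def y(2) norm_divide)
    then show ?thesis using nz[of a] ZG(2)[OF y(1)] y(2) by (simp add: pos_divide_le_eq)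
   qed
   show "(h \<circ> \<psi>) holomorphic_on ball 0 1"
    by (rule holomorphic_on_compose_gen[OF psi h]) (use gp in blast)
   show "cmod ((\<Prod>a\<in>#image_mset \<phi> Z. \<psi> w - \<psi> a) * (h \<circ> \<psi>) w) \<le> b" if "cmod w < 1" for w
    unfolding pr comp_def using b[of "\<psi> w"] gp[of w] that by simp
  qed (use q in auto)
  then show "cmod ((\<Prod>y\<in>#Z. z0 - y) * h z0) \<le> b * q ^ size Z" unfolding pr by (simp add: w0)
 qed
qed

text \<open>Borel-Caratheodory for p = log (h / h(0)): since Re p < A, the Schwarz lemma applies to
  p / (2 A - p) and gives |p| <= 2 A on the disc of half the radius; Cauchy's inequality with radius
  rho/4 yields 8 A / rho.\<close>

lemma log_deriv_bound:
 fixes h :: "complex \<Rightarrow> complex"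
 assumes h: "h holomorphic_on ball 0 rho" and nz: "\<And>z. cmod z < rho \<Longrightarrow> h z \<noteq> 0" and r: "rho > 0"
  and b: "\<And>z. cmod z < rho \<Longrightarrow> cmod (h z) < cmod (h 0) * exp A"
  and z: "cmod z \<le> rho / 4"
 shows "cmod (deriv h z / h z) \<le> 8 * A / rho"
proof -
 have A0: "A > 0"
 proof -
  have "cmod (h 0) * 1 < cmod (h 0) * exp A" using b[of 0] r by simp
  moreover have "cmod (h 0) > 0" using nz[of 0] r by simp
  ultimately have "1 < exp A" by (metis mult_less_cancel_left_pos)
  then show ?thesis by simp
 qed
 have "contractible (ball (0::complex) rho)" by (simp add: convex_imp_contractible)
 then obtain l where l: "l holomorphic_on ball 0 rho" "\<And>z. z \<in> ball 0 rho \<Longrightarrow> h z = exp (l z)"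
  using contractible_imp_holomorphic_log[OF h] nz by (auto simp: dist_norm)
 define p where "p w = l w - l 0" for w
 have ph: "p holomorphic_on ball 0 rho" unfolding p_def by (intro holomorphic_intros l)
 have Rp: "Re (p w) < A" if "cmod w < rho" for w
 proof -
  have "exp (Re (l w)) < exp (Re (l 0)) * exp A"
   using b[OF that] l(2)[of w] l(2)[of 0] that r by simp
  then show ?thesis unfolding exp_add[symmetric] by (simp add: p_def)
 qed
 have lt: "cmod (p w) < cmod (2 * of_real A - p w)" if "cmod w < rho" for w
 proof -
  have "cmod (2 * of_real A - p w) ^ 2 - cmod (p w) ^ 2 = 4 * A * (A - Re (p w))"
   unfolding cmod_power2 by (simp add: power2_eq_square algebra_simps)
  moreover have "4 * A * (A - Re (p w)) > 0" using A0 Rp[OF that] by simp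
  ultimately have "cmod (p w) ^ 2 < cmod (2 * of_real A - p w) ^ 2" by linarith
  then show ?thesis by (rule power_less_imp_less_base) simp
 qed
 have dnz: "2 * of_real A - p w \<noteq> 0" if "cmod w < rho" for w using lt[OF that] by auto
 define k where "k w = p (of_real rho * w) / (2 * of_real A - p (of_real rho * w))" for w
 have sc: "cmod (of_real rho * w) < rho" if "cmod w < 1" for w :: complex
  using that r by (simp add: norm_mult)
 have kh: "k holomorphic_on ball 0 1"
 proof -
  have "p \<circ> (\<lambda>w. of_real rho * w) holomorphic_on ball 0 1"
   by (rule holomorphic_on_compose_gen[OF _ ph]) (use sc in \<open>auto intro!: holomorphic_intros simp: dist_norm\<close>)
  then have "(\<lambda>w. p (of_real rho * w)) holomorphic_on ball 0 1" by (simp add: comp_def)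
  then show ?thesis unfolding k_def using dnz sc by (intro holomorphic_intros) auto
 qed
 have kb: "cmod (k w) \<le> cmod w" if w: "cmod w < 1" for w
 proof (rule Schwarz_Lemma(1)[OF kh _ _ w])
  show "k 0 = 0" by (simp add: k_def p_def)
  show "cmod (k x) < 1" if "cmod x < 1" for x
   using lt[OF sc[OF that]] dnz[OF sc[OF that]] by (simp add: k_def norm_divide)
 qed
 have pb: "cmod (p w) \<le> 2 * A" if w: "cmod w \<le> rho / 2" for w
 proof -
  define u where "u = w / of_real rho"
  have u: "of_real rho * u = w" using r by (simp add: u_def)
  have u2: "cmod u \<le> 1 / 2" using w r by (simp add: u_def norm_divide field_simps)
  have "cmod (k u) \<le> 1 / 2" using kb[of u] u2 by linarith
  moreover have "k u * (2 * of_real A - p w) = p w"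
   using dnz[of w] w r by (simp add: k_def u)
  ultimately have "cmod (p w) \<le> 1 / 2 * cmod (2 * of_real A - p w)"
   by (metis mult_right_mono norm_ge_zero norm_mult)
  moreover have "cmod (2 * of_real A - p w) \<le> 2 * A + cmod (p w)"
   using norm_triangle_ineq4[of "2 * of_real A" "p w"] A0 by (simp add: norm_mult)
  ultimately show ?thesis by linarith
 qed
 have zin: "cmod w < rho" if "w \<in> cball z (rho / 4)" for w
  using that z r norm_triangle_sub[of w z] by (auto simp: dist_norm norm_minus_commute)
 have sub: "cball z (rho / 4) \<subseteq> ball 0 rho" using zin by (auto simp: dist_norm)
 have "cmod ((deriv ^^ 1) p z) \<le> fact 1 * (2 * A) / (rho / 4) ^ 1"
 proof (rule Cauchy_inequality)
  show "p holomorphic_on ball z (rho / 4)"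
   by (rule holomorphic_on_subset[OF ph]) (use sub ball_subset_cball[of z "rho / 4"] in blast)
  show "continuous_on (cball z (rho / 4)) p"
   by (rule continuous_on_subset[OF holomorphic_on_imp_continuous_on[OF ph] sub])
  show "cmod (p x) \<le> 2 * A" if "cmod (z - x) = rho / 4" for x
   using that z norm_triangle_ineq2[of x z] by (intro pb) (simp add: norm_minus_commute)
 qed (use r in auto)
 then have dp: "cmod (deriv p z) \<le> 8 * A / rho" by simp
 have zr: "z \<in> ball 0 rho" using z r by (auto simp: dist_norm)
 have dl: "(l has_field_derivative deriv l z) (at z)" using l(1) zr by (intro holomorphic_derivI) auto
 have "deriv p z = deriv l z"
  unfolding p_def by (rule DERIV_imp_deriv) (use dl in \<open>auto intro!: derivative_eq_intros\<close>)
 moreover have "deriv h z = exp (l z) * deriv l z"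
 proof (rule DERIV_imp_deriv)
  have "((\<lambda>z. exp (l z)) has_field_derivative exp (l z) * deriv l z) (at z)"
   using dl by (auto intro!: derivative_eq_intros)
  then show "(h has_field_derivative exp (l z) * deriv l z) (at z)"
   by (rule has_field_derivative_transform_within_open[OF _ open_ball zr]) (use l(2) in auto)
 qed
 ultimately have "deriv h z / h z = deriv p z" using l(2)[OF zr] by simp
 with dp show ?thesis by simp
qed

text \<open>Uniform convergence near 0 passes to all derivatives at 0, by Weierstrass.\<close>

lemma power_series_coeff_limit:
 fixes a :: "nat \<Rightarrow> nat \<Rightarrow> complex"
 assumes r: "rho > 0"
  and g: "\<And>n z. cmod z < rho \<Longrightarrow> (\<lambda>j. a n j * z ^ j) sums g n z" "\<And>n. g n holomorphic_on ball 0 rho"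
  and G: "\<And>z. cmod z < rho \<Longrightarrow> (\<lambda>j. b j * z ^ j) sums G z"
  and lim: "uniform_limit (ball 0 rho) g G sequentially"
 shows "(\<lambda>n. a n j) \<longlonglongrightarrow> b j"
proof -
 have coeff: "x j = (deriv ^^ j) k 0 / fact j"
  if k: "\<And>z. cmod z < rho \<Longrightarrow> (\<lambda>j. x j * z ^ j) sums k z" for x and k :: "complex \<Rightarrow> complex"
 proof -
  define F where "F = Abs_fps x"
  have "conv_radius x \<ge> norm (of_real (rho / 2) :: complex)"
   by (rule conv_radius_geI) (use k[of "of_real (rho / 2)"] r in \<open>auto simp: sums_iff\<close>)
  moreover have "norm (of_real (rho / 2) :: complex) = rho / 2" using r by simp
  ultimately have "conv_radius x \<ge> ereal (rho / 2)" by metis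
  moreover have "ereal (rho / 2) > 0" using r by simp
  ultimately have cr: "fps_conv_radius F > 0"
   unfolding fps_conv_radius_def F_def by (simp add: Abs_fps_inverse less_le_trans[of 0 "ereal (rho / 2)"])
  have "fps_nth F j = (deriv ^^ j) (eval_fps F) 0 / fact j" by (rule fps_nth_conv_deriv[OF cr])
  also have "(deriv ^^ j) (eval_fps F) 0 = (deriv ^^ j) k 0"
  proof (rule higher_deriv_cong_ev)
   have "\<forall>\<^sub>F z in nhds 0. z \<in> ball 0 rho" using r by (intro eventually_nhds_in_open) auto
   then show "\<forall>\<^sub>F z in nhds 0. eval_fps F z = k z"
    by eventually_elim (use k in \<open>auto simp: eval_fps_def F_def sums_iff dist_norm\<close>)
  qed simp
  finally show ?thesis by (simp add: F_def)
 qed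
 have "(\<lambda>n. (deriv ^^ j) (g n) 0) \<longlonglongrightarrow> (deriv ^^ j) G 0"
  by (rule higher_deriv_complex_uniform_limit[OF lim]) (use g(2) r in auto)
 then have "(\<lambda>n. (deriv ^^ j) (g n) 0 / fact j) \<longlonglongrightarrow> (deriv ^^ j) G 0 / fact j" by (intro tendsto_divide) auto
 then show ?thesis using coeff[of "a n" "g n" for n] coeff[of b G] g(1) G by simp
qed

text \<open>A weak form of Stirling's upper bound; the induction step is (1 + 1/x)^(x+1) >=
  e.\<close>

lemma fact_exp_le: "fact n * exp (real n) \<le> exp 1 * real n * real n ^ n" if "n \<ge> 1"
 using that
proof (induction n rule: dec_induct)
 case (step n)
 define x where "x = real n"
 have x: "x \<ge> 1" using step by (simp add: x_def)
 have "1 - 1 / (1 + 1 / x) \<le> ln (1 + 1 / x)"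
 proof -
  have xp: "1 + 1 / x > 0" using x by (simp add: add_pos_pos)
  then have "ln (1 / (1 + 1 / x)) = - ln (1 + 1 / x)" using ln_inverse[of "1 + 1 / x"] by (simp only: inverse_eq_divide)
  moreover have "ln (1 / (1 + 1 / x)) \<le> 1 / (1 + 1 / x) - 1" using xp by (intro ln_le_minus_one) simp
  ultimately show ?thesis by linarith
 qed
 moreover have "1 - 1 / (1 + 1 / x) = 1 / (x + 1)" using x by (simp add: field_simps)
 ultimately have "1 \<le> (x + 1) * ln (1 + 1 / x)" using x by (simp add: field_simps)
 then have "exp 1 \<le> exp ((x + 1) * ln (1 + 1 / x))" by simp
 also have "\<dots> = (1 + 1 / x) ^ (n + 1)"
 proof -
  have "(x + 1) * ln (1 + 1 / x) = real (n + 1) * ln (1 + 1 / x)" by (simp add: x_def)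
  moreover have "1 + 1 / x > 0" using x by (simp add: add_pos_pos)
  ultimately show ?thesis by (simp only: exp_of_nat_mult exp_ln)
 qed
 finally have "exp 1 * x ^ (n + 1) \<le> (1 + 1 / x) ^ (n + 1) * x ^ (n + 1)" using x by (intro mult_right_mono) auto
 also have "\<dots> = (x + 1) ^ (n + 1)"
 proof -
  have "(1 + 1 / x) * x = x + 1" using x by (simp add: field_simps)
  then show ?thesis by (simp only: power_mult_distrib[symmetric])
 qed
 finally have e: "exp 1 * x ^ (n + 1) \<le> (x + 1) ^ (n + 1)" .
 have "fact (Suc n) * exp (real (Suc n)) = (x + 1) * exp 1 * (fact n * exp (real n))"
  by (simp add: x_def exp_add algebra_simps)
 also have "\<dots> \<le> (x + 1) * exp 1 * (exp 1 * real n * real n ^ n)" using step.IH x by (intro mult_left_mono) auto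
 also have "\<dots> = (x + 1) * exp 1 * (exp 1 * x ^ (n + 1))" by (simp add: x_def)
 also have "\<dots> \<le> (x + 1) * exp 1 * (x + 1) ^ (n + 1)" using e x by (intro mult_left_mono) auto
 finally show ?case by (simp add: x_def mult_ac add.commute)
qed simp

text \<open>Near c a polynomial behaves like a power, so p(c + x sigma) and p(c + x) differ by
  constants and a power of |sigma|, uniformly in x. In the Cauchy estimate P and Q therefore cost
  only a factor independent of n and x.\<close>

lemma poly_local_two_sided:
 fixes p :: "complex poly"
 assumes "p \<noteq> 0"
 shows "\<exists>rho>0. \<exists>C>0. \<forall>x \<sigma>. 0 < cmod x \<and> cmod x \<le> rho \<and> 0 < cmod \<sigma> \<and> cmod \<sigma> \<le> 2 \<longrightarrow>
   cmod (poly p (c + x * \<sigma>)) \<le> C * cmod (poly p (c + x)) \<and>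
   cmod (poly p (c + x)) * cmod \<sigma> ^ order c p \<le> C * cmod (poly p (c + x * \<sigma>))"
proof -
 obtain q where q: "p = [:- c, 1:] ^ order c p * q" "poly q c \<noteq> 0"
  using order_decomp[OF assms, of c] by (auto simp: poly_eq_0_iff_dvd)
 define k where "k = order c p"
 have pq: "poly p (c + y) = y ^ k * poly q (c + y)" for y
  by (subst q(1)) (simp add: k_def)
 define b where "b = cmod (poly q c)"
 have b: "b > 0" using q(2) by (simp add: b_def)
 have "(poly q \<longlongrightarrow> poly q c) (nhds c)"
 proof -
  have "isCont (poly q) c" by simp
  then show ?thesis by (simp add: isCont_def tendsto_at_iff_tendsto_nhds)
 qed
 then have "\<forall>\<^sub>F z in nhds c. dist (poly q z) (poly q c) < b / 2" using b by (intro tendstoD) auto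
 then obtain d where d: "d > 0" "\<And>z. dist z c < d \<Longrightarrow> dist (poly q z) (poly q c) < b / 2"
  by (auto simp: eventually_nhds_metric)
 have qb: "cmod (poly q (c + y)) \<le> 2 * b" "b / 2 \<le> cmod (poly q (c + y))" if "cmod y < d" for y
 proof -
  have "cmod (poly q (c + y) - poly q c) < b / 2" using d(2)[of "c + y"] that by (simp add: dist_norm)
  then show "cmod (poly q (c + y)) \<le> 2 * b" "b / 2 \<le> cmod (poly q (c + y))"
   using norm_triangle_ineq2[of "poly q (c + y)" "poly q c"] norm_triangle_ineq3[of "poly q (c + y)" "poly q c"] b
   unfolding b_def by linarith+
 qed
 show ?thesis
 proof (rule exI[of _ "d / 3"], intro conjI, use d in simp, rule exI[of _ "4 * 2 ^ k"], intro conjI allI impI)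
  fix x \<sigma> :: complex assume "0 < cmod x \<and> cmod x \<le> d / 3 \<and> 0 < cmod \<sigma> \<and> cmod \<sigma> \<le> 2"
  then have x: "0 < cmod x" "cmod x \<le> d / 3" "0 < cmod \<sigma>" "cmod \<sigma> \<le> 2" by auto
  have xd: "cmod x < d" using x(2) d(1) by linarith
  have "cmod (x * \<sigma>) \<le> cmod x * 2" unfolding norm_mult using x by (intro mult_left_mono) auto
  then have xs: "cmod (x * \<sigma>) < d" using x(2) d(1) by linarith
  define X where "X = cmod x ^ k"
  define Y where "Y = cmod \<sigma> ^ k"
  have X: "X > 0" "Y > 0" "Y \<le> 2 ^ k" using x by (auto simp: X_def Y_def power_mono)
  have e: "cmod (poly p (c + x)) = X * cmod (poly q (c + x))" "cmod (poly p (c + x * \<sigma>)) = X * Y * cmod (poly q (c + x * \<sigma>))"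
   by (simp_all add: pq norm_mult norm_power X_def Y_def power_mult_distrib)
  have "X * Y * cmod (poly q (c + x * \<sigma>)) \<le> X * 2 ^ k * (2 * b)"
   using X qb(1)[OF xs] by (intro mult_mono) auto
  also have "\<dots> = 4 * 2 ^ k * (X * (b / 2))" by simp
  also have "\<dots> \<le> 4 * 2 ^ k * (X * cmod (poly q (c + x)))"
   using X qb(2)[OF xd] by (intro mult_left_mono) auto
  finally show "cmod (poly p (c + x * \<sigma>)) \<le> 4 * 2 ^ k * cmod (poly p (c + x))" by (simp only: e)
  have "X * cmod (poly q (c + x)) * Y \<le> X * (2 * b) * Y"
   using X b qb(1)[OF xd] by (intro mult_mono) auto
  also have "\<dots> = 4 * (X * Y * (b / 2))" by simp
  also have "\<dots> \<le> 4 * 2 ^ k * (X * Y * cmod (poly q (c + x * \<sigma>)))"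
   using X qb(2)[OF xs] b by (intro mult_mono mult_left_mono) auto
  finally show "cmod (poly p (c + x)) * cmod \<sigma> ^ order c p \<le> 4 * 2 ^ k * cmod (poly p (c + x * \<sigma>))"
   by (simp only: e Y_def k_def)
 qed simp
qed

section \<open>The scaled derivative near the pole\<close>

context fuss_measure
begin

text \<open>By continuity of \<open>vb\<close>, a real member of the sequence may be replaced by a
  non-real point close to it.\<close>

lemma boundary_limit_slit:
 assumes k: "\<And>n. k n \<in> SL" "k \<longlonglongrightarrow> of_real k0" "k0 \<ge> 1 / cstar m"
  and v: "(\<lambda>n. vb (k n)) \<longlonglongrightarrow> v"
 shows "saddle_good m v"
proof -
 have "\<exists>k'. Im k' \<noteq> 0 \<and> cmod (k' - k n) < inverse (real (Suc n)) \<and> cmod (vb k' - vb (k n)) < inverse (real (Suc n))" for n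
 proof (cases "Im (k n) = 0")
  case True
  have "isCont vb (k n)"
   using holomorphic_on_imp_continuous_on[OF vb_holomorphic] open_slit k(1) by (auto simp: continuous_on_eq_continuous_at)
  then have "(vb \<longlongrightarrow> vb (k n)) (nhds (k n))" by (simp add: isCont_def tendsto_at_iff_tendsto_nhds)
  then have "\<forall>\<^sub>F z in nhds (k n). dist (vb z) (vb (k n)) < inverse (real (Suc n))" by (rule tendstoD) simp
  then obtain d where d: "d > 0" "\<And>z. dist z (k n) < d \<Longrightarrow> dist (vb z) (vb (k n)) < inverse (real (Suc n))"
   by (auto simp: eventually_nhds_metric)
  define y where "y = min d (inverse (real (Suc n))) / 2"
  have y: "0 < y" "y < d" "y < inverse (real (Suc n))" using d(1) by (auto simp: y_def min_def field_simps)
  have "dist (k n + \<i> * of_real y) (k n) = y" using y by (simp add: dist_norm norm_mult)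
  then show ?thesis using y d(2)[of "k n + \<i> * of_real y"] True
   by (intro exI[of _ "k n + \<i> * of_real y"]) (simp add: dist_norm)
 qed (auto intro!: exI[of _ "k n"])
 then obtain k' where k': "\<And>n. Im (k' n) \<noteq> 0" "\<And>n. cmod (k' n - k n) < inverse (real (Suc n))"
  "\<And>n. cmod (vb (k' n) - vb (k n)) < inverse (real (Suc n))" by metis
 have close: "a' \<longlonglongrightarrow> l" if "\<And>n. cmod (a' n - a n) < inverse (real (Suc n))" "a \<longlonglongrightarrow> l" for a a' :: "nat \<Rightarrow> complex" and l
 proof -
  have "(\<lambda>n. a' n - a n) \<longlonglongrightarrow> 0"
   by (rule Lim_null_comparison[OF _ LIMSEQ_inverse_real_of_nat]) (use that(1) in \<open>auto intro!: always_eventually less_imp_le\<close>)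
  from tendsto_add[OF this that(2)] show ?thesis by simp
 qed
 show ?thesis
  by (rule boundary_limit[OF k'(1) close[OF k'(2) k(2)] k(3) close[OF k'(3) v]])
qed

lemma vb_bounded:
 assumes k: "k \<in> SL" "cmod k \<ge> d" "d > 0"
 shows "cmod (vb k) \<le> 1 + 2 * real m / d"
proof (cases "cmod (vb k) \<ge> 1")
 case True
 define a where "a = cmod (vb k)"
 have m0: "real m > 0" using m_ge by simp
 have "k * vb k ^ (m + 1) = of_nat m * (vb k - 1)" using vb_equation[OF k(1)] m0 by (simp add: field_simps)
 then have "cmod k * a ^ (m + 1) = real m * cmod (vb k - 1)" by (metis a_def norm_mult norm_power norm_of_nat)
 also have "cmod (vb k - 1) \<le> 2 * a" using norm_triangle_ineq4[of "vb k" 1] True by (simp add: a_def)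
 finally have 1: "cmod k * a ^ (m + 1) \<le> real m * (2 * a)" using m0 by simp
 have "a ^ 2 \<le> a ^ (m + 1)" using True m_ge by (intro power_increasing) (auto simp: a_def)
 then have "d * a ^ 2 \<le> cmod k * a ^ (m + 1)" using k by (intro mult_mono) auto
 with 1 have "d * a ^ 2 \<le> real m * (2 * a)" by linarith
 then have "(d * a) * a \<le> (2 * real m) * a" by (simp add: power2_eq_square mult_ac)
 moreover have "a > 0" using True unfolding a_def by linarith
 ultimately have "d * a \<le> 2 * real m" by (rule mult_right_le_imp_le)
 then have "a \<le> 2 * real m / d" using k(3) by (simp add: pos_le_divide_eq mult.commute)
 then show ?thesis by (simp add: a_def)
next
 case False
 have "0 \<le> 2 * real m / d" using k(3) by simp
 with False show ?thesis by linarith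
qed

lemma J_eq: "k \<in> SL \<Longrightarrow> k \<noteq> 0 \<Longrightarrow> J k = (1 - 1 / vb k ^ m) / k"
 by (simp add: vb_inverse_power V_def)

text \<open>The n-th root of a quotient: above, t^(-n) times the exponential factor at the point tau
  of the Cauchy circle; below, the same expression at the saddle 1 + tau = v, with |v - 1| for
  t.\<close>

definition cauchy_ratio :: "complex \<Rightarrow> complex \<Rightarrow> real \<Rightarrow> complex \<Rightarrow> real" where
 "cauchy_ratio k v t tau = cmod (v - 1) / t * exp (Re ((1 - 1 / (1 + tau) ^ m) / k) - Re ((1 - 1 / v ^ m) / k))"

text \<open>By compactness: along counterexamples k tends to a point k0 of the slit and
  \<open>vb\<close> to some v, which is \<open>saddle_good\<close>. The radius t = e^(-eps/4) |v -
  1| works in the limit, since the exponential factor is then at most 1 and |v - 1| / t = e^(eps/4)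
  is below e^eps. Moreover t <= e^(-eps/4) because |v - 1| <= 1, which keeps the circles away from
  the pole tau = -1.\<close>

lemma cauchy_ratio_near_boundary:
 assumes e: "eps > 0"
 shows "\<exists>rho>0. \<forall>k\<in>SL. cmod k \<le> K \<longrightarrow> (\<exists>k0\<ge>1 / cstar m. cmod (k - of_real k0) < rho) \<longrightarrow>
   (\<exists>t>0. t \<le> exp (- eps / 4) \<and> (\<forall>tau. cmod tau = t \<longrightarrow> cauchy_ratio k (vb k) t tau \<le> exp eps))"
proof (rule ccontr)
 assume neg: "\<not> ?thesis"
 define b where "b j = 1 / cstar m * inverse (real (Suc j)) / 2" for j
 have b: "b j > 0" "b j \<le> 1 / cstar m / 2" for j
 proof -
  show "b j > 0" unfolding b_def using L_pos by simp
  have "1 / cstar m / 2 * inverse (real (Suc j)) \<le> 1 / cstar m / 2 * 1"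
   using L_pos by (intro mult_left_mono) (auto simp: inverse_eq_divide)
  then show "b j \<le> 1 / cstar m / 2" by (simp add: b_def)
 qed
 have bl: "b \<longlonglongrightarrow> 0"
 proof -
  have "b \<longlonglongrightarrow> 1 / cstar m * 0 / 2" unfolding b_def by (intro tendsto_intros LIMSEQ_inverse_real_of_nat) auto
  then show ?thesis by simp
 qed
 have "\<exists>k k0. k \<in> SL \<and> cmod k \<le> K \<and> k0 \<ge> 1 / cstar m \<and> cmod (k - of_real k0) < b j \<and>
   (\<forall>t. 0 < t \<and> t \<le> exp (- eps / 4) \<longrightarrow> (\<exists>tau. cmod tau = t \<and> cauchy_ratio k (vb k) t tau > exp eps))" for j
  using neg b(1)[of j] by (meson not_le)
 then obtain k and x :: "nat \<Rightarrow> real" where k: "\<And>j. k j \<in> SL" "\<And>j. cmod (k j) \<le> K" "\<And>j. x j \<ge> 1 / cstar m"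
  "\<And>j. cmod (k j - of_real (x j)) < b j"
  and bad: "\<And>j t. 0 < t \<Longrightarrow> t \<le> exp (- eps / 4) \<Longrightarrow> \<exists>tau. cmod tau = t \<and> cauchy_ratio (k j) (vb (k j)) t tau > exp eps"
  by metis
 have xb: "cmod (of_real (x j)) \<le> K + 1 / cstar m / 2" for j
  using norm_triangle_ineq2[of "of_real (x j)" "k j"] k(2,4)[of j] b(2)[of j] by (simp add: norm_minus_commute)
 have kl: "cmod (k j) \<ge> 1 / cstar m / 2" for j
 proof -
  have "x j \<le> cmod (of_real (x j))" by simp
  then show ?thesis using norm_triangle_ineq2[of "of_real (x j)" "k j"] k(3,4)[of j] b(2)[of j]
   unfolding norm_minus_commute[of "k j"] by linarith
 qed
 have vbd: "cmod (vb (k j)) \<le> 1 + 2 * real m / (1 / cstar m / 2)" for j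
  by (rule vb_bounded[OF k(1) kl]) (use L_pos in simp)
 have "bounded (range (\<lambda>j. (x j, vb (k j))))"
 proof -
  have "range (\<lambda>j. (x j, vb (k j))) \<subseteq> cball 0 (K + 1 / cstar m / 2) \<times> cball 0 (1 + 2 * real m / (1 / cstar m / 2))"
   using xb vbd by auto
  then show ?thesis by (rule bounded_subset[OF bounded_Times[OF bounded_cball bounded_cball]])
 qed
 from bounded_imp_convergent_subsequence[OF this] obtain l r1 where
  r1: "strict_mono r1" "((\<lambda>j. (x j, vb (k j))) \<circ> r1) \<longlonglongrightarrow> l" by blast
 define k0 where "k0 = fst l"
 define v where "v = snd l"
 have xl: "(\<lambda>j. x (r1 j)) \<longlonglongrightarrow> k0" using tendsto_fst[OF r1(2)] by (simp add: k0_def comp_def)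
 have vl: "(\<lambda>j. vb (k (r1 j))) \<longlonglongrightarrow> v" using tendsto_snd[OF r1(2)] by (simp add: v_def comp_def)
 have kl: "(\<lambda>j. k (r1 j)) \<longlonglongrightarrow> of_real k0"
 proof -
  have "(\<lambda>j. k j - of_real (x j)) \<longlonglongrightarrow> 0"
   by (rule Lim_null_comparison[OF _ bl]) (use k(4) in \<open>auto intro!: always_eventually less_imp_le\<close>)
  from LIMSEQ_subseq_LIMSEQ[OF this r1(1)] have "(\<lambda>j. k (r1 j) - of_real (x (r1 j))) \<longlonglongrightarrow> 0" by (simp add: comp_def)
  from tendsto_add[OF this tendsto_of_real[OF xl]] show ?thesis by simp
 qed
 have k0: "k0 \<ge> 1 / cstar m" by (rule LIMSEQ_le_const[OF xl]) (use k(3) in auto)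
 have k0p: "k0 > 0" using k0 L_pos by (smt (verit) divide_pos_pos)
 have sg: "saddle_good m v" by (rule boundary_limit_slit[OF k(1) kl k0 vl])
 define t where "t = exp (- eps / 4) * cmod (v - 1)"
 have t: "0 < t" "t \<le> exp (- eps / 4)" "t < cmod (v - 1)"
  using sg e by (auto simp: t_def saddle_good_def mult_le_cancel_left1)
 have t1: "t < 1" using t(2) e by (simp add: order_le_less_trans)
 have "\<forall>j. \<exists>tau. cmod tau = t \<and> cauchy_ratio (k (r1 j)) (vb (k (r1 j))) t tau > exp eps" using bad[OF t(1,2)] by blast
 then obtain tau where tau: "\<And>j. cmod (tau j) = t" "\<And>j. cauchy_ratio (k (r1 j)) (vb (k (r1 j))) t (tau j) > exp eps" by metis
 have "bounded (range tau)" by (rule bounded_subset[of "cball 0 t"]) (use tau in auto)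
 from bounded_imp_convergent_subsequence[OF this] obtain tau0 r2 where
  r2: "strict_mono r2" "(tau \<circ> r2) \<longlonglongrightarrow> tau0" by blast
 have tl: "(\<lambda>j. tau (r2 j)) \<longlonglongrightarrow> tau0" using r2(2) by (simp add: comp_def)
 have "(\<lambda>j. cmod (tau (r2 j))) \<longlonglongrightarrow> cmod tau0" by (rule tendsto_norm[OF tl])
 then have t0: "cmod tau0 = t" using tau(1) by (simp add: LIMSEQ_const_iff)
 have nz: "1 + tau0 \<noteq> 0" using t0 t1 by (metis add_eq_0_iff2 less_irrefl norm_minus_cancel norm_one)
 have kl2: "(\<lambda>j. k (r1 (r2 j))) \<longlonglongrightarrow> of_real k0" using LIMSEQ_subseq_LIMSEQ[OF kl r2(1)] by (simp add: comp_def)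
 have vl2: "(\<lambda>j. vb (k (r1 (r2 j)))) \<longlonglongrightarrow> v" using LIMSEQ_subseq_LIMSEQ[OF vl r2(1)] by (simp add: comp_def)
 have "(\<lambda>j. cauchy_ratio (k (r1 (r2 j))) (vb (k (r1 (r2 j)))) t (tau (r2 j))) \<longlonglongrightarrow> cauchy_ratio (of_real k0) v t tau0"
  unfolding cauchy_ratio_def using nz k0p sg t(1) by (intro tendsto_intros kl2 vl2 tl) (auto simp: saddle_good_def)
 then have "exp eps \<le> cauchy_ratio (of_real k0) v t tau0"
  by (rule LIMSEQ_le_const) (use tau(2) in \<open>auto intro: less_imp_le\<close>)
 also have "\<dots> \<le> cmod (v - 1) / t * 1"
 proof -
  have "Re (1 / v ^ m) \<le> Re (1 / (1 + tau0) ^ m)" using sg t(3) t0 by (simp add: saddle_good_def)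
  then have "Re (1 - 1 / (1 + tau0) ^ m) \<le> Re (1 - 1 / v ^ m)" by simp
  then have "Re ((1 - 1 / (1 + tau0) ^ m) / of_real k0) \<le> Re ((1 - 1 / v ^ m) / of_real k0)"
   unfolding Re_divide_of_real using k0p by (intro divide_right_mono) auto
  then show ?thesis unfolding cauchy_ratio_def using t(1) by (intro mult_left_mono) auto
 qed
 also have "\<dots> = exp (eps / 4)" using t(1) by (simp add: t_def exp_minus field_simps)
 finally show False using e by simp
qed

text \<open>As k tends to infinity, k v^(m+1) = m (v - 1) with bounded v forces v to 0. Then |v - 1|
  tends to 1 and both exponents to 0, so for fixed t = e^(-eps/4) the ratio is at most e^(eps/4) in
  the limit.\<close>

lemma cauchy_ratio_far:
 assumes e: "eps > 0"
 shows "\<exists>K0. \<forall>k\<in>SL. cmod k \<ge> K0 \<longrightarrow> (\<forall>tau. cmod tau = exp (- eps / 4) \<longrightarrow>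
   cauchy_ratio k (vb k) (exp (- eps / 4)) tau \<le> exp eps)"
proof (rule ccontr)
 define t where "t = exp (- eps / 4)"
 have t: "0 < t" "t < 1" using e by (auto simp: t_def)
 have m0: "real m > 0" using m_ge by simp
 assume neg: "\<not> ?thesis"
 have "\<exists>k tau. k \<in> SL \<and> cmod k \<ge> real (Suc j) \<and> cmod tau = t \<and> cauchy_ratio k (vb k) t tau > exp eps" for j
  using neg unfolding t_def by (meson not_le)
 then obtain k tau where k: "\<And>j. k j \<in> SL" "\<And>j. cmod (k j) \<ge> real (Suc j)" and tau: "\<And>j. cmod (tau j) = t"
  and bad: "\<And>j. cauchy_ratio (k j) (vb (k j)) t (tau j) > exp eps" by metis
 have k1: "cmod (k j) \<ge> 1" for j using k(2)[of j] by simp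
 have knz: "k j \<noteq> 0" for j using k1[of j] by auto
 have ik: "(\<lambda>j. 1 / cmod (k j)) \<longlonglongrightarrow> 0"
 proof (rule Lim_null_comparison[OF _ LIMSEQ_inverse_real_of_nat])
  show "\<forall>\<^sub>F j in sequentially. norm (1 / cmod (k j)) \<le> inverse (real (Suc j))"
   using k(2) by (auto simp: inverse_eq_divide intro!: always_eventually frac_le)
 qed
 define b where "b = 1 + 2 * real m / 1"
 have vbd: "cmod (vb (k j)) \<le> b" for j unfolding b_def by (rule vb_bounded[OF k(1) k1]) simp
 have eq: "k j * vb (k j) ^ (m + 1) = of_nat m * (vb (k j) - 1)" for j
  using vb_equation[OF k(1)[of j]] m0 by (simp add: field_simps)
 have vp: "cmod (vb (k j)) ^ (m + 1) \<le> real m * (b + 1) * (1 / cmod (k j))" for j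
 proof -
  have "cmod (k j) * cmod (vb (k j)) ^ (m + 1) = real m * cmod (vb (k j) - 1)"
   by (metis eq norm_mult norm_power norm_of_nat)
  also have "\<dots> \<le> real m * (b + 1)"
   using norm_triangle_ineq4[of "vb (k j)" 1] vbd[of j] by (intro mult_left_mono) auto
  finally show ?thesis using knz[of j] by (simp add: field_simps)
 qed
 have "(\<lambda>j. real m * (b + 1) * (1 / cmod (k j))) \<longlonglongrightarrow> real m * (b + 1) * 0" by (rule tendsto_mult_left[OF ik])
 note pl = this
 have pw: "(\<lambda>j. cmod (vb (k j)) ^ (m + 1)) \<longlonglongrightarrow> 0"
 proof (rule Lim_null_comparison[where g = "\<lambda>j. real m * (b + 1) * (1 / cmod (k j))"], intro always_eventually allI)
  fix j
  have "norm (cmod (vb (k j)) ^ (m + 1)) = cmod (vb (k j)) ^ (m + 1)" by (rule real_norm_def[THEN trans]) (rule abs_of_nonneg, rule zero_le_power, rule norm_ge_zero)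
  then show "norm (cmod (vb (k j)) ^ (m + 1)) \<le> real m * (b + 1) * (1 / cmod (k j))" using vp[of j] by (simp only:)
 next
  show "(\<lambda>j. real m * (b + 1) * (1 / cmod (k j))) \<longlonglongrightarrow> 0" using pl by (simp only: mult_zero_right)
 qed
 have "(\<lambda>j. root (m + 1) (cmod (vb (k j)) ^ (m + 1))) \<longlonglongrightarrow> root (m + 1) 0" by (rule tendsto_real_root[OF pw])
 moreover have "root (m + 1) (cmod (vb (k j)) ^ (m + 1)) = cmod (vb (k j))" for j by (rule real_root_power_cancel) auto
 ultimately have v0': "(\<lambda>j. cmod (vb (k j))) \<longlonglongrightarrow> 0" by (simp only: real_root_zero)
 then have v0: "(\<lambda>j. vb (k j)) \<longlonglongrightarrow> 0" by (rule tendsto_norm_zero_cancel)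
 have ikc: "(\<lambda>j. 1 / k j) \<longlonglongrightarrow> 0" by (rule tendsto_norm_zero_cancel) (simp only: norm_divide norm_one ik)
 \<comment> \<open>The saddle equation replaces v^(-m)/k, whose limit is not visible, by a quotient
   that is continuous at v = 0.\<close>
 have Jl: "(1 - 1 / vb (k j) ^ m) / k j = 1 / k j - vb (k j) / (of_nat m * (vb (k j) - 1))" for j
 proof -
  have "vb (k j) \<noteq> 0" by (rule vb_nonzero[OF k(1)])
  then have "vb (k j) / (k j * vb (k j) ^ (m + 1)) = 1 / (vb (k j) ^ m * k j)" using knz[of j] by simp
  then show ?thesis unfolding eq by (simp add: diff_divide_distrib)
 qed
 have "(\<lambda>j. 1 / k j - vb (k j) / (of_nat m * (vb (k j) - 1))) \<longlonglongrightarrow> 0 - 0 / (of_nat m * (0 - 1))"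
  using m0 by (intro tendsto_intros ikc v0) auto
 then have J0: "(\<lambda>j. (1 - 1 / vb (k j) ^ m) / k j) \<longlonglongrightarrow> 0" unfolding Jl by simp
 have "(\<lambda>j. (1 + 1 / (1 - t) ^ m) * (1 / cmod (k j))) \<longlonglongrightarrow> (1 + 1 / (1 - t) ^ m) * 0"
  by (rule tendsto_mult_left[OF ik])
 then have T0: "(\<lambda>j. (1 + 1 / (1 - t) ^ m) * (1 / cmod (k j))) \<longlonglongrightarrow> 0" by simp
 define g where "g j = cmod (vb (k j) - 1) / t * exp ((1 + 1 / (1 - t) ^ m) * (1 / cmod (k j)) - Re ((1 - 1 / vb (k j) ^ m) / k j))" for j
 have "g \<longlonglongrightarrow> cmod (0 - 1) / t * exp (0 - Re 0)"
  unfolding g_def using t by (intro tendsto_intros T0 J0 v0) auto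
 moreover have "cmod (0 - 1) / t * exp (0 - Re 0) = exp (eps / 4)" by (simp add: t_def exp_minus field_simps)
 ultimately have gl: "g \<longlonglongrightarrow> exp (eps / 4)" by simp
 have "exp eps \<le> g j" for j
 proof -
  have s: "cmod (1 + tau j) \<ge> 1 - t" using norm_triangle_ineq4[of "1 + tau j" "tau j"] tau[of j] by simp
  have "Re ((1 - 1 / (1 + tau j) ^ m) / k j) \<le> cmod ((1 - 1 / (1 + tau j) ^ m) / k j)" by (rule complex_Re_le_cmod)
  also have "\<dots> = cmod (1 - 1 / (1 + tau j) ^ m) * (1 / cmod (k j))" by (simp add: norm_divide)
  also have "\<dots> \<le> (1 + 1 / (1 - t) ^ m) * (1 / cmod (k j))"
  proof (rule mult_right_mono)
   have "cmod (1 / (1 + tau j) ^ m) \<le> 1 / (1 - t) ^ m"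
    using s t by (auto simp: norm_divide norm_power intro!: frac_le power_mono)
   then show "cmod (1 - 1 / (1 + tau j) ^ m) \<le> 1 + 1 / (1 - t) ^ m"
    using norm_triangle_ineq4[of 1 "1 / (1 + tau j) ^ m"] by simp
  qed simp
  finally have "cauchy_ratio (k j) (vb (k j)) t (tau j) \<le> g j"
   unfolding cauchy_ratio_def g_def using t by (intro mult_left_mono) auto
  then show ?thesis using bad[of j] by simp
 qed
 then have "exp eps \<le> exp (eps / 4)" by (intro LIMSEQ_le_const[OF gl]) auto
 then show False using e by simp
qed

definition Om :: "complex set" where "Om = {Y. Y ^ m \<in> SL}"

text \<open>The inverse saddle value (v - 1) e^(-J) divided by Y^m, in a form that is holomorphic
  and nonzero also at Y = 0: with k = Y^m one has v - 1 = k / (m V - k).\<close>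

definition Th :: "complex \<Rightarrow> complex" where
 "Th Y = exp (- J (Y ^ m)) / (of_nat m * V (Y ^ m) - Y ^ m)"

lemma open_Om: "open Om"
proof -
 have "open ((\<lambda>Y::complex. Y ^ m) -` SL)" by (intro open_vimage open_slit continuous_intros)
 then show ?thesis by (simp add: Om_def vimage_def)
qed

lemma zero_in_Om: "0 \<in> Om" using m_ge zero_in_slit by (simp add: Om_def zero_power)

lemma scale_Om: "Y \<in> Om \<Longrightarrow> 0 \<le> t \<Longrightarrow> t \<le> 1 \<Longrightarrow> of_real t * Y \<in> Om"
 using scale_slit[of "Y ^ m" "cstar m" "t ^ m"] L_pos by (simp add: Om_def power_mult_distrib power_le_one)

lemma Th_den_nz: "Y \<in> Om \<Longrightarrow> of_nat m * V (Y ^ m) - Y ^ m \<noteq> 0"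
 using V_nonzero(2)[of "Y ^ m"] m_ge by (simp add: Om_def field_simps)

lemma J_power_holomorphic: "(\<lambda>Y. J (Y ^ m)) holomorphic_on Om"
proof -
 have "J \<circ> (\<lambda>Y. Y ^ m) holomorphic_on Om"
  by (rule holomorphic_on_compose_gen[OF _ J_holomorphic]) (auto intro!: holomorphic_intros simp: Om_def)
 then show ?thesis by (simp add: comp_def)
qed

lemma Th_holomorphic: "Th holomorphic_on Om"
 unfolding Th_def using Th_den_nz unfolding V_def by (intro holomorphic_intros J_power_holomorphic) auto

lemma Th_nz: "Y \<in> Om \<Longrightarrow> Th Y \<noteq> 0" using Th_den_nz by (simp add: Th_def)

lemma Th_0: "Th 0 = exp (- 1) / of_nat m" using m_ge by (simp add: Th_def J_0 V_0 zero_power)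

lemma Th_eq: assumes "Y \<in> Om" shows "Y ^ m * Th Y = (vb (Y ^ m) - 1) * exp (- J (Y ^ m))"
proof -
 have "of_nat m * V (Y ^ m) - Y ^ m = of_nat m * (V (Y ^ m) - Y ^ m / of_nat m)" using m_ge by (simp add: field_simps)
 then show ?thesis using vb_minus_1[of "Y ^ m"] assms by (simp add: Th_def Om_def)
qed

text \<open>The source of the limiting moments. By the saddle equation log (v - 1) - (1 - v^(-m))/k
  is stationary in v, so only the explicit k counts and k d/dk of it is (1 - v^(-m))/k = J. Division
  by k = Y^m subtracts 1, and Y d/dY is m k d/dk. The proof confirms this by differentiating
  \<open>V_identity\<close> implicitly.\<close>

lemma Th_log_deriv:
 assumes Y: "Y \<in> Om"
 shows "Y * (deriv Th Y / Th Y) = of_nat m * (J (Y ^ m) - 1)"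
proof (cases "Y = 0")
 case False
 define k where "k = Y ^ m"
 have k: "k \<in> SL" "k \<noteq> 0" using Y False by (auto simp: k_def Om_def)
 define J' where "J' = deriv J k"
 define V' where "V' = - (J k + k * J')"
 define mm :: complex where "mm = of_nat m"
 have mm: "mm \<noteq> 0" using m_ge by (simp add: mm_def)
 have dJ: "(J has_field_derivative J') (at k)"
  unfolding J'_def by (rule holomorphic_derivI[OF J_holomorphic open_slit k(1)])
 have dV: "(V has_field_derivative V') (at k)"
  unfolding V_def[abs_def] V'_def by (auto intro!: derivative_eq_intros dJ)
 have A: "mm * V k - k \<noteq> 0" using Th_den_nz[OF Y] by (simp add: mm_def k_def)
 have Vn: "V k \<noteq> 0" "V k - k / mm \<noteq> 0" using V_nonzero[OF k(1)] by (auto simp: mm_def)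
 have ev: "\<forall>\<^sub>F z in nhds k. (V z - z / mm) ^ m = V z ^ (m + 1)"
 proof -
  have "\<forall>\<^sub>F z in nhds k. z \<in> SL" by (rule eventually_nhds_in_open[OF open_slit k(1)])
  then show ?thesis by eventually_elim (use V_identity in \<open>simp add: mm_def\<close>)
 qed
 have d1: "((\<lambda>z. (V z - z / mm) ^ m) has_field_derivative mm * (V k - k / mm) ^ (m - 1) * (V' - 1 / mm)) (at k)"
  using mm by (auto intro!: derivative_eq_intros dV simp: mm_def)
 have d2: "((\<lambda>z. V z ^ (m + 1)) has_field_derivative (mm + 1) * V k ^ m * V') (at k)"
 proof -
  have e: "mm + 1 = of_nat (m + 1)" "V k ^ m = V k ^ (m + 1 - Suc 0)" by (simp_all add: mm_def)
  have "(mm + 1) * V k ^ m * V' = of_nat (m + 1) * (V' * V k ^ (m + 1 - Suc 0))" unfolding e by (simp only: mult_ac)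
  then show ?thesis using DERIV_power[OF dV, of "m + 1"] by (simp only:)
 qed
 have "mm * (V k - k / mm) ^ (m - 1) * (V' - 1 / mm) = (mm + 1) * V k ^ m * V'"
  using DERIV_unique[OF d1] d2 DERIV_cong_ev[OF refl ev refl] by blast
 then have "(V k - k / mm) * V k * (mm * (V k - k / mm) ^ (m - 1) * (V' - 1 / mm)) = (V k - k / mm) * V k * ((mm + 1) * V k ^ m * V')"
  by simp
 moreover have "(V k - k / mm) * (V k - k / mm) ^ (m - 1) = (V k - k / mm) ^ m"
  using m_ge by (simp add: power_eq_if)
 moreover have "(V k - k / mm) ^ m = V k * V k ^ m" using V_identity[OF k(1)] by (simp add: mm_def)
 ultimately have "(V k * V k ^ m) * (V k * (mm * (V' - 1 / mm))) = (V k * V k ^ m) * ((V k - k / mm) * ((mm + 1) * V'))"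
  by (simp only: mult_ac)
 then have "V k * (mm * (V' - 1 / mm)) = (V k - k / mm) * ((mm + 1) * V')" using Vn(1) by simp
 then have "mm * (V k * (mm * (V' - 1 / mm))) = mm * ((V k - k / mm) * ((mm + 1) * V'))" by simp
 moreover have "mm * (V' - 1 / mm) = mm * V' - 1" "mm * (V k - k / mm) = mm * V k - k"
  using mm by (simp_all add: right_diff_distrib)
 ultimately have "mm * V k * (mm * V' - 1) = (mm * V k - k) * ((mm + 1) * V')" by (simp only: mult.assoc[symmetric])
 then have key: "V' * ((mm + 1) * k - mm * V k) = mm * V k" by (simp add: algebra_simps)
 \<comment> \<open>Logarithmic derivative of e^(-J) / (m V - k) with respect to k.\<close>
 define N where "N = - J' - (mm * V' - 1) / (mm * V k - k)"
 have N: "k * N = J k - 1"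
 proof -
  have "(mm * V k - k) * (k * N - (J k - 1)) = (mm * V k - k) * (V' + 1) - k * (mm * V' - 1)"
   using A by (simp add: N_def V'_def field_simps)
  also have "\<dots> = 0" using key by (simp add: algebra_simps)
  finally show ?thesis using A by simp
 qed
 have "(Th has_field_derivative Th Y * (N * (mm * Y ^ (m - 1)))) (at Y)"
 proof -
  have dk: "((\<lambda>Y. Y ^ m) has_field_derivative mm * Y ^ (m - 1)) (at Y)"
   by (auto intro!: derivative_eq_intros simp: mm_def)
  have dJY: "((\<lambda>Y. J (Y ^ m)) has_field_derivative J' * (mm * Y ^ (m - 1))) (at Y)"
   by (rule DERIV_chain2[OF dJ[unfolded k_def] dk])
  have dVY: "((\<lambda>Y. V (Y ^ m)) has_field_derivative V' * (mm * Y ^ (m - 1))) (at Y)"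
   by (rule DERIV_chain2[OF dV[unfolded k_def] dk])
  have A': "mm * V (Y ^ m) - Y ^ m \<noteq> 0" using A by (simp add: k_def)
  have T: "Th = (\<lambda>Y. exp (- J (Y ^ m)) / (mm * V (Y ^ m) - Y ^ m))" by (simp add: Th_def[abs_def] mm_def)
  show ?thesis
   unfolding T by (rule derivative_eq_intros dJY dVY dk A' refl)+ (use A' in \<open>simp add: N_def k_def divide_simps, simp add: algebra_simps\<close>)
 qed
 then have "deriv Th Y = Th Y * (N * (mm * Y ^ (m - 1)))" by (rule DERIV_imp_deriv)
 then have "Y * (deriv Th Y / Th Y) = mm * (Y * Y ^ (m - 1) * N)" using Th_nz[OF Y] by simp
 also have "Y * Y ^ (m - 1) = k" using m_ge by (simp add: k_def power_eq_if)
 finally show ?thesis using N by (simp add: mm_def k_def)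
qed (use m_ge in \<open>simp add: J_0 zero_power\<close>)

lemma J_power_sums:
 assumes Y: "cmod Y ^ m < 1 / cstar m"
 shows "(\<lambda>k. (if k \<ge> 1 \<and> m dvd k then of_nat m * of_real (mom (k div m)) else 0) * Y ^ k) sums (of_nat m * (J (Y ^ m) - 1))"
proof -
 have m0: "m > 0" using m_ge by simp
 have "(\<lambda>q. of_real (mom q) * (Y ^ m) ^ q) sums J (Y ^ m)" using Y by (intro J_sums) (simp add: norm_power)
 moreover have "(\<lambda>q. if q = 0 then 1 else 0 :: complex) sums 1" using sums_single[of 0 "\<lambda>_. 1 :: complex"] by simp
 ultimately have "(\<lambda>q. of_real (mom q) * (Y ^ m) ^ q - (if q = 0 then 1 else 0)) sums (J (Y ^ m) - 1)" by (rule sums_diff)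
 then have s: "(\<lambda>q. of_nat m * (of_real (mom q) * (Y ^ m) ^ q - (if q = 0 then 1 else 0))) sums (of_nat m * (J (Y ^ m) - 1))"
  by (rule sums_mult)
 define F where "F k = (if k \<ge> 1 \<and> m dvd k then of_nat m * of_real (mom (k div m)) else 0) * Y ^ k" for k
 have "(\<lambda>q. F (m * q)) = (\<lambda>q. of_nat m * (of_real (mom q) * (Y ^ m) ^ q - (if q = 0 then 1 else 0)))"
  using m0 mom_0 by (auto simp: F_def fun_eq_iff power_mult Suc_le_eq)
 with s have s': "(\<lambda>q. F (m * q)) sums (of_nat m * (J (Y ^ m) - 1))" by simp
 have "F sums (of_nat m * (J (Y ^ m) - 1))"
 proof -
  have "(\<lambda>q. F (m * q)) sums (of_nat m * (J (Y ^ m) - 1)) \<longleftrightarrow> F sums (of_nat m * (J (Y ^ m) - 1))"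
  proof (rule sums_mono_reindex)
   show "strict_mono (\<lambda>q. m * q)" using m0 by (simp add: strict_mono_def)
   show "F k = 0" if "k \<notin> range (\<lambda>q. m * q)" for k using that by (auto simp: F_def dvd_def)
  qed
  with s' show ?thesis by blast
 qed
 then show ?thesis by (simp add: F_def[abs_def])
qed

end

section \<open>The derivative normalised by the saddle value\<close>

locale hyper_micro = hyper_disc P Q S T c m r + fuss_measure "mu_micro m" m
 for P Q S T c m r
begin

text \<open>The same choice of root as inside \<open>mu_hat\<close>, so that the two match
  literally.\<close>

definition \<eta> :: complex where "\<eta> = (SOME \<eta>. \<eta> ^ m = - lamc)"

lemma eta_power: "\<eta> ^ m = - lamc"
proof -
 have "exp (Ln (- lamc) / of_nat m) ^ m = exp (of_nat m * (Ln (- lamc) / of_nat m))"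
  by (rule exp_of_nat_mult[symmetric])
 also have "\<dots> = - lamc" using lamc_nz m_pos by simp
 finally show ?thesis unfolding \<eta>_def by (rule someI[of "\<lambda>x. x ^ m = - lamc"])
qed

lemma eta_nz: "\<eta> \<noteq> 0" using eta_power lamc_nz m_pos by (auto simp: zero_power)

text \<open>Unit of length in zeta = c + dl n * Y. Since dl^m = -lamc/n, the leading part of the
  exponent changes by n (1 - (1 + tau)^(-m)) / Y^m from x to x (1 + tau).\<close>

definition dl :: "nat \<Rightarrow> complex" where "dl n = \<eta> / of_real (root m (real n))"

lemma root_pos: "n \<ge> 1 \<Longrightarrow> root m (real n) > 0" using m_pos by simp

lemma dl_nz: "n \<ge> 1 \<Longrightarrow> dl n \<noteq> 0" using eta_nz root_pos[of n] by (simp add: dl_def)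

lemma dl_power: "n \<ge> 1 \<Longrightarrow> dl n ^ m = - lamc / of_nat n"
proof -
 assume "n \<ge> 1"
 have "of_real (root m (real n)) ^ m = (of_nat n :: complex)"
  unfolding of_real_power[symmetric] using m_pos by (simp add: real_root_pow_pos2)
 then show ?thesis by (simp add: dl_def power_divide eta_power)
qed

lemma inverse_root_tendsto: "(\<lambda>n. 1 / root m (real n)) \<longlonglongrightarrow> 0"
proof -
 have "(\<lambda>n. root m (1 / real n)) \<longlonglongrightarrow> root m 0" by (rule tendsto_real_root[OF lim_1_over_n])
 then show ?thesis using m_pos by (simp add: real_root_divide)
qed

lemma dl_norm: "cmod (dl n) = cmod \<eta> * (1 / root m (real n))"
 by (simp add: dl_def norm_divide real_root_ge_zero abs_of_nonneg)

lemma dl_tendsto: "(\<lambda>n. cmod (dl n)) \<longlonglongrightarrow> 0"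
proof -
 have "(\<lambda>n. cmod \<eta> * (1 / root m (real n))) \<longlonglongrightarrow> cmod \<eta> * 0" by (intro tendsto_intros inverse_root_tendsto)
 then show ?thesis by (simp add: dl_norm[abs_def])
qed

lemma dl_small:
 assumes "0 \<le> b" "0 < d" shows "\<forall>\<^sub>F n in sequentially. cmod (dl n) * b \<le> d"
proof -
 have "(\<lambda>n. cmod (dl n) * b) \<longlonglongrightarrow> 0 * b" by (intro tendsto_intros dl_tendsto)
 then have "\<forall>\<^sub>F n in sequentially. cmod (dl n) * b < d" using assms by (intro order_tendstoD(2)[where y = "0 * b"]) auto
 then show ?thesis by eventually_elim simp
qed

lemma near_c_notin: "0 < cmod x \<Longrightarrow> cmod x \<le> r \<Longrightarrow> c + x \<notin> Sg"
proof
 assume x: "0 < cmod x" "cmod x \<le> r" and "c + x \<in> Sg"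
 then have "c + x \<in> cball c r \<inter> Sg" by (simp add: dist_norm)
 then have "c + x = c" using r_sing by blast
 then show False using x by simp
qed

lemma near_c_notin': "cmod x \<le> r \<Longrightarrow> c + x \<notin> Sg - {c}"
 using near_c_notin[of x] by (cases "x = 0") auto

lemma E_local: "\<exists>rho>0. \<exists>C\<ge>0. \<forall>y. 0 < cmod y \<and> cmod y \<le> rho \<longrightarrow>
  cmod (E (c + y) - lamc / y ^ m) \<le> C * (cmod y / cmod y ^ m)"
proof -
 have cS: "c \<in> - (Sg - {c})" by simp
 have "(s has_field_derivative deriv s c) (at (0 + c))"
  using holomorphic_derivI[OF s_holomorphic open_compl' cS] by simp
 then have "((\<lambda>y. s (y + c)) has_field_derivative deriv s c) (at 0)" by (simp only: DERIV_shift)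
 note ds = DERIV_diff[OF this DERIV_const[of lamc]]
 have "((\<lambda>y. s (c + y) - lamc) has_field_derivative deriv s c) (at 0)"
  using ds by (simp add: add.commute)
 then have "\<exists>d>0. \<forall>k. cmod k < d \<longrightarrow> cmod (s (c + k) - lamc) \<le> (cmod (deriv s c) + 1) * cmod k"
  by (rule differentiable_zero_bound) (simp add: lamc_def)
 then obtain d where d: "d > 0" "\<And>k. cmod k < d \<Longrightarrow> cmod (s (c + k) - lamc) \<le> (cmod (deriv s c) + 1) * cmod k" by blast
 show ?thesis
 proof (rule exI[of _ "d / 2"], intro conjI, use d in simp, rule exI[of _ "cmod (deriv s c) + 1"], intro conjI allI impI)
  fix y assume y: "0 < cmod y \<and> cmod y \<le> d / 2"
  have "E (c + y) - lamc / y ^ m = (s (c + y) - lamc) / y ^ m" by (simp add: E_eq diff_divide_distrib)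
  then have "cmod (E (c + y) - lamc / y ^ m) = cmod (s (c + y) - lamc) / cmod y ^ m" by (simp add: norm_divide norm_power)
  also have "\<dots> \<le> ((cmod (deriv s c) + 1) * cmod y) / cmod y ^ m"
  proof (intro divide_right_mono d(2))
   have "0 < cmod y" "cmod y \<le> d / 2" using y by auto
   then show "cmod y < d" by linarith
  qed simp
  finally show "cmod (E (c + y) - lamc / y ^ m) \<le> (cmod (deriv s c) + 1) * (cmod y / cmod y ^ m)" by simp
 qed simp
qed

definition A :: "nat \<Rightarrow> complex \<Rightarrow> complex" where
 "A n x = x ^ n * (deriv ^^ n) f (c + x) / (fact n * f (c + x))"

lemma f_nz: assumes "0 < cmod x" "cmod x \<le> r" shows "f (c + x) \<noteq> 0"
proof -
 have n: "c + x \<notin> Sg" by (rule near_c_notin[OF assms])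
 have "poly (PT P T) (c + x) * poly (Psharp P T) (c + x) = poly P (c + x)"
  by (subst (3) P_factor[symmetric]) simp
 moreover have "poly (Psharp P T) (c + x) \<noteq> 0" using r_Psharp assms by (simp add: dist_norm)
 ultimately have "poly P (c + x) \<noteq> 0" using PT_nz[OF n] by auto
 then show ?thesis using Q_nz[OF n] by (simp add: hyperexp_def)
qed

text \<open>Cauchy's inequality for f on the circle of radius t |x| about c + x. By
  \<open>poly_local_two_sided\<close>, P contributes a constant and 1/Q at most a power of 1/(1 -
  t).\<close>

lemma A_bound: "\<exists>rho>0. \<exists>C>0. \<forall>x t n G. 0 < cmod x \<and> cmod x \<le> rho \<and> 0 < t \<and> t < 1 \<and>
  (\<forall>tau. cmod tau = t \<longrightarrow> Re (E (c + x * (1 + tau))) - Re (E (c + x)) \<le> G) \<longrightarrow>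
  cmod (A n x) \<le> C / (1 - t) ^ order c Q * exp G / t ^ n"
proof -
 define b where "b = order c Q"
 obtain r1 C1 where C1: "r1 > 0" "C1 > 0" "\<And>x \<sigma>. 0 < cmod x \<Longrightarrow> cmod x \<le> r1 \<Longrightarrow> 0 < cmod \<sigma> \<Longrightarrow> cmod \<sigma> \<le> 2 \<Longrightarrow>
   cmod (poly P (c + x * \<sigma>)) \<le> C1 * cmod (poly P (c + x))"
  using poly_local_two_sided[OF nz(1), of c] by metis
 obtain r2 C2 where C2: "r2 > 0" "C2 > 0" "\<And>x \<sigma>. 0 < cmod x \<Longrightarrow> cmod x \<le> r2 \<Longrightarrow> 0 < cmod \<sigma> \<Longrightarrow> cmod \<sigma> \<le> 2 \<Longrightarrow>
   cmod (poly Q (c + x)) * cmod \<sigma> ^ b \<le> C2 * cmod (poly Q (c + x * \<sigma>))"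
  using poly_local_two_sided[OF nz(2), of c] unfolding b_def by metis
 define rho where "rho = min (min r1 r2) (r / 2)"
 have rho: "rho > 0" "rho \<le> r1" "rho \<le> r2" "rho \<le> r / 2" using C1 C2 r_pos by (auto simp: rho_def)
 have main: "cmod (A n x) \<le> (C1 * C2) / (1 - t) ^ b * exp G / t ^ n"
  if x: "0 < cmod x" "cmod x \<le> rho" and t: "0 < t" "t < 1"
   and G: "\<And>tau. cmod tau = t \<Longrightarrow> Re (E (c + x * (1 + tau))) - Re (E (c + x)) \<le> G" for x t n G
 proof -
  have xr: "cmod x \<le> r" using x rho r_pos by linarith
  have fx: "f (c + x) \<noteq> 0" by (rule f_nz[OF x(1) xr])
  have sig: "1 - t \<le> cmod (1 + tau)" "cmod (1 + tau) \<le> 2" if "cmod tau \<le> t" for tau :: complex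
   using norm_triangle_ineq4[of "1 + tau" tau] norm_triangle_ineq[of 1 tau] that t by auto
  have ns: "c + x * (1 + tau) \<notin> Sg" if "cmod tau \<le> t" for tau
  proof (rule near_c_notin)
   have "cmod (1 + tau) > 0" using sig(1)[OF that] t by linarith
   then show "0 < cmod (x * (1 + tau))" using x(1) by (simp add: norm_mult)
   have "cmod (x * (1 + tau)) \<le> rho * 2" unfolding norm_mult using sig(2)[OF that] x rho by (intro mult_mono) auto
   then show "cmod (x * (1 + tau)) \<le> r" using rho(4) by linarith
  qed
  define X where "X = C1 * C2 / (1 - t) ^ b * exp G * cmod (f (c + x))"
  have sub: "cball (c + x) (cmod x * t) \<subseteq> - Sg"
  proof
   fix w assume "w \<in> cball (c + x) (cmod x * t)"
   then have w: "cmod (w - (c + x)) \<le> cmod x * t" by (simp add: dist_norm norm_minus_commute)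
   define tau where "tau = (w - (c + x)) / x"
   have "cmod tau \<le> t" using w x(1) by (simp add: tau_def norm_divide pos_divide_le_eq mult.commute)
   moreover have "w = c + x * (1 + tau)" using x(1) by (simp add: tau_def field_simps)
   ultimately show "w \<in> - Sg" using ns by simp
  qed
  have "cmod ((deriv ^^ n) f (c + x)) \<le> fact n * X / (cmod x * t) ^ n"
  proof (rule Cauchy_inequality)
   show "f holomorphic_on ball (c + x) (cmod x * t)"
    by (rule holomorphic_on_subset[OF f_holomorphic]) (use sub ball_subset_cball[of "c + x" "cmod x * t"] in blast)
   show "continuous_on (cball (c + x) (cmod x * t)) f"
    by (rule continuous_on_subset[OF holomorphic_on_imp_continuous_on[OF f_holomorphic] sub])
   show "0 < cmod x * t" using x t by simp
   fix w assume w: "cmod (c + x - w) = cmod x * t"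
   define tau where "tau = (w - (c + x)) / x"
   have tau: "cmod tau = t" using w x(1) by (simp add: tau_def norm_divide norm_minus_commute)
   have wt: "w = c + x * (1 + tau)" using x(1) by (simp add: tau_def field_simps)
   have s0: "0 < cmod (1 + tau)" using sig(1)[of tau] tau t by linarith
   have s2: "cmod (1 + tau) \<le> 2" using sig(2)[of tau] tau by simp
   have wn: "w \<notin> Sg" using ns[of tau] tau wt by simp
   have P1: "cmod (poly P w) \<le> C1 * cmod (poly P (c + x))"
    unfolding wt by (rule C1(3)) (use x rho s0 s2 in auto)
   have Q1: "cmod (poly Q (c + x)) * cmod (1 + tau) ^ b \<le> C2 * cmod (poly Q w)"
    unfolding wt by (rule C2(3)) (use x rho s0 s2 in auto)
   have Qw: "cmod (poly Q w) > 0" using Q_nz[OF wn] by simp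
   have Qx: "cmod (poly Q (c + x)) > 0" using Q_nz[OF near_c_notin[OF x(1) xr]] by simp
   have "cmod (poly Q (c + x)) * (1 - t) ^ b \<le> cmod (poly Q (c + x)) * cmod (1 + tau) ^ b"
    using sig(1)[of tau] tau t by (intro mult_left_mono power_mono) auto
   with Q1 have Q2: "cmod (poly Q (c + x)) * (1 - t) ^ b \<le> C2 * cmod (poly Q w)" by linarith
   have tb: "(1 - t) ^ b > 0" using t by simp
   have "1 / cmod (poly Q w) \<le> C2 / ((1 - t) ^ b * cmod (poly Q (c + x)))"
    using Q2 Qw Qx tb by (simp add: field_simps)
   then have "cmod (poly P w) * (1 / cmod (poly Q w)) * exp (Re (E w))
     \<le> (C1 * cmod (poly P (c + x))) * (C2 / ((1 - t) ^ b * cmod (poly Q (c + x)))) * exp (Re (E (c + x)) + G)"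
    using P1 G[OF tau] C1(2) C2(2) tb unfolding wt[symmetric] by (intro mult_mono) auto
   then show "cmod (f w) \<le> X"
    by (simp add: X_def hyperexp_def norm_mult norm_divide exp_add mult_ac)
  qed
  then have "cmod ((deriv ^^ n) f (c + x)) * cmod x ^ n / (fact n * cmod (f (c + x)))
    \<le> (fact n * X / (cmod x * t) ^ n) * cmod x ^ n / (fact n * cmod (f (c + x)))"
   by (intro divide_right_mono mult_right_mono) auto
  also have "\<dots> = C1 * C2 / (1 - t) ^ b * exp G / t ^ n"
   using fx x t by (simp add: X_def power_mult_distrib)
  finally show ?thesis by (simp add: A_def norm_divide norm_mult norm_power mult_ac)
 qed
 show ?thesis
 proof (rule exI[of _ rho], intro conjI, rule rho(1), rule exI[of _ "C1 * C2"], intro conjI allI impI)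
  show "C1 * C2 > 0" using C1 C2 by simp
 qed (use main b_def in blast)
qed

text \<open>The overview's function, written with \<open>B n\<close> and \<open>Th\<close> instead
  of f^(n) and v, so that Y = 0 is an ordinary point. The denominator consists of those factors of f
  and W that do not vanish at c.\<close>

definition H :: "nat \<Rightarrow> complex \<Rightarrow> complex" where
 "H n Y = (of_nat n ^ n / fact n) * poly (B n) (c + dl n * Y) * Th Y ^ n
   / (poly (Psharp P T) (c + dl n * Y) * (- lamc * poly Wt (c + dl n * Y)) ^ n)"

lemma H_den_nz: "cmod (dl n * Y) \<le> r \<Longrightarrow> poly (Psharp P T) (c + dl n * Y) \<noteq> 0"
 "cmod (dl n * Y) \<le> r \<Longrightarrow> poly Wt (c + dl n * Y) \<noteq> 0"
 using r_Psharp Wt_nz[of "c + dl n * Y"] near_c_notin'[of "dl n * Y"] by (auto simp: dist_norm)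

lemma H_holomorphic: "cmod (dl n) * R' \<le> r \<Longrightarrow> H n holomorphic_on Om \<inter> ball 0 R'"
proof -
 assume R': "cmod (dl n) * R' \<le> r"
 have "cmod (dl n * Y) \<le> r" if "Y \<in> Om \<inter> ball 0 R'" for Y
 proof -
  have "cmod (dl n * Y) \<le> cmod (dl n) * R'" unfolding norm_mult using that by (intro mult_left_mono) auto
  then show ?thesis using R' by linarith
 qed
 then show ?thesis unfolding H_def
  using H_den_nz lamc_nz
  by (intro holomorphic_intros holomorphic_on_subset[OF Th_holomorphic]) (auto simp del: norm_mult simp: norm_mult[symmetric])
qed

text \<open>With a = -lamc Wt(c), \<open>B_c\<close> and \<open>U_c\<close> give B_n(c) = (m a)^n
  P_sharp(c), and Th(0) = 1/(e m); all but n^n / (n! e^n) cancels.\<close>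

lemma H_0: "n \<ge> 1 \<Longrightarrow> H n 0 = of_real (real n ^ n / (fact n * exp (real n)))"
proof -
 assume n: "n \<ge> 1"
 have "poly Wt c \<noteq> 0" using H_den_nz(2)[of n 0] r_pos by simp
 moreover have "poly (Psharp P T) c \<noteq> 0" using H_den_nz(1)[of n 0] r_pos by simp
 moreover have "exp (- 1 :: complex) ^ n = 1 / exp (of_nat n)"
 proof -
  have "exp (1 :: complex) ^ n = exp (of_nat n)" using exp_of_nat_mult[of n "1 :: complex"] by simp
  then show ?thesis by (simp add: exp_minus power_inverse inverse_eq_divide power_one_over)
 qed
 moreover define a where "a = - (lamc * poly Wt c)"
 moreover have "poly U c = of_nat m * a" by (simp add: U_c a_def)
 moreover have "a \<noteq> 0" using calculation lamc_nz by simp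
 ultimately show ?thesis using m_pos
  by (simp add: H_def B_c Th_0 power_divide power_mult_distrib exp_of_real[symmetric] flip: a_def)
qed

lemma H_0_ge: "n \<ge> 1 \<Longrightarrow> cmod (H n 0) \<ge> 1 / (exp 1 * real n)"
proof -
 assume n: "n \<ge> 1"
 have "cmod (H n 0) = real n ^ n / (fact n * exp (real n))" unfolding H_0[OF n] norm_of_real by simp
 moreover have "1 / (exp 1 * real n) \<le> real n ^ n / (fact n * exp (real n))"
  using fact_exp_le[OF n] n by (simp add: field_simps)
 ultimately show ?thesis by simp
qed

text \<open>W(c + x) = x^(m+1) Wt(c + x) and x^m = -lamc Y^m / n account for all powers of x and
  n.\<close>

lemma H_eq:
 assumes n: "n \<ge> 1" and Y: "Y \<in> Om" "Y \<noteq> 0" and x: "cmod (dl n * Y) \<le> r"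
 shows "H n Y = A n (dl n * Y) * ((vb (Y ^ m) - 1) * exp (- J (Y ^ m))) ^ n"
proof -
 define x where "x = dl n * Y"
 have x0: "x \<noteq> 0" using dl_nz[OF n] Y by (simp add: x_def)
 have xr: "0 < cmod x" "cmod x \<le> r" using x0 x by (auto simp: x_def)
 have nS: "c + x \<notin> Sg" by (rule near_c_notin[OF xr])
 have W: "poly W (c + x) = x * x ^ m * poly Wt (c + x)" by (simp add: poly_W)
 have xm: "x ^ m = - lamc * Y ^ m / of_nat n" by (simp add: x_def power_mult_distrib dl_power[OF n])
 have Wt0: "poly Wt (c + x) \<noteq> 0" "poly (Psharp P T) (c + x) \<noteq> 0" using H_den_nz[of n Y] x by (auto simp: x_def)
 have fz: "f (c + x) = R 0 (c + x) * poly (Psharp P T) (c + x)" using higher_deriv_f[OF nS, of 0] by simp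
 have "R n (c + x) = R 0 (c + x) / poly W (c + x) ^ n" by (simp add: R_def)
 then have fn: "(deriv ^^ n) f (c + x) = R 0 (c + x) / poly W (c + x) ^ n * poly (B n) (c + x)"
  using higher_deriv_f[OF nS, of n] by simp
 have "A n x = x ^ n * poly (B n) (c + x) / (fact n * poly (Psharp P T) (c + x) * poly W (c + x) ^ n)"
  unfolding A_def fz fn using R_nz[OF nS, of 0] by simp
 also have "\<dots> = poly (B n) (c + x) / (fact n * poly (Psharp P T) (c + x) * (x ^ m * poly Wt (c + x)) ^ n)"
  unfolding W using x0 by (simp add: power_mult_distrib)
 also have "\<dots> = (of_nat n ^ n / fact n) * poly (B n) (c + x) / (poly (Psharp P T) (c + x) * (- lamc * poly Wt (c + x)) ^ n * (Y ^ m) ^ n)"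
 proof -
  define a where "a = - lamc * poly Wt (c + x)"
  have "x ^ m * poly Wt (c + x) = a * Y ^ m / of_nat n" by (simp add: xm a_def)
  then show ?thesis unfolding a_def[symmetric] using n by (simp add: power_mult_distrib power_divide mult_ac)
 qed
 finally have Ae: "A n x = \<dots>" .
 have "H n Y = A n x * (Y ^ m * Th Y) ^ n"
  unfolding Ae H_def x_def[symmetric] using Y(2) by (simp add: power_mult_distrib)
 then show ?thesis unfolding Th_eq[OF Y(1)] x_def .
qed

text \<open>Beyond lamc/x^m the exponent is O(|x|^(1-m)), which for |Y| in a fixed range is O(n |dl
  n|) = o(n). Constants disappear in the n-th root, and \<open>cauchy_ratio\<close> controls the
  leading part. The lower bound y0 on |Y| is needed since |x|^(1-m) grows towards c.\<close>

lemma H_bound_ratio: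
 assumes e: "eps > 0" and y0: "y0 > 0" and t1: "t1 < 1"
 shows "\<forall>\<^sub>F n in sequentially. \<forall>Y\<in>Om. \<forall>t. y0 \<le> cmod Y \<longrightarrow> cmod Y \<le> R1 \<longrightarrow> 0 < t \<longrightarrow> t \<le> t1 \<longrightarrow>
  (\<forall>tau. cmod tau = t \<longrightarrow> cauchy_ratio (Y ^ m) (vb (Y ^ m)) t tau \<le> exp eps) \<longrightarrow> cmod (H n Y) \<le> exp (2 * eps * real n)"
proof -
 obtain rho1 C1 where C1: "rho1 > 0" "C1 > 0" "\<And>x t n G. 0 < cmod x \<Longrightarrow> cmod x \<le> rho1 \<Longrightarrow> 0 < t \<Longrightarrow> t < 1 \<Longrightarrow>
  (\<And>tau. cmod tau = t \<Longrightarrow> Re (E (c + x * (1 + tau))) - Re (E (c + x)) \<le> G) \<Longrightarrow>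
  cmod (A n x) \<le> C1 / (1 - t) ^ order c Q * exp G / t ^ n"
  using A_bound by metis
 obtain rho2 C2 where C2: "rho2 > 0" "C2 \<ge> 0" "\<And>y. 0 < cmod y \<Longrightarrow> cmod y \<le> rho2 \<Longrightarrow>
   cmod (E (c + y) - lamc / y ^ m) \<le> C2 * (cmod y / cmod y ^ m)"
  using E_local by metis
 \<comment> \<open>Half of \<open>rho2\<close>, because |x (1 + tau)| may reach 2 |x|.\<close>
 define rho where "rho = min (min rho1 (rho2 / 2)) r"
 have rho: "rho > 0" "rho \<le> rho1" "2 * rho \<le> rho2" "rho \<le> r" using C1 C2 r_pos by (auto simp: rho_def)
 define R2 where "R2 = max R1 1"
 have R2: "R2 \<ge> 1" "R1 \<le> R2" by (auto simp: R2_def)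
 define C3 where "C3 = C1 / (1 - t1) ^ order c Q"
 have C3: "C3 > 0" using C1 t1 by (simp add: C3_def)
 define K where "K = C2 * (2 / (1 - t1) ^ m + 1) * (R2 / (cmod lamc * y0 ^ m))"
 have K: "K \<ge> 0" using C2 t1 y0 R2 by (auto simp: K_def)
 have ev1: "\<forall>\<^sub>F n in sequentially. cmod (dl n) * R2 \<le> rho" by (rule dl_small) (use R2 rho in auto)
 have ev2: "\<forall>\<^sub>F n in sequentially. ln C3 / real n + K * cmod (dl n) < eps"
 proof -
  have "(\<lambda>n. ln C3 / real n + K * cmod (dl n)) \<longlonglongrightarrow> 0 + K * 0"
   by (intro tendsto_intros dl_tendsto tendsto_divide_0[OF tendsto_const] filterlim_real_sequentially filterlim_at_top_imp_at_infinity)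
  then show ?thesis using e by (intro order_tendstoD(2)[where y = "0 + K * 0"]) auto
 qed
 show ?thesis using ev1 ev2 eventually_ge_at_top[of "1::nat"]
 proof eventually_elim
  case (elim n)
  have n: "n \<ge> 1" "real n > 0" using elim by auto
  show ?case
  proof (intro ballI allI impI)
   fix Y t assume Y: "Y \<in> Om" and yb: "y0 \<le> cmod Y" "cmod Y \<le> R1" and t: "0 < t" "t \<le> t1"
    and cr: "\<forall>tau. cmod tau = t \<longrightarrow> cauchy_ratio (Y ^ m) (vb (Y ^ m)) t tau \<le> exp eps"
   define k where "k = Y ^ m"
   define v where "v = vb k"
   define x where "x = dl n * Y"
   have Y0: "Y \<noteq> 0" using yb y0 by auto
   have k: "k \<in> SL" "k \<noteq> 0" using Y Y0 by (auto simp: k_def Om_def)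
   have v1: "cmod (v - 1) > 0" using vb_minus_1[OF k(1)] V_nonzero(2)[OF k(1)] k(2) m_ge by (simp add: v_def)
   have x0: "x \<noteq> 0" using dl_nz[OF n(1)] Y0 by (simp add: x_def)
   have "cmod x \<le> cmod (dl n) * R2" unfolding x_def norm_mult using yb R2 by (intro mult_left_mono) auto
   then have xs: "0 < cmod x" "cmod x \<le> rho" using x0 elim by auto
   have xm: "x ^ m = - lamc * k / of_nat n" by (simp add: x_def k_def power_mult_distrib dl_power[OF n(1)])
   have xq: "cmod x / cmod x ^ m \<le> real n * cmod (dl n) * (R2 / (cmod lamc * y0 ^ m))"
   proof -
    have "cmod x ^ m = cmod lamc * cmod Y ^ m / real n"
     unfolding norm_power[symmetric] xm by (simp add: norm_mult norm_divide k_def norm_power)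
    then have "cmod x / cmod x ^ m = real n * cmod (dl n) * (cmod Y / (cmod lamc * cmod Y ^ m))"
     by (simp add: x_def norm_mult)
    also have "\<dots> \<le> real n * cmod (dl n) * (R2 / (cmod lamc * y0 ^ m))"
     using yb R2 y0 lamc_nz by (intro mult_left_mono frac_le power_mono mult_left_mono) auto
    finally show ?thesis .
   qed
   define err where "err = C2 * (2 / (1 - t1) ^ m + 1) * (cmod x / cmod x ^ m)"
   have err: "err \<le> real n * (K * cmod (dl n))"
   proof -
    have "err \<le> C2 * (2 / (1 - t1) ^ m + 1) * (real n * cmod (dl n) * (R2 / (cmod lamc * y0 ^ m)))"
     unfolding err_def using xq C2(2) t1 by (intro mult_left_mono) auto
    then show ?thesis by (simp add: K_def mult_ac)
   qed
   \<comment> \<open>With this G the radius t cancels in exp G / t^n, and multiplying by |(v - 1)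
     e^(-J)|^n leaves exp (n eps + err).\<close>
   define G where "G = real n * (eps + ln t + Re ((1 - 1 / v ^ m) / k) - ln (cmod (v - 1))) + err"
   have "cmod (A n x) \<le> C1 / (1 - t) ^ order c Q * exp G / t ^ n"
   proof (rule C1(3))
    show "0 < cmod x" "cmod x \<le> rho1" "0 < t" "t < 1" using xs rho t t1 by auto
    fix tau :: complex assume tau: "cmod tau = t"
    define \<sigma> where "\<sigma> = 1 + tau"
    have s1: "1 - t1 \<le> cmod \<sigma>" "cmod \<sigma> \<le> 2" unfolding \<sigma>_def
     using norm_triangle_ineq4[of "1 + tau" tau] norm_triangle_ineq[of 1 tau] tau t t1 by auto
    have s0: "\<sigma> \<noteq> 0" using s1 t1 by auto
    have y1: "0 < cmod (x * \<sigma>)" using s0 x0 by simp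
    have "cmod (x * \<sigma>) \<le> rho * 2" unfolding norm_mult using xs s1 rho(1) by (intro mult_mono) auto
    then have y2: "cmod (x * \<sigma>) \<le> rho2" using rho by linarith
    have E1: "cmod (E (c + x * \<sigma>) - lamc / (x * \<sigma>) ^ m) \<le> C2 * (2 / (1 - t1) ^ m * (cmod x / cmod x ^ m))"
    proof -
     have "cmod (x * \<sigma>) / cmod (x * \<sigma>) ^ m = cmod \<sigma> / cmod \<sigma> ^ m * (cmod x / cmod x ^ m)"
      by (simp add: norm_mult power_mult_distrib mult_ac)
     also have "\<dots> \<le> 2 / (1 - t1) ^ m * (cmod x / cmod x ^ m)"
      using s1 t1 by (intro mult_right_mono frac_le power_mono) auto
     finally have "C2 * (cmod (x * \<sigma>) / cmod (x * \<sigma>) ^ m) \<le> C2 * (2 / (1 - t1) ^ m * (cmod x / cmod x ^ m))"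
      using C2(2) by (rule mult_left_mono)
     with C2(3)[OF y1 y2] show ?thesis by linarith
    qed
    have E2: "cmod (E (c + x) - lamc / x ^ m) \<le> C2 * (cmod x / cmod x ^ m)"
     by (rule C2(3)) (use xs rho in auto)
    have "E (c + x * \<sigma>) - E (c + x) = (lamc / (x * \<sigma>) ^ m - lamc / x ^ m)
      + ((E (c + x * \<sigma>) - lamc / (x * \<sigma>) ^ m) - (E (c + x) - lamc / x ^ m))" by simp
    also have "lamc / (x * \<sigma>) ^ m - lamc / x ^ m = of_nat n * ((1 - 1 / \<sigma> ^ m) / k)"
     unfolding power_mult_distrib xm using n k lamc_nz s0 by (simp add: field_simps)
    finally have dE: "E (c + x * \<sigma>) - E (c + x) = of_nat n * ((1 - 1 / \<sigma> ^ m) / k)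
      + ((E (c + x * \<sigma>) - lamc / (x * \<sigma>) ^ m) - (E (c + x) - lamc / x ^ m))" .
    have Re_aux: "Re u - Re w = real n * Re a + Re b" if "u - w = of_nat n * a + b" for u w a b
     using arg_cong[OF that, of Re] by simp
    have "Re (E (c + x * \<sigma>)) - Re (E (c + x)) = real n * Re ((1 - 1 / \<sigma> ^ m) / k)
      + Re ((E (c + x * \<sigma>) - lamc / (x * \<sigma>) ^ m) - (E (c + x) - lamc / x ^ m))"
     by (rule Re_aux[OF dE])
    also have "Re ((E (c + x * \<sigma>) - lamc / (x * \<sigma>) ^ m) - (E (c + x) - lamc / x ^ m)) \<le> err"
    proof -
     have "Re ((E (c + x * \<sigma>) - lamc / (x * \<sigma>) ^ m) - (E (c + x) - lamc / x ^ m))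
       \<le> cmod ((E (c + x * \<sigma>) - lamc / (x * \<sigma>) ^ m) - (E (c + x) - lamc / x ^ m))" by (rule complex_Re_le_cmod)
     also have "\<dots> \<le> C2 * (2 / (1 - t1) ^ m * (cmod x / cmod x ^ m)) + C2 * (cmod x / cmod x ^ m)"
      by (rule order_trans[OF norm_triangle_ineq4 add_mono[OF E1 E2]])
     finally show ?thesis by (simp add: err_def algebra_simps)
    qed
    also have "real n * Re ((1 - 1 / \<sigma> ^ m) / k) \<le> real n * (eps + ln t + Re ((1 - 1 / v ^ m) / k) - ln (cmod (v - 1)))"
    proof (rule mult_left_mono)
     have "cmod (v - 1) / t * exp (Re ((1 - 1 / \<sigma> ^ m) / k) - Re ((1 - 1 / v ^ m) / k)) \<le> exp eps"
      using cr tau unfolding cauchy_ratio_def k_def[symmetric] v_def[symmetric] \<sigma>_def by blast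
     then have "ln (cmod (v - 1) / t * exp (Re ((1 - 1 / \<sigma> ^ m) / k) - Re ((1 - 1 / v ^ m) / k))) \<le> ln (exp eps)"
      using v1 t by (intro ln_mono) auto
     also have "ln (cmod (v - 1) / t * exp (Re ((1 - 1 / \<sigma> ^ m) / k) - Re ((1 - 1 / v ^ m) / k)))
       = ln (cmod (v - 1)) - ln t + (Re ((1 - 1 / \<sigma> ^ m) / k) - Re ((1 - 1 / v ^ m) / k))"
      using v1 t by (subst ln_mult) (auto simp: ln_div)
     finally show "Re ((1 - 1 / \<sigma> ^ m) / k) \<le> eps + ln t + Re ((1 - 1 / v ^ m) / k) - ln (cmod (v - 1))" by simp
    qed simp
    finally show "Re (E (c + x * (1 + tau))) - Re (E (c + x)) \<le> G" by (simp add: G_def \<sigma>_def)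
   qed
   also have "\<dots> \<le> C3 * exp G / t ^ n"
    unfolding C3_def using t t1 C1 by (intro divide_right_mono mult_right_mono frac_le power_mono) auto
   finally have Ab: "cmod (A n x) \<le> C3 * exp G / t ^ n" .
   have "H n Y = A n x * ((v - 1) * exp (- J k)) ^ n"
    using H_eq[OF n(1) Y Y0] xs rho by (simp add: x_def k_def v_def)
   then have "cmod (H n Y) = cmod (A n x) * (cmod (v - 1) * exp (- Re (J k))) ^ n"
    by (simp add: norm_mult norm_power)
   also have "\<dots> \<le> (C3 * exp G / t ^ n) * (cmod (v - 1) * exp (- Re (J k))) ^ n"
    by (intro mult_right_mono Ab) simp
   also have "\<dots> = exp (ln C3 + real n * eps + err)"
   proof -
    have "cmod (v - 1) * exp (- Re (J k)) = exp (ln (cmod (v - 1)) - Re (J k))"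
     using v1 by (simp add: exp_diff exp_minus field_simps)
    then have e1: "(cmod (v - 1) * exp (- Re (J k))) ^ n = exp (real n * (ln (cmod (v - 1)) - Re (J k)))"
     by (simp only: exp_of_nat_mult)
    have e2: "t ^ n = exp (real n * ln t)" using t by (simp add: exp_of_nat_mult)
    have "G + real n * (ln (cmod (v - 1)) - Re (J k)) - real n * ln t = real n * eps + err"
     unfolding G_def J_eq[OF k] v_def by (simp add: algebra_simps)
    then have "C3 * exp (G + real n * (ln (cmod (v - 1)) - Re (J k)) - real n * ln t) = exp (ln C3 + real n * eps + err)"
     using C3 by (simp add: exp_add)
    then show ?thesis unfolding e1 e2 by (simp add: exp_add exp_diff)
   qed
   also have "\<dots> \<le> exp (2 * eps * real n)"
   proof -
    have "real n * (ln C3 / real n + K * cmod (dl n)) \<le> real n * eps" using elim n by (intro mult_left_mono) auto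
    then have "ln C3 + real n * (K * cmod (dl n)) \<le> real n * eps" using n by (simp add: distrib_left)
    moreover have "2 * eps * real n = real n * eps + real n * eps" by simp
    ultimately have "ln C3 + real n * eps + err \<le> 2 * eps * real n" using err by linarith
    then show ?thesis by simp
   qed
   finally show "cmod (H n Y) \<le> exp (2 * eps * real n)" .
  qed
 qed
qed

text \<open>The circle estimates apply for Y^m close to the ray and for |Y| > R1. The remaining
  points form a compact set F inside the domain, to which
  \<open>maximum_modulus_relative_compact\<close> extends the bound; F contains Y = 0, where the
  Cauchy estimate says nothing.\<close>

theorem H_bound:
 assumes e: "eps > 0"
 shows "\<forall>\<^sub>F n in sequentially. \<forall>Y\<in>Om. cmod Y < R0 \<longrightarrow> cmod (H n Y) \<le> exp (eps * real n)"
proof -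
 define e2 where "e2 = eps / 2"
 have e2: "e2 > 0" using e by (simp add: e2_def)
 define t1 where "t1 = exp (- e2 / 4)"
 have t1: "0 < t1" "t1 < 1" using e2 by (auto simp: t1_def)
 obtain K0 where K0: "\<And>k tau. k \<in> SL \<Longrightarrow> cmod k \<ge> K0 \<Longrightarrow> cmod tau = t1 \<Longrightarrow> cauchy_ratio k (vb k) t1 tau \<le> exp e2"
  using cauchy_ratio_far[OF e2] unfolding t1_def by blast
 define R1 where "R1 = max R0 (max K0 1)"
 have R1: "R1 \<ge> R0" "R1 \<ge> K0" "R1 \<ge> 1" by (auto simp: R1_def)
 define R2 where "R2 = R1 + 1"
 have R2: "R2 > R1" by (simp add: R2_def)
 obtain rho' where rho': "rho' > 0" "\<And>k k0. k \<in> SL \<Longrightarrow> cmod k \<le> R2 ^ m \<Longrightarrow> k0 \<ge> 1 / cstar m \<Longrightarrow> cmod (k - of_real k0) < rho' \<Longrightarrow>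
   \<exists>t>0. t \<le> t1 \<and> (\<forall>tau. cmod tau = t \<longrightarrow> cauchy_ratio k (vb k) t tau \<le> exp e2)"
  using cauchy_ratio_near_boundary[OF e2, of "R2 ^ m"] unfolding t1_def by blast
 define l where "l = 1 / cstar m"
 have l: "l > 0" using L_pos by (simp add: l_def)
 define rho where "rho = min rho' (l / 2)"
 have rho: "rho > 0" "rho \<le> rho'" "rho \<le> l / 2" using rho' l by (auto simp: rho_def)
 \<comment> \<open>If Y^m is within rho <= l/2 of the ray from l, then |Y^m| > l/2, and hence |Y| >=
   y0.\<close>
 define y0 where "y0 = min 1 (l / 2)"
 have y0: "y0 > 0" "y0 \<le> 1" "y0 \<le> l / 2" using l by (auto simp: y0_def)
 define F where "F = {Y::complex. cmod Y \<le> R1} \<inter> (\<Inter>k0\<in>{l..}. {Y. rho \<le> cmod (Y ^ m - of_real k0)})"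
 have Fc: "compact F"
 proof -
  have "closed (\<Inter>k0\<in>{l..}. {Y::complex. rho \<le> cmod (Y ^ m - of_real k0)})"
   by (intro closed_INT ballI closed_Collect_le continuous_intros)
  moreover have "{Y::complex. cmod Y \<le> R1} = cball 0 R1" by (auto simp: dist_norm)
  ultimately show ?thesis by (simp add: F_def compact_Int_closed)
 qed
 define D where "D = Om \<inter> ball 0 R2"
 have FD: "F \<subseteq> D"
 proof
  fix Y assume Y: "Y \<in> F"
  have "Y ^ m \<in> SL"
  proof (rule ccontr)
   assume "Y ^ m \<notin> SL"
   then have "Im (Y ^ m) = 0" "Re (Y ^ m) \<ge> l" by (auto simp: slit_def l_def)
   then have "Y ^ m = of_real (Re (Y ^ m))" "Re (Y ^ m) \<in> {l..}" by (auto simp: complex_eq_iff)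
   then have "rho \<le> cmod (Y ^ m - Y ^ m)" using Y unfolding F_def by (metis (mono_tags, lifting) INT_iff IntD2 mem_Collect_eq)
   then show False using rho(1) by simp
  qed
  then show "Y \<in> D" using Y R2 by (auto simp: D_def Om_def F_def)
 qed
 have oD: "open D" by (auto simp: D_def open_Om)
 have ev1: "\<forall>\<^sub>F n in sequentially. cmod (dl n) * R2 \<le> r" by (rule dl_small) (use R1 R2 r_pos in auto)
 show ?thesis using H_bound_ratio[OF e2 y0(1) t1(2), of R2] ev1
 proof eventually_elim
  case (elim n)
  have key: "cmod (H n Y) \<le> exp (eps * real n)"
   if "Y \<in> Om" "y0 \<le> cmod Y" "cmod Y \<le> R2" "0 < t" "t \<le> t1"
    "\<And>tau. cmod tau = t \<Longrightarrow> cauchy_ratio (Y ^ m) (vb (Y ^ m)) t tau \<le> exp e2" for Y t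
  proof -
   have "cmod (H n Y) \<le> exp (2 * e2 * real n)" using elim(1) that by blast
   then show ?thesis by (simp add: e2_def)
  qed
  have "cmod (H n Y) \<le> exp (eps * real n)" if YD: "Y \<in> D" for Y
  proof (rule maximum_modulus_relative_compact[OF oD _ Fc FD _ YD])
   show "H n holomorphic_on D" unfolding D_def by (rule H_holomorphic[OF elim(2)])
   fix z assume z: "z \<in> D - F"
   then have zO: "z \<in> Om" "cmod z \<le> R2" "z ^ m \<in> SL" by (auto simp: D_def Om_def)
   show "cmod (H n z) \<le> exp (eps * real n)"
   proof (cases "cmod z > R1")
    case True
    have z1: "1 \<le> cmod z" using True R1 by linarith
    have "cmod z ^ 1 \<le> cmod z ^ m" by (rule power_increasing[OF m_pos z1])
    then have "cmod (z ^ m) \<ge> K0" using True R1 by (simp add: norm_power)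
    then show ?thesis using zO z1 y0 t1 K0[OF zO(3)] by (intro key[of z t1]) auto
   next
    case False
    then obtain k0 where k0: "k0 \<ge> l" "cmod (z ^ m - of_real k0) < rho" using z by (auto simp: F_def not_le)
    have "cmod (z ^ m) \<le> R2 ^ m" unfolding norm_power using zO by (intro power_mono) auto
    then obtain t where t: "t > 0" "t \<le> t1" "\<And>tau. cmod tau = t \<Longrightarrow> cauchy_ratio (z ^ m) (vb (z ^ m)) t tau \<le> exp e2"
     using rho'(2)[OF zO(3), of k0] k0 rho by (auto simp: l_def)
    have "k0 \<le> cmod (of_real k0)" by simp
    also have "\<dots> \<le> cmod (z ^ m) + cmod (z ^ m - of_real k0)"
     using norm_triangle_sub[of "of_real k0" "z ^ m"] by (simp add: norm_minus_commute)
    finally have zm: "cmod (z ^ m) > l / 2" using k0 rho by linarith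
    have "y0 \<le> cmod z"
    proof (rule ccontr)
     assume "\<not> y0 \<le> cmod z"
     then have a: "cmod z < y0" by simp
     have "cmod z ^ m \<le> cmod z ^ 1" using a y0 m_pos by (intro power_decreasing) auto
     then show False using a y0 zm by (simp add: norm_power)
    qed
    then show ?thesis using zO t by (intro key[of z t]) auto
   qed
  qed
  moreover have "Y \<in> D" if "Y \<in> Om" "cmod Y < R0" for Y using that R1 R2 by (auto simp: D_def)
  ultimately show ?case by blast
 qed
qed

end

section \<open>Moments of the zeros\<close>

lemma sum_mset_count:
 fixes F :: "'a \<Rightarrow> 'b :: comm_semiring_1"
 assumes "finite A" "set_mset M \<subseteq> A"
 shows "(\<Sum>x\<in>#M. F x) = (\<Sum>x\<in>A. of_nat (count M x) * F x)"
 using assms(2)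
proof (induction M)
 case (add a M)
 have "(\<Sum>x\<in>A. of_nat (count (add_mset a M) x) * F x) = (\<Sum>x\<in>A. of_nat (count M x) * F x + (if x = a then F x else 0))"
  by (intro sum.cong) (auto simp: algebra_simps)
 also have "\<dots> = (\<Sum>x\<in>A. of_nat (count M x) * F x) + F a"
  using assms(1) add.prems by (simp add: sum.distrib)
 finally show ?case using add by (simp add: add.commute)
qed simp

lemma sum_proots:
 fixes F :: "complex \<Rightarrow> 'b :: comm_semiring_1"
 assumes p: "p \<noteq> 0"
 shows "(\<Sum>zeta\<in>#filter_mset X (proots p). F zeta) = (\<Sum>zeta | poly p zeta = 0 \<and> X zeta. of_nat (order zeta p) * F zeta)"
proof -
 have "(\<Sum>zeta\<in>#filter_mset X (proots p). F zeta) = (\<Sum>zeta | poly p zeta = 0 \<and> X zeta. of_nat (count (filter_mset X (proots p)) zeta) * F zeta)"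
  using p poly_roots_finite[OF p] by (intro sum_mset_count) auto
 also have "\<dots> = (\<Sum>zeta | poly p zeta = 0 \<and> X zeta. of_nat (order zeta p) * F zeta)"
  using p by (intro sum.cong) auto
 finally show ?thesis .
qed

text \<open>Here and below a derivative is stored as value times logarithmic derivative, so that
  products, quotients and powers act additively on the second factor.\<close>

lemma log_deriv_mult:
 fixes f g :: "complex \<Rightarrow> complex"
 assumes "(f has_field_derivative f z * a) (at z)" "(g has_field_derivative g z * b) (at z)"
 shows "((\<lambda>w. f w * g w) has_field_derivative (f z * g z) * (a + b)) (at z)"
 using DERIV_mult[OF assms] by (simp add: algebra_simps)

lemma log_deriv_divide:
 fixes f g :: "complex \<Rightarrow> complex"
 assumes "(f has_field_derivative f z * a) (at z)" "(g has_field_derivative g z * b) (at z)" "g z \<noteq> 0"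
 shows "((\<lambda>w. f w / g w) has_field_derivative (f z / g z) * (a - b)) (at z)"
proof -
 have "(f z * a * g z - f z * (g z * b)) / (g z * g z) = (f z / g z) * (a - b)"
  using assms(3) by (simp add: field_simps)
 then show ?thesis using DERIV_divide[OF assms] by simp
qed

lemma log_deriv_power:
 fixes f :: "complex \<Rightarrow> complex"
 assumes "(f has_field_derivative f z * a) (at z)"
 shows "((\<lambda>w. f w ^ n) has_field_derivative (f z ^ n) * (of_nat n * a)) (at z)"
proof (induction n)
 case (Suc n)
 from log_deriv_mult[OF assms this] show ?case by (simp add: algebra_simps)
qed simp

lemma log_deriv_prod_mset:
 fixes z :: complex
 assumes "\<And>y. y \<in># M \<Longrightarrow> z \<noteq> y"
 shows "((\<lambda>w. \<Prod>y\<in>#M. w - y) has_field_derivative (\<Prod>y\<in>#M. z - y) * (\<Sum>y\<in>#M. 1 / (z - y))) (at z)"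
 using assms
proof (induction M)
 case (add y M)
 have "((\<lambda>w. w - y) has_field_derivative (z - y) * (1 / (z - y))) (at z)"
  using add.prems[of y] by (auto intro!: derivative_eq_intros)
 from log_deriv_mult[OF this add.IH] show ?case using add.prems by simp
qed simp

text \<open>Power sums of 1/y are the Taylor coefficients of -z times the logarithmic derivative of
  the product of the z - y. The term k = 0, the number of points, is missing.\<close>

lemma geometric_mset_sums:
 fixes z :: complex
 assumes "\<And>y. y \<in># M \<Longrightarrow> cmod z < cmod y"
 shows "(\<lambda>k. (if k = 0 then 0 else \<Sum>y\<in>#M. (1 / y) ^ k) * z ^ k) sums (\<Sum>y\<in>#M. - (z / (z - y)))"
 using assms
proof (induction M)
 case empty
 show ?case by (simp cong: if_cong)
next
 case (add y M)
 have zy: "cmod (z / y) < 1" "y \<noteq> 0" using add.prems[of y] by (auto simp: norm_divide divide_less_eq)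
 have zy2: "z \<noteq> y" using add.prems[of y] by auto
 have "(\<lambda>k. (z / y) ^ k - (if k = 0 then 1 else 0)) sums (1 / (1 - z / y) - 1)"
  using sums_single[of 0 "\<lambda>_. 1 :: complex"] by (intro sums_diff geometric_sums zy) simp
 also have "1 / (1 - z / y) - 1 = - (z / (z - y))" using zy zy2 by (simp add: divide_simps) (simp add: algebra_simps)
 also have "(\<lambda>k. (z / y) ^ k - (if k = 0 then 1 else 0)) = (\<lambda>k. (if k = 0 then 0 else (1 / y) ^ k) * z ^ k)"
  by (auto simp: fun_eq_iff power_divide)
 finally have "(\<lambda>k. (if k = 0 then 0 else (1 / y) ^ k) * z ^ k) sums (- (z / (z - y)))" .
 from sums_add[OF this add.IH] have "(\<lambda>k. (if k = 0 then 0 else (1 / y) ^ k) * z ^ k + (if k = 0 then 0 else \<Sum>y\<in>#M. (1 / y) ^ k) * z ^ k)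
   sums (- (z / (z - y)) + (\<Sum>y\<in>#M. - (z / (z - y))))" using add.prems by simp
 also have "(\<lambda>k. (if k = 0 then 0 else (1 / y) ^ k) * z ^ k + (if k = 0 then 0 else \<Sum>y\<in>#M. (1 / y) ^ k) * z ^ k)
  = (\<lambda>k. (if k = 0 then 0 else \<Sum>y\<in>#add_mset y M. (1 / y) ^ k) * z ^ k)" by (auto simp: fun_eq_iff algebra_simps)
 finally show ?case by simp
qed

lemma holomorphic_prod_mset: "(\<lambda>z. \<Prod>y\<in>#M. z - y) holomorphic_on A"
 by (induction M) (auto intro!: holomorphic_intros)

lemma holomorphic_sum_mset:
 fixes A :: "complex set"
 assumes "\<And>y. y \<in># M \<Longrightarrow> y \<notin> A"
 shows "(\<lambda>z. \<Sum>y\<in>#M. - (z / (z - y))) holomorphic_on A"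
 using assms by (induction M) (auto intro!: holomorphic_intros)

lemma sum_mset_scaled_reciprocal:
 fixes z :: complex
 shows "(\<Sum>y\<in>#M. - (z / (z - y))) = - (z * (\<Sum>y\<in>#M. 1 / (z - y)))"
 by (induction M) (simp_all add: algebra_simps)

lemma sum_four_lt:
 fixes a b d :: real
 assumes "b < a" "d \<le> a" "0 < a"
 shows "2 * (a + a * 1 + b) + d < 16 * a"
 using assms by simp

lemma prod_mset_scale:
 fixes a :: complex
 shows "(\<Prod>y\<in>#M. a * g y) = a ^ size M * (\<Prod>y\<in>#M. g y)"
 by (induction M) auto

lemma norm_prod_mset_le:
 fixes g :: "'a \<Rightarrow> complex"
 assumes "\<And>y. y \<in># M \<Longrightarrow> cmod (g y) \<le> b" "0 \<le> b"
 shows "cmod (\<Prod>y\<in>#M. g y) \<le> b ^ size M"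
 using assms(1)
proof (induction M)
 case (add y M)
 have "cmod (g y) * cmod (\<Prod>y\<in>#M. g y) \<le> b * b ^ size M"
  using add assms(2) by (intro mult_mono) auto
 then show ?case by (simp add: norm_mult)
qed simp

lemma norm_prod_mset_ge:
 fixes g :: "'a \<Rightarrow> complex"
 assumes "\<And>y. y \<in># M \<Longrightarrow> b \<le> cmod (g y)" "0 \<le> b"
 shows "b ^ size M \<le> cmod (\<Prod>y\<in>#M. g y)"
 using assms(1)
proof (induction M)
 case (add y M)
 have "b * b ^ size M \<le> cmod (g y) * cmod (\<Prod>y\<in>#M. g y)"
  using add assms(2) by (intro mult_mono) auto
 then show ?case by (simp add: norm_mult)
qed simp

lemma norm_sum_mset_le:
 fixes g :: "'a \<Rightarrow> complex"
 assumes "\<And>y. y \<in># M \<Longrightarrow> cmod (g y) \<le> b"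
 shows "cmod (\<Sum>y\<in>#M. g y) \<le> real (size M) * b"
 using assms
proof (induction M)
 case (add y M)
 have "cmod (g y + (\<Sum>y\<in>#M. g y)) \<le> cmod (g y) + cmod (\<Sum>y\<in>#M. g y)" by (rule norm_triangle_ineq)
 also have "\<dots> \<le> b + real (size M) * b" using add by (intro add_mono) auto
 finally show ?case by (simp add: algebra_simps)
qed simp

section \<open>Power sums of the rescaled zeros\<close>

context hyper_micro
begin

definition Zn :: "nat \<Rightarrow> complex multiset" where
 "Zn n = image_mset (\<lambda>zeta. (zeta - c) / dl n) (proots (B n))"

definition Hc :: "nat \<Rightarrow> complex" where
 "Hc n = (of_nat n ^ n / fact n) * (lead_coeff (B n) * dl n ^ size (Zn n))"

definition Hd :: "nat \<Rightarrow> complex \<Rightarrow> complex" where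
 "Hd n Y = poly (Psharp P T) (c + dl n * Y) * (- lamc * poly Wt (c + dl n * Y)) ^ n"

lemma poly_B_prod:
 assumes n: "n \<ge> 1"
 shows "poly (B n) (c + dl n * z) = lead_coeff (B n) * dl n ^ size (Zn n) * (\<Prod>y\<in>#Zn n. z - y)"
proof -
 have "poly (B n) (c + dl n * z) = poly (smult (lead_coeff (B n)) (\<Prod>x\<in>#proots (B n). [:- x, 1:])) (c + dl n * z)"
  by (simp only: complex_poly_decompose_multiset)
 also have "\<dots> = lead_coeff (B n) * (\<Prod>x\<in>#proots (B n). c + dl n * z - x)"
  by (simp add: poly_prod_mset image_mset.compositionality comp_def algebra_simps)
 also have "(\<Prod>x\<in>#proots (B n). c + dl n * z - x) = (\<Prod>x\<in>#proots (B n). dl n * (z - (x - c) / dl n))"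
  using dl_nz[OF n] by (intro arg_cong[where f = prod_mset] image_mset_cong) (simp add: field_simps)
 also have "\<dots> = dl n ^ size (Zn n) * (\<Prod>y\<in>#Zn n. z - y)"
  by (subst prod_mset_scale) (simp add: Zn_def image_mset.compositionality comp_def)
 finally show ?thesis by simp
qed

lemma H_prod: "n \<ge> 1 \<Longrightarrow> H n z = (\<Prod>y\<in>#Zn n. z - y) * (Hc n * Th z ^ n / Hd n z)"
 by (simp add: H_def poly_B_prod Hc_def Hd_def)

lemma H_split:
 assumes n: "n \<ge> 1"
 shows "H n z = (\<Prod>y\<in>#filter_mset X (Zn n). z - y) *
   ((\<Prod>y\<in>#filter_mset (\<lambda>y. \<not> X y) (Zn n). z - y) * (Hc n * Th z ^ n / Hd n z))"
proof -
 have "(\<Prod>y\<in>#Zn n. z - y) = (\<Prod>y\<in>#filter_mset X (Zn n). z - y) * (\<Prod>y\<in>#filter_mset (\<lambda>y. \<not> X y) (Zn n). z - y)"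
  by (subst multiset_partition[of "Zn n" X]) (simp only: image_mset_union prod_mset.union)
 then show ?thesis unfolding H_prod[OF n] by (simp only: mult.assoc)
qed

lemma Hd_nz: "cmod (dl n * Y) \<le> r \<Longrightarrow> Hd n Y \<noteq> 0"
 using H_den_nz lamc_nz by (simp add: Hd_def)

lemma cofactor_holomorphic:
 assumes R': "cmod (dl n) * R' \<le> r"
 shows "(\<lambda>z. Hc n * Th z ^ n / Hd n z) holomorphic_on Om \<inter> ball 0 R'"
proof -
 have nz: "Hd n Y \<noteq> 0" if "Y \<in> Om \<inter> ball 0 R'" for Y
 proof (rule Hd_nz)
  have "cmod (dl n * Y) \<le> cmod (dl n) * R'" unfolding norm_mult using that by (intro mult_left_mono) auto
  then show "cmod (dl n * Y) \<le> r" using R' by linarith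
 qed
 have "Hd n holomorphic_on Om \<inter> ball 0 R'" unfolding Hd_def by (intro holomorphic_intros)
 then show ?thesis
  using nz by (intro holomorphic_intros holomorphic_on_subset[OF Th_holomorphic]) auto
qed

text \<open>Starlike about 0, hence simply connected, as the Riemann map in
  \<open>zero_count_compact\<close> requires.\<close>

lemma starlike_Om_ball: "R' > 0 \<Longrightarrow> starlike (Om \<inter> ball 0 R')"
 unfolding starlike_def
proof (intro bexI[of _ 0] ballI subsetI)
 fix x y :: complex assume R': "R' > 0" and x: "x \<in> Om \<inter> ball 0 R'" and "y \<in> closed_segment 0 x"
 then obtain u where u: "0 \<le> u" "u \<le> 1" "y = of_real u * x" by (auto simp: closed_segment_def scaleR_conv_of_real)
 have "u * cmod x \<le> 1 * cmod x" using u by (intro mult_right_mono) auto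
 then show "y \<in> Om \<inter> ball 0 R'" using u x scale_Om[of x u] by (auto simp: norm_mult)
qed (use zero_in_Om in auto)

lemma ln_over_n: "(\<lambda>n. (a + ln (real n)) / real n) \<longlonglongrightarrow> 0"
proof -
 have "(\<lambda>n. a / real n + ln (real n) / real n) \<longlonglongrightarrow> 0 + 0"
  by (intro tendsto_add lim_ln_over_n tendsto_divide_0[OF tendsto_const] filterlim_real_sequentially filterlim_at_top_imp_at_infinity)
 then show ?thesis by (simp add: add_divide_distrib)
qed

text \<open>\<open>zero_count_compact\<close> at 0: for N zeros in K, |H(0)| >= 1/(e n) and |H| <=
  e^(eps n) give 1/(e n) <= e^(eps n) q^N. So N <= (eps n + 1 + ln n) / (-ln q), with eps
  arbitrary.\<close>

theorem zeros_compact: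
 assumes K: "compact K" "K \<subseteq> Om"
 shows "(\<lambda>n. real (size (filter_mset (\<lambda>y. y \<in> K) (Zn n))) / real n) \<longlonglongrightarrow> 0"
proof -
 obtain R' where R': "R' > 0" "\<And>y. y \<in> K \<Longrightarrow> cmod y < R'"
 proof -
  obtain a where "a > 0" "\<And>y. y \<in> K \<Longrightarrow> cmod y < a"
   using compact_imp_bounded[OF K(1)] unfolding bounded_pos_less by blast
  then show ?thesis using that by blast
 qed
 define G where "G = Om \<inter> ball 0 R'"
 have G: "open G" "simply_connected G" "0 \<in> G" "K \<subseteq> G"
  using open_Om starlike_imp_simply_connected[OF starlike_Om_ball[OF R'(1)]] zero_in_Om R' K(2) by (auto simp: G_def)
 have GU: "G \<noteq> UNIV"
 proof
  assume "G = UNIV"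
  then have "of_real R' \<in> G" by simp
  then show False using R'(1) by (simp add: G_def)
 qed
 obtain q where q: "0 < q" "q < 1"
  "\<And>Z h b. \<lbrakk>set_mset Z \<subseteq> K; h holomorphic_on G; \<And>z. z \<in> G \<Longrightarrow> cmod ((\<Prod>y\<in>#Z. z - y) * h z) \<le> b\<rbrakk>
    \<Longrightarrow> cmod ((\<Prod>y\<in>#Z. 0 - y) * h 0) \<le> b * q ^ size Z"
  using zero_count_compact[OF G(1,2) GU G(3) K(1) G(4)] by blast
 define l where "l = - ln q"
 have l: "l > 0" using q by (simp add: l_def)
 show ?thesis
 proof (rule tendstoI)
  fix e :: real assume e: "e > 0"
  define eps where "eps = e * l / 2"
  have eps: "eps > 0" using e l by (simp add: eps_def)
  have ev1: "\<forall>\<^sub>F n in sequentially. cmod (dl n) * R' \<le> r" by (rule dl_small) (use R' r_pos in auto)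
  have ev2: "\<forall>\<^sub>F n in sequentially. (1 + ln (real n)) / real n < eps"
   using order_tendstoD(2)[OF ln_over_n eps] .
  show "\<forall>\<^sub>F n in sequentially. dist (real (size (filter_mset (\<lambda>y. y \<in> K) (Zn n))) / real n) 0 < e"
   using H_bound[OF eps, of R'] ev1 ev2 eventually_ge_at_top[of "1::nat"]
  proof eventually_elim
   case (elim n)
   have n: "n \<ge> 1" "real n > 0" using elim by auto
   define Z where "Z = filter_mset (\<lambda>y. y \<in> K) (Zn n)"
   define h where "h z = (\<Prod>y\<in>#filter_mset (\<lambda>y. y \<notin> K) (Zn n). z - y) * (Hc n * Th z ^ n / Hd n z)" for z
   have Hh: "H n z = (\<Prod>y\<in>#Z. z - y) * h z" for z unfolding Z_def h_def by (rule H_split[OF n(1)])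
   have hh: "h holomorphic_on G" unfolding h_def G_def
    by (intro holomorphic_on_mult holomorphic_prod_mset cofactor_holomorphic elim(2))
   have "cmod ((\<Prod>y\<in>#Z. 0 - y) * h 0) \<le> exp (eps * real n) * q ^ size Z"
   proof (rule q(3)[OF _ hh])
    show "cmod ((\<Prod>y\<in>#Z. z - y) * h z) \<le> exp (eps * real n)" if "z \<in> G" for z
     unfolding Hh[symmetric] using elim(1) that by (auto simp: G_def)
   qed (auto simp: Z_def)
   then have "cmod (H n 0) \<le> exp (eps * real n) * q ^ size Z" unfolding Hh .
   with H_0_ge[OF n(1)] have "1 / (exp 1 * real n) \<le> exp (eps * real n) * q ^ size Z" by linarith
   then have "ln (1 / (exp 1 * real n)) \<le> ln (exp (eps * real n) * q ^ size Z)"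
    using n q(1) by (intro ln_mono) auto
   moreover have "ln (1 / (exp 1 * real n)) = - (1 + ln (real n))" using n by (simp add: ln_div ln_mult)
   moreover have "ln (exp (eps * real n) * q ^ size Z) = eps * real n - real (size Z) * l"
    using q(1) by (simp add: ln_mult ln_realpow l_def)
   ultimately have "real (size Z) * l \<le> eps * real n + (1 + ln (real n))" by linarith
   also have "\<dots> < eps * real n + eps * real n" using elim(3) n by (simp add: pos_divide_less_eq)
   also have "\<dots> = (e * real n) * l" by (simp add: eps_def)
   finally have "real (size Z) < e * real n" using l by simp
   then show ?case using n by (simp add: Z_def pos_divide_less_eq)
  qed
 qed
qed

lemma zero_notin_Zn: "n \<ge> 1 \<Longrightarrow> 0 \<notin># Zn n"
 using dl_nz[of n] B_nz[of n] B_c_nz[of n] by (auto simp: Zn_def)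

lemma log_deriv_poly_bounded:
 assumes "\<And>z. z \<in> cball c r \<Longrightarrow> poly p z \<noteq> 0"
 shows "\<exists>b\<ge>0. \<forall>z\<in>cball c r. cmod (poly (pderiv p) z / poly p z) \<le> b"
proof -
 have "continuous_on (cball c r) (\<lambda>z. poly (pderiv p) z / poly p z)"
  using assms by (intro continuous_intros) auto
 from compact_norm_bound[OF compact_cball this] show ?thesis by blast
qed

text \<open>The zeros with |y| <= e1 are o(n) and are divided out of H. The cofactor h has no zero
  on |z| < e1 and satisfies |h| <= |h(0)| e^(o(n)), so \<open>log_deriv_bound\<close> makes h'/h =
  o(n) near 0. But h'/h is the sum of the 1/(z - y) plus n Th'/Th plus o(n), and
  \<open>Th_log_deriv\<close> evaluates Th'/Th. Hence the sums of -z/(z - y), divided by n, tend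
  uniformly to m (J(z^m) - 1), and so do their Taylor coefficients.\<close>

theorem big_moments:
 assumes e1: "e1 > 0" "(2 * e1) ^ m < 1 / cstar m" and k: "k \<ge> 1"
 shows "(\<lambda>n. (\<Sum>y\<in>#filter_mset (\<lambda>y. cmod y > e1) (Zn n). (1 / y) ^ k) / (of_nat m * of_nat n))
      \<longlonglongrightarrow> (if m dvd k then of_real (mom (k div m)) else 0)"
proof -
 have m0: "m > 0" using m_pos by simp
 define rho where "rho = e1 / 4"
 have rho: "rho > 0" "rho < e1" using e1 by (auto simp: rho_def)
 have small_Om: "z \<in> Om" if "cmod z \<le> 2 * e1" for z
 proof -
  have "cmod z ^ m \<le> (2 * e1) ^ m" using that by (intro power_mono) auto
  then have "z ^ m \<in> ball 0 (1 / cstar m)" using e1(2) by (simp add: norm_power)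
  then show ?thesis using ball_subset_slit unfolding Om_def by blast
 qed
 define big where "big n = filter_mset (\<lambda>y. cmod y > e1) (Zn n)" for n
 define sm where "sm n = filter_mset (\<lambda>y. \<not> cmod y > e1) (Zn n)" for n
 define a where "a n k = (if k = 0 then 0 else \<Sum>y\<in>#big n. (1 / y) ^ k) / of_nat n" for n k
 define g where "g n z = (\<Sum>y\<in>#big n. - (z / (z - y))) / of_nat n" for n z
 define b where "b k = (if k \<ge> 1 \<and> m dvd k then of_nat m * of_real (mom (k div m)) else (0::complex))" for k
 define G where "G z = of_nat m * (J (z ^ m) - 1)" for z
 have bigD: "cmod y > e1" if "y \<in># big n" for n y using that by (auto simp: big_def)
 obtain b1 where b1: "b1 \<ge> 0" "\<And>z. z \<in> cball c r \<Longrightarrow> cmod (poly (pderiv (Psharp P T)) z / poly (Psharp P T) z) \<le> b1"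
  using log_deriv_poly_bounded[of "Psharp P T"] r_Psharp by blast
 have Wtn: "poly Wt z \<noteq> 0" if "z \<in> cball c r" for z
  using H_den_nz Wt_nz[of z] near_c_notin'[of "z - c"] that by (auto simp: dist_norm norm_minus_commute)
 obtain b2 where b2: "b2 \<ge> 0" "\<And>z. z \<in> cball c r \<Longrightarrow> cmod (poly (pderiv Wt) z / poly Wt z) \<le> b2"
  using log_deriv_poly_bounded[of Wt] Wtn by blast
 have smc: "(\<lambda>n. real (size (sm n)) / real n) \<longlonglongrightarrow> 0"
 proof -
  have "cball 0 e1 \<subseteq> Om" using small_Om e1(1) by auto
  from zeros_compact[OF compact_cball this] show ?thesis by (simp add: sm_def not_less)
 qed
 have lim: "uniform_limit (ball 0 rho) g G sequentially"
 proof (rule uniform_limitI)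
  fix e :: real assume e: "e > 0"
  define eps where "eps = e / 16"
  have eps: "eps > 0" using e by (simp add: eps_def)
  have ev1: "\<forall>\<^sub>F n in sequentially. cmod (dl n) * (3 * e1) \<le> r" by (rule dl_small) (use e1 r_pos in auto)
  have ev2: "\<forall>\<^sub>F n in sequentially. (2 + ln (real n)) / real n < eps" using order_tendstoD(2)[OF ln_over_n eps] .
  have ev3: "\<forall>\<^sub>F n in sequentially. real (size (sm n)) / real n < eps" using order_tendstoD(2)[OF smc eps] .
  have ev4: "\<forall>\<^sub>F n in sequentially. cmod (dl n) * (rho * (b1 + b2)) \<le> eps" by (rule dl_small) (use rho b1 b2 eps in auto)
  show "\<forall>\<^sub>F n in sequentially. \<forall>z\<in>ball 0 rho. dist (g n z) (G z) < e"
   using H_bound[OF eps, of "3 * e1"] ev1 ev2 ev3 ev4 eventually_ge_at_top[of "1::nat"]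
  proof eventually_elim
   case (elim n)
   have n: "n \<ge> 1" "real n > 0" using elim by auto
   \<comment> \<open>A small zero is divided out as (z - y)/(2 e1). At z = 0 this is at most 1 in
     modulus, so |h(0)| >= |H(0)|; on |z| = 2 e1 it is at least 1/2, so |h| <= 2^N |H|
     there.\<close>
   define K where "K = (2 * of_real e1 :: complex)"
   have K0: "K \<noteq> 0" "cmod K = 2 * e1" using e1 by (auto simp: K_def norm_mult)
   define N where "N = size (sm n)"
   define h where "h z = (\<Prod>y\<in>#big n. z - y) * (K ^ N * Hc n * Th z ^ n / Hd n z)" for z
   define \<pi> where "\<pi> z = (\<Prod>y\<in>#sm n. (1 / K) * (z - y))" for z
   have Hh: "H n z = \<pi> z * h z" for z
   proof -
    have "\<pi> z = (1 / K) ^ N * (\<Prod>y\<in>#sm n. z - y)" unfolding \<pi>_def N_def by (rule prod_mset_scale)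
    then show ?thesis
     using H_split[OF n(1), of z "\<lambda>y. cmod y > e1"] K0
     by (simp add: h_def big_def sm_def power_divide)
   qed
   have smD: "cmod y \<le> e1" if "y \<in># sm n" for y using that by (auto simp: sm_def)
   have dOm: "cball 0 (2 * e1) \<subseteq> Om \<inter> ball 0 (3 * e1)" using small_Om e1(1) by auto
   have hh: "h holomorphic_on Om \<inter> ball 0 (3 * e1)"
   proof -
    have "(\<lambda>z. (\<Prod>y\<in>#big n. z - y) * (K ^ N * (Hc n * Th z ^ n / Hd n z))) holomorphic_on Om \<inter> ball 0 (3 * e1)"
     by (intro holomorphic_on_mult holomorphic_prod_mset cofactor_holomorphic elim(2) holomorphic_on_const)
    then show ?thesis by (simp add: h_def[abs_def] mult.assoc)
   qed
   have hb: "cmod (h z) \<le> exp (eps * real n) * 2 ^ N" if z: "cmod z < e1" for z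
   proof (rule maximum_modulus_frontier[of h "ball 0 (2 * e1)"])
    show "h holomorphic_on interior (ball 0 (2 * e1))"
     by (rule holomorphic_on_subset[OF hh]) (use dOm in auto)
    have "closure (ball (0::complex) (2 * e1)) \<subseteq> Om \<inter> ball 0 (3 * e1)" using dOm e1(1) by simp
    then show "continuous_on (closure (ball 0 (2 * e1))) h"
     by (rule continuous_on_subset[OF holomorphic_on_imp_continuous_on[OF hh]])
    show "z \<in> ball 0 (2 * e1)" using z e1(1) by simp
    fix w :: complex assume "w \<in> frontier (ball 0 (2 * e1))"
    then have w: "cmod w = 2 * e1" using e1(1) by simp
    have wO: "w \<in> Om" "cmod w < 3 * e1" using small_Om w e1(1) by auto
    have "(1 / 2) ^ N \<le> cmod (\<pi> w)"
     unfolding \<pi>_def N_def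
    proof (rule norm_prod_mset_ge)
     fix y assume "y \<in># sm n"
     then have "cmod (w - y) \<ge> e1" using smD[of y] w norm_triangle_ineq2[of w y] by simp
     then show "1 / 2 \<le> cmod (1 / K * (w - y))" using K0 e1(1) by (simp add: norm_mult norm_divide field_simps)
    qed simp
    then have "(1 / 2) ^ N * cmod (h w) \<le> cmod (\<pi> w) * cmod (h w)" by (rule mult_right_mono) simp
    also have "\<dots> = cmod (H n w)" by (simp add: Hh norm_mult)
    also have "\<dots> \<le> exp (eps * real n)" using elim(1) wO by blast
    finally show "cmod (h w) \<le> exp (eps * real n) * 2 ^ N" by (simp add: power_one_over field_simps)
   qed simp
   have h0: "1 / (exp 1 * real n) \<le> cmod (h 0)"
   proof -
    have "cmod (\<pi> 0) \<le> 1 ^ size (sm n)"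
     unfolding \<pi>_def
    proof (rule norm_prod_mset_le)
     fix y assume "y \<in># sm n"
     then show "cmod (1 / K * (0 - y)) \<le> 1" using smD[of y] K0 e1(1) by (simp add: norm_mult norm_divide field_simps)
    qed simp
    then have "cmod (\<pi> 0) * cmod (h 0) \<le> 1 * cmod (h 0)" by (intro mult_right_mono) auto
    then show ?thesis using H_0_ge[OF n(1)] by (simp add: Hh norm_mult)
   qed
   \<comment> \<open>eps n from the bound on H, N ln 2 from the removed zeros, 1 + ln n from the
     lower bound at 0, and a further 1 to make the inequality strict.\<close>
   define A' where "A' = eps * real n + real N * ln 2 + (2 + ln (real n))"
   have hlt: "cmod (h z) < cmod (h 0) * exp A'" if z: "cmod z < e1" for z
   proof -
    have "exp (eps * real n) * 2 ^ N * 1 < exp (eps * real n) * 2 ^ N * exp 1" by (intro mult_strict_left_mono) auto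
    also have "\<dots> = 1 / (exp 1 * real n) * exp A'"
    proof -
     have "exp (2 :: real) = exp 1 * exp 1" by (simp add: exp_add[symmetric])
     then show ?thesis using n(2) by (simp add: A'_def exp_add exp_of_nat_mult)
    qed
    also have "\<dots> \<le> cmod (h 0) * exp A'" by (rule mult_right_mono[OF h0]) simp
    finally show ?thesis using hb[OF z] by simp
   qed
   have dz: "cmod (dl n * z) \<le> r" if "cmod z < e1" for z
   proof -
    have "cmod (dl n * z) \<le> cmod (dl n) * (3 * e1)" unfolding norm_mult using that e1 by (intro mult_left_mono) auto
    then show ?thesis using elim(2) by linarith
   qed
   have hnz: "h z \<noteq> 0" if z: "cmod z < e1" for z
   proof -
    have "h 0 \<noteq> 0"
    proof
     assume "h 0 = 0"
     then have "1 / (exp 1 * real n) \<le> 0" using h0 by (simp only: norm_zero)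
     moreover have "1 / (exp 1 * real n) > 0" using n by simp
     ultimately show False by linarith
    qed
    then have "Hc n \<noteq> 0" by (auto simp: h_def)
    moreover have "z \<in> Om" using small_Om z e1(1) by auto
    ultimately show ?thesis using Th_nz[of z] Hd_nz[OF dz[OF z]] K0 bigD z by (force simp: h_def prod_mset_zero_iff)
   qed
   show ?case
   proof
    fix z :: complex assume "z \<in> ball 0 rho"
    then have z: "cmod z < rho" "cmod z < e1" using rho by auto
    have zO: "z \<in> Om" using small_Om z(2) e1(1) by auto
    define x where "x = c + dl n * z"
    have xb: "x \<in> cball c r" using dz[OF z(2)] by (simp add: x_def dist_norm)
    define p1 where "p1 = poly (pderiv (Psharp P T)) x / poly (Psharp P T) x"
    define w1 where "w1 = poly (pderiv Wt) x / poly Wt x"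
    define tau where "tau = deriv Th z / Th z"
    define S where "S = (\<Sum>y\<in>#big n. 1 / (z - y))"
    have dc: "((\<lambda>w. poly p (c + dl n * w)) has_field_derivative poly p x * (dl n * (poly (pderiv p) x / poly p x))) (at z)"
     if "poly p x \<noteq> 0" for p
     using that unfolding x_def by (auto intro!: derivative_eq_intros poly_DERIV[THEN DERIV_chain2])
    have Pn: "poly (Psharp P T) x \<noteq> 0" "poly Wt x \<noteq> 0" using r_Psharp xb Wtn[OF xb] by auto
    have dTh: "(Th has_field_derivative Th z * tau) (at z)"
     using holomorphic_derivI[OF Th_holomorphic open_Om zO] Th_nz[OF zO] by (simp add: tau_def)
    have dW: "((\<lambda>w. - lamc * poly Wt (c + dl n * w)) has_field_derivative (- lamc * poly Wt x) * (0 + dl n * w1)) (at z)"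
     using log_deriv_mult[OF _ dc[OF Pn(2), unfolded x_def], of "\<lambda>_. - lamc" 0] by (simp add: w1_def x_def)
    have dHd: "(Hd n has_field_derivative Hd n z * (dl n * p1 + of_nat n * (0 + dl n * w1))) (at z)"
     unfolding Hd_def[abs_def] using log_deriv_mult[OF dc[OF Pn(1), unfolded x_def] log_deriv_power[OF dW[unfolded x_def], of n]]
     by (simp add: p1_def x_def)
    have dnum: "((\<lambda>w. K ^ N * Hc n * Th w ^ n) has_field_derivative (K ^ N * Hc n * Th z ^ n) * (0 + of_nat n * tau)) (at z)"
     using log_deriv_mult[OF _ log_deriv_power[OF dTh, of n], of "\<lambda>_. K ^ N * Hc n" 0] by simp
    have "(h has_field_derivative h z * (S + ((0 + of_nat n * tau) - (dl n * p1 + of_nat n * (0 + dl n * w1))))) (at z)"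
     unfolding h_def[abs_def] S_def
    proof (rule log_deriv_mult[OF log_deriv_prod_mset log_deriv_divide[OF dnum dHd Hd_nz[OF dz[OF z(2)]]]])
     show "z \<noteq> y" if "y \<in># big n" for y using bigD[OF that] z(2) by auto
    qed
    then have "deriv h z / h z = S + of_nat n * tau - dl n * p1 - of_nat n * (dl n * w1)"
     using hnz[OF z(2)] by (simp add: DERIV_imp_deriv)
    moreover have "cmod (deriv h z / h z) \<le> 8 * A' / e1"
    proof (rule log_deriv_bound[where h = h and rho = e1, OF _ hnz e1(1) hlt])
     show "h holomorphic_on ball 0 e1" by (rule holomorphic_on_subset[OF hh]) (use dOm e1(1) in auto)
    qed (use z(1) in \<open>auto simp: rho_def\<close>)
    ultimately have hb2: "cmod (S + of_nat n * tau - dl n * p1 - of_nat n * (dl n * w1)) \<le> 8 * A' / e1" by simp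
    have gS: "of_nat n * g n z = - (z * S)"
    proof -
     have "(\<Sum>y\<in>#big n. - (z / (z - y))) = - (z * S)"
      unfolding S_def by (rule sum_mset_scaled_reciprocal)
     then show ?thesis using n by (simp add: g_def)
    qed
    have "of_nat n * (g n z - G z) = - (z * (S + of_nat n * tau - dl n * p1 - of_nat n * (dl n * w1))) - z * (dl n * (p1 + of_nat n * w1))"
    proof -
     have zt: "z * tau = G z" using Th_log_deriv[OF zO] by (simp add: tau_def G_def)
     have "of_nat n * (g n z - G z) = of_nat n * g n z - of_nat n * (z * tau)" unfolding zt by (rule right_diff_distrib)
     then show ?thesis unfolding gS by (simp add: algebra_simps)
    qed
    then have "real n * cmod (g n z - G z) = cmod (- (z * (S + of_nat n * tau - dl n * p1 - of_nat n * (dl n * w1))) - z * (dl n * (p1 + of_nat n * w1)))"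
     by (metis norm_mult norm_of_nat)
    also have "\<dots> \<le> cmod z * cmod (S + of_nat n * tau - dl n * p1 - of_nat n * (dl n * w1)) + cmod z * (cmod (dl n) * cmod (p1 + of_nat n * w1))"
     by (rule order_trans[OF norm_triangle_ineq4]) (simp add: norm_mult)
    also have "\<dots> \<le> rho * (8 * A' / e1) + rho * (cmod (dl n) * (real n * (b1 + b2)))"
    proof (intro add_mono mult_mono mult_left_mono)
     have "cmod (p1 + of_nat n * w1) \<le> cmod p1 + real n * cmod w1"
      by (rule order_trans[OF norm_triangle_ineq]) (simp add: norm_mult)
     also have "\<dots> \<le> real n * b1 + real n * b2"
     proof (intro add_mono mult_left_mono)
      have "cmod p1 \<le> 1 * b1" using b1(2)[OF xb] by (simp add: p1_def)
      also have "\<dots> \<le> real n * b1" using n b1(1) by (intro mult_right_mono) auto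
      finally show "cmod p1 \<le> real n * b1" .
     qed (use b2(2)[OF xb] in \<open>auto simp: w1_def\<close>)
     finally show "cmod (p1 + of_nat n * w1) \<le> real n * (b1 + b2)" by (simp add: distrib_left)
    qed (use z rho hb2 in auto)
    also have "\<dots> = real n * (2 * (A' / real n) + cmod (dl n) * (rho * (b1 + b2)))"
     using n e1 by (simp add: rho_def field_simps)
    finally have "cmod (g n z - G z) \<le> 2 * (A' / real n) + cmod (dl n) * (rho * (b1 + b2))" using n by simp
    also have "A' / real n = eps + real N / real n * ln 2 + (2 + ln (real n)) / real n"
     using n by (simp add: A'_def add_divide_distrib)
    also have "real N / real n * ln 2 \<le> eps * 1"
     using elim(4) ln_2_less_1 eps by (intro mult_mono) (auto simp: N_def)
    finally have "cmod (g n z - G z) \<le> 2 * (eps + eps * 1 + (2 + ln (real n)) / real n) + cmod (dl n) * (rho * (b1 + b2))" by simp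
    also have "\<dots> < 16 * eps"
     by (rule sum_four_lt[OF elim(3) elim(5) eps])
    also have "16 * eps = e" by (simp add: eps_def)
    finally show "dist (g n z) (G z) < e" by (simp add: dist_norm)
   qed
  qed
 qed
 have "(\<lambda>n. a n k) \<longlonglongrightarrow> b k"
 proof (rule power_series_coeff_limit[OF rho(1) _ _ _ lim])
  show "(\<lambda>j. a n j * z ^ j) sums g n z" if z: "cmod z < rho" for n z
  proof -
   have "(\<lambda>j. (if j = 0 then 0 else \<Sum>y\<in>#big n. (1 / y) ^ j) * z ^ j / of_nat n) sums g n z"
    unfolding g_def by (intro sums_divide geometric_mset_sums) (use bigD z rho in force)
   then show ?thesis by (simp add: a_def)
  qed
  show "g n holomorphic_on ball 0 rho" for n
   unfolding g_def divide_inverse[of _ "of_nat n"]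
   by (intro holomorphic_on_mult holomorphic_sum_mset holomorphic_on_const) (use bigD rho in force)
  show "(\<lambda>j. b j * z ^ j) sums G z" if z: "cmod z < rho" for z
   unfolding b_def G_def
  proof (rule J_power_sums)
   have "cmod z ^ m \<le> (2 * e1) ^ m" using z rho by (intro power_mono) auto
   then show "cmod z ^ m < 1 / cstar m" using e1(2) by linarith
  qed
 qed
 then have "(\<lambda>n. a n k / of_nat m) \<longlonglongrightarrow> b k / of_nat m" using m0 by (intro tendsto_divide) auto
 moreover have "b k / of_nat m = (if m dvd k then of_real (mom (k div m)) else 0)" using k m0 by (simp add: b_def)
 moreover have "(\<lambda>n. a n k / of_nat m) = (\<lambda>n. (\<Sum>y\<in>#filter_mset (\<lambda>y. cmod y > e1) (Zn n). (1 / y) ^ k) / (of_nat m * of_nat n))"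
  using k by (simp add: a_def big_def fun_eq_iff mult.commute)
 ultimately show ?thesis by simp
qed

lemma size_Zn: "size (Zn n) \<le> (degree W + degree U) * n + degree (Psharp P T)"
 using degree_B[of n] by (simp add: Zn_def size_proots_complex)

definition Zd :: "nat \<Rightarrow> complex multiset" where "Zd n = filter_mset (\<lambda>y. cmod (dl n * y) < r) (Zn n)"

lemma size_Zd: "n \<ge> 1 \<Longrightarrow> size (Zd n) = disc_count c r (B n)"
proof -
 assume n: "n \<ge> 1"
 have "size (Zd n) = (\<Sum>zeta\<in>#filter_mset (\<lambda>zeta. cmod (zeta - c) < r) (proots (B n)). (1::nat))"
  using dl_nz[OF n] by (simp add: Zd_def Zn_def filter_mset_image_mset)
 also have "\<dots> = disc_count c r (B n)" unfolding sum_proots[OF B_nz] by (simp add: disc_count_def)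
 finally show ?thesis .
qed

lemma size_Zd_tendsto: "(\<lambda>n. real (size (Zd n)) / (real m * real n)) \<longlonglongrightarrow> 1"
proof -
 have m0: "real m > 0" using m_pos by simp
 have "(\<lambda>n. (real (disc_count c r (B n)) - real m * real n) / real n / real m + 1) \<longlonglongrightarrow> 0 / real m + 1"
  using m0 by (intro tendsto_intros count_disc) auto
 then have "(\<lambda>n. (real (disc_count c r (B n)) - real m * real n) / real n / real m + 1) \<longlonglongrightarrow> 1" by simp
 then show ?thesis
 proof (rule Lim_transform_eventually)
  show "\<forall>\<^sub>F n in sequentially. (real (disc_count c r (B n)) - real m * real n) / real n / real m + 1 = real (size (Zd n)) / (real m * real n)"
   using eventually_ge_at_top[of "1::nat"] by eventually_elim (use m0 in \<open>simp add: size_Zd field_simps\<close>)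
 qed
qed

text \<open>Zeros outside the disc satisfy |1/y| <= |dl n| / r, which tends to 0, and there are only
  O(n) of them; with k >= 1 their contribution disappears.\<close>

theorem disc_moments:
 assumes e1: "e1 > 0" "(2 * e1) ^ m < 1 / cstar m" and k: "k \<ge> 1"
 shows "(\<lambda>n. (\<Sum>y\<in>#filter_mset (\<lambda>y. cmod y > e1) (Zd n). (1 / y) ^ k) / (of_nat m * of_nat n))
      \<longlonglongrightarrow> (if m dvd k then of_real (mom (k div m)) else 0)"
proof -
 have m0: "real m > 0" using m_pos by simp
 define far where "far n = filter_mset (\<lambda>y. cmod y > e1) (filter_mset (\<lambda>y. \<not> cmod (dl n * y) < r) (Zn n))" for n
 define C where "C = real (degree W + degree U) + real (degree (Psharp P T))"
 have bound: "norm ((\<Sum>y\<in>#far n. (1 / y) ^ k) / (of_nat m * of_nat n)) \<le> C / real m * (cmod (dl n) / r) ^ k" if n: "n \<ge> 1" for n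
 proof -
  have "cmod (\<Sum>y\<in>#far n. (1 / y) ^ k) \<le> real (size (far n)) * (cmod (dl n) / r) ^ k"
  proof (rule norm_sum_mset_le)
   fix y assume y: "y \<in># far n"
   then have "r \<le> cmod (dl n) * cmod y" by (auto simp: far_def norm_mult)
   moreover have "cmod y > 0" using y e1 by (auto simp: far_def)
   ultimately have "1 / cmod y \<le> cmod (dl n) / r" using r_pos by (simp add: field_simps)
   then show "cmod ((1 / y) ^ k) \<le> (cmod (dl n) / r) ^ k" unfolding norm_power norm_divide norm_one by (intro power_mono) auto
  qed
  also have "\<dots> \<le> (C * real n) * (cmod (dl n) / r) ^ k"
  proof (rule mult_right_mono)
   have "size (far n) \<le> size (Zn n)" unfolding far_def
    by (rule order_trans[OF size_filter_mset_lesseq size_filter_mset_lesseq])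
   then have "real (size (far n)) \<le> real ((degree W + degree U) * n + degree (Psharp P T))"
    using size_Zn[of n] by (simp only: of_nat_le_iff)
   also have "\<dots> \<le> C * real n"
    using mult_left_mono[of 1 "real n" "real (degree (Psharp P T))"] n by (simp add: C_def algebra_simps)
   finally show "real (size (far n)) \<le> C * real n" .
  qed (use r_pos in simp)
  finally have "cmod (\<Sum>y\<in>#far n. (1 / y) ^ k) / (real m * real n) \<le> (C * real n) * (cmod (dl n) / r) ^ k / (real m * real n)"
   by (rule divide_right_mono) simp
  then show ?thesis using n m0 by (simp add: norm_divide norm_mult)
 qed
 have far0: "(\<lambda>n. (\<Sum>y\<in>#far n. (1 / y) ^ k) / (of_nat m * of_nat n)) \<longlonglongrightarrow> 0"
 proof (rule Lim_null_comparison)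
  show "\<forall>\<^sub>F n in sequentially. norm ((\<Sum>y\<in>#far n. (1 / y) ^ k) / (of_nat m * of_nat n)) \<le> C / real m * (cmod (dl n) / r) ^ k"
   using eventually_ge_at_top[of "1::nat"] by eventually_elim (rule bound)
  have "(\<lambda>n. C / real m * (cmod (dl n) / r) ^ k) \<longlonglongrightarrow> C / real m * (0 / r) ^ k"
   using r_pos by (intro tendsto_mult_left tendsto_power tendsto_divide dl_tendsto tendsto_const) auto
  then show "(\<lambda>n. C / real m * (cmod (dl n) / r) ^ k) \<longlonglongrightarrow> 0" using k by (simp add: zero_power)
 qed
 have split: "(\<Sum>y\<in>#filter_mset (\<lambda>y. cmod y > e1) (Zn n). (1 / y) ^ k)
   = (\<Sum>y\<in>#filter_mset (\<lambda>y. cmod y > e1) (Zd n). (1 / y) ^ k) + (\<Sum>y\<in>#far n. (1 / y) ^ k)" for n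
 proof -
  have "filter_mset (\<lambda>y. cmod y > e1) (Zn n) = filter_mset (\<lambda>y. cmod y > e1) (Zd n + filter_mset (\<lambda>y. \<not> cmod (dl n * y) < r) (Zn n))"
   unfolding Zd_def by (simp only: multiset_partition[symmetric])
  then show ?thesis by (simp add: far_def)
 qed
 from tendsto_diff[OF big_moments[OF e1 k] far0] show ?thesis
  unfolding split by (simp add: add_divide_distrib)
qed

end

section \<open>Polynomial density on the star\<close>

text \<open>Polynomials in u alone, without conj u: these are what the power sums control.\<close>

definition poly_approx :: "complex set \<Rightarrow> (complex \<Rightarrow> complex) \<Rightarrow> bool" where
 "poly_approx X F \<longleftrightarrow> (\<forall>e>0. \<exists>p. \<forall>u\<in>X. cmod (F u - poly p u) < e)"

lemma poly_approx_poly: "poly_approx X (poly p)"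
 unfolding poly_approx_def by (intro allI impI exI[of _ p]) auto

lemma poly_approx_cong: "poly_approx X F \<Longrightarrow> (\<And>u. u \<in> X \<Longrightarrow> F u = F' u) \<Longrightarrow> poly_approx X F'"
 unfolding poly_approx_def by (metis (no_types, lifting))

lemma poly_approx_const: "poly_approx X (\<lambda>_. a)"
 using poly_approx_poly[of X "[:a:]"] by (rule poly_approx_cong) simp

lemma poly_approx_add:
 assumes "poly_approx X F" "poly_approx X G"
 shows "poly_approx X (\<lambda>u. F u + G u)"
 unfolding poly_approx_def
proof (intro allI impI)
 fix e :: real assume "e > 0"
 then have e: "e / 2 > 0" by simp
 obtain p where p: "\<And>u. u \<in> X \<Longrightarrow> cmod (F u - poly p u) < e / 2" using assms(1) e unfolding poly_approx_def by blast
 obtain q where q: "\<And>u. u \<in> X \<Longrightarrow> cmod (G u - poly q u) < e / 2" using assms(2) e unfolding poly_approx_def by blast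
 show "\<exists>p. \<forall>u\<in>X. cmod (F u + G u - poly p u) < e"
 proof (intro exI[of _ "p + q"] ballI)
  fix u assume u: "u \<in> X"
  have "F u + G u - poly (p + q) u = (F u - poly p u) + (G u - poly q u)" by simp
  then have "cmod (F u + G u - poly (p + q) u) \<le> cmod (F u - poly p u) + cmod (G u - poly q u)"
   by (metis norm_triangle_ineq)
  then show "cmod (F u + G u - poly (p + q) u) < e" using p[OF u] q[OF u] by linarith
 qed
qed

lemma poly_approx_bounded:
 assumes "compact X" "poly_approx X F"
 shows "\<exists>b>0. \<forall>u\<in>X. cmod (F u) \<le> b"
proof -
 obtain p where p: "\<And>u. u \<in> X \<Longrightarrow> cmod (F u - poly p u) < 1"
  using assms(2) unfolding poly_approx_def by (meson zero_less_one)
 have "continuous_on X (poly p)" by (intro continuous_intros)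
 from compact_norm_bound[OF assms(1) this] obtain b where b: "b \<ge> 0" "\<forall>u\<in>X. cmod (poly p u) \<le> b" by blast
 show ?thesis
 proof (intro exI[of _ "b + 1"] conjI ballI)
  fix u assume u: "u \<in> X"
  show "cmod (F u) \<le> b + 1" using norm_triangle_sub[of "F u" "poly p u"] p[OF u] b(2) u by fastforce
 qed (use b in auto)
qed

lemma poly_approx_mult:
 assumes X: "compact X" and F: "poly_approx X F" and G: "poly_approx X G"
 shows "poly_approx X (\<lambda>u. F u * G u)"
 unfolding poly_approx_def
proof (intro allI impI)
 fix e :: real assume e: "e > 0"
 obtain b1 where b1: "b1 > 0" "\<And>u. u \<in> X \<Longrightarrow> cmod (F u) \<le> b1" using poly_approx_bounded[OF X F] by blast
 obtain b2 where b2: "b2 > 0" "\<And>u. u \<in> X \<Longrightarrow> cmod (G u) \<le> b2" using poly_approx_bounded[OF X G] by blast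
 define d1 where "d1 = e / (2 * (b2 + 1))"
 define d where "d = min 1 (e / (2 * b1))"
 have d: "d1 > 0" "d > 0" using e b1 b2 by (auto simp: d1_def d_def)
 obtain p where p: "\<And>u. u \<in> X \<Longrightarrow> cmod (F u - poly p u) < d1" using F d(1) unfolding poly_approx_def by blast
 obtain q where q: "\<And>u. u \<in> X \<Longrightarrow> cmod (G u - poly q u) < d" using G d(2) unfolding poly_approx_def by blast
 show "\<exists>p. \<forall>u\<in>X. cmod (F u * G u - poly p u) < e"
 proof (intro exI[of _ "p * q"] ballI)
  fix u assume u: "u \<in> X"
  have "F u * G u - poly (p * q) u = F u * (G u - poly q u) + (F u - poly p u) * poly q u" by (simp add: algebra_simps)
  then have "cmod (F u * G u - poly (p * q) u) \<le> cmod (F u) * cmod (G u - poly q u) + cmod (F u - poly p u) * cmod (poly q u)"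
   by (metis norm_mult norm_triangle_ineq)
  also have "\<dots> < b1 * d + d1 * (b2 + 1)"
  proof (rule add_le_less_mono)
   show "cmod (F u) * cmod (G u - poly q u) \<le> b1 * d" using b1(2)[OF u] q[OF u] b1(1) by (intro mult_mono) auto
   have "cmod (poly q u) \<le> cmod (G u) + cmod (G u - poly q u)"
    using norm_triangle_sub[of "poly q u" "G u"] by (simp add: norm_minus_commute)
   then have "cmod (poly q u) \<le> b2 + 1" using b2(2)[OF u] q[OF u] by (simp add: d_def)
   then have "cmod (F u - poly p u) * cmod (poly q u) \<le> cmod (F u - poly p u) * (b2 + 1)" by (intro mult_left_mono) auto
   also have "\<dots> < d1 * (b2 + 1)" using p[OF u] b2(1) by (intro mult_strict_right_mono) auto
   finally show "cmod (F u - poly p u) * cmod (poly q u) < d1 * (b2 + 1)" .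
  qed
  also have "\<dots> \<le> e"
  proof -
   have "b1 * d \<le> b1 * (e / (2 * b1))" using b1(1) by (intro mult_left_mono) (auto simp: d_def)
   also have "\<dots> = e / 2" using b1(1) by simp
   finally have "b1 * d \<le> e / 2" .
   moreover have "d1 * (b2 + 1) = e / 2" using b2(1) by (simp add: d1_def field_simps)
   ultimately show ?thesis by linarith
  qed
  finally show "cmod (F u * G u - poly (p * q) u) < e" .
 qed
qed

lemma poly_approx_limit:
 assumes "\<And>e. e > 0 \<Longrightarrow> \<exists>G. poly_approx X G \<and> (\<forall>u\<in>X. cmod (F u - G u) < e)"
 shows "poly_approx X F"
 unfolding poly_approx_def
proof (intro allI impI)
 fix e :: real assume "e > 0"
 then have e: "e / 2 > 0" by simp
 obtain G where G: "poly_approx X G" "\<And>u. u \<in> X \<Longrightarrow> cmod (F u - G u) < e / 2" using assms[OF e] by blast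
 obtain p where p: "\<And>u. u \<in> X \<Longrightarrow> cmod (G u - poly p u) < e / 2" using G(1) e unfolding poly_approx_def by blast
 show "\<exists>p. \<forall>u\<in>X. cmod (F u - poly p u) < e"
 proof (intro exI[of _ p] ballI)
  fix u assume u: "u \<in> X"
  have "cmod (F u - poly p u) \<le> cmod (F u - G u) + cmod (G u - poly p u)"
   using norm_triangle_ineq[of "F u - G u" "G u - poly p u"] by simp
  then show "cmod (F u - poly p u) < e" using G(2)[OF u] p[OF u] by linarith
 qed
qed

lemma poly_approx_real_polynomial:
 fixes k :: "complex \<Rightarrow> 'a :: real_normed_vector"
 assumes X: "compact X" and lin: "\<And>l :: 'a \<Rightarrow> real. bounded_linear l \<Longrightarrow> poly_approx X (\<lambda>u. of_real (l (k u)))"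
  and g: "real_polynomial_function g"
 shows "poly_approx X (\<lambda>u. of_real (g (k u)))"
 using g
proof (induction g rule: real_polynomial_function.induct)
 case (linear f)
 then show ?case by (rule lin)
next
 case (const a)
 show ?case by (rule poly_approx_const)
next
 case (add f g)
 from poly_approx_add[OF add.IH] show ?case by simp
next
 case (mult f g)
 from poly_approx_mult[OF X mult.IH] show ?case by simp
qed

definition star :: "nat \<Rightarrow> complex set" where "star m = {u. u ^ m \<in> of_real ` {0..cstar m}}"

lemma compact_star: assumes m: "m \<ge> 1" shows "compact (star m)"
proof -
 have "closed (of_real ` {0..cstar m} :: complex set)"
  by (intro compact_imp_closed compact_continuous_image continuous_intros compact_Icc)
 then have "closed ((\<lambda>u::complex. u ^ m) -` (of_real ` {0..cstar m}))" by (intro closed_vimage continuous_intros)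
 moreover have "(\<lambda>u::complex. u ^ m) -` (of_real ` {0..cstar m}) = star m" by (auto simp: star_def)
 moreover have "star m \<subseteq> cball 0 (max 1 (cstar m))"
 proof
  fix u assume "u \<in> star m"
  then obtain x where x: "u ^ m = of_real x" "0 \<le> x" "x \<le> cstar m" by (auto simp: star_def)
  have um: "cmod u ^ m \<le> cstar m" using x by (metis abs_of_nonneg norm_of_real norm_power)
  show "u \<in> cball 0 (max 1 (cstar m))"
  proof (cases "cmod u \<le> 1")
   case False
   then have "cmod u ^ 1 \<le> cmod u ^ m" using m by (intro power_increasing) auto
   then show ?thesis using um by simp
  qed (simp add: le_max_iff_disj)
 qed
 ultimately show ?thesis by (metis bounded_cball bounded_subset compact_eq_bounded_closed)
qed

text \<open>On the star u^m = |u|^m, so conj u = u^(m-1) |u|^(2-m). The factor |u|^(2-m) depends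
  only on u^m in [0, \<open>cstar m\<close>]; replacing |u| by max |u| d makes it continuous there
  and moves the product by at most d. Weierstrass in the variable u^m then gives polynomials in
  u.\<close>

lemma cnj_poly_approx: assumes m: "m \<ge> 1" shows "poly_approx (star m) cnj"
proof (rule poly_approx_limit)
 fix e :: real assume e: "e > 0"
 define d where "d = e / 2"
 have d: "d > 0" "d < e" using e by (auto simp: d_def)
 define \<phi> where "\<phi> x = 1 / max (root m x) d ^ (m - 1) * max (root m x) d" for x
 have c\<phi>: "continuous_on {0..cstar m} \<phi>"
  unfolding \<phi>_def using d by (intro continuous_intros) (auto simp: less_max_iff_disj max_def)
 have ap: "poly_approx (star m) (\<lambda>u. of_real (\<phi> (Re (u ^ m))))"
 proof (rule poly_approx_limit)
  fix e' :: real assume e': "e' > 0"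
  obtain g where g: "real_polynomial_function g" "\<And>x. x \<in> {0..cstar m} \<Longrightarrow> \<bar>\<phi> x - g x\<bar> < e'"
   using Stone_Weierstrass_real_polynomial_function[OF compact_Icc c\<phi> e'] by blast
  show "\<exists>G. poly_approx (star m) G \<and> (\<forall>u\<in>star m. cmod (of_real (\<phi> (Re (u ^ m))) - G u) < e')"
  proof (intro exI[of _ "\<lambda>u. of_real (g (Re (u ^ m)))"] conjI ballI)
   show "poly_approx (star m) (\<lambda>u. of_real (g (Re (u ^ m))))"
   proof (rule poly_approx_real_polynomial[OF compact_star[OF m] _ g(1)])
    fix l :: "real \<Rightarrow> real" assume l: "bounded_linear l"
    show "poly_approx (star m) (\<lambda>u. of_real (l (Re (u ^ m))))"
    proof (rule poly_approx_cong[OF poly_approx_poly[of _ "monom (of_real (l 1)) m"]])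
     fix u assume "u \<in> star m"
     then obtain x where x: "u ^ m = of_real x" by (auto simp: star_def)
     interpret bounded_linear l by fact
     have "l x = x * l 1" using scaleR[of x 1] by simp
     then show "poly (monom (of_real (l 1)) m) u = of_real (l (Re (u ^ m)))" by (simp add: poly_monom x mult.commute)
    qed
   qed
   fix u assume "u \<in> star m"
   then obtain x where x: "u ^ m = of_real x" "x \<in> {0..cstar m}" by (auto simp: star_def)
   show "cmod (of_real (\<phi> (Re (u ^ m))) - of_real (g (Re (u ^ m)))) < e'"
    unfolding x(1) of_real_diff[symmetric] norm_of_real using g(2)[OF x(2)] by simp
  qed
 qed
 show "\<exists>G. poly_approx (star m) G \<and> (\<forall>u\<in>star m. cmod (cnj u - G u) < e)"
 proof (intro exI[of _ "\<lambda>u. u ^ (m - 1) * of_real (\<phi> (Re (u ^ m)))"] conjI ballI)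
  have "poly_approx (star m) (\<lambda>u. u ^ (m - 1))"
   by (rule poly_approx_cong[OF poly_approx_poly[of _ "monom 1 (m - 1)"]]) (simp add: poly_monom)
  then show "poly_approx (star m) (\<lambda>u. u ^ (m - 1) * of_real (\<phi> (Re (u ^ m))))"
   by (rule poly_approx_mult[OF compact_star[OF m] _ ap])
  fix u assume "u \<in> star m"
  then obtain x where x: "u ^ m = of_real x" "0 \<le> x" by (auto simp: star_def)
  define rho where "rho = cmod u"
  have "rho ^ m = x" using x by (metis rho_def abs_of_nonneg norm_of_real norm_power)
  then have r: "root m x = rho" using m by (metis rho_def less_le_trans norm_ge_zero real_root_power_cancel zero_less_one)
  have rx: "of_real x = u * u ^ (m - 1)" using x(1) m by (simp add: power_eq_if)
  show "cmod (cnj u - u ^ (m - 1) * of_real (\<phi> (Re (u ^ m)))) < e"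
  proof (cases "u = 0")
   case True
   show ?thesis
   proof (cases "m = 1")
    case True
    then show ?thesis using \<open>u = 0\<close> d r x by (simp add: \<phi>_def rho_def)
   next
    case False
    then show ?thesis using \<open>u = 0\<close> e m by (simp add: zero_power)
   qed
  next
   case u0: False
   have rp: "rho > 0" using u0 by (simp add: rho_def)
   define t where "t = max rho d"
   have t: "t \<ge> rho" "t > 0" "t \<ge> d" using rp by (auto simp: t_def)
   have ph: "\<phi> (Re (u ^ m)) = t / t ^ (m - 1)" by (simp add: \<phi>_def x(1) r t_def)
   have "cnj u * u ^ m = u ^ (m - 1) * (u * cnj u)" using m by (simp add: power_eq_if)
   also have "u * cnj u = of_real (rho ^ 2)" using complex_norm_square[of u] by (simp add: rho_def)
   finally have "cnj u * of_real (rho ^ m) = u ^ (m - 1) * of_real (rho ^ 2)"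
    using x(1) \<open>rho ^ m = x\<close> by simp
   moreover have "rho ^ m = rho * rho ^ (m - 1)" using m by (simp add: power_eq_if)
   ultimately have cu: "cnj u = u ^ (m - 1) * of_real (rho / rho ^ (m - 1))"
    using rp by (simp add: power2_eq_square field_simps)
   have "cnj u - u ^ (m - 1) * of_real (\<phi> (Re (u ^ m))) = u ^ (m - 1) * of_real (rho / rho ^ (m - 1) - t / t ^ (m - 1))"
    unfolding ph by (subst cu) (simp add: algebra_simps)
   then have nm: "cmod (cnj u - u ^ (m - 1) * of_real (\<phi> (Re (u ^ m)))) = rho ^ (m - 1) * \<bar>rho / rho ^ (m - 1) - t / t ^ (m - 1)\<bar>"
    by (simp only: norm_mult norm_power norm_of_real rho_def)
   show ?thesis
   proof (cases "rho \<ge> d")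
    case True
    then have "t = rho" by (simp add: t_def)
    then show ?thesis unfolding nm using e by simp
   next
    case False
    then have td: "t = d" "rho < d" by (auto simp: t_def)
    define a where "a = rho ^ (m - 1) * (t / t ^ (m - 1))"
    have "rho ^ (m - 1) * \<bar>rho / rho ^ (m - 1) - t / t ^ (m - 1)\<bar> = \<bar>rho ^ (m - 1) * (rho / rho ^ (m - 1) - t / t ^ (m - 1))\<bar>"
     using rp by (simp add: abs_mult)
    also have "rho ^ (m - 1) * (rho / rho ^ (m - 1) - t / t ^ (m - 1)) = rho - a" using rp by (simp add: a_def right_diff_distrib)
    finally have nm': "cmod (cnj u - u ^ (m - 1) * of_real (\<phi> (Re (u ^ m)))) = \<bar>rho - a\<bar>" using nm by simp
    have "rho ^ (m - 1) \<le> t ^ (m - 1)" using t rp by (intro power_mono) auto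
    then have "rho ^ (m - 1) / t ^ (m - 1) \<le> 1" using t by simp
    then have "rho ^ (m - 1) / t ^ (m - 1) * t \<le> 1 * t" using t by (intro mult_right_mono) auto
    then have "a \<le> d" by (simp add: a_def td)
    moreover have "a \<ge> 0" using rp t by (simp add: a_def)
    ultimately show ?thesis unfolding nm' using td(2) rp d(2) by linarith
   qed
  qed
 qed
qed

text \<open>Real polynomials in Re u and Im u are polynomials in u and conj u, hence limits of
  polynomials in u; Stone-Weierstrass does the rest.\<close>

lemma star_poly_dense:
 assumes m: "m \<ge> 1" and G: "continuous_on UNIV G"
 shows "poly_approx (star m) G"
proof -
 have id: "poly_approx (star m) (\<lambda>u. u)"
  by (rule poly_approx_cong[OF poly_approx_poly[of _ "[:0, 1:]"]]) simp
 have re: "poly_approx (star m) (\<lambda>u. of_real (h u))" if h: "continuous_on UNIV h" for h :: "complex \<Rightarrow> real"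
 proof (rule poly_approx_limit)
  fix e :: real assume e: "e > 0"
  have hc: "continuous_on (star m) h" by (rule continuous_on_subset[OF h]) simp
  obtain g where g: "real_polynomial_function g" "\<And>u. u \<in> star m \<Longrightarrow> \<bar>h u - g u\<bar> < e"
   using Stone_Weierstrass_real_polynomial_function[OF compact_star[OF m] hc e] by blast
  show "\<exists>G. poly_approx (star m) G \<and> (\<forall>u\<in>star m. cmod (of_real (h u) - G u) < e)"
  proof (intro exI[of _ "\<lambda>u. of_real (g u)"] conjI ballI)
   show "poly_approx (star m) (\<lambda>u. of_real (g u))"
   proof (rule poly_approx_real_polynomial[OF compact_star[OF m] _ g(1), where k = "\<lambda>u. u"])
    fix l :: "complex \<Rightarrow> real" assume l: "bounded_linear l"
    interpret bounded_linear l by fact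
    \<comment> \<open>A real-linear form on the plane is l(u) = a u + b conj u.\<close>
    define a b where "a = (of_real (l 1) - \<i> * of_real (l \<i>)) / 2" and "b = (of_real (l 1) + \<i> * of_real (l \<i>)) / 2"
    have "poly_approx (star m) (\<lambda>u. a * u + b * cnj u)"
     by (intro poly_approx_add poly_approx_mult compact_star[OF m] poly_approx_const id cnj_poly_approx[OF m])
    then show "poly_approx (star m) (\<lambda>u. of_real (l u))"
    proof (rule poly_approx_cong)
     fix u :: complex
     have "u = Re u *\<^sub>R 1 + Im u *\<^sub>R \<i>" by (simp add: complex_eq_iff)
     then have "l u = l (Re u *\<^sub>R 1 + Im u *\<^sub>R \<i>)" by metis
     also have "\<dots> = Re u * l 1 + Im u * l \<i>" by (simp only: add scaleR real_scaleR_def)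
     finally have "l u = Re u * l 1 + Im u * l \<i>" .
     then show "a * u + b * cnj u = of_real (l u)"
      by (simp add: a_def b_def complex_eq_iff algebra_simps add_divide_distrib diff_divide_distrib)
    qed
   qed
   fix u assume "u \<in> star m"
   then show "cmod (of_real (h u) - of_real (g u)) < e"
    unfolding of_real_diff[symmetric] norm_of_real using g(2) by simp
  qed
 qed
 have "poly_approx (star m) (\<lambda>u. of_real (Re (G u)) + \<i> * of_real (Im (G u)))"
  by (intro poly_approx_add poly_approx_mult compact_star[OF m] poly_approx_const re continuous_intros G)
 then show ?thesis by (rule poly_approx_cong) (rule complex_eq[symmetric])
qed

lemma root_of_unity_sum:
 assumes m: "m \<ge> 1"
 shows "(\<Sum>\<nu><m. (1 / exp (2 * pi * \<i> * of_nat \<nu> / of_nat m)) ^ k) = (if m dvd k then of_nat m else (0::complex))"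
proof -
 define w where "w = exp (- (2 * pi * \<i> * of_nat k / of_nat m) :: complex)"
 have m0: "(of_nat m :: complex) \<noteq> 0" using m by simp
 have t: "(1 / exp (2 * pi * \<i> * of_nat \<nu> / of_nat m)) ^ k = w ^ \<nu>" for \<nu>
  unfolding w_def exp_of_nat_mult[symmetric] by (simp add: power_one_over exp_of_nat_mult[symmetric] exp_minus inverse_eq_divide mult_ac)
 have wm: "w ^ m = 1"
 proof -
  have "w ^ m = exp (of_nat m * (- (2 * pi * \<i> * of_nat k / of_nat m)))" unfolding w_def by (rule exp_of_nat_mult[symmetric])
  also have "of_nat m * (- (2 * pi * \<i> * of_nat k / of_nat m)) = - (of_nat k * (2 * pi * \<i>) :: complex)" using m0 by simp
  also have "exp \<dots> = 1" by (simp add: exp_minus exp_of_nat_mult)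
  finally show ?thesis .
 qed
 show ?thesis
 proof (cases "m dvd k")
  case True
  then obtain j where j: "k = m * j" by auto
  have "w = exp (- (of_nat j * (2 * pi * \<i>)))" using m0 by (simp add: w_def j mult_ac)
  also have "\<dots> = 1" by (simp add: exp_minus exp_of_nat_mult)
  finally show ?thesis unfolding t using True by simp
 next
  case False
  have "w \<noteq> 1"
  proof
   assume "w = 1"
   then obtain n :: int where "- (2 * pi * \<i> * of_nat k / of_nat m) = complex_of_real (of_int (2 * n) * pi) * \<i>"
    unfolding w_def exp_eq_1 by (auto simp: complex_eq_iff)
   then have "Im (- (2 * pi * \<i> * of_nat k / of_nat m)) = of_int (2 * n) * pi" by simp
   moreover have "Im (- (2 * pi * \<i> * of_nat k / of_nat m)) = - (2 * pi * real k / real m)"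
    by (simp add: Im_divide_of_nat)
   ultimately have "pi * (- real k - of_int n * real m) = 0" using m by (simp add: field_simps)
   then have "- real k = of_int n * real m" by simp
   then have "real_of_int (int k) = real_of_int (- n * int m)" by simp
   then have "int k = - n * int m" by (simp only: of_int_eq_iff)
   then have "int m dvd int k" by simp
   then show False using False by simp
  qed
  then show ?thesis unfolding t using False wm by (simp add: sum_gp_strict)
 qed
qed

section \<open>The limit law in the variable u = 1/Y\<close>

context fuss_measure
begin

text \<open>Point of the star over x on the ray of index nu, in the variable u = 1/Y. Thus eta
  divided by it is the value of \<open>phi\<close>.\<close>

definition up :: "nat \<Rightarrow> real \<Rightarrow> complex" where
 "up \<nu> x = of_real (x powr (1 / real m)) / exp (2 * pi * \<i> * of_nat \<nu> / of_nat m)"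

definition Lim :: "(complex \<Rightarrow> complex) \<Rightarrow> complex" where
 "Lim G = (\<Sum>\<nu><m. LINT x|M. G (up \<nu> x)) / of_nat m"

lemma up_measurable [measurable]: "up \<nu> \<in> borel_measurable borel"
 unfolding up_def by measurable

lemma up_power: "(up \<nu> x) ^ k = of_real ((x powr (1 / real m)) ^ k) * (1 / exp (2 * pi * \<i> * of_nat \<nu> / of_nat m)) ^ k"
 by (simp add: up_def power_divide)

lemma powr_root: "x \<ge> 0 \<Longrightarrow> (x powr (1 / real m)) ^ m = x"
 using m_ge by (cases "x = 0") (simp_all add: powr_realpow[symmetric] powr_powr zero_power)

lemma up_star: assumes "x \<in> {0..cstar m}" shows "up \<nu> x \<in> star m"
proof -
 have m0: "(of_nat m :: complex) \<noteq> 0" using m_ge by simp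
 have "exp (2 * pi * \<i> * of_nat \<nu> / of_nat m) ^ m = exp (of_nat m * (2 * pi * \<i> * of_nat \<nu> / of_nat m))"
  by (rule exp_of_nat_mult[symmetric])
 also have "\<dots> = exp (of_nat \<nu> * (2 * pi * \<i>))" using m0 by (simp add: mult_ac)
 also have "\<dots> = 1" by (simp add: exp_of_nat_mult)
 finally have "up \<nu> x ^ m = of_real x" unfolding up_power using powr_root[of x] assms by (simp add: power_one_over)
 then show ?thesis using assms by (auto simp: star_def)
qed

lemma up_integrable:
 fixes G :: "complex \<Rightarrow> complex"
 assumes "continuous_on UNIV G"
 shows "integrable M (\<lambda>x. G (up \<nu> x))"
proof -
 have [measurable]: "G \<in> borel_measurable borel" by (rule borel_measurable_continuous_onI[OF assms])
 have "continuous_on (star m) G" by (rule continuous_on_subset[OF assms]) simp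
 from compact_norm_bound[OF compact_star[OF m_ge] this] obtain b where "\<forall>u\<in>star m. cmod (G u) \<le> b" by blast
 then show ?thesis by (intro norm_integral_bound(1)[of _ b]) (use up_star in auto)
qed

lemma Lim_close:
 assumes F: "continuous_on UNIV F" and G: "continuous_on UNIV G" and e: "\<And>u. u \<in> star m \<Longrightarrow> cmod (F u - G u) \<le> e"
 shows "cmod (Lim F - Lim G) \<le> e"
proof -
 have m0: "real m > 0" using m_ge by simp
 have [measurable]: "F \<in> borel_measurable borel" "G \<in> borel_measurable borel"
  using F G by (auto intro: borel_measurable_continuous_onI)
 have "Lim F - Lim G = (\<Sum>\<nu><m. LINT x|M. F (up \<nu> x) - G (up \<nu> x)) / of_nat m"
  unfolding Lim_def diff_divide_distrib[symmetric] sum_subtractf[symmetric]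
  by (simp add: Bochner_Integration.integral_diff up_integrable F G)
 also have "cmod \<dots> \<le> (\<Sum>\<nu><m. e) / real m"
  unfolding norm_divide norm_of_nat
  by (intro divide_right_mono sum_norm_le norm_integral_bound(2)) (use e up_star in auto)
 also have "\<dots> = e" using m0 by simp
 finally show ?thesis .
qed

text \<open>Averaging over the m rays kills the exponents not divisible by m, and x^(1/m) to the
  power m j is x^j.\<close>

lemma Lim_power: "Lim (\<lambda>u. u ^ k) = (if m dvd k then of_real (mom (k div m)) else 0)"
proof -
 have m0: "(of_nat m :: complex) \<noteq> 0" using m_ge by simp
 have "(\<Sum>\<nu><m. LINT x|M. up \<nu> x ^ k) = (\<Sum>\<nu><m. (1 / exp (2 * pi * \<i> * of_nat \<nu> / of_nat m)) ^ k * (LINT x|M. of_real ((x powr (1 / real m)) ^ k)))"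
  unfolding up_power by (intro sum.cong refl) (simp add: mult.commute)
 also have "\<dots> = (if m dvd k then of_nat m else 0) * (LINT x|M. of_real ((x powr (1 / real m)) ^ k))"
  unfolding sum_distrib_right[symmetric] root_of_unity_sum[OF m_ge] ..
 finally have "Lim (\<lambda>u. u ^ k) = (if m dvd k then (LINT x|M. of_real ((x powr (1 / real m)) ^ k)) else 0)"
  using m0 by (simp add: Lim_def)
 moreover have "(LINT x|M. complex_of_real ((x powr (1 / real m)) ^ k)) = of_real (mom (k div m))" if md: "m dvd k"
 proof -
  obtain j where j: "k = m * j" using md by auto
  have "(LINT x|M. complex_of_real ((x powr (1 / real m)) ^ k)) = (LINT x|M. complex_of_real (x ^ j))"
  proof (rule integral_cong_AE)
   show "AE x in M. complex_of_real ((x powr (1 / real m)) ^ k) = complex_of_real (x ^ j)"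
    using AE_L by eventually_elim (simp add: j power_mult powr_root del: of_real_power)
  qed measurable
  also have "\<dots> = of_real (mom j)" unfolding mom_def by (rule integral_complex_of_real)
  finally show ?thesis using j m_ge by simp
 qed
 ultimately show ?thesis by simp
qed

lemma Lim_poly: "Lim (poly p) = (\<Sum>k\<le>degree p. coeff p k * Lim (\<lambda>u. u ^ k))"
proof -
 have "(LINT x|M. poly p (up \<nu> x)) = (\<Sum>k\<le>degree p. coeff p k * (LINT x|M. up \<nu> x ^ k))" for \<nu>
  unfolding poly_altdef
  by (subst Bochner_Integration.integral_sum) (auto intro!: integrable_mult_right up_integrable[where G = "\<lambda>u. u ^ _"] continuous_intros)
 then have "(\<Sum>\<nu><m. LINT x|M. poly p (up \<nu> x)) = (\<Sum>\<nu><m. \<Sum>k\<le>degree p. coeff p k * (LINT x|M. up \<nu> x ^ k))" by simp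
 also have "\<dots> = (\<Sum>k\<le>degree p. \<Sum>\<nu><m. coeff p k * (LINT x|M. up \<nu> x ^ k))" by (rule sum.swap)
 also have "\<dots> = (\<Sum>k\<le>degree p. coeff p k * (\<Sum>\<nu><m. LINT x|M. up \<nu> x ^ k))" by (simp only: sum_distrib_left)
 finally have e: "(\<Sum>\<nu><m. LINT x|M. poly p (up \<nu> x)) = (\<Sum>k\<le>degree p. coeff p k * (\<Sum>\<nu><m. LINT x|M. up \<nu> x ^ k))" .
 show ?thesis unfolding Lim_def e by (simp only: sum_divide_distrib[where A = "{..degree p}"] times_divide_eq_right)
qed

end

section \<open>Weak convergence\<close>

lemma sum_mset_sum_swap: "(\<Sum>y\<in>#M. \<Sum>k\<in>A. f k y) = (\<Sum>k\<in>A. \<Sum>y\<in>#M. f k y)"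
 by (induction M) (auto simp: sum.distrib)

lemma sum_mset_filter_split:
 fixes F :: "'a \<Rightarrow> complex"
 shows "(\<Sum>y\<in>#M. F y) = (\<Sum>y\<in>#filter_mset X M. F y) + (\<Sum>y\<in>#filter_mset (\<lambda>y. \<not> X y) M. F y)"
 by (induction M) (auto simp: algebra_simps)

lemma size_filter_split: "size M = size (filter_mset X M) + size (filter_mset (\<lambda>y. \<not> X y) M)"
 by (induction M) auto

lemma size_filter_filter_le: "size (filter_mset X (filter_mset Y M)) \<le> size (filter_mset X M)"
 by (induction M) auto

lemma openin_sphere_preimage:
 assumes "openin riemann_sphere X"
 shows "open (Some -` X)" "None \<in> X \<Longrightarrow> \<exists>b. \<forall>z. cmod z \<ge> b \<longrightarrow> Some z \<in> X"
proof -
 from assms consider U where "open U" "X = Some ` U"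
  | C where "compact C" "X = insert None (Some ` (- C))"
  by (auto simp: riemann_sphere_def openin_Alexandroff_compactification Compl_eq_Diff_UNIV[symmetric])
 then have "open (Some -` X) \<and> (None \<in> X \<longrightarrow> (\<exists>b. \<forall>z. cmod z \<ge> b \<longrightarrow> Some z \<in> X))"
 proof cases
  case (1 U)
  then show ?thesis by (auto simp: inj_vimage_image_eq)
 next
  case (2 C)
  have "Some -` X = - C" using 2 by auto
  moreover obtain b where "\<And>z. z \<in> C \<Longrightarrow> cmod z < b"
   using compact_imp_bounded[OF 2(1)] unfolding bounded_pos_less by blast
  ultimately show ?thesis using 2 compact_imp_closed[OF 2(1)] by (auto intro!: exI[of _ b] simp: open_Compl) force
 qed
 then show "open (Some -` X)" "None \<in> X \<Longrightarrow> \<exists>b. \<forall>z. cmod z \<ge> b \<longrightarrow> Some z \<in> X" by auto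
qed

text \<open>Elementary form of continuity on \<open>riemann_sphere\<close>, which suits test
  functions given by a formula on the plane.\<close>

definition sphere_cont :: "(complex option \<Rightarrow> complex) \<Rightarrow> bool" where
 "sphere_cont F \<longleftrightarrow> continuous_on UNIV (\<lambda>z. F (Some z)) \<and> ((\<lambda>z. F (Some z)) \<longlongrightarrow> F None) at_infinity"

lemma sphere_cont_continuous_map:
 assumes "continuous_map riemann_sphere euclidean F"
 shows "sphere_cont F"
proof -
 have op: "openin riemann_sphere {w. F w \<in> V}" if "open V" for V
  using openin_continuous_map_preimage[OF assms, of V] that by simp
 have "open ((\<lambda>z. F (Some z)) -` V)" if "open V" for V
  using openin_sphere_preimage(1)[OF op[OF that]] by (simp add: vimage_def)
 then have "continuous_on UNIV (\<lambda>z. F (Some z))" by (simp add: continuous_on_open_vimage)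
 moreover have "((\<lambda>z. F (Some z)) \<longlongrightarrow> F None) at_infinity"
 proof (rule topological_tendstoI)
  fix V assume V: "open V" "F None \<in> V"
  obtain b where "\<And>z. cmod z \<ge> b \<Longrightarrow> F (Some z) \<in> V" using openin_sphere_preimage(2)[OF op[OF V(1)]] V(2) by auto
  then show "\<forall>\<^sub>F z in at_infinity. F (Some z) \<in> V" unfolding eventually_at_infinity by blast
 qed
 ultimately show ?thesis by (simp add: sphere_cont_def)
qed

lemma sphere_cont_bounded:
 assumes F: "sphere_cont F"
 shows "\<exists>b\<ge>0. \<forall>w. cmod (F w) \<le> b"
proof -
 have "\<forall>\<^sub>F z in at_infinity. dist (F (Some z)) (F None) < 1"
  using F unfolding sphere_cont_def by (intro tendstoD) auto
 then obtain a where a: "\<And>z. cmod z \<ge> a \<Longrightarrow> dist (F (Some z)) (F None) < 1" unfolding eventually_at_infinity by blast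
 have "continuous_on (cball 0 a) (\<lambda>z. F (Some z))"
  using F unfolding sphere_cont_def by (blast intro: continuous_on_subset)
 from compact_norm_bound[OF compact_cball this] obtain b where b: "b \<ge> 0" "\<And>z. z \<in> cball 0 a \<Longrightarrow> cmod (F (Some z)) \<le> b" by blast
 show ?thesis
 proof (intro exI[of _ "max b (cmod (F None) + 1)"] conjI allI)
  fix w
  show "cmod (F w) \<le> max b (cmod (F None) + 1)"
  proof (cases w)
   case (Some z)
   show ?thesis
   proof (cases "cmod z \<ge> a")
    case True
    have "cmod (F (Some z)) \<le> cmod (F None) + cmod (F (Some z) - F None)" by (rule norm_triangle_sub)
    then show ?thesis using a[OF True] Some by (simp add: dist_norm)
   next
    case False
    then show ?thesis using b(2)[of z] Some by simp
   qed
  qed simp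
 qed (use b in auto)
qed

lemma sphere_cont_measurable:
 assumes F: "sphere_cont F"
 shows "F \<in> borel_measurable sphere_borel"
proof (rule borel_measurableI)
 fix V :: "complex set" assume V: "open V"
 have os: "Some ` U \<in> sets sphere_borel" if "open U" for U
  unfolding sphere_borel_def
  by (rule in_measure_of) (use that in \<open>auto simp: riemann_sphere_def openin_Alexandroff_compactification\<close>)
 have "UNIV - Some ` (UNIV :: complex set) \<in> sets sphere_borel"
  using sets.compl_sets[OF os[OF open_UNIV]] by simp
 moreover have "UNIV - Some ` (UNIV :: complex set) = {None}" by (auto simp: notin_range_Some)
 ultimately have n: "{None} \<in> sets sphere_borel" by simp
 have oV: "open ((\<lambda>z. F (Some z)) -` V)" using F V unfolding sphere_cont_def by (intro open_vimage) auto
 have "F -` V \<inter> space sphere_borel = Some ` ((\<lambda>z. F (Some z)) -` V) \<union> (if F None \<in> V then {None} else {})"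
 proof (intro set_eqI)
  fix w show "w \<in> F -` V \<inter> space sphere_borel \<longleftrightarrow> w \<in> Some ` ((\<lambda>z. F (Some z)) -` V) \<union> (if F None \<in> V then {None} else {})"
   by (cases w) auto
 qed
 then show "F -` V \<inter> space sphere_borel \<in> sets sphere_borel" using sets.Un[OF os[OF oV] n] os[OF oV]
  by (cases "F None \<in> V") (simp_all only: if_True if_False Un_empty_right)
qed

context hyper_micro
begin

text \<open>Outside two sets with o(n) zeros, G(1/y) is within 2 e' of p(1/y), and the averages of
  the polynomial p converge by \<open>disc_moments\<close>, with exponent 0 supplied by the total
  count. The two sets are |y| <= e1 and K, the reciprocals of those u with |u| <= 1/e1 at which G -
  p is not small; they avoid the star, so K is a compact subset of \<open>Om\<close>.\<close>

theorem zeros_weak: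
 assumes G: "continuous_on UNIV G" and b: "\<And>u. cmod (G u) \<le> b"
 shows "(\<lambda>n. (\<Sum>y\<in>#Zd n. G (1 / y)) / (of_nat m * of_nat n)) \<longlonglongrightarrow> Lim G"
proof (rule tendstoI)
 fix e :: real assume e: "e > 0"
 define e' where "e' = e / 8"
 have e': "e' > 0" using e by (simp add: e'_def)
 have m0: "real m \<ge> 1" using m_pos by simp
 have b0: "b \<ge> 0" using b[of 0] norm_ge_zero order_trans by blast
 define l where "l = 1 / cstar m"
 have l: "l > 0" using L_pos by (simp add: l_def)
 \<comment> \<open>Then 2 e1 is below 1 and below 1 / \<open>cstar m\<close>, hence so is its m-th
   power, as \<open>disc_moments\<close> asks.\<close>
 define e1 where "e1 = min 1 l / 4"
 have e1: "e1 > 0" using l by (simp add: e1_def)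
 have e1m: "(2 * e1) ^ m < 1 / cstar m"
 proof -
  have "(2 * e1) ^ m \<le> (2 * e1) ^ 1" using l m_pos by (intro power_decreasing) (auto simp: e1_def)
  also have "\<dots> < l" using l by (simp add: e1_def min_def)
  finally show ?thesis by (simp add: l_def)
 qed
 obtain p where p: "\<And>u. u \<in> star m \<Longrightarrow> cmod (G u - poly p u) < e'"
  using star_poly_dense[OF m_pos G] e' unfolding poly_approx_def by blast
 obtain bp where bp: "bp \<ge> 0" "\<And>u. u \<in> cball 0 (1 / e1) \<Longrightarrow> cmod (poly p u) \<le> bp"
 proof -
  have "continuous_on (cball 0 (1 / e1)) (poly p)" by (intro continuous_intros)
  from compact_norm_bound[OF compact_cball this] show ?thesis using that by blast
 qed
 \<comment> \<open>Disjoint from the star, in particular from u = 0, which is Y = infinity; so the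
   reciprocals of its points form a compact set.\<close>
 define C where "C = {u. cmod u \<le> 1 / e1} \<inter> {u. 2 * e' \<le> cmod (G u - poly p u)}"
 have Cc: "compact C"
 proof -
  have "closed {u. 2 * e' \<le> cmod (G u - poly p u)}" by (intro closed_Collect_le continuous_intros G)
  moreover have "{u::complex. cmod u \<le> 1 / e1} = cball 0 (1 / e1)" by (auto simp: dist_norm)
  ultimately show ?thesis by (simp add: C_def compact_Int_closed)
 qed
 have Cs: "u \<notin> star m" if "u \<in> C" for u
 proof
  assume "u \<in> star m"
  then have "cmod (G u - poly p u) < e'" by (rule p)
  then show False using that e' by (simp add: C_def)
 qed
 have "0 \<in> star m" using m_pos L_pos by (auto simp: star_def zero_power intro!: image_eqI[of _ _ 0])
 then have C0: "u \<noteq> 0" if "u \<in> C" for u using Cs[OF that] by auto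
 define K where "K = (\<lambda>u. 1 / u) ` C"
 have Kc: "compact K" unfolding K_def by (intro compact_continuous_image continuous_intros Cc) (use C0 in auto)
 have KO: "K \<subseteq> Om"
 proof
  fix y assume "y \<in> K"
  then obtain u where u: "u \<in> C" "y = 1 / u" by (auto simp: K_def)
  show "y \<in> Om"
  proof (rule ccontr)
   assume "y \<notin> Om"
   then have y: "Im (y ^ m) = 0" "Re (y ^ m) \<ge> l" by (auto simp: Om_def slit_def l_def)
   define a where "a = Re (y ^ m)"
   have ya: "y ^ m = of_real a" "a \<ge> l" using y by (auto simp: a_def complex_eq_iff)
   have "u ^ m = 1 / y ^ m" using u C0[OF u(1)] by (simp add: power_divide)
   then have "u ^ m = of_real (1 / a)" using ya by simp
   moreover have "0 \<le> 1 / a" using ya(2) l by simp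
   moreover have "1 / a \<le> 1 / l" using ya(2) l by (intro frac_le) auto
   moreover have "1 / l = cstar m" by (simp add: l_def)
   ultimately have "u ^ m = of_real (1 / a)" "1 / a \<in> {0..cstar m}" by auto
   then have "u \<in> star m" unfolding star_def by blast
   then show False using Cs[OF u(1)] by simp
  qed
 qed
 have cO: "cball 0 e1 \<subseteq> Om"
 proof
  fix z :: complex assume "z \<in> cball 0 e1"
  then have "cmod z ^ m \<le> (2 * e1) ^ m" using e1 by (intro power_mono) auto
  then have "z ^ m \<in> ball 0 (1 / cstar m)" using e1m by (simp add: norm_power)
  then show "z \<in> Om" using ball_subset_slit unfolding Om_def by blast
 qed
 define sm where "sm n = filter_mset (\<lambda>y. \<not> cmod y > e1) (Zd n)" for n
 define big where "big n = filter_mset (\<lambda>y. cmod y > e1) (Zd n)" for n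
 define Kn where "Kn n = filter_mset (\<lambda>y. y \<in> K) (big n)" for n
 have sml: "(\<lambda>n. real (size (sm n)) / real n) \<longlonglongrightarrow> 0"
 proof (rule Lim_null_comparison[OF _ zeros_compact[OF compact_cball cO]])
  show "\<forall>\<^sub>F n in sequentially. norm (real (size (sm n)) / real n) \<le> real (size (filter_mset (\<lambda>y. y \<in> cball 0 e1) (Zn n))) / real n"
  proof (intro always_eventually allI)
   fix n
   have "sm n = filter_mset (\<lambda>y. y \<in> cball 0 e1) (filter_mset (\<lambda>y. cmod (dl n * y) < r) (Zn n))"
    by (simp add: sm_def Zd_def not_less)
   then have "size (sm n) \<le> size (filter_mset (\<lambda>y. y \<in> cball 0 e1) (Zn n))" using size_filter_filter_le by metis
   then show "norm (real (size (sm n)) / real n) \<le> real (size (filter_mset (\<lambda>y. y \<in> cball 0 e1) (Zn n))) / real n"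
    by (simp add: divide_right_mono)
  qed
 qed
 have Knl: "(\<lambda>n. real (size (Kn n)) / real n) \<longlonglongrightarrow> 0"
 proof (rule Lim_null_comparison[OF _ zeros_compact[OF Kc KO]])
  show "\<forall>\<^sub>F n in sequentially. norm (real (size (Kn n)) / real n) \<le> real (size (filter_mset (\<lambda>y. y \<in> K) (Zn n))) / real n"
  proof (intro always_eventually allI)
   fix n
   have "size (Kn n) \<le> size (filter_mset (\<lambda>y. y \<in> K) (Zd n))" unfolding Kn_def big_def by (rule size_filter_filter_le)
   also have "\<dots> \<le> size (filter_mset (\<lambda>y. y \<in> K) (Zn n))" unfolding Zd_def by (rule size_filter_filter_le)
   finally show "norm (real (size (Kn n)) / real n) \<le> real (size (filter_mset (\<lambda>y. y \<in> K) (Zn n))) / real n"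
    by (simp add: divide_right_mono)
  qed
 qed
 define PP where "PP n = (\<Sum>y\<in>#big n. poly p (1 / y)) / (of_nat m * of_nat n)" for n
 have mom_lim: "(\<lambda>n. (\<Sum>y\<in>#big n. (1 / y) ^ k) / (of_nat m * of_nat n)) \<longlonglongrightarrow> Lim (\<lambda>u. u ^ k)" for k
 proof (cases "k = 0")
  case True
  have "(\<lambda>n. real (size (Zd n)) / (real m * real n) - real (size (sm n)) / real n / real m) \<longlonglongrightarrow> 1 - 0 / real m"
   using m0 by (intro tendsto_intros size_Zd_tendsto sml) auto
  then have "(\<lambda>n. complex_of_real (real (size (Zd n)) / (real m * real n) - real (size (sm n)) / real n / real m)) \<longlonglongrightarrow> of_real (1 - 0 / real m)"
   by (rule tendsto_of_real)
  moreover have "complex_of_real (real (size (Zd n)) / (real m * real n) - real (size (sm n)) / real n / real m) = (\<Sum>y\<in>#big n. (1 / y) ^ k) / (of_nat m * of_nat n)" for n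
  proof -
   have "real (size (big n)) = real (size (Zd n)) - real (size (sm n))"
    using size_filter_split[of "Zd n" "\<lambda>y. cmod y > e1"] by (simp add: big_def sm_def)
   then have "complex_of_real (real (size (Zd n)) / (real m * real n) - real (size (sm n)) / real n / real m) = of_real (real (size (big n)) / (real m * real n))"
    by (simp add: diff_divide_distrib mult.commute)
   then show ?thesis using True by simp
  qed
  ultimately show ?thesis using True by (simp add: Lim_power[of 0, simplified] mom_0)
 next
  case False
  then show ?thesis using disc_moments[OF e1 e1m, of k] by (simp add: big_def Lim_power)
 qed
 have Pl: "PP \<longlonglongrightarrow> Lim (poly p)"
 proof -
  have "(\<lambda>n. \<Sum>k\<le>degree p. coeff p k * ((\<Sum>y\<in>#big n. (1 / y) ^ k) / (of_nat m * of_nat n))) \<longlonglongrightarrow> (\<Sum>k\<le>degree p. coeff p k * Lim (\<lambda>u. u ^ k))"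
   by (intro tendsto_sum tendsto_mult_left mom_lim)
  moreover have "(\<Sum>k\<le>degree p. coeff p k * ((\<Sum>y\<in>#big n. (1 / y) ^ k) / (of_nat m * of_nat n))) = PP n" for n
   unfolding PP_def poly_altdef sum_mset_sum_swap sum_divide_distrib
   by (intro sum.cong refl) (simp add: sum_mset_distrib_left)
  ultimately show ?thesis by (simp add: Lim_poly)
 qed
 have LL: "cmod (Lim (poly p) - Lim G) \<le> e'"
  using p by (intro Lim_close continuous_intros G) (auto simp: norm_minus_commute intro: less_imp_le)
 have main: "cmod ((\<Sum>y\<in>#Zd n. G (1 / y)) / (of_nat m * of_nat n) - PP n)
   \<le> b * (real (size (sm n)) / real n) + (b + bp) * (real (size (Kn n)) / real n) + 2 * e' * (real (size (Zd n)) / (real m * real n))"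
  if n: "n \<ge> 1" for n
 proof -
  define D where "D y = G (1 / y) - poly p (1 / y)" for y
  define good where "good = filter_mset (\<lambda>y. y \<notin> K) (big n)"
  have bigD: "e1 < cmod y" if "y \<in># big n" for y using that by (auto simp: big_def)
  have ub: "1 / y \<in> cball 0 (1 / e1)" if "y \<in># big n" for y
   using bigD[OF that] e1 by (simp add: norm_divide frac_le)
  have "(\<Sum>y\<in>#Zd n. G (1 / y)) - (\<Sum>y\<in>#big n. poly p (1 / y)) = (\<Sum>y\<in>#big n. D y) + (\<Sum>y\<in>#sm n. G (1 / y))"
  proof -
   have "(\<Sum>y\<in>#big n. G (1 / y)) = (\<Sum>y\<in>#big n. D y) + (\<Sum>y\<in>#big n. poly p (1 / y))"
    unfolding sum_mset.distrib[symmetric] D_def by simp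
   then show ?thesis using sum_mset_filter_split[of "\<lambda>y. G (1 / y)" "Zd n" "\<lambda>y. cmod y > e1"] by (simp add: big_def sm_def)
  qed
  also have "(\<Sum>y\<in>#big n. D y) = (\<Sum>y\<in>#Kn n. D y) + (\<Sum>y\<in>#good. D y)"
   unfolding Kn_def good_def by (rule sum_mset_filter_split)
  finally have "cmod ((\<Sum>y\<in>#Zd n. G (1 / y)) - (\<Sum>y\<in>#big n. poly p (1 / y)))
    \<le> cmod (\<Sum>y\<in>#Kn n. D y) + cmod (\<Sum>y\<in>#good. D y) + cmod (\<Sum>y\<in>#sm n. G (1 / y))"
   by (metis (no_types, lifting) add_right_mono norm_triangle_ineq order_trans)
  also have "\<dots> \<le> real (size (Kn n)) * (b + bp) + real (size (Zd n)) * (2 * e') + real (size (sm n)) * b"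
  proof (intro add_mono norm_sum_mset_le b)
   fix y assume "y \<in># Kn n"
   then have "1 / y \<in> cball 0 (1 / e1)" using ub by (simp add: Kn_def)
   then show "cmod (D y) \<le> b + bp" unfolding D_def
    by (intro order_trans[OF norm_triangle_ineq4] add_mono b bp(2))
  next
   have "cmod (\<Sum>y\<in>#good. D y) \<le> real (size good) * (2 * e')"
   proof (rule norm_sum_mset_le)
    fix y assume y: "y \<in># good"
    have "1 / y \<notin> C"
    proof
     assume "1 / y \<in> C"
     then have "1 / (1 / y) \<in> K" unfolding K_def by (rule imageI)
     then show False using y by (simp add: good_def)
    qed
    moreover have "cmod (1 / y) \<le> 1 / e1" using ub[of y] y by (simp add: good_def)
    ultimately show "cmod (D y) \<le> 2 * e'" by (simp add: C_def D_def)
   qed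
   also have "size good \<le> size (Zd n)" unfolding good_def big_def
    by (rule order_trans[OF size_filter_mset_lesseq size_filter_mset_lesseq])
   then have "real (size good) * (2 * e') \<le> real (size (Zd n)) * (2 * e')" using e' by (intro mult_right_mono) auto
   finally show "cmod (\<Sum>y\<in>#good. D y) \<le> real (size (Zd n)) * (2 * e')" .
  qed
  finally have "cmod ((\<Sum>y\<in>#Zd n. G (1 / y)) - (\<Sum>y\<in>#big n. poly p (1 / y))) / (real m * real n)
    \<le> (real (size (Kn n)) * (b + bp) + real (size (Zd n)) * (2 * e') + real (size (sm n)) * b) / (real m * real n)"
   by (rule divide_right_mono) simp
  also have "\<dots> = (b + bp) * (real (size (Kn n)) / (real m * real n)) + 2 * e' * (real (size (Zd n)) / (real m * real n)) + b * (real (size (sm n)) / (real m * real n))"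
   by (simp add: add_divide_distrib mult_ac)
  also have "\<dots> \<le> (b + bp) * (real (size (Kn n)) / real n) + 2 * e' * (real (size (Zd n)) / (real m * real n)) + b * (real (size (sm n)) / real n)"
  proof -
   have "a / (real m * real n) \<le> a / real n" if "a \<ge> 0" for a
   proof (rule divide_left_mono)
    show "real n \<le> real m * real n" using m0 mult_right_mono[of 1 "real m" "real n"] by simp
   qed (use that n m0 in auto)
   then show ?thesis using b0 bp(1) by (intro add_mono mult_left_mono order_refl) auto
  qed
  finally show ?thesis unfolding PP_def diff_divide_distrib[symmetric] norm_divide norm_mult norm_of_nat by linarith
 qed
 have bl: "(\<lambda>n. b * (real (size (sm n)) / real n)) \<longlonglongrightarrow> b * 0" by (rule tendsto_mult_left[OF sml])
 have kl: "(\<lambda>n. (b + bp) * (real (size (Kn n)) / real n)) \<longlonglongrightarrow> (b + bp) * 0" by (rule tendsto_mult_left[OF Knl])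
 have ev1: "\<forall>\<^sub>F n in sequentially. b * (real (size (sm n)) / real n) < e'" using order_tendstoD(2)[OF bl] e' by simp
 have ev2: "\<forall>\<^sub>F n in sequentially. (b + bp) * (real (size (Kn n)) / real n) < e'" using order_tendstoD(2)[OF kl] e' by simp
 have ev3: "\<forall>\<^sub>F n in sequentially. real (size (Zd n)) / (real m * real n) < 2" using order_tendstoD(2)[OF size_Zd_tendsto] by simp
 have ev4: "\<forall>\<^sub>F n in sequentially. dist (PP n) (Lim (poly p)) < e'" by (rule tendstoD[OF Pl e'])
 show "\<forall>\<^sub>F n in sequentially. dist ((\<Sum>y\<in>#Zd n. G (1 / y)) / (of_nat m * of_nat n)) (Lim G) < e"
  using ev1 ev2 ev3 ev4 eventually_ge_at_top[of "1::nat"]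
 proof eventually_elim
  case (elim n)
  define X where "X = (\<Sum>y\<in>#Zd n. G (1 / y)) / (of_nat m * of_nat n)"
  have "2 * e' * (real (size (Zd n)) / (real m * real n)) \<le> 2 * e' * 2" using elim(3) e' by (intro mult_left_mono) auto
  then have "cmod (X - PP n) < 6 * e'" using main[OF elim(5)] elim(1,2) unfolding X_def by linarith
  moreover have "cmod (PP n - Lim (poly p)) < e'" using elim(4) by (simp add: dist_norm)
  moreover have "cmod (X - Lim G) \<le> cmod (X - PP n) + cmod (PP n - Lim (poly p)) + cmod (Lim (poly p) - Lim G)"
   using norm_triangle_ineq[of "X - PP n" "PP n - Lim (poly p)"] norm_triangle_ineq[of "X - Lim (poly p)" "Lim (poly p) - Lim G"] by simp
  ultimately have "cmod (X - Lim G) < 8 * e'" using LL by linarith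
  then show ?case by (simp add: dist_norm X_def e'_def)
 qed
qed

end

section \<open>Transfer to the Riemann sphere\<close>

lemma of_real_sum_mset: "(\<Sum>y\<in>#M. complex_of_real (t y)) = of_real (\<Sum>y\<in>#M. t y)"
 by (induction M) auto

lemma size_filter_le_sum:
 fixes t :: "'a \<Rightarrow> real"
 assumes "\<And>y. y \<in># M \<Longrightarrow> 0 \<le> t y" "\<And>y. y \<in># M \<Longrightarrow> X y \<Longrightarrow> 1 \<le> t y"
 shows "real (size (filter_mset X M)) \<le> (\<Sum>y\<in>#M. t y)"
 using assms
proof (induction M)
 case (add y M)
 have IH: "real (size (filter_mset X M)) \<le> (\<Sum>y\<in>#M. t y)" using add by auto
 have "0 \<le> t y" "X y \<Longrightarrow> 1 \<le> t y" using add.prems by auto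
 then show ?case using IH by (cases "X y") auto
qed simp

text \<open>Equal to 1 for |z| >= k + 1 and to 0 for |z| <= k: it counts the points that escape to
  infinity.\<close>

lemma sphere_cont_bump:
 "sphere_cont (\<lambda>w. case w of None \<Rightarrow> 1 | Some z \<Rightarrow> of_real (min 1 (max 0 (cmod z - k))))"
proof -
 have "\<forall>\<^sub>F z in at_infinity. complex_of_real (min 1 (max 0 (cmod z - k))) = 1"
  unfolding eventually_at_infinity by (intro exI[of _ "k + 1"]) (auto simp: min_def max_def)
 then have "((\<lambda>z. complex_of_real (min 1 (max 0 (cmod z - k)))) \<longlongrightarrow> 1) at_infinity" by (rule tendsto_eventually)
 then show ?thesis unfolding sphere_cont_def by (auto intro!: continuous_intros)
qed

lemma sphere_cont_compact_support:
 fixes g :: "complex \<Rightarrow> complex"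
 assumes g: "continuous_on UNIV g" "compact (closure {z. g z \<noteq> 0})"
 shows "sphere_cont (\<lambda>w. case w of None \<Rightarrow> 0 | Some z \<Rightarrow> g z)"
proof -
 obtain b where b: "\<And>z. z \<in> closure {z. g z \<noteq> 0} \<Longrightarrow> cmod z < b"
  using compact_imp_bounded[OF g(2)] unfolding bounded_pos_less by blast
 have "g z = 0" if "b \<le> cmod z" for z
  using b[of z] closure_subset[of "{z. g z \<noteq> 0}"] that by force
 then have "\<forall>\<^sub>F z in at_infinity. g z = 0" unfolding eventually_at_infinity by blast
 then have "(g \<longlongrightarrow> 0) at_infinity" by (rule tendsto_eventually)
 then show ?thesis using g(1) by (simp add: sphere_cont_def)
qed

context hyper_micro
begin

text \<open>A test function on the sphere in the coordinate u = 1/Y, where eta Y is the rescaled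
  zero; infinity becomes u = 0.\<close>

definition GG :: "(complex option \<Rightarrow> complex) \<Rightarrow> complex \<Rightarrow> complex" where
 "GG F u = (if u = 0 then F None else F (Some (\<eta> / u)))"

lemma GG_continuous:
 assumes F: "sphere_cont F" shows "continuous_on UNIV (GG F)"
proof -
 have c: "continuous_on UNIV (\<lambda>z. F (Some z))" and l: "((\<lambda>z. F (Some z)) \<longlongrightarrow> F None) at_infinity"
  using F by (auto simp: sphere_cont_def)
 have c1: "continuous_on (- {0}) (\<lambda>u. F (Some (\<eta> / u)))"
  by (rule continuous_on_compose2[OF c, of _ "\<lambda>u. \<eta> / u"]) (auto intro!: continuous_intros)
 have c2: "continuous_on (- {0}) (GG F)"
  by (rule continuous_on_eq[OF c1]) (simp add: GG_def)
 have "isCont (GG F) u" for u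
 proof (cases "u = 0")
  case False
  have "open (- {0 :: complex})" by (simp add: open_Compl)
  then show ?thesis using c2 False by (simp add: continuous_on_eq_continuous_at)
 next
  case True
  have "(GG F \<longlongrightarrow> F None) (at 0)"
  proof (rule tendstoI)
   fix e :: real assume "e > 0"
   with l have "\<forall>\<^sub>F z in at_infinity. dist (F (Some z)) (F None) < e" by (rule tendstoD)
   then obtain b where b: "\<And>z. cmod z \<ge> b \<Longrightarrow> dist (F (Some z)) (F None) < e" unfolding eventually_at_infinity by blast
   define d where "d = cmod \<eta> / (\<bar>b\<bar> + 1)"
   have d: "d > 0" using eta_nz by (simp add: d_def)
   have "dist (GG F u) (F None) < e" if u: "u \<noteq> 0" "cmod u < d" for u
   proof -
    have "cmod u * (\<bar>b\<bar> + 1) < cmod \<eta>" using u(2) by (simp add: d_def pos_less_divide_eq)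
    then have "\<bar>b\<bar> + 1 < cmod (\<eta> / u)" using u(1) by (simp add: norm_divide pos_less_divide_eq mult.commute)
    then show ?thesis using u(1) b[of "\<eta> / u"] by (simp add: GG_def)
   qed
   then show "\<forall>\<^sub>F u in at 0. dist (GG F u) (F None) < e"
    unfolding eventually_at using d by (intro exI[of _ d]) (auto simp: dist_norm)
  qed
  then show ?thesis unfolding True isCont_def by (simp add: GG_def)
 qed
 then show ?thesis by (simp add: continuous_at_imp_continuous_on)
qed

lemma GG_inverse: "y \<noteq> 0 \<Longrightarrow> GG F (1 / y) = F (Some (\<eta> * y))"
 by (simp add: GG_def)

theorem zeros_weak_sphere:
 assumes F: "sphere_cont F"
 shows "(\<lambda>n. (\<Sum>y\<in>#Zd n. F (Some (\<eta> * y))) / (of_nat m * of_nat n)) \<longlonglongrightarrow> Lim (GG F)"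
proof -
 obtain b where b: "\<And>w. cmod (F w) \<le> b" using sphere_cont_bounded[OF F] by blast
 have "(\<lambda>n. (\<Sum>y\<in>#Zd n. GG F (1 / y)) / (of_nat m * of_nat n)) \<longlonglongrightarrow> Lim (GG F)"
  by (rule zeros_weak[OF GG_continuous[OF F], of b]) (simp add: GG_def b)
 then show ?thesis
 proof (rule Lim_transform_eventually)
  show "\<forall>\<^sub>F n in sequentially. (\<Sum>y\<in>#Zd n. GG F (1 / y)) / (of_nat m * of_nat n) = (\<Sum>y\<in>#Zd n. F (Some (\<eta> * y))) / (of_nat m * of_nat n)"
   using eventually_ge_at_top[of "1::nat"]
  proof eventually_elim
   case (elim n)
   have "y \<noteq> 0" if "y \<in># Zd n" for y using zero_notin_Zn[OF elim] that by (auto simp: Zd_def)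
   then have "image_mset (\<lambda>y. GG F (1 / y)) (Zd n) = image_mset (\<lambda>y. F (Some (\<eta> * y))) (Zd n)"
    by (intro image_mset_cong) (simp add: GG_inverse)
   then show ?case by simp
  qed
 qed
qed

lemma AE_pos: "AE x in mu_micro m. x > 0" by (rule mu_micro_fuss(2)[OF m_pos])

lemma phi_measurable_M [measurable]: "phi m \<eta> \<nu> \<in> measurable (mu_micro m) sphere_borel"
 using measurable_phi measurable_cong_sets[OF sets_M refl] by blast

text \<open>Writes the average of m image measures as one image of a product measure, so that change
  of variables and Fubini apply to integrals against \<open>mu_hat\<close>.\<close>

lemma mu_hat_distr:
 defines "p \<equiv> pmf_of_set {..<m}"
 shows "(\<lambda>(\<nu>, x). phi m \<eta> \<nu> x) \<in> measurable (measure_pmf p \<Otimes>\<^sub>M mu_micro m) sphere_borel"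
  "mu_hat m lamc = distr (measure_pmf p \<Otimes>\<^sub>M mu_micro m) sphere_borel (\<lambda>(\<nu>, x). phi m \<eta> \<nu> x)"
proof -
 have ne: "{..<m} \<noteq> {}" "finite {..<m}" using m_pos by (auto simp: lessThan_empty_iff)
 have "(\<lambda>(\<nu>, x). phi m \<eta> \<nu> x) \<in> measurable (count_space UNIV \<Otimes>\<^sub>M mu_micro m) sphere_borel"
  by (rule measurable_pair_measure_countable1) (auto intro: phi_measurable_M)
 moreover have "sets (measure_pmf p \<Otimes>\<^sub>M mu_micro m) = sets (count_space UNIV \<Otimes>\<^sub>M mu_micro m)"
  by (intro sets_pair_measure_cong refl) simp
 ultimately show meas: "(\<lambda>(\<nu>, x). phi m \<eta> \<nu> x) \<in> measurable (measure_pmf p \<Otimes>\<^sub>M mu_micro m) sphere_borel"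
  using measurable_cong_sets[OF _ refl] by blast
 show "mu_hat m lamc = distr (measure_pmf p \<Otimes>\<^sub>M mu_micro m) sphere_borel (\<lambda>(\<nu>, x). phi m \<eta> \<nu> x)"
 proof (rule measure_eqI)
  fix X assume "X \<in> sets (mu_hat m lamc)"
  then have X: "X \<in> sets sphere_borel" by simp
  have "emeasure (distr (measure_pmf p \<Otimes>\<^sub>M mu_micro m) sphere_borel (\<lambda>(\<nu>, x). phi m \<eta> \<nu> x)) X
    = emeasure (measure_pmf p \<Otimes>\<^sub>M mu_micro m) ((\<lambda>(\<nu>, x). phi m \<eta> \<nu> x) -` X \<inter> space (measure_pmf p \<Otimes>\<^sub>M mu_micro m))"
   by (rule emeasure_distr[OF meas X])
  also have "\<dots> = (\<integral>\<^sup>+\<nu>. emeasure (mu_micro m) (Pair \<nu> -` ((\<lambda>(\<nu>, x). phi m \<eta> \<nu> x) -` X \<inter> space (measure_pmf p \<Otimes>\<^sub>M mu_micro m))) \<partial>measure_pmf p)"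
   by (rule emeasure_pair_measure_alt[OF measurable_sets[OF meas X]])
  also have "\<dots> = (\<integral>\<^sup>+\<nu>. emeasure (distr (mu_micro m) sphere_borel (phi m \<eta> \<nu>)) X \<partial>measure_pmf p)"
   by (intro nn_integral_cong) (simp add: emeasure_distr X vimage_def space_pair_measure)
  also have "\<dots> = (\<Sum>\<nu><m. emeasure (distr (mu_micro m) sphere_borel (phi m \<eta> \<nu>)) X) / of_nat m"
   unfolding p_def by (subst nn_integral_pmf_of_set[OF ne]) simp
  also have "\<dots> = emeasure (mu_hat m lamc) X"
   unfolding emeasure_mu_hat[OF X] \<eta>_def[symmetric]
   using m_pos by (simp add: divide_ennreal_def mult.commute inverse_ennreal ennreal_of_nat_eq_real_of_nat inverse_eq_divide)
  finally show "emeasure (mu_hat m lamc) X = emeasure (distr (measure_pmf p \<Otimes>\<^sub>M mu_micro m) sphere_borel (\<lambda>(\<nu>, x). phi m \<eta> \<nu> x)) X" ..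
 qed simp
qed

lemma prob_space_mu_hat: "prob_space (mu_hat m lamc)"
proof -
 interpret p: prob_space "measure_pmf (pmf_of_set {..<m})" by (rule prob_space_measure_pmf)
 interpret PP: pair_prob_space "measure_pmf (pmf_of_set {..<m})" "mu_micro m" ..
 show ?thesis unfolding mu_hat_distr(2) by (rule PP.prob_space_distr[OF mu_hat_distr(1)])
qed

lemma up_nz: "x > 0 \<Longrightarrow> up \<nu> x \<noteq> 0" by (simp add: up_def)

lemma phi_up: "x > 0 \<Longrightarrow> phi m \<eta> \<nu> x = Some (\<eta> / up \<nu> x)"
 by (simp add: phi_def up_def powr_minus divide_simps)

theorem integral_mu_hat:
 assumes F: "sphere_cont F"
 shows "(LINT w|mu_hat m lamc. F w) = Lim (GG F)"
proof -
 define p where "p = pmf_of_set {..<m}"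
 have ne: "{..<m} \<noteq> {}" "finite {..<m}" using m_pos by (auto simp: lessThan_empty_iff)
 interpret p: prob_space "measure_pmf p" by (rule prob_space_measure_pmf)
 interpret PP: pair_prob_space "measure_pmf p" "mu_micro m" ..
 obtain b where b: "\<And>w. cmod (F w) \<le> b" using sphere_cont_bounded[OF F] by blast
 note Fm = sphere_cont_measurable[OF F]
 note ph = mu_hat_distr(1)[folded p_def]
 have Fp: "(\<lambda>z. F (case z of (\<nu>, x) \<Rightarrow> phi m \<eta> \<nu> x)) \<in> borel_measurable (measure_pmf p \<Otimes>\<^sub>M mu_micro m)"
  by (rule measurable_compose[OF ph Fm])
 have int: "integrable (measure_pmf p \<Otimes>\<^sub>M mu_micro m) (\<lambda>z. F (case z of (\<nu>, x) \<Rightarrow> phi m \<eta> \<nu> x))"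
  by (rule PP.integrable_const_bound[of _ b]) (use b Fp in auto)
 have "(LINT w|mu_hat m lamc. F w) = integral\<^sup>L (measure_pmf p \<Otimes>\<^sub>M mu_micro m) (\<lambda>z. F (case z of (\<nu>, x) \<Rightarrow> phi m \<eta> \<nu> x))"
  unfolding mu_hat_distr(2)[folded p_def] by (rule integral_distr[OF ph Fm])
 also have "\<dots> = (LINT \<nu>|measure_pmf p. (LINT x|mu_micro m. F (phi m \<eta> \<nu> x)))"
  using PP.integral_fst'[OF int] by simp
 also have "\<dots> = (\<Sum>\<nu><m. pmf p \<nu> *\<^sub>R (LINT x|mu_micro m. F (phi m \<eta> \<nu> x)))"
  by (rule integral_measure_pmf) (use ne in \<open>auto simp: p_def\<close>)
 also have "\<dots> = (\<Sum>\<nu><m. (LINT x|mu_micro m. GG F (up \<nu> x)) / of_nat m)"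
 proof (intro sum.cong refl)
  fix \<nu> assume n: "\<nu> \<in> {..<m}"
  have [measurable]: "GG F \<in> borel_measurable borel" by (rule borel_measurable_continuous_onI[OF GG_continuous[OF F]])
  have "(LINT x|mu_micro m. F (phi m \<eta> \<nu> x)) = (LINT x|mu_micro m. GG F (up \<nu> x))"
  proof (rule integral_cong_AE)
   show "(\<lambda>x. F (phi m \<eta> \<nu> x)) \<in> borel_measurable (mu_micro m)" by (rule measurable_compose[OF phi_measurable_M Fm])
   show "(\<lambda>x. GG F (up \<nu> x)) \<in> borel_measurable (mu_micro m)" by measurable
   show "AE x in mu_micro m. F (phi m \<eta> \<nu> x) = GG F (up \<nu> x)"
    using AE_pos by eventually_elim (use up_nz phi_up in \<open>simp add: GG_def\<close>)
  qed
  then show "pmf p \<nu> *\<^sub>R (LINT x|mu_micro m. F (phi m \<eta> \<nu> x)) = (LINT x|mu_micro m. GG F (up \<nu> x)) / of_nat m"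
   using n ne by (simp add: p_def pmf_of_set scaleR_conv_of_real divide_inverse mult.commute)
 qed
 also have "\<dots> = Lim (GG F)" by (simp only: Lim_def sum_divide_distrib)
 finally show ?thesis .
qed

definition DZ :: "nat \<Rightarrow> real \<Rightarrow> complex set" where
 "DZ n rho = {zeta \<in> deriv_zeros P Q S T n. 0 < cmod (zeta - c) \<and> cmod (zeta - c) < rho}"

lemma finite_DZ: "finite (DZ n rho)"
 by (rule finite_subset[OF _ poly_roots_finite[OF B_nz[of n]]]) (auto simp: DZ_def deriv_zeros_eq)

lemma DZ_mult: "zeta \<in> DZ n rho \<Longrightarrow> deriv_mult P Q S T n zeta = order zeta (B n)"
 by (rule deriv_mult_eq[OF _ B_nz]) (auto simp: DZ_def deriv_zeros_eq)

lemma DZ_eq: "rho \<le> r \<Longrightarrow> DZ n rho = {zeta. poly (B n) zeta = 0 \<and> cmod (zeta - c) < rho}"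
 unfolding DZ_def by (rule zeros_in_disc)

text \<open>n^(1/m) (zeta - c) equals eta y, and multiplicities become repetitions in the
  multiset.\<close>

lemma zero_sum:
 fixes F :: "complex \<Rightarrow> complex"
 assumes n: "n \<ge> 1" and rho: "rho \<le> r"
 shows "(\<Sum>zeta\<in>DZ n rho. of_nat (deriv_mult P Q S T n zeta) * F (of_real (root m (real n)) * (zeta - c)))
  = (\<Sum>y\<in>#filter_mset (\<lambda>y. cmod (dl n * y) < rho) (Zn n). F (\<eta> * y))"
proof -
 have rt: "root m (real n) \<noteq> 0" using root_pos[OF n] by simp
 have "(\<Sum>zeta\<in>DZ n rho. of_nat (deriv_mult P Q S T n zeta) * F (of_real (root m (real n)) * (zeta - c)))
   = (\<Sum>zeta\<in>DZ n rho. of_nat (order zeta (B n)) * F (of_real (root m (real n)) * (zeta - c)))"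
  by (intro sum.cong refl) (simp add: DZ_mult)
 also have "\<dots> = (\<Sum>zeta\<in>#filter_mset (\<lambda>zeta. cmod (zeta - c) < rho) (proots (B n)). F (of_real (root m (real n)) * (zeta - c)))"
  unfolding DZ_eq[OF rho] by (rule sum_proots[OF B_nz, symmetric])
 also have "\<dots> = (\<Sum>y\<in>#filter_mset (\<lambda>y. cmod (dl n * y) < rho) (Zn n). F (\<eta> * y))"
  using dl_nz[OF n] eta_nz rt
  by (simp add: Zn_def filter_mset_image_mset image_mset.compositionality comp_def) (simp add: dl_def mult.commute)
 finally show ?thesis .
qed

lemma sets_nu_local: "sets (nu_local P Q S T c rho n) = sets sphere_borel"
 by (simp add: nu_local_def)

lemma finite_nu_local: "finite_measure (nu_local P Q S T c rho n)"
proof (rule finite_measureI)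
 show "emeasure (nu_local P Q S T c rho n) (space (nu_local P Q S T c rho n)) \<noteq> \<infinity>"
  unfolding nu_local_def DZ_def[symmetric] using finite_DZ[of n rho]
   sets.top[of sphere_borel]
  by (simp add: emeasure_distr emeasure_point_measure_finite space_point_measure)
qed

lemma integral_nu_local:
 fixes F :: "complex option \<Rightarrow> complex"
 assumes Fm: "F \<in> borel_measurable sphere_borel"
 shows "(LINT w|nu_local P Q S T c rho n. F w) =
  (\<Sum>zeta\<in>DZ n rho. of_nat (deriv_mult P Q S T n zeta) * F (Some (of_real (root m (real n)) * (zeta - c)))) / (of_nat m * of_nat n)"
proof -
 have mo: "order c T = m" using m by simp
 define w where "w zeta = real (deriv_mult P Q S T n zeta) / (real m * real n)" for zeta
 have "(LINT w|nu_local P Q S T c rho n. F w) = (LINT zeta|point_measure (DZ n rho) (\<lambda>zeta. ennreal (w zeta)). F (Some (of_real (root m (real n)) * (zeta - c))))"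
  unfolding nu_local_def DZ_def[symmetric] mo w_def by (rule integral_distr[OF _ Fm]) simp
 also have "\<dots> = (\<Sum>zeta\<in>DZ n rho. w zeta *\<^sub>R F (Some (of_real (root m (real n)) * (zeta - c))))"
  by (rule lebesgue_integral_point_measure_finite[OF finite_DZ]) (simp add: w_def)
 also have "\<dots> = (\<Sum>zeta\<in>DZ n rho. of_nat (deriv_mult P Q S T n zeta) * F (Some (of_real (root m (real n)) * (zeta - c)))) / (of_nat m * of_nat n)"
  unfolding sum_divide_distrib by (intro sum.cong refl) (simp add: w_def scaleR_conv_of_real)
 finally show ?thesis .
qed

text \<open>Dominated convergence, with pointwise limit 0 because x > 0 almost everywhere: the limit
  law has no mass at infinity.\<close>

lemma bump_integral_tendsto:
 "(\<lambda>k. Lim (GG (\<lambda>w. case w of None \<Rightarrow> 1 | Some z \<Rightarrow> of_real (min 1 (max 0 (cmod z - real k)))))) \<longlonglongrightarrow> 0"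
proof -
 define h where "h k = GG (\<lambda>w. case w of None \<Rightarrow> 1 | Some z \<Rightarrow> of_real (min 1 (max 0 (cmod z - real k))))" for k :: nat
 have hm [measurable]: "h k \<in> borel_measurable borel" for k
  unfolding h_def by (rule borel_measurable_continuous_onI[OF GG_continuous[OF sphere_cont_bump]])
 have "(\<lambda>k. LINT x|mu_micro m. h k (up \<nu> x)) \<longlonglongrightarrow> (LINT x|mu_micro m. 0)" for \<nu>
 proof (rule integral_dominated_convergence[where w = "\<lambda>_. 1"])
  show "AE x in mu_micro m. (\<lambda>k. h k (up \<nu> x)) \<longlonglongrightarrow> 0"
   using AE_pos
  proof eventually_elim
   case (elim x)
   obtain N :: nat where N: "cmod (\<eta> / up \<nu> x) \<le> real N" using real_arch_simple by blast
   have "\<forall>\<^sub>F k in sequentially. h k (up \<nu> x) = 0"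
    using eventually_ge_at_top[of N]
   proof eventually_elim
    case (elim k)
    then have "cmod (\<eta> / up \<nu> x) \<le> real k" using N by linarith
    then show ?case using up_nz[OF \<open>x > 0\<close>, of \<nu>] by (simp add: h_def GG_def)
   qed
   then show ?case by (rule tendsto_eventually)
  qed
  show "AE x in mu_micro m. norm (h k (up \<nu> x)) \<le> 1" for k
   by (intro AE_I2) (auto simp: h_def GG_def)
 qed (auto simp: measurable_cong_sets[OF sets_M refl])
 then have "(\<lambda>k. \<Sum>\<nu><m. LINT x|mu_micro m. h k (up \<nu> x)) \<longlonglongrightarrow> (\<Sum>\<nu><m. LINT x|mu_micro m. 0)" by (rule tendsto_sum)
 then have "(\<lambda>k. (\<Sum>\<nu><m. LINT x|mu_micro m. h k (up \<nu> x)) / of_nat m) \<longlonglongrightarrow> 0 / of_nat m"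
  using m_pos by (intro tendsto_divide) auto
 then show ?thesis by (simp add: Lim_def h_def)
qed

text \<open>These zeros have |eta y| >= n^(1/m) rr n, eventually at least k + 1, so the k-th bump
  function is 1 on them. Its limit integral is small for large k.\<close>

lemma outer_count:
 assumes rr: "filterlim (\<lambda>n. root m (real n) * rr n) at_top sequentially"
 shows "(\<lambda>n. real (size (filter_mset (\<lambda>y. \<not> cmod (dl n * y) < rr n) (Zd n))) / (real m * real n)) \<longlonglongrightarrow> 0"
proof (rule tendstoI)
 fix e :: real assume "e > 0"
 then have e: "e / 2 > 0" by simp
 define F where "F k w = (case w of None \<Rightarrow> 1 | Some z \<Rightarrow> complex_of_real (min 1 (max 0 (cmod z - real k))))" for k :: nat and w
 have Fc: "sphere_cont (F k)" for k unfolding F_def by (rule sphere_cont_bump)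
 have "(\<lambda>k. Lim (GG (F k))) \<longlonglongrightarrow> 0" using bump_integral_tendsto by (simp add: F_def[abs_def])
 from tendstoD[OF this e] obtain k where k: "dist (Lim (GG (F k))) 0 < e / 2" by (auto simp: eventually_sequentially)
 have ev1: "\<forall>\<^sub>F n in sequentially. dist ((\<Sum>y\<in>#Zd n. F k (Some (\<eta> * y))) / (of_nat m * of_nat n)) (Lim (GG (F k))) < e / 2"
  by (rule tendstoD[OF zeros_weak_sphere[OF Fc] e])
 have ev2: "\<forall>\<^sub>F n in sequentially. real k + 1 \<le> root m (real n) * rr n"
  using rr by (simp add: filterlim_at_top)
 show "\<forall>\<^sub>F n in sequentially. dist (real (size (filter_mset (\<lambda>y. \<not> cmod (dl n * y) < rr n) (Zd n))) / (real m * real n)) 0 < e"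
  using ev1 ev2 eventually_ge_at_top[of "1::nat"]
 proof eventually_elim
  case (elim n)
  define t where "t y = min 1 (max 0 (cmod (\<eta> * y) - real k))" for y
  define X where "X = (\<Sum>y\<in>#Zd n. t y)"
  have sF: "(\<Sum>y\<in>#Zd n. F k (Some (\<eta> * y))) = of_real X"
   unfolding X_def of_real_sum_mset[symmetric] by (simp add: F_def t_def)
  have le: "real (size (filter_mset (\<lambda>y. \<not> cmod (dl n * y) < rr n) (Zd n))) \<le> X"
   unfolding X_def
  proof (rule size_filter_le_sum)
   fix y assume "\<not> cmod (dl n * y) < rr n"
   then have "rr n \<le> cmod (\<eta> * y) / root m (real n)"
    using root_pos[OF elim(3)] by (simp add: dl_def norm_divide norm_mult)
   then have "root m (real n) * rr n \<le> cmod (\<eta> * y)"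
    using root_pos[OF elim(3)] by (simp add: pos_le_divide_eq mult.commute)
   then show "1 \<le> t y" using elim(2) by (simp add: t_def)
  qed (simp add: t_def)
  define mn where "mn = real m * real n"
  have mn: "mn > 0" using elim(3) m_pos by (simp add: mn_def)
  have "cmod (of_real X / of_real mn) \<le> dist (of_real X / of_real mn) (Lim (GG (F k))) + dist (Lim (GG (F k))) 0"
   using dist_triangle[of "of_real X / of_real mn :: complex" 0 "Lim (GG (F k))"] by simp
  moreover have "dist (of_real X / of_real mn) (Lim (GG (F k))) < e / 2" using elim(1) unfolding sF by (simp add: mn_def)
  ultimately have "cmod (of_real X / of_real mn) < e" using k by linarith
  then have "\<bar>X / mn\<bar> < e" unfolding of_real_divide[symmetric] norm_of_real .
  moreover have "real (size (filter_mset (\<lambda>y. \<not> cmod (dl n * y) < rr n) (Zd n))) / mn \<le> X / mn" using le mn by (simp add: divide_right_mono)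
  moreover have "0 \<le> real (size (filter_mset (\<lambda>y. \<not> cmod (dl n * y) < rr n) (Zd n))) / mn" using mn by simp
  ultimately show ?case unfolding mn_def[symmetric] dist_real_def by linarith
 qed
qed

text \<open>The sum over the shrinking disc differs from that over D(c, r) by the zeros of
  \<open>outer_count\<close>, which are o(n) in number while F is bounded.\<close>

theorem nu_local_tendsto:
 assumes rr: "rr \<longlonglongrightarrow> 0" "filterlim (\<lambda>n. root m (real n) * rr n) at_top sequentially" and F: "sphere_cont F"
 shows "(\<lambda>n. LINT w|nu_local P Q S T c (rr n) n. F w) \<longlonglongrightarrow> (LINT w|mu_hat m lamc. F w)"
proof -
 obtain b where b: "b \<ge> 0" "\<And>w. cmod (F w) \<le> b" using sphere_cont_bounded[OF F] by blast
 define D where "D n = filter_mset (\<lambda>y. \<not> cmod (dl n * y) < rr n) (Zd n)" for n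
 have ev: "\<forall>\<^sub>F n in sequentially. rr n < r" by (rule order_tendstoD(2)[OF rr(1) r_pos])
 have D0: "(\<lambda>n. (\<Sum>y\<in>#D n. F (Some (\<eta> * y))) / (of_nat m * of_nat n)) \<longlonglongrightarrow> 0"
 proof (rule Lim_null_comparison)
  show "\<forall>\<^sub>F n in sequentially. norm ((\<Sum>y\<in>#D n. F (Some (\<eta> * y))) / (of_nat m * of_nat n)) \<le> b * (real (size (D n)) / (real m * real n))"
  proof (intro always_eventually allI)
   fix n
   have "cmod (\<Sum>y\<in>#D n. F (Some (\<eta> * y))) / (real m * real n) \<le> (real (size (D n)) * b) / (real m * real n)"
    by (intro divide_right_mono norm_sum_mset_le b) simp
   then show "norm ((\<Sum>y\<in>#D n. F (Some (\<eta> * y))) / (of_nat m * of_nat n)) \<le> b * (real (size (D n)) / (real m * real n))"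
    by (simp add: norm_divide norm_mult mult.commute)
  qed
  have "(\<lambda>n. b * (real (size (D n)) / (real m * real n))) \<longlonglongrightarrow> b * 0"
   unfolding D_def by (rule tendsto_mult_left[OF outer_count[OF rr(2)]])
  then show "(\<lambda>n. b * (real (size (D n)) / (real m * real n))) \<longlonglongrightarrow> 0" by simp
 qed
 have "(\<lambda>n. (\<Sum>y\<in>#Zd n. F (Some (\<eta> * y))) / (of_nat m * of_nat n) - (\<Sum>y\<in>#D n. F (Some (\<eta> * y))) / (of_nat m * of_nat n)) \<longlonglongrightarrow> Lim (GG F) - 0"
  by (rule tendsto_diff[OF zeros_weak_sphere[OF F] D0])
 then have "(\<lambda>n. (\<Sum>y\<in>#Zd n. F (Some (\<eta> * y))) / (of_nat m * of_nat n) - (\<Sum>y\<in>#D n. F (Some (\<eta> * y))) / (of_nat m * of_nat n)) \<longlonglongrightarrow> (LINT w|mu_hat m lamc. F w)"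
  by (simp add: integral_mu_hat[OF F])
 then show ?thesis
 proof (rule Lim_transform_eventually)
  show "\<forall>\<^sub>F n in sequentially. (\<Sum>y\<in>#Zd n. F (Some (\<eta> * y))) / (of_nat m * of_nat n) - (\<Sum>y\<in>#D n. F (Some (\<eta> * y))) / (of_nat m * of_nat n)
    = (LINT w|nu_local P Q S T c (rr n) n. F w)"
   using ev eventually_ge_at_top[of "1::nat"]
  proof eventually_elim
   case (elim n)
   have "filter_mset (\<lambda>y. cmod (dl n * y) < rr n) (Zd n) = filter_mset (\<lambda>y. cmod (dl n * y) < rr n) (Zn n)"
    unfolding Zd_def filter_filter_mset using elim(1) by (intro filter_mset_cong refl) auto
   then have "(\<Sum>y\<in>#Zd n. F (Some (\<eta> * y))) = (\<Sum>y\<in>#filter_mset (\<lambda>y. cmod (dl n * y) < rr n) (Zn n). F (Some (\<eta> * y))) + (\<Sum>y\<in>#D n. F (Some (\<eta> * y)))"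
    using sum_mset_filter_split[of "\<lambda>y. F (Some (\<eta> * y))" "Zd n" "\<lambda>y. cmod (dl n * y) < rr n"] by (simp add: D_def)
   then show ?case
    unfolding integral_nu_local[OF sphere_cont_measurable[OF F]]
    using zero_sum[OF elim(2) less_imp_le[OF elim(1)], of "\<lambda>z. F (Some z)"] by (simp add: add_divide_distrib)
  qed
 qed
qed

theorem local_zeros_tendsto:
 fixes g :: "complex \<Rightarrow> complex"
 assumes g: "continuous_on UNIV g" "compact (closure {z. g z \<noteq> 0})"
 shows "(\<lambda>n. 1 / (of_nat m * of_nat n) * (\<Sum>zeta\<in>DZ n r. of_nat (deriv_mult P Q S T n zeta) * g (of_real (root m (real n)) * (zeta - c))))
   \<longlonglongrightarrow> (LINT w|mu_hat m lamc. (case w of None \<Rightarrow> 0 | Some z \<Rightarrow> g z))"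
proof -
 note F = sphere_cont_compact_support[OF g]
 show ?thesis unfolding integral_mu_hat[OF F]
 proof (rule Lim_transform_eventually[OF zeros_weak_sphere[OF F]])
  show "\<forall>\<^sub>F n in sequentially. (\<Sum>y\<in>#Zd n. case Some (\<eta> * y) of None \<Rightarrow> 0 | Some z \<Rightarrow> g z) / (of_nat m * of_nat n)
    = 1 / (of_nat m * of_nat n) * (\<Sum>zeta\<in>DZ n r. of_nat (deriv_mult P Q S T n zeta) * g (of_real (root m (real n)) * (zeta - c)))"
   using eventually_ge_at_top[of "1::nat"]
   by eventually_elim (simp add: zero_sum Zd_def)
 qed
qed

theorem nu_local_mass:
 assumes rr: "rr \<longlonglongrightarrow> 0" "filterlim (\<lambda>n. root m (real n) * rr n) at_top sequentially"
 shows "(\<lambda>n. measure (nu_local P Q S T c (rr n) n) UNIV) \<longlonglongrightarrow> 1"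
proof -
 interpret mh: prob_space "mu_hat m lamc" by (rule prob_space_mu_hat)
 have sp: "space (nu_local P Q S T c (rr n) n) = UNIV" for n by (simp add: nu_local_def)
 have "sphere_cont (\<lambda>_. 1)" by (simp add: sphere_cont_def)
 from nu_local_tendsto[OF rr this]
 have "(\<lambda>n. complex_of_real (measure (nu_local P Q S T c (rr n) n) UNIV)) \<longlonglongrightarrow> of_real 1"
  by (simp add: sp scaleR_conv_of_real mh.prob_space)
 then show ?thesis by (simp only: tendsto_of_real_iff)
qed

theorem weak_conv:
 assumes rr: "rr \<longlonglongrightarrow> 0" "filterlim (\<lambda>n. root m (real n) * rr n) at_top sequentially"
 shows "sphere_weak_conv (\<lambda>n. nu_local P Q S T c (rr n) n) (mu_hat m lamc)"
proof -
 interpret mh: prob_space "mu_hat m lamc" by (rule prob_space_mu_hat)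
 show ?thesis
  unfolding sphere_weak_conv_def
  using nu_local_tendsto[OF rr sphere_cont_continuous_map] finite_nu_local sets_nu_local mh.finite_measure_axioms by simp
qed

end

theorem corollary42:
  fixes P Q S T :: "complex poly" and c :: complex and r :: real and m :: nat
  assumes data: "hyperexp_data P Q S T"
    and c: "poly T c = 0" and m: "m = order c T"
    and r_pos: "r > 0"
    and r_sing: "cball c r \<inter> sing_set Q T = {c}"
    and r_nearest: "\<forall>z \<in> cball c r - {c}. \<forall>a \<in> sing_set Q T - {c}. cmod (z - c) < cmod (z - a)"
    and r_Psharp: "\<forall>z \<in> cball c r. poly (Psharp P T) z \<noteq> 0"
  shows
    "emeasure (mu_fix Q S T) (frontier (ball c r)) = 0 \<and>
     (\<lambda>n. real (\<Sum>\<zeta> | poly (Bpoly P Q S T n) \<zeta> = 0 \<and> cmod (\<zeta> - c) < r.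
                  order \<zeta> (Bpoly P Q S T n)) - real m * real n) \<in> o(\<lambda>n. real n) \<and>
     (\<lambda>n. real (\<Sum>\<zeta> | \<zeta> \<in> deriv_zeros P Q S T n \<and> 0 < cmod (\<zeta> - c) \<and> cmod (\<zeta> - c) < r.
                  deriv_mult P Q S T n \<zeta>) - real m * real n) \<in> o(\<lambda>n. real n) \<and>
     (\<forall>(lam :: nat \<Rightarrow> complex) (Ereg :: complex \<Rightarrow> complex).
        lam m \<noteq> 0 \<and> Ereg analytic_on {c} \<and>
        (\<forall>\<^sub>F z in at c. expo S T z = (\<Sum>s = 1..m. lam s / (z - c) ^ s) + Ereg z) \<longrightarrow>
        (\<forall>g :: complex \<Rightarrow> complex.
           continuous_on UNIV g \<and> compact (closure {z. g z \<noteq> 0}) \<longrightarrow>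
           (\<lambda>n. 1 / (of_nat m * of_nat n) *
                (\<Sum>\<zeta> | \<zeta> \<in> deriv_zeros P Q S T n \<and> 0 < cmod (\<zeta> - c) \<and> cmod (\<zeta> - c) < r.
                   of_nat (deriv_mult P Q S T n \<zeta>) *
                   g (of_real (root m (real n)) * (\<zeta> - c))))
           \<longlonglongrightarrow> (LINT w|mu_hat m (lam m). (case w of None \<Rightarrow> 0 | Some z \<Rightarrow> g z))) \<and>
        (\<forall>rr :: nat \<Rightarrow> real.
           decseq rr \<and> rr \<longlonglongrightarrow> 0 \<and>
           filterlim (\<lambda>n. root m (real n) * rr n) at_top sequentially \<longrightarrow>
           sphere_weak_conv (\<lambda>n. nu_local P Q S T c (rr n) n) (mu_hat m (lam m)) \<and>
           (\<lambda>n. measure (nu_local P Q S T c (rr n) n) UNIV) \<longlonglongrightarrow> 1))"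
proof -
 interpret hyper_disc P Q S T c m r
  by unfold_locales (fact data c m r_pos r_sing r_nearest r_Psharp)+
 interpret fuss_measure "mu_micro m" m by (rule mu_micro_fuss(1)[OF m_pos])
 interpret hyper_micro P Q S T c m r ..
 have o1: "(\<lambda>n. real (disc_count c r (Bpoly P Q S T n)) - real m * real n) \<in> o(\<lambda>n. real n)"
  by (rule smalloI_tendsto[OF count_disc]) (use eventually_gt_at_top[of "0::nat"] in \<open>eventually_elim, simp\<close>)
 have o2: "(\<Sum>\<zeta>\<in>DZ n r. deriv_mult P Q S T n \<zeta>) = disc_count c r (Bpoly P Q S T n)" for n
 proof -
  have "(\<Sum>\<zeta>\<in>DZ n r. deriv_mult P Q S T n \<zeta>) = (\<Sum>\<zeta>\<in>DZ n r. order \<zeta> (Bpoly P Q S T n))"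
   by (intro sum.cong refl) (rule DZ_mult)
  then show ?thesis unfolding DZ_eq[OF order_refl] disc_count_def .
 qed
 show ?thesis
  unfolding DZ_def[symmetric] o2 disc_count_def[symmetric]
 proof (intro conjI allI impI mu_fix_frontier o1)
  fix lam :: "nat \<Rightarrow> complex" and Ereg :: "complex \<Rightarrow> complex"
  assume "lam m \<noteq> 0 \<and> Ereg analytic_on {c} \<and> (\<forall>\<^sub>F z in at c. expo S T z = (\<Sum>s = 1..m. lam s / (z - c) ^ s) + Ereg z)"
  then have lam: "lam m = lamc" using lam_top[of Ereg lam] by blast
  {
   fix g :: "complex \<Rightarrow> complex"
   assume "continuous_on UNIV g \<and> compact (closure {z. g z \<noteq> 0})"
   then show "(\<lambda>n. 1 / (of_nat m * of_nat n) * (\<Sum>\<zeta>\<in>DZ n r. of_nat (deriv_mult P Q S T n \<zeta>) * g (of_real (root m (real n)) * (\<zeta> - c))))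
     \<longlonglongrightarrow> (LINT w|mu_hat m (lam m). (case w of None \<Rightarrow> 0 | Some z \<Rightarrow> g z))"
    unfolding lam by (intro local_zeros_tendsto) auto
  }
  fix rr :: "nat \<Rightarrow> real"
  assume "decseq rr \<and> rr \<longlonglongrightarrow> 0 \<and> filterlim (\<lambda>n. root m (real n) * rr n) at_top sequentially"
  then have rr: "rr \<longlonglongrightarrow> 0" "filterlim (\<lambda>n. root m (real n) * rr n) at_top sequentially" by auto
  show "sphere_weak_conv (\<lambda>n. nu_local P Q S T c (rr n) n) (mu_hat m (lam m))" unfolding lam by (rule weak_conv[OF rr])
  show "(\<lambda>n. measure (nu_local P Q S T c (rr n) n) UNIV) \<longlonglongrightarrow> 1" by (rule nu_local_mass[OF rr])
 qed
qed

end
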